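(* Let $d\geq 2$. For every $p\in (1,\infty)\setminus\{2\}$ there exist an elliptic $B:[0,1]\times \mathbb{R}^d\to \mathbb{C}^{d\times d}$ and $f \in L^p(0,1;H^{-1}(\mathbb{R}^d))$ such that the unique solution $u$ to $$u' - \operatorname{div}(B\nabla u) = f \ \text{ on } (0,1), \qquad u(0)=0, \qquad (\ast)$$ satisfies $u\notin L^p(0,1;H^{1}(\mathbb{R}^d))$.
   Context: All function spaces consist of complex-valued functions, and $d$ is an integer. $H^1(\mathbb{R}^d)$ is the usual $L^2$-based Sobolev space and $H^{-1}(\mathbb{R}^d)$ is its (anti)dual, with $H^1(\mathbb{R}^d)\hookrightarrow L^2(\mathbb{R}^d)\hookrightarrow H^{-1}(\mathbb{R}^d)$. For a Banach space $X$, $L^p(0,1;X)$ is the Bochner space and $H^1(0,1;X)$ is the space of $u\in L^2(0,1;X)$ with weak derivative $u'\in L^2(0,1;X)$. Elliptic: a measurable function $B \colon [0,1] \times \mathbb{R}^d \to \mathbb{C}^{d\times d}$ is called elliptic if there exist constants $\Lambda, \lambda > 0$ such that for all $t \in [0,1]$, $x\in \mathbb{R}^d$ and $\xi \in \mathbb{C}^d$ one has $|B(t,x)\xi| \leq \Lambda |\xi|$ and $\operatorname{Re}\big(B(t,x)\xi\cdot\overline{\xi}\big) \geq \lambda|\xi|^2$. The operator $\operatorname{div}(B(t)\nabla \cdot)\colon H^1(\mathbb{R}^d)\to H^{-1}(\mathbb{R}^d)$ is defined weakly by $\langle -\operatorname{div}(B(t)\nabla v), w\rangle = \int_{\mathbb{R}^d}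 B(t,x)\nabla v(x)\cdot\overline{\nabla w(x)}\,dx$. Solution: a function $u\in L^2(0,1;H^1(\mathbb{R}^d))\cap H^1(0,1;H^{-1}(\mathbb{R}^d))$ is called a solution to $(\ast)$ if for all $t\in[0,1]$ one has $u(t) - \int_0^t \operatorname{div}(B(\tau)\nabla u(\tau))\,d\tau = \int_0^t f(\tau)\,d\tau$, with Bochner integrals in $H^{-1}(\mathbb{R}^d)$ (using the continuous representative of $u$). By Lions' theorem, for every elliptic $B$ and every $f\in L^2(0,1;H^{-1}(\mathbb{R}^d))$ there is exactly one solution.
   Formalization: For p<2 a solution as defined lies in L^2(0,1;H^1), hence in L^p(0,1;H^1), so the claim fails literally; there it is read as: no solution of (∗), even in the class L^1(0,1;H^1)∩W^{1,1}(0,1;H^{-1}), belongs to L^p(0,1;H^1). For p>2 the claim is literal. *)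

theory Defs
  imports "HOL-Analysis.Analysis"
begin

section \<open>Separable Hilbert spaces\<close>

lemma countable_basis_of_dense:
  fixes D :: "'a::metric_space set"
  assumes "countable D" "closure D = UNIV"
  shows "\<exists>B::'a set set. countable B \<and> open = generate_topology B"
proof -
  define B where "B = (\<lambda>(x::'a, r::rat). ball x (of_rat r)) ` (D \<times> UNIV)"
  have "countable B"
    unfolding B_def using assms(1) by auto
  moreover have "topological_basis B"
  proof (rule topological_basisI)
    fix U :: "'a set" and x assume U: "open U" "x \<in> U"
    then obtain e where e: "e > 0" "ball x e \<subseteq> U"
      by (auto simp: open_contains_ball)
    then obtain r :: rat where r: "0 < real_of_rat r" "real_of_rat r < e / 2"
      using of_rat_dense[of 0 "e/2"] by (metis half_gt_zero)
    obtain y where y: "y \<in> D" "dist y x < of_rat r"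
      using assms(2) r(1) closure_approachable[of x D] by (metis UNIV_I)
    have "ball y (of_rat r) \<subseteq> ball x e"
    proof
      fix z assume "z \<in> ball y (of_rat r)"
      then have "dist y z < of_rat r" by simp
      then show "z \<in> ball x e"
        using y(2) r(2) dist_triangle[of x z y] by (simp add: dist_commute)
    qed
    moreover have "x \<in> ball y (of_rat r)" using y by simp
    moreover have "ball y (of_rat r) \<in> B" unfolding B_def using y(1) by force
    ultimately show "\<exists>B'\<in>B. x \<in> B' \<and> B' \<subseteq> U" using e(2) by blast
  qed (auto simp: B_def)
  ultimately show ?thesis
    using topological_basis_imp_subbasis by blast
qed

lemma countable_basis_of_expanding_map:
  fixes g :: "'a::metric_space \<Rightarrow> 'b::{metric_space,second_countable_topology}"
  assumes "\<And>x y. dist x y \<le> C * dist (g x) (g y)"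
  shows "\<exists>B::'a set set. countable B \<and> open = generate_topology B"
proof -
  obtain T where T: "countable T" "T \<subseteq> range g" "range g \<subseteq> closure T"
    by (metis separable)
  define D where "D = inv g ` T"
  have "x \<in> closure D" for x
    unfolding closure_approachable
  proof (intro allI impI)
    fix e :: real assume e: "e > 0"
    define C' where "C' = max C 1"
    have C': "C' > 0" "C \<le> C'" by (auto simp: C'_def)
    have "g x \<in> closure T" using T(3) by auto
    then obtain t where t: "t \<in> T" "dist t (g x) < e / C'"
      unfolding closure_approachable using e C'(1) by (meson divide_pos_pos)
    have "g (inv g t) = t" using t(1) T(2) by (auto intro: f_inv_into_f)
    then have "dist (inv g t) x \<le> C * dist t (g x)" using assms[of "inv g t" x] by simp
    also have "\<dots> \<le> C' * dist t (g x)" using C'(2) by (simp add: mult_right_mono)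
    also have "\<dots> < e" using t(2) C'(1) by (simp add: field_simps)
    finally show "\<exists>y\<in>D. dist y x < e" unfolding D_def using t(1) by blast
  qed
  then show ?thesis
    by (intro countable_basis_of_dense[of D]) (auto simp: D_def T(1))
qed

lemma orthogonal_projection_exists:
  fixes S :: "'a::{real_inner,complete_space} set"
  assumes "subspace S" "closed S"
  obtains p where "p \<in> S" "\<And>y. y \<in> S \<Longrightarrow> (x - p) \<bullet> y = 0"
proof -
  define d where "d = infdist x S"
  have ne: "S \<noteq> {}" using assms(1) subspace_0 by auto
  have d0: "d \<ge> 0" unfolding d_def by (rule infdist_nonneg)
  have dle: "d \<le> norm (x - y)" if "y \<in> S" for y
    unfolding d_def using infdist_le[OF that, of x] by (simp add: dist_norm)
  have "\<exists>y\<in>S. norm (x - y) < d + 1 / Suc n" for n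
  proof (rule ccontr)
    assume "\<not> ?thesis"
    then have "d + 1 / Suc n \<le> infdist x S"
      unfolding infdist_notempty[OF ne] by (intro cINF_greatest) (auto simp: ne dist_norm not_less)
    then show False using d_def by (simp add: field_simps)
  qed
  then obtain q where q: "\<And>n. q n \<in> S" "\<And>n. norm (x - q n) < d + 1 / Suc n" by metis
  have est: "(norm (q m - q n))\<^sup>2 \<le> (8 * d + 8) / Suc N" if "m \<ge> N" "n \<ge> N" for m n N
  proof -
    have mid: "(1/2) *\<^sub>R (q m + q n) \<in> S"
      using assms(1) q(1) by (simp add: subspace_add subspace_scale)
    have par: "(norm (q m - q n))\<^sup>2
        = 2 * (norm (x - q m))\<^sup>2 + 2 * (norm (x - q n))\<^sup>2 - 4 * (norm (x - (1/2) *\<^sub>R (q m + q n)))\<^sup>2"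
      by (simp add: power2_norm_eq_inner inner_diff_left inner_diff_right inner_add_left inner_add_right
          inner_commute algebra_simps)
    have le: "(norm (x - q k))\<^sup>2 \<le> (d + 1 / Suc N)\<^sup>2" if "k \<ge> N" for k
    proof (rule power_mono)
      have "1 / real (Suc k) \<le> 1 / real (Suc N)" using that by (simp add: field_simps)
      then show "norm (x - q k) \<le> d + 1 / Suc N" using q(2)[of k] by linarith
    qed simp
    have "(norm (x - (1/2) *\<^sub>R (q m + q n)))\<^sup>2 \<ge> d\<^sup>2"
      using dle[OF mid] d0 by (intro power_mono)
    then have "(norm (q m - q n))\<^sup>2 \<le> 4 * (d + 1 / Suc N)\<^sup>2 - 4 * d\<^sup>2"
      unfolding par using le[OF that(1)] le[OF that(2)] by linarith
    also have "\<dots> = (8 * d + 4 / Suc N) / Suc N"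
    proof -
      have "4 * (d + a)\<^sup>2 - 4 * d\<^sup>2 = (8 * d + 4 * a) * a" for a :: real
        by (simp add: power2_eq_square algebra_simps)
      from this[of "1 / Suc N"] show ?thesis by simp
    qed
    also have "\<dots> \<le> (8 * d + 8) / Suc N"
      by (intro divide_right_mono) (auto simp: field_simps)
    finally show ?thesis .
  qed
  have "Cauchy q"
  proof (rule CauchyI)
    fix e :: real assume e: "e > 0"
    obtain N where N: "(8 * d + 8) / e\<^sup>2 < real N" using reals_Archimedean2 by blast
    then have "8 * d + 8 < e\<^sup>2 * real N" using e by (simp add: field_simps)
    also have "\<dots> \<le> e\<^sup>2 * real (Suc N)" by (intro mult_left_mono) auto
    finally have "(8 * d + 8) / Suc N < e\<^sup>2" by (simp add: divide_simps mult.commute)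
    then have "norm (q m - q n) < e" if "m \<ge> N" "n \<ge> N" for m n
      using est[OF that] e by (intro power_less_imp_less_base[of _ 2 e]) auto
    then show "\<exists>M. \<forall>m\<ge>M. \<forall>n\<ge>M. norm (q m - q n) < e" by blast
  qed
  then obtain p where p: "q \<longlonglongrightarrow> p" using convergent_eq_Cauchy by blast
  have pS: "p \<in> S" using assms(2) p q(1) closed_sequentially by blast
  have "norm (x - p) \<le> d"
  proof (rule LIMSEQ_le)
    show "(\<lambda>n. norm (x - q n)) \<longlonglongrightarrow> norm (x - p)" by (intro tendsto_intros p)
    show "(\<lambda>n. d + 1 / Suc n) \<longlonglongrightarrow> d"
      using tendsto_add[OF tendsto_const lim_1_over_n[THEN LIMSEQ_Suc], of d] by simp
    show "\<exists>N. \<forall>n\<ge>N. norm (x - q n) \<le> d + 1 / Suc n" using q(2) less_imp_le by blast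
  qed
  have "(x - p) \<bullet> y = 0" if y: "y \<in> S" for y
  proof (cases "y = 0")
    case False
    define c where "c = ((x - p) \<bullet> y) / (y \<bullet> y)"
    have "p + c *\<^sub>R y \<in> S" using assms(1) pS y by (simp add: subspace_add subspace_scale)
    then have "norm (x - p) \<le> norm (x - p - c *\<^sub>R y)"
      using dle \<open>norm (x - p) \<le> d\<close> by (metis diff_diff_eq order_trans)
    then have "(x - p) \<bullet> (x - p) \<le> (x - p - c *\<^sub>R y) \<bullet> (x - p - c *\<^sub>R y)"
      by (simp add: norm_le)
    also have "\<dots> = (x - p) \<bullet> (x - p) - ((x - p) \<bullet> y)\<^sup>2 / (y \<bullet> y)"
    proof -
      have "(x - p - c *\<^sub>R y) \<bullet> (x - p - c *\<^sub>R y)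
          = (x - p) \<bullet> (x - p) - 2 * c * ((x - p) \<bullet> y) + c * c * (y \<bullet> y)"
        by (simp only: inner_diff_left inner_diff_right inner_scaleR_left inner_scaleR_right)
           (simp add: inner_commute algebra_simps)
      then show ?thesis using False by (simp add: c_def power2_eq_square)
    qed
    finally have "((x - p) \<bullet> y)\<^sup>2 / (y \<bullet> y) \<le> 0" by simp
    moreover have "y \<bullet> y > 0" using False by simp
    ultimately show ?thesis by (simp add: divide_le_0_iff)
  qed simp
  with pS show ?thesis by (rule that)
qed

lemma riesz_representation_real:
  fixes \<phi> :: "'a::{real_inner,complete_space} \<Rightarrow> real"
  assumes "bounded_linear \<phi>"
  obtains z where "\<And>x. \<phi> x = z \<bullet> x"
proof (cases "\<forall>x. \<phi> x = 0")
  case True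
  then show ?thesis using that[of 0] by simp
next
  case False
  then obtain x0 where x0: "\<phi> x0 \<noteq> 0" by blast
  interpret bounded_linear \<phi> by fact
  define S where "S = {x. \<phi> x = 0}"
  have "subspace S" by (auto simp: S_def subspace_def add scaleR)
  moreover have "closed S"
    unfolding S_def by (intro closed_Collect_eq continuous_on_const linear_continuous_on assms)
  ultimately obtain p where p: "p \<in> S" "\<And>y. y \<in> S \<Longrightarrow> (x0 - p) \<bullet> y = 0"
    using orthogonal_projection_exists[of S x0] by blast
  define w where "w = x0 - p"
  have w: "\<phi> w = \<phi> x0" using p(1) by (simp add: w_def diff S_def)
  then have wne: "w \<bullet> w \<noteq> 0" using x0 by auto
  have "\<phi> x = ((\<phi> w / (w \<bullet> w)) *\<^sub>R w) \<bullet> x" for x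
  proof -
    have "x - (\<phi> x / \<phi> w) *\<^sub>R w \<in> S" using w x0 by (simp add: S_def diff scaleR)
    then have "w \<bullet> (x - (\<phi> x / \<phi> w) *\<^sub>R w) = 0" using p(2) w_def by blast
    then have "w \<bullet> x = (\<phi> x / \<phi> w) * (w \<bullet> w)" by (simp add: inner_diff_right)
    then show ?thesis using wne w x0 by (simp add: field_simps)
  qed
  then show ?thesis using that by blast
qed

lemma countable_basis_of_total_set:
  fixes S :: "'a::{real_inner,complete_space} set"
  assumes "countable S" and total: "\<And>x. (\<And>s. s \<in> S \<Longrightarrow> x \<bullet> s = 0) \<Longrightarrow> x = 0"
  shows "\<exists>B::'a set set. countable B \<and> open = generate_topology B"
proof -
  define D where "D = (\<lambda>l. \<Sum>(r,s)\<leftarrow>l. real_of_rat r *\<^sub>R s) ` lists (UNIV \<times> S)"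
  have "countable D" unfolding D_def using assms(1) by (intro countable_image countable_lists) auto
  have sp: "x \<in> closure D" if "x \<in> span S" for x
    using that
  proof (induction rule: span_induct_alt)
    case base
    have "0 \<in> D" unfolding D_def by (rule image_eqI[of _ _ "[]"]) auto
    then show ?case using closure_subset by blast
  next
    case (step c s y)
    show ?case unfolding closure_approachable
    proof (intro allI impI)
      fix e :: real assume e: "e > 0"
      obtain y' where y': "y' \<in> D" "dist y' y < e/2"
        using step(2) e unfolding closure_approachable by (meson half_gt_zero)
      define b where "b = e / (2 * (norm s + 1))"
      have n: "norm s + 1 > 0" by (smt (verit) norm_ge_zero)
      have b: "b > 0" unfolding b_def using e n by simp
      obtain r where r: "c < real_of_rat r" "real_of_rat r < c + b"
        using of_rat_dense[of c "c + b"] b by auto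
      have "norm ((real_of_rat r - c) *\<^sub>R s) \<le> b * (norm s + 1)"
        using r b by (auto intro!: mult_mono)
      also have "\<dots> = e / 2" unfolding b_def using n by (simp add: field_simps)
      finally have "norm (real_of_rat r *\<^sub>R s + y' - (c *\<^sub>R s + y)) < e"
        using y'(2) norm_triangle_ineq[of "(real_of_rat r - c) *\<^sub>R s" "y' - y"]
        by (simp add: dist_norm algebra_simps)
      moreover have "real_of_rat r *\<^sub>R s + y' \<in> D"
      proof -
        from y'(1) obtain l where l: "l \<in> lists (UNIV \<times> S)" "y' = (\<Sum>(r,s)\<leftarrow>l. real_of_rat r *\<^sub>R s)"
          unfolding D_def by blast
        show ?thesis unfolding D_def
          using l step(1) by (intro image_eqI[of _ _ "(r,s) # l"]) auto
      qed
      ultimately show "\<exists>y'\<in>D. dist y' (c *\<^sub>R s + y) < e" by (auto simp: dist_norm)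
    qed
  qed
  have "x \<in> closure (span S)" for x
  proof -
    have "subspace (closure (span S))"
      unfolding subspace_def
    proof (intro conjI ballI allI)
      show "0 \<in> closure (span S)" using span_zero closure_subset by blast
    next
      fix a b assume ab: "a \<in> closure (span S)" "b \<in> closure (span S)"
      obtain f where f: "\<And>n. f n \<in> span S" "f \<longlonglongrightarrow> a"
        using ab(1) by (auto simp: closure_sequential)
      obtain g where g: "\<And>n. g n \<in> span S" "g \<longlonglongrightarrow> b"
        using ab(2) by (auto simp: closure_sequential)
      show "a + b \<in> closure (span S)"
        unfolding closure_sequential using f g
        by (intro exI[of _ "\<lambda>n. f n + g n"]) (simp add: span_add tendsto_add)
    next
      fix c :: real and a assume a: "a \<in> closure (span S)"
      obtain f where f: "\<And>n. f n \<in> span S" "f \<longlonglongrightarrow> a"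
        using a by (auto simp: closure_sequential)
      show "c *\<^sub>R a \<in> closure (span S)"
        unfolding closure_sequential using f
        by (intro exI[of _ "\<lambda>n. c *\<^sub>R f n"]) (simp add: span_scale tendsto_scaleR)
    qed
    then obtain p where p: "p \<in> closure (span S)" "\<And>y. y \<in> closure (span S) \<Longrightarrow> (x - p) \<bullet> y = 0"
      using orthogonal_projection_exists[of "closure (span S)" x] by auto
    have "x - p = 0"
      using p(2) by (intro total) (meson closure_subset span_base subsetD)
    then show ?thesis using p(1) by simp
  qed
  moreover have "closure (span S) \<subseteq> closure D"
    using sp by (simp add: closure_minimal subsetI)
  ultimately show ?thesis
    by (intro countable_basis_of_dense[OF \<open>countable D\<close>]) auto
qed

section \<open>The space L2\<close>

definition sq_int :: "('a::euclidean_space \<Rightarrow> 'b::euclidean_space) \<Rightarrow> bool" where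
  "sq_int f \<longleftrightarrow> f \<in> borel_measurable lborel \<and> integrable lborel (\<lambda>x. (norm (f x))\<^sup>2)"

definition l2_rel :: "('a::euclidean_space \<Rightarrow> 'b::euclidean_space) \<Rightarrow> ('a \<Rightarrow> 'b) \<Rightarrow> bool" where
  "l2_rel f g \<longleftrightarrow> sq_int f \<and> sq_int g \<and> (AE x in lborel. f x = g x)"

lemma sq_int_zero: "sq_int (\<lambda>_. 0)"
  by (simp add: sq_int_def)

lemma sq_int_scaleR: "sq_int f \<Longrightarrow> sq_int (\<lambda>x. c *\<^sub>R f x)"
  unfolding sq_int_def by (auto simp: power_mult_distrib)

lemma sq_int_bound:
  assumes "sq_int f" "g \<in> borel_measurable lborel" "\<And>x. norm (g x) \<le> c * norm (f x)"
  shows "sq_int g"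
  unfolding sq_int_def
proof (intro conjI)
  show "integrable lborel (\<lambda>x. (norm (g x))\<^sup>2)"
  proof (rule Bochner_Integration.integrable_bound)
    show "integrable lborel (\<lambda>x. c\<^sup>2 * (norm (f x))\<^sup>2)"
      using assms(1) unfolding sq_int_def by simp
    show "AE x in lborel. norm ((norm (g x))\<^sup>2) \<le> norm (c\<^sup>2 * (norm (f x))\<^sup>2)"
      using power_mono[OF assms(3) norm_ge_zero, of _ 2] by (auto simp: power_mult_distrib)
  qed (use assms(2) in auto)
qed fact

lemma sq_int_add:
  assumes "sq_int f" "sq_int g"
  shows "sq_int (\<lambda>x. f x + g x)"
proof -
  have [measurable]: "f \<in> borel_measurable lborel" "g \<in> borel_measurable lborel"
    using assms by (auto simp: sq_int_def)
  have "integrable lborel (\<lambda>x. (norm (f x + g x))\<^sup>2)"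
  proof (rule Bochner_Integration.integrable_bound)
    show "integrable lborel (\<lambda>x. 2 * (norm (f x))\<^sup>2 + 2 * (norm (g x))\<^sup>2)"
      using assms by (auto simp: sq_int_def)
    have "(norm (f x + g x))\<^sup>2 \<le> 2 * (norm (f x))\<^sup>2 + 2 * (norm (g x))\<^sup>2" for x
    proof -
      have "(norm (f x + g x))\<^sup>2 \<le> (norm (f x) + norm (g x))\<^sup>2"
        by (intro power_mono norm_triangle_ineq) auto
      also have "\<dots> \<le> 2 * (norm (f x))\<^sup>2 + 2 * (norm (g x))\<^sup>2"
        using sum_squares_bound[of "norm (f x)" "norm (g x)"] by (simp add: power2_sum)
      finally show ?thesis .
    qed
    then show "AE x in lborel. norm ((norm (f x + g x))\<^sup>2) \<le> norm (2 * (norm (f x))\<^sup>2 + 2 * (norm (g x))\<^sup>2)"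
      by auto
  qed simp
  then show ?thesis by (simp add: sq_int_def)
qed

lemma sq_int_uminus: "sq_int f \<Longrightarrow> sq_int (\<lambda>x. - f x)"
  by (simp add: sq_int_def)

lemma sq_int_diff: "sq_int f \<Longrightarrow> sq_int g \<Longrightarrow> sq_int (\<lambda>x. f x - g x)"
  using sq_int_add[of f "\<lambda>x. - g x"] sq_int_uminus[of g] by simp

lemma integrable_norm_mult:
  assumes "sq_int f" "sq_int g"
  shows "integrable lborel (\<lambda>x. norm (f x) * norm (g x))"
proof (rule Bochner_Integration.integrable_bound)
  show "integrable lborel (\<lambda>x. (norm (f x))\<^sup>2 + (norm (g x))\<^sup>2)"
    using assms by (auto simp: sq_int_def)
  have [measurable]: "f \<in> borel_measurable lborel" "g \<in> borel_measurable lborel"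
    using assms by (auto simp: sq_int_def)
  show "(\<lambda>x. norm (f x) * norm (g x)) \<in> borel_measurable lborel" by simp
  have "norm (f x) * norm (g x) \<le> (norm (f x))\<^sup>2 + (norm (g x))\<^sup>2" for x
  proof -
    have "0 \<le> norm (f x) * norm (g x)" by simp
    then show ?thesis using sum_squares_bound[of "norm (f x)" "norm (g x)"] by linarith
  qed
  then show "AE x in lborel. norm (norm (f x) * norm (g x)) \<le> norm ((norm (f x))\<^sup>2 + (norm (g x))\<^sup>2)"
    by auto
qed

lemma integrable_inner:
  assumes "sq_int f" "sq_int g"
  shows "integrable lborel (\<lambda>x. f x \<bullet> g x)"
proof (rule Bochner_Integration.integrable_bound[OF integrable_norm_mult[OF assms]])
  show "(\<lambda>x. f x \<bullet> g x) \<in> borel_measurable lborel"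
    using assms by (auto simp: sq_int_def)
  show "AE x in lborel. norm (f x \<bullet> g x) \<le> norm (norm (f x) * norm (g x))"
    using Cauchy_Schwarz_ineq2 by auto
qed

text \<open>Square-integrable functions modulo equality almost everywhere. Representatives are Borel
  measurable; since every Lebesgue measurable function agrees almost everywhere with a Borel
  measurable one, this is the usual space of classes.\<close>

quotient_type (overloaded) ('a, 'b) l2 = "'a::euclidean_space \<Rightarrow> 'b::euclidean_space" / partial: l2_rel
proof (rule part_equivpI)
  show "\<exists>f::'a \<Rightarrow> 'b. l2_rel f f" using sq_int_zero by (auto simp: l2_rel_def)
  show "symp (l2_rel :: ('a \<Rightarrow> 'b) \<Rightarrow> _)" by (auto simp: symp_def l2_rel_def eq_commute)
  show "transp (l2_rel :: ('a \<Rightarrow> 'b) \<Rightarrow> _)"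
    unfolding transp_def l2_rel_def
  proof (intro allI impI conjI; elim conjE)
    fix f g h :: "'a \<Rightarrow> 'b"
    assume "AE x in lborel. f x = g x" "AE x in lborel. g x = h x"
    then show "AE x in lborel. f x = h x" by eventually_elim simp
  qed
qed

definition l2_fun :: "('a, 'b) l2 \<Rightarrow> 'a::euclidean_space \<Rightarrow> 'b::euclidean_space" where
  "l2_fun = rep_l2"

lemma sq_int_l2_fun: "sq_int (l2_fun F)"
  using Quotient3_rel_rep[OF Quotient3_l2] Quotient3_rep_reflp[OF Quotient3_l2, of F]
  by (auto simp: l2_fun_def l2_rel_def)

lemma measurable_l2_fun [measurable]: "l2_fun F \<in> borel_measurable borel"
  using sq_int_l2_fun[of F] by (simp add: sq_int_def)

lemma abs_l2_fun [simp]: "abs_l2 (l2_fun F) = F"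
  using Quotient3_abs_rep[OF Quotient3_l2] by (simp add: l2_fun_def)

lemma abs_l2_eq_iff: "sq_int f \<Longrightarrow> sq_int g \<Longrightarrow> abs_l2 f = abs_l2 g \<longleftrightarrow> (AE x in lborel. f x = g x)"
  using Quotient3_rel[OF Quotient3_l2, of f g] by (auto simp: l2_rel_def)

lemma l2_fun_abs: "sq_int f \<Longrightarrow> AE x in lborel. l2_fun (abs_l2 f) x = f x"
  using abs_l2_eq_iff[OF sq_int_l2_fun, of f "abs_l2 f"] by simp

lemma l2_eqI: "(AE x in lborel. l2_fun F x = l2_fun G x) \<Longrightarrow> F = G"
  using abs_l2_eq_iff[OF sq_int_l2_fun sq_int_l2_fun, of F G] by simp

instantiation l2 :: (euclidean_space, euclidean_space) real_inner
begin

definition zero_l2 :: "('a, 'b) l2" where "0 = abs_l2 (\<lambda>_. 0)"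
definition plus_l2 :: "('a, 'b) l2 \<Rightarrow> ('a, 'b) l2 \<Rightarrow> ('a, 'b) l2" where
  "F + G = abs_l2 (\<lambda>x. l2_fun F x + l2_fun G x)"
definition minus_l2 :: "('a, 'b) l2 \<Rightarrow> ('a, 'b) l2 \<Rightarrow> ('a, 'b) l2" where
  "F - G = abs_l2 (\<lambda>x. l2_fun F x - l2_fun G x)"
definition uminus_l2 :: "('a, 'b) l2 \<Rightarrow> ('a, 'b) l2" where
  "- F = abs_l2 (\<lambda>x. - l2_fun F x)"
definition scaleR_l2 :: "real \<Rightarrow> ('a, 'b) l2 \<Rightarrow> ('a, 'b) l2" where
  "c *\<^sub>R F = abs_l2 (\<lambda>x. c *\<^sub>R l2_fun F x)"
definition inner_l2 :: "('a, 'b) l2 \<Rightarrow> ('a, 'b) l2 \<Rightarrow> real" where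
  "F \<bullet> G = (LINT x|lborel. l2_fun F x \<bullet> l2_fun G x)"
definition norm_l2 :: "('a, 'b) l2 \<Rightarrow> real" where "norm (F :: ('a, 'b) l2) = sqrt (F \<bullet> F)"
definition dist_l2 :: "('a, 'b) l2 \<Rightarrow> ('a, 'b) l2 \<Rightarrow> real" where "dist (F :: ('a, 'b) l2) G = norm (F - G)"
definition sgn_l2 :: "('a, 'b) l2 \<Rightarrow> ('a, 'b) l2" where "sgn (F :: ('a, 'b) l2) = inverse (norm F) *\<^sub>R F"
definition uniformity_l2 :: "(('a, 'b) l2 \<times> ('a, 'b) l2) filter" where
  "uniformity = (INF e\<in>{0<..}. principal {(F, G :: ('a, 'b) l2). dist F G < e})"
definition open_l2 :: "('a, 'b) l2 set \<Rightarrow> bool" where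
  "open U \<longleftrightarrow> (\<forall>F\<in>U. eventually (\<lambda>(F', G :: ('a, 'b) l2). F' = F \<longrightarrow> G \<in> U) uniformity)"

lemma l2_fun_zero: "AE x in lborel. l2_fun (0 :: ('a, 'b) l2) x = 0"
  unfolding zero_l2_def by (rule l2_fun_abs[OF sq_int_zero])
lemma l2_fun_plus: "AE x in lborel. l2_fun (F + G :: ('a, 'b) l2) x = l2_fun F x + l2_fun G x"
  unfolding plus_l2_def by (intro l2_fun_abs sq_int_add sq_int_l2_fun)
lemma l2_fun_minus: "AE x in lborel. l2_fun (F - G :: ('a, 'b) l2) x = l2_fun F x - l2_fun G x"
  unfolding minus_l2_def by (intro l2_fun_abs sq_int_diff sq_int_l2_fun)
lemma l2_fun_uminus: "AE x in lborel. l2_fun (- F :: ('a, 'b) l2) x = - l2_fun F x"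
  unfolding uminus_l2_def by (intro l2_fun_abs sq_int_uminus sq_int_l2_fun)
lemma l2_fun_scaleR: "AE x in lborel. l2_fun (c *\<^sub>R F :: ('a, 'b) l2) x = c *\<^sub>R l2_fun F x"
  unfolding scaleR_l2_def by (intro l2_fun_abs sq_int_scaleR sq_int_l2_fun)

instance
proof
  fix F G H :: "('a, 'b) l2" and c d :: real
  have "AE x in lborel. l2_fun (F + G + H) x = l2_fun (F + (G + H)) x"
    using l2_fun_plus[of F G] l2_fun_plus[of "F + G" H] l2_fun_plus[of G H] l2_fun_plus[of F "G + H"]
    by eventually_elim (simp add: add.assoc)
  then show "F + G + H = F + (G + H)" by (rule l2_eqI)
  have "AE x in lborel. l2_fun (F + G) x = l2_fun (G + F) x"
    using l2_fun_plus[of F G] l2_fun_plus[of G F]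
    by eventually_elim (simp add: add.commute)
  then show "F + G = G + F" by (rule l2_eqI)
  have "AE x in lborel. l2_fun (0 + F) x = l2_fun (F) x"
    using l2_fun_plus[of 0 F] l2_fun_zero
    by eventually_elim (simp add: algebra_simps)
  then show "0 + F = F" by (rule l2_eqI)
  have "AE x in lborel. l2_fun (- F + F) x = l2_fun (0) x"
    using l2_fun_plus[of "- F" F] l2_fun_zero l2_fun_uminus[of F]
    by eventually_elim (simp add: algebra_simps)
  then show "- F + F = 0" by (rule l2_eqI)
  have "AE x in lborel. l2_fun (F - G) x = l2_fun (F + - G) x"
    using l2_fun_plus[of F "- G"] l2_fun_minus[of F G] l2_fun_uminus[of G]
    by eventually_elim simp
  then show "F - G = F + - G" by (rule l2_eqI)
  have "AE x in lborel. l2_fun (c *\<^sub>R (F + G)) x = l2_fun (c *\<^sub>R F + c *\<^sub>R G) x"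
    using l2_fun_plus[of F G] l2_fun_plus[of "c *\<^sub>R F" "c *\<^sub>R G"] l2_fun_scaleR[of c F]
      l2_fun_scaleR[of c G] l2_fun_scaleR[of c "F + G"]
    by eventually_elim (simp add: scaleR_add_right)
  then show "c *\<^sub>R (F + G) = c *\<^sub>R F + c *\<^sub>R G" by (rule l2_eqI)
  have "AE x in lborel. l2_fun ((c + d) *\<^sub>R F) x = l2_fun (c *\<^sub>R F + d *\<^sub>R F) x"
    using l2_fun_plus[of "c *\<^sub>R F" "d *\<^sub>R F"] l2_fun_scaleR[of c F] l2_fun_scaleR[of d F]
      l2_fun_scaleR[of "c + d" F]
    by eventually_elim (simp add: scaleR_add_left)
  then show "(c + d) *\<^sub>R F = c *\<^sub>R F + d *\<^sub>R F" by (rule l2_eqI)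
  have "AE x in lborel. l2_fun (c *\<^sub>R d *\<^sub>R F) x = l2_fun ((c * d) *\<^sub>R F) x"
    using l2_fun_scaleR[of c "d *\<^sub>R F"] l2_fun_scaleR[of d F] l2_fun_scaleR[of "c * d" F]
    by eventually_elim (simp add: algebra_simps)
  then show "c *\<^sub>R d *\<^sub>R F = (c * d) *\<^sub>R F" by (rule l2_eqI)
  have "AE x in lborel. l2_fun (1 *\<^sub>R F) x = l2_fun (F) x"
    using l2_fun_scaleR[of 1 F]
    by eventually_elim (simp add: algebra_simps)
  then show "1 *\<^sub>R F = F" by (rule l2_eqI)
  show "dist F G = norm (F - G)" by (rule dist_l2_def)
  show "sgn F = inverse (norm F) *\<^sub>R F" by (rule sgn_l2_def)
  show "uniformity = (INF e\<in>{0<..}. principal {(F, G :: ('a, 'b) l2). dist F G < e})"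
    by (rule uniformity_l2_def)
  show "open U \<longleftrightarrow> (\<forall>F\<in>U. eventually (\<lambda>(F', G :: ('a, 'b) l2). F' = F \<longrightarrow> G \<in> U) uniformity)"
    for U :: "('a, 'b) l2 set" by (rule open_l2_def)
  show "norm F = sqrt (F \<bullet> F)" by (rule norm_l2_def)
  show "F \<bullet> G = G \<bullet> F" by (simp add: inner_l2_def inner_commute)
  show "(F + G) \<bullet> H = F \<bullet> H + G \<bullet> H"
  proof -
    have "(F + G) \<bullet> H = (LINT x|lborel. l2_fun F x \<bullet> l2_fun H x + l2_fun G x \<bullet> l2_fun H x)"
      unfolding inner_l2_def
    proof (rule integral_cong_AE)
      show "AE x in lborel. l2_fun (F + G) x \<bullet> l2_fun H x = l2_fun F x \<bullet> l2_fun H x + l2_fun G x \<bullet> l2_fun H x"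
        using l2_fun_plus[of F G] by eventually_elim (simp add: inner_add_left)
    qed auto
    then show ?thesis by (simp add: inner_l2_def integrable_inner sq_int_l2_fun)
  qed
  show "(c *\<^sub>R F) \<bullet> G = c * (F \<bullet> G)"
  proof -
    have "(c *\<^sub>R F) \<bullet> G = (LINT x|lborel. c * (l2_fun F x \<bullet> l2_fun G x))"
      unfolding inner_l2_def
    proof (rule integral_cong_AE)
      show "AE x in lborel. l2_fun (c *\<^sub>R F) x \<bullet> l2_fun G x = c * (l2_fun F x \<bullet> l2_fun G x)"
        using l2_fun_scaleR[of c F] by eventually_elim simp
    qed auto
    then show ?thesis by (simp add: inner_l2_def)
  qed
  show "0 \<le> F \<bullet> F" unfolding inner_l2_def by (rule integral_nonneg_AE) simp
  show "F \<bullet> F = 0 \<longleftrightarrow> F = 0"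
  proof -
    have "F \<bullet> F = 0 \<longleftrightarrow> (AE x in lborel. l2_fun F x \<bullet> l2_fun F x = 0)"
      unfolding inner_l2_def
      by (intro integral_nonneg_eq_0_iff_AE integrable_inner sq_int_l2_fun) auto
    also have "\<dots> \<longleftrightarrow> (AE x in lborel. l2_fun F x = l2_fun 0 x)"
      using l2_fun_zero by (auto elim: AE_mp)
    also have "\<dots> \<longleftrightarrow> F = 0" using l2_eqI by auto
    finally show ?thesis .
  qed
qed

end

lemma norm_l2_sq: "(norm F)\<^sup>2 = (LINT x|lborel. (norm (l2_fun F x))\<^sup>2)"
  by (simp add: power2_norm_eq_inner inner_l2_def)

lemma nn_integral_l2_fun:
  "(\<integral>\<^sup>+x. ennreal ((norm (l2_fun F x))\<^sup>2) \<partial>lborel) = ennreal ((norm F)\<^sup>2)"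
  unfolding norm_l2_sq
  by (rule nn_integral_eq_integral) (use sq_int_l2_fun[of F] in \<open>auto simp: sq_int_def\<close>)

lemma sq_intI_nn_integral:
  assumes "f \<in> borel_measurable lborel" "(\<integral>\<^sup>+x. ennreal ((norm (f x))\<^sup>2) \<partial>lborel) < \<infinity>"
  shows "sq_int f"
  unfolding sq_int_def
proof (intro conjI integrableI_bounded)
  show "(\<integral>\<^sup>+x. ennreal (norm ((norm (f x))\<^sup>2)) \<partial>lborel) < \<infinity>" using assms(2) by simp
qed (use assms(1) in auto)

instance l2 :: (euclidean_space, euclidean_space) banach
proof
  fix X :: "nat \<Rightarrow> ('a, 'b) l2"
  assume C: "Cauchy X"
  have "\<exists>N. \<forall>m\<ge>N. \<forall>n\<ge>N. norm (X m - X n) < (1/2)^k" for k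
    using C unfolding Cauchy_iff by (metis zero_less_divide_1_iff zero_less_numeral zero_less_power)
  then obtain N where N: "\<And>k m n. m \<ge> N k \<Longrightarrow> n \<ge> N k \<Longrightarrow> norm (X m - X n) < (1/2)^k" by metis
  define r where "r k = (\<Sum>i\<le>k. N i)" for k
  have r: "r m \<ge> N k" if "m \<ge> k" for m k
    unfolding r_def using that by (intro member_le_sum) auto
  define f where "f k = l2_fun (X (r k))" for k
  have [measurable]: "f k \<in> borel_measurable borel" for k unfolding f_def by simp
  have norm_diff: "(\<integral>\<^sup>+x. ennreal ((norm (f m x - f k x))\<^sup>2) \<partial>lborel) = ennreal ((norm (X (r m) - X (r k)))\<^sup>2)" for m k
  proof -
    have "(\<integral>\<^sup>+x. ennreal ((norm (f m x - f k x))\<^sup>2) \<partial>lborel)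
        = (\<integral>\<^sup>+x. ennreal ((norm (l2_fun (X (r m) - X (r k)) x))\<^sup>2) \<partial>lborel)"
      by (rule nn_integral_cong_AE)
        (use l2_fun_minus[of "X (r m)" "X (r k)"] in \<open>eventually_elim, simp add: f_def\<close>)
    then show ?thesis by (simp add: nn_integral_l2_fun)
  qed
  define D where "D k x = (norm (f (Suc k) x - f k x))\<^sup>2" for k x
  have "(\<integral>\<^sup>+x. (\<Sum>k. ennreal (2^k * D k x)) \<partial>lborel) = (\<Sum>k. \<integral>\<^sup>+x. ennreal (2^k * D k x) \<partial>lborel)"
    unfolding D_def by (rule nn_integral_suminf) simp
  also have "\<dots> \<le> (\<Sum>k. ennreal ((1/2)^k))"
  proof (rule suminf_le)
    fix k
    have "(\<integral>\<^sup>+x. ennreal (2^k * D k x) \<partial>lborel) = ennreal (2^k) * (\<integral>\<^sup>+x. ennreal (D k x) \<partial>lborel)"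
      unfolding D_def by (subst nn_integral_cmult[symmetric]) (auto simp: ennreal_mult)
    also have "\<dots> = ennreal (2^k * (norm (X (r (Suc k)) - X (r k)))\<^sup>2)"
      unfolding D_def norm_diff by (simp add: ennreal_mult)
    also have "\<dots> \<le> ennreal (2^k * ((1/2)^k)\<^sup>2)"
      using N[of k "r (Suc k)" "r k"] r[of k "Suc k"] r[of k k]
      by (intro ennreal_leI mult_left_mono power_mono) auto
    also have "2^k * ((1/2)^k)\<^sup>2 = ((1/2)^k :: real)"
      by (simp add: power2_eq_square field_simps)
    finally show "(\<integral>\<^sup>+x. ennreal (2^k * D k x) \<partial>lborel) \<le> ennreal ((1/2)^k)" .
  qed auto
  also have "\<dots> = ennreal (\<Sum>k. (1/2)^k)"
    by (intro suminf_ennreal2) (auto intro: summable_geometric)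
  also have "\<dots> < \<infinity>" by simp
  finally have fin: "(\<integral>\<^sup>+x. (\<Sum>k. ennreal (2^k * D k x)) \<partial>lborel) \<noteq> \<infinity>" by simp
  have "AE x in lborel. (\<Sum>k. ennreal (2^k * D k x)) \<noteq> \<infinity>"
    by (rule nn_integral_noteq_infinite[OF _ fin]) (simp add: D_def)
  then have conv: "AE x in lborel. convergent (\<lambda>k. f k x)"
  proof eventually_elim
    case (elim x)
    have "summable (\<lambda>k. 2^k * D k x)"
      using elim by (intro summable_suminf_not_top) (auto simp: D_def)
    then have "(\<lambda>k. 2^k * D k x) \<longlonglongrightarrow> 0" by (rule summable_LIMSEQ_zero)
    then have "Bseq (\<lambda>k. 2^k * D k x)" by (meson convergentI convergent_imp_Bseq)
    then obtain K where K: "K > 0" "\<And>k. 2^k * D k x \<le> K"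
      unfolding Bseq_def by (auto simp: D_def)
    have bd: "norm (f (Suc k) x - f k x) \<le> sqrt K * (1 / sqrt 2)^k" for k
    proof -
      have "D k x \<le> K / 2^k" using K(2)[of k] by (simp add: field_simps)
      then have "sqrt (D k x) \<le> sqrt (K / 2^k)" by simp
      then show ?thesis by (simp add: D_def real_sqrt_divide real_sqrt_power power_divide)
    qed
    have "summable (\<lambda>k. sqrt K * (1 / sqrt 2)^k)"
      by (intro summable_mult summable_geometric) (auto simp: real_less_lsqrt)
    then have "summable (\<lambda>k. f (Suc k) x - f k x)"
      by (rule summable_comparison_test'[where N = 0]) (rule bd)
    then have "convergent (\<lambda>n. \<Sum>k<n. f (Suc k) x - f k x)"
      by (simp add: summable_iff_convergent)
    then have "convergent (\<lambda>n. f n x - f 0 x)"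
      unfolding sum_lessThan_telescope[of "\<lambda>k. f k x"] .
    then obtain l where "(\<lambda>n. f n x - f 0 x) \<longlonglongrightarrow> l" by (auto simp: convergent_def)
    then have "(\<lambda>n. f n x - f 0 x + f 0 x) \<longlonglongrightarrow> l + f 0 x" by (intro tendsto_intros)
    then show ?case by (auto simp: convergent_def)
  qed
  define g where "g x = lim (\<lambda>k. f k x)" for x
  have [measurable]: "g \<in> borel_measurable borel"
    unfolding g_def by (rule borel_measurable_lim_metric) simp
  have lim_g: "AE x in lborel. (\<lambda>k. f k x) \<longlonglongrightarrow> g x"
    using conv by eventually_elim (simp add: g_def convergent_LIMSEQ_iff)
  have fatou: "(\<integral>\<^sup>+x. ennreal ((norm (g x - f k x))\<^sup>2) \<partial>lborel) \<le> ennreal (((1/2)^k)\<^sup>2)" for k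
  proof -
    have "(\<integral>\<^sup>+x. ennreal ((norm (g x - f k x))\<^sup>2) \<partial>lborel)
        = (\<integral>\<^sup>+x. liminf (\<lambda>m. ennreal ((norm (f m x - f k x))\<^sup>2)) \<partial>lborel)"
    proof (rule nn_integral_cong_AE)
      show "AE x in lborel. ennreal ((norm (g x - f k x))\<^sup>2) = liminf (\<lambda>m. ennreal ((norm (f m x - f k x))\<^sup>2))"
        using lim_g
      proof eventually_elim
        case (elim x)
        have "(\<lambda>m. ennreal ((norm (f m x - f k x))\<^sup>2)) \<longlonglongrightarrow> ennreal ((norm (g x - f k x))\<^sup>2)"
          by (intro tendsto_intros elim)
        then show ?case by (intro lim_imp_Liminf[symmetric]) simp_all
      qed
    qed
    also have "\<dots> \<le> liminf (\<lambda>m. \<integral>\<^sup>+x. ennreal ((norm (f m x - f k x))\<^sup>2) \<partial>lborel)"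
      by (rule nn_integral_liminf) simp
    also have "\<dots> \<le> ennreal (((1/2)^k)\<^sup>2)"
    proof (rule Liminf_le[OF sequentially_bot])
      show "\<forall>\<^sub>F m in sequentially. (\<integral>\<^sup>+x. ennreal ((norm (f m x - f k x))\<^sup>2) \<partial>lborel) \<le> ennreal (((1/2)^k)\<^sup>2)"
        unfolding norm_diff
      proof (rule eventually_sequentiallyI[of k])
        fix m assume "m \<ge> k"
        then show "ennreal ((norm (X (r m) - X (r k)))\<^sup>2) \<le> ennreal (((1/2)^k)\<^sup>2)"
          using N[of k "r m" "r k"] r[of k m] r[of k k] by (intro ennreal_leI power_mono) auto
      qed
    qed
    finally show ?thesis .
  qed
  have gf: "sq_int (\<lambda>x. g x - f k x)" for k
    by (rule sq_intI_nn_integral) (auto intro: le_less_trans[OF fatou])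
  have "sq_int g"
    using sq_int_add[OF gf[of 0] sq_int_l2_fun[of "X (r 0)"]] by (simp add: f_def)
  define G where "G = abs_l2 g"
  have G: "norm (X (r k) - G) \<le> (1/2)^k" for k
  proof -
    have "ennreal ((norm (X (r k) - G))\<^sup>2) = (\<integral>\<^sup>+x. ennreal ((norm (g x - f k x))\<^sup>2) \<partial>lborel)"
      unfolding nn_integral_l2_fun[symmetric]
    proof (rule nn_integral_cong_AE)
      show "AE x in lborel. ennreal ((norm (l2_fun (X (r k) - G) x))\<^sup>2) = ennreal ((norm (g x - f k x))\<^sup>2)"
        using l2_fun_minus[of "X (r k)" G] l2_fun_abs[OF \<open>sq_int g\<close>]
        by eventually_elim (simp add: G_def f_def norm_minus_commute)
    qed
    also have "\<dots> \<le> ennreal (((1/2)^k)\<^sup>2)" by (rule fatou)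
    finally have "(norm (X (r k) - G))\<^sup>2 \<le> ((1/2)^k)\<^sup>2" by (simp add: ennreal_le_iff)
    then show ?thesis by (rule power2_le_imp_le) simp
  qed
  have "X \<longlonglongrightarrow> G"
  proof (rule LIMSEQ_I)
    fix e :: real assume "e > 0"
    then obtain k where k: "(1/2)^k < e / 2" using real_arch_pow_inv[of "e/2" "1/2"] by auto
    have "norm (X n - G) < e" if "n \<ge> N k" for n
    proof -
      have "norm (X n - G) \<le> norm (X n - X (r k)) + norm (X (r k) - G)"
        using norm_triangle_ineq[of "X n - X (r k)" "X (r k) - G"] by simp
      also have "\<dots> < (1/2)^k + (1/2)^k"
        using N[of k n "r k"] that r[of k k] G[of k] by linarith
      finally show ?thesis using k by simp
    qed
    then show "\<exists>no. \<forall>n\<ge>no. norm (X n - G) < e" by blast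
  qed
  then show "convergent X" by (auto simp: convergent_def)
qed


lemma inner_abs_l2:
  assumes "sq_int f" "sq_int g"
  shows "abs_l2 f \<bullet> abs_l2 g = (LINT x|lborel. f x \<bullet> g x)"
  unfolding inner_l2_def
proof (rule integral_cong_AE)
  show "AE x in lborel. l2_fun (abs_l2 f) x \<bullet> l2_fun (abs_l2 g) x = f x \<bullet> g x"
    using l2_fun_abs[OF assms(1)] l2_fun_abs[OF assms(2)] by eventually_elim simp
qed (use assms in \<open>auto simp: sq_int_def\<close>)

lemma AE_zero_of_generator:
  fixes g :: "'a::euclidean_space \<Rightarrow> real"
  assumes g: "integrable lborel g" and B: "countable B" "topological_basis B"
    and zero: "\<And>\<F>. finite \<F> \<Longrightarrow> \<F> \<subseteq> B \<Longrightarrow> (LINT x:\<Inter>\<F>|lborel. g x) = 0"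
  shows "AE x in lborel. g x = 0"
proof -
  define P where "P = {\<Inter>\<F> | \<F>. finite \<F> \<and> \<F> \<subseteq> B}"
  have stable: "Int_stable P"
    unfolding Int_stable_def P_def
  proof safe
    fix F G assume "finite F" "F \<subseteq> B" "finite G" "G \<subseteq> B"
    then show "\<exists>\<F>. \<Inter>F \<inter> \<Inter>G = \<Inter>\<F> \<and> finite \<F> \<and> \<F> \<subseteq> B"
      by (intro exI[of _ "F \<union> G"]) auto
  qed
  have "open A" if "A \<in> P" for A
    using that topological_basis_open[OF B(2)] unfolding P_def by (auto intro!: open_Inter)
  then have "sigma_sets UNIV P \<subseteq> sets borel"
    by (intro sets.sigma_sets_subset[of P borel, simplified]) auto
  moreover have "sets borel \<subseteq> sigma_sets UNIV P"
  proof -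
    have "B \<subseteq> P" unfolding P_def by (auto intro: exI[of _ "{_}"])
    then show ?thesis
      unfolding borel_eq_countable_basis[OF B] using sigma_sets_subseteq[of B P UNIV] by simp
  qed
  ultimately have sets: "sigma_sets UNIV P = sets borel" by blast
  have int: "set_integrable lborel A g" if "A \<in> sets borel" for A
    unfolding set_integrable_def using that g by (intro integrable_mult_indicator) auto
  have P_zero: "(LINT x:A|lborel. g x) = 0" if "A \<in> P" for A
    using that zero unfolding P_def by blast
  have UNIV_zero: "(LINT x:UNIV|lborel. g x) = 0"
    using zero[of "{}"] by simp
  have PU: "P \<subseteq> Pow UNIV" by simp
  have all_zero: "(LINT x:A|lborel. g x) = 0" if "A \<in> sigma_sets UNIV P" for A
    using stable PU that
  proof (induction rule: sigma_sets_induct_disjoint)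
    case (basic A)
    then show ?case by (rule P_zero)
  next
    case empty
    then show ?case by (simp add: set_lebesgue_integral_def)
  next
    case (compl A)
    have "(LINT x:UNIV|lborel. g x) = (LINT x:A|lborel. g x) + (LINT x:UNIV - A|lborel. g x)"
      using compl(1) sets int by (subst set_integral_Un[symmetric]) auto
    then show ?case using compl(2) UNIV_zero by simp
  next
    case (union A)
    have "(LINT x:(\<Union>i. A i)|lborel. g x) = (\<Sum>i. (LINT x:A i|lborel. g x))"
    proof (rule lebesgue_integral_countable_add)
      show "A i \<in> sets lborel" for i using union(2) sets by auto
      show "i \<noteq> j \<Longrightarrow> A i \<inter> A j = {}" for i j using union(1) by (auto simp: disjoint_family_on_def)
      show "set_integrable lborel (\<Union>i. A i) g"
        using union(2) sets by (intro int) auto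
    qed
    then show ?case using union(3) by simp
  qed
  show ?thesis
    using density_unique_real[OF g, of "\<lambda>_. 0"] all_zero sets by (simp add: set_lebesgue_integral_def)
qed

instance l2 :: (euclidean_space, euclidean_space) second_countable_topology
proof
  obtain B :: "'a set set" where B: "countable B" "topological_basis B"
    using ex_countable_basis by blast
  define e :: "'a set set \<times> nat \<times> 'b \<Rightarrow> 'a \<Rightarrow> 'b"
    where "e = (\<lambda>(\<F>, n, b) x. indicator (\<Inter>\<F> \<inter> ball 0 (real n)) x *\<^sub>R b)"
  define S where "S = (\<lambda>i. abs_l2 (e i)) ` ({\<F>. finite \<F> \<and> \<F> \<subseteq> B} \<times> UNIV \<times> Basis)"
  have opn: "open (\<Inter>\<F>)" if "finite \<F>" "\<F> \<subseteq> B" for \<F>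
    using that topological_basis_open[OF B(2)] by (auto intro!: open_Inter)
  have e: "sq_int (e (\<F>, n, b))" if "finite \<F>" "\<F> \<subseteq> B" for \<F> n b
  proof -
    have "\<Inter>\<F> \<inter> ball 0 (real n) \<in> sets lborel" using opn[OF that] by auto
    moreover have "emeasure lborel (\<Inter>\<F> \<inter> ball 0 (real n)) < \<infinity>"
      by (intro emeasure_bounded_finite bounded_Int) auto
    ultimately have "integrable lborel (\<lambda>x. indicator (\<Inter>\<F> \<inter> ball 0 (real n)) x *\<^sub>R (norm b)\<^sup>2)"
      by (intro integrable_scaleR_left integrable_real_indicator)
    moreover have "(norm (e (\<F>, n, b) x))\<^sup>2 = indicator (\<Inter>\<F> \<inter> ball 0 (real n)) x *\<^sub>R (norm b)\<^sup>2" for x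
      by (simp add: e_def split: split_indicator)
    ultimately show ?thesis
      using \<open>\<Inter>\<F> \<inter> ball 0 (real n) \<in> sets lborel\<close> unfolding sq_int_def by (simp add: e_def)
  qed
  have "countable S"
    unfolding S_def using B(1)
    by (intro countable_image countable_SIGMA countable_Collect_finite_subset)
      (auto intro: countable_finite)
  then show "\<exists>B::('a, 'b) l2 set set. countable B \<and> open = generate_topology B"
  proof (rule countable_basis_of_total_set)
    fix F :: "('a, 'b) l2"
    assume orth: "\<And>s. s \<in> S \<Longrightarrow> F \<bullet> s = 0"
    have "AE x in lborel. indicator (ball 0 (real n)) x * (l2_fun F x \<bullet> b) = 0" if b: "b \<in> Basis" for n b
    proof (rule AE_zero_of_generator[OF _ B])
      have "integrable lborel (\<lambda>x. l2_fun F x \<bullet> e ({}, n, b) x)"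
        by (intro integrable_inner sq_int_l2_fun e) auto
      then show "integrable lborel (\<lambda>x. indicator (ball 0 (real n)) x * (l2_fun F x \<bullet> b))"
        by (simp add: e_def)
    next
      fix \<F> assume F: "finite \<F>" "\<F> \<subseteq> B"
      have "(LINT x|lborel. l2_fun F x \<bullet> e (\<F>, n, b) x) = F \<bullet> abs_l2 (e (\<F>, n, b))"
        using inner_abs_l2[OF sq_int_l2_fun e[OF F], of F] by simp
      also have "\<dots> = 0" using F b by (intro orth) (auto simp: S_def)
      also have "(LINT x|lborel. l2_fun F x \<bullet> e (\<F>, n, b) x)
          = (LINT x:\<Inter>\<F>|lborel. indicator (ball 0 (real n)) x * (l2_fun F x \<bullet> b))"
        unfolding set_lebesgue_integral_def
        by (rule Bochner_Integration.integral_cong) (auto simp: e_def split: split_indicator)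
      finally show "(LINT x:\<Inter>\<F>|lborel. indicator (ball 0 (real n)) x * (l2_fun F x \<bullet> b)) = 0" .
    qed
    then have "AE x in lborel. \<forall>n. \<forall>b\<in>Basis. indicator (ball 0 (real n)) x * (l2_fun F x \<bullet> b) = 0"
      by (subst AE_all_countable, intro allI) (subst AE_ball_countable, auto intro: countable_finite)
    then have "AE x in lborel. l2_fun F x = l2_fun 0 x"
      using l2_fun_zero[where 'a = 'a and 'b = 'b]
    proof eventually_elim
      case (elim x)
      obtain n where "norm x < real n" using reals_Archimedean2 by blast
      then have "x \<in> ball 0 (real n)" by simp
      then have "l2_fun F x \<bullet> b = 0" if "b \<in> Basis" for b
        using elim(1) that by (metis indicator_simps(1) mult_1)
      then have "l2_fun F x = 0" using euclidean_all_zero_iff[of "l2_fun F x"] by blast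
      then show ?case using elim(2) by simp
    qed
    then show "F = 0" by (rule l2_eqI)
  qed
qed

lemma integral_norm_mult_le:
  fixes f :: "'a::euclidean_space \<Rightarrow> 'b::euclidean_space" and g :: "'a \<Rightarrow> 'c::euclidean_space"
  assumes "sq_int f" "sq_int g"
  shows "(LINT x|lborel. norm (f x) * norm (g x))
    \<le> sqrt (LINT x|lborel. (norm (f x))\<^sup>2) * sqrt (LINT x|lborel. (norm (g x))\<^sup>2)"
proof -
  have n: "sq_int (\<lambda>x. norm (f x))" "sq_int (\<lambda>x. norm (g x))"
    using assms by (auto simp: sq_int_def)
  have "(LINT x|lborel. norm (f x) * norm (g x)) = abs_l2 (\<lambda>x. norm (f x)) \<bullet> abs_l2 (\<lambda>x. norm (g x))"
    by (simp add: inner_abs_l2 n)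
  also have "\<dots> \<le> norm (abs_l2 (\<lambda>x. norm (f x))) * norm (abs_l2 (\<lambda>x. norm (g x)))"
    by (rule norm_cauchy_schwarz)
  also have "\<dots> = sqrt (LINT x|lborel. (norm (f x))\<^sup>2) * sqrt (LINT x|lborel. (norm (g x))\<^sup>2)"
    unfolding norm_l2_def by (simp add: inner_abs_l2 n power2_eq_square)
  finally show ?thesis .
qed

lemma l2_pairing:
  fixes c :: "'b::euclidean_space \<Rightarrow> complex" and \<psi> :: "'a::euclidean_space \<Rightarrow> complex"
  assumes c: "bounded_linear c" and \<psi>: "sq_int \<psi>"
  shows integrable_l2_pairing: "\<And>F :: ('a, 'b) l2. integrable lborel (\<lambda>x. c (l2_fun F x) * \<psi> x)"
    and bounded_linear_l2_pairing: "bounded_linear (\<lambda>F :: ('a, 'b) l2. LINT x|lborel. c (l2_fun F x) * \<psi> x)"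
proof -
  interpret c: bounded_linear c by fact
  obtain K where K: "K > 0" "\<And>y. norm (c y) \<le> norm y * K" using c.pos_bounded by blast
  have [measurable]: "\<psi> \<in> borel_measurable borel" using \<psi> by (simp add: sq_int_def)
  have [measurable]: "c \<in> borel_measurable borel"
    by (intro borel_measurable_continuous_onI linear_continuous_on c)
  have bd: "norm (c y * z) \<le> K * (norm y * norm z)" for y z
    using mult_right_mono[OF K(2)[of y] norm_ge_zero[of z]] by (simp add: norm_mult mult_ac)
  show int: "integrable lborel (\<lambda>x. c (l2_fun F x) * \<psi> x)" for F :: "('a, 'b) l2"
  proof (rule Bochner_Integration.integrable_bound)
    show "integrable lborel (\<lambda>x. K * (norm (l2_fun F x) * norm (\<psi> x)))"
      by (intro integrable_mult_right integrable_norm_mult sq_int_l2_fun \<psi>)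
    show "AE x in lborel. norm (c (l2_fun F x) * \<psi> x) \<le> norm (K * (norm (l2_fun F x) * norm (\<psi> x)))"
      using bd K(1) by (auto simp: abs_mult)
  qed simp
  show "bounded_linear (\<lambda>F :: ('a, 'b) l2. LINT x|lborel. c (l2_fun F x) * \<psi> x)"
  proof (rule bounded_linear_intro[where K = "K * sqrt (LINT x|lborel. (norm (\<psi> x))\<^sup>2)"])
    fix F G :: "('a, 'b) l2" and r :: real
    have "(LINT x|lborel. c (l2_fun (F + G) x) * \<psi> x)
        = (LINT x|lborel. c (l2_fun F x) * \<psi> x + c (l2_fun G x) * \<psi> x)"
    proof (rule integral_cong_AE)
      show "AE x in lborel. c (l2_fun (F + G) x) * \<psi> x = c (l2_fun F x) * \<psi> x + c (l2_fun G x) * \<psi> x"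
        using l2_fun_plus[of F G] by eventually_elim (simp add: c.add distrib_right)
    qed auto
    then show "(LINT x|lborel. c (l2_fun (F + G) x) * \<psi> x)
        = (LINT x|lborel. c (l2_fun F x) * \<psi> x) + (LINT x|lborel. c (l2_fun G x) * \<psi> x)"
      by (simp add: int)
    have "(LINT x|lborel. c (l2_fun (r *\<^sub>R F) x) * \<psi> x) = (LINT x|lborel. r *\<^sub>R (c (l2_fun F x) * \<psi> x))"
    proof (rule integral_cong_AE)
      show "AE x in lborel. c (l2_fun (r *\<^sub>R F) x) * \<psi> x = r *\<^sub>R (c (l2_fun F x) * \<psi> x)"
        using l2_fun_scaleR[of r F] by eventually_elim (simp add: c.scaleR)
    qed auto
    then show "(LINT x|lborel. c (l2_fun (r *\<^sub>R F) x) * \<psi> x) = r *\<^sub>R (LINT x|lborel. c (l2_fun F x) * \<psi> x)"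
      by simp
    have "norm (LINT x|lborel. c (l2_fun F x) * \<psi> x) \<le> (LINT x|lborel. K * (norm (l2_fun F x) * norm (\<psi> x)))"
      by (intro Bochner_Integration.integral_norm_bound_integral int integrable_mult_right integrable_norm_mult
          sq_int_l2_fun \<psi> bd)
    also have "\<dots> = K * (LINT x|lborel. norm (l2_fun F x) * norm (\<psi> x))" by simp
    also have "\<dots> \<le> K * (norm F * sqrt (LINT x|lborel. (norm (\<psi> x))\<^sup>2))"
      using integral_norm_mult_le[OF sq_int_l2_fun[of F] \<psi>] K(1)
      by (intro mult_left_mono) (simp_all add: norm_l2_sq[symmetric])
    finally show "norm (LINT x|lborel. c (l2_fun F x) * \<psi> x) \<le> norm F * (K * sqrt (LINT x|lborel. (norm (\<psi> x))\<^sup>2))"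
      by (simp add: mult_ac)
  qed
qed

lemma measurable_fst_l2 [measurable]:
    "(\<lambda>x. fst (l2_fun (F :: ('a, 'b \<times> 'c) l2) x)) \<in> borel_measurable (borel :: 'a::euclidean_space measure)"
  and measurable_snd_l2 [measurable]:
    "(\<lambda>x. snd (l2_fun (F :: ('a, 'b::euclidean_space \<times> 'c::euclidean_space) l2) x)) \<in> borel_measurable borel"
  by (rule measurable_compose[OF measurable_l2_fun borel_measurable_continuous_onI];
      intro continuous_intros)+

section \<open>The Sobolev space H1\<close>

definition partial_deriv :: "'d::finite \<Rightarrow> (real^'d \<Rightarrow> complex) \<Rightarrow> real^'d \<Rightarrow> complex" where
  "partial_deriv j \<phi> x = frechet_derivative \<phi> (at x) (axis j 1)"

text \<open>Complex-valued functions of class \<open>C\<^sub>c\<^sup>\<infinity>\<close>: all iterated partial derivatives exist and are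
  differentiable.\<close>

definition test_function :: "(real^'d::finite \<Rightarrow> complex) \<Rightarrow> bool" where
  "test_function \<phi> \<longleftrightarrow>
     (\<forall>js x. foldr partial_deriv js \<phi> differentiable at x) \<and> compact (closure {x. \<phi> x \<noteq> 0})"

definition weak_gradient :: "(real^'d::finite \<Rightarrow> complex) \<Rightarrow> (real^'d \<Rightarrow> complex^'d) \<Rightarrow> bool" where
  "weak_gradient a g \<longleftrightarrow> (\<forall>\<phi> j. test_function \<phi> \<longrightarrow>
     (LINT x|lborel. a x * partial_deriv j \<phi> x) = - (LINT x|lborel. g x $ j * \<phi> x))"

lemma sq_int_compact_support:
  fixes f :: "'a::euclidean_space \<Rightarrow> 'b::euclidean_space"
  assumes "continuous_on UNIV f" "compact K" "\<And>x. x \<notin> K \<Longrightarrow> f x = 0"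
  shows "sq_int f"
  unfolding sq_int_def
proof
  show "f \<in> borel_measurable lborel"
    using assms(1) by (simp add: borel_measurable_continuous_onI)
  have "integrable lborel (\<lambda>x. indicator K x *\<^sub>R (norm (f x))\<^sup>2)"
    by (rule borel_integrable_compact) (intro assms continuous_intros continuous_on_subset[OF assms(1)] subset_UNIV)+
  moreover have "(\<lambda>x. indicator K x *\<^sub>R (norm (f x))\<^sup>2) = (\<lambda>x. (norm (f x))\<^sup>2)"
    using assms(3) by (auto simp: fun_eq_iff split: split_indicator)
  ultimately show "integrable lborel (\<lambda>x. (norm (f x))\<^sup>2)" by simp
qed

lemma sq_int_test_function:
  assumes "test_function \<phi>"
  shows "sq_int \<phi>" "sq_int (partial_deriv j \<phi>)"
proof -
  define K where "K = closure {x. \<phi> x \<noteq> 0}"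
  have K: "compact K" using assms by (simp add: test_function_def K_def)
  have diff: "foldr partial_deriv js \<phi> differentiable at x" for js x
    using assms by (simp add: test_function_def)
  have cont: "continuous_on UNIV (foldr partial_deriv js \<phi>)" for js
    using diff by (intro differentiable_imp_continuous_on) (simp add: differentiable_on_def)
  have out: "\<phi> x = 0" if "x \<notin> K" for x
    using that closure_subset[of "{x. \<phi> x \<noteq> 0}"] unfolding K_def by auto
  show "sq_int \<phi>"
    using cont[of "[]"] K out by (intro sq_int_compact_support) auto
  have "partial_deriv j \<phi> x = 0" if x: "x \<notin> K" for x
  proof -
    have "(\<phi> has_derivative (\<lambda>_. 0)) (at x)"
    proof (rule has_derivative_transform_within_open)
      show "((\<lambda>_. 0) has_derivative (\<lambda>_. 0)) (at x)" by simp
      show "open (- K)" by (simp add: K_def open_Compl)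
    qed (use x out in auto)
    then have "frechet_derivative \<phi> (at x) = (\<lambda>_. 0)"
      by (rule frechet_derivative_at[symmetric])
    then show ?thesis by (simp add: partial_deriv_def)
  qed
  then show "sq_int (partial_deriv j \<phi>)"
    using cont[of "[j]"] K by (intro sq_int_compact_support) auto
qed

definition h1_graph :: "(real^'d::finite, complex \<times> (complex^'d)) l2 set" where
  "h1_graph = {F. weak_gradient (\<lambda>x. fst (l2_fun F x)) (\<lambda>x. snd (l2_fun F x))}"

definition h1_defect :: "(real^'d::finite \<Rightarrow> complex) \<Rightarrow> 'd \<Rightarrow> (real^'d, complex \<times> (complex^'d)) l2 \<Rightarrow> complex" where
  "h1_defect \<phi> j F = (LINT x|lborel. fst (l2_fun F x) * partial_deriv j \<phi> x)
     + (LINT x|lborel. snd (l2_fun F x) $ j * \<phi> x)"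

lemma bounded_linear_h1_defect: "test_function \<phi> \<Longrightarrow> bounded_linear (h1_defect \<phi> j)"
  unfolding h1_defect_def
  by (intro bounded_linear_add bounded_linear_l2_pairing sq_int_test_function bounded_linear_fst
      bounded_linear_compose[OF bounded_linear_vec_nth bounded_linear_snd])

lemma h1_graph_eq: "h1_graph = (\<Inter>(\<phi>, j)\<in>{\<phi>. test_function \<phi>} \<times> UNIV. {F. h1_defect \<phi> j F = 0})"
  unfolding h1_graph_def weak_gradient_def h1_defect_def by (auto simp: eq_neg_iff_add_eq_0)

lemma subspace_h1_graph: "subspace (h1_graph :: (real^'d::finite, complex \<times> (complex^'d)) l2 set)"
proof -
  have "subspace {F. h1_defect \<phi> j F = 0}"
    if "test_function \<phi>" for \<phi> :: "real^'d \<Rightarrow> complex" and j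
    using bounded_linear_h1_defect[OF that, of j, THEN bounded_linear.linear]
    by (auto simp: subspace_def linear_0 linear_add linear_scale)
  then show ?thesis unfolding h1_graph_eq by (intro subspace_Inter) auto
qed

lemma closed_h1_graph: "closed (h1_graph :: (real^'d::finite, complex \<times> (complex^'d)) l2 set)"
proof -
  have "closed {F. h1_defect \<phi> j F = 0}"
    if "test_function \<phi>" for \<phi> :: "real^'d \<Rightarrow> complex" and j
    by (intro closed_Collect_eq continuous_on_const linear_continuous_on bounded_linear_h1_defect that)
  then show ?thesis unfolding h1_graph_eq by (intro closed_INT) auto
qed

text \<open>An element of \<open>H\<^sup>1(\<real>\<^sup>d)\<close> is an \<open>L\<^sup>2\<close> function together with its weak gradient, which is
  unique as a class. The product norm on \<open>\<complex> \<times> \<complex>\<^sup>d\<close> induces the usual Sobolev norm, see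
  \<open>norm_h1_sq\<close>; conversely \<open>h1_exists\<close> shows that no element is missing.\<close>

typedef (overloaded) 'd h1 = "h1_graph :: (real^'d::finite, complex \<times> (complex^'d)) l2 set"
  using subspace_0[OF subspace_h1_graph] by blast

instantiation h1 :: (finite) real_inner
begin

definition zero_h1 :: "'a h1" where "0 = Abs_h1 0"
definition plus_h1 :: "'a h1 \<Rightarrow> 'a h1 \<Rightarrow> 'a h1" where "v + w = Abs_h1 (Rep_h1 v + Rep_h1 w)"
definition minus_h1 :: "'a h1 \<Rightarrow> 'a h1 \<Rightarrow> 'a h1" where "v - w = Abs_h1 (Rep_h1 v - Rep_h1 w)"
definition uminus_h1 :: "'a h1 \<Rightarrow> 'a h1" where "- v = Abs_h1 (- Rep_h1 v)"
definition scaleR_h1 :: "real \<Rightarrow> 'a h1 \<Rightarrow> 'a h1" where "c *\<^sub>R v = Abs_h1 (c *\<^sub>R Rep_h1 v)"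
definition inner_h1 :: "'a h1 \<Rightarrow> 'a h1 \<Rightarrow> real" where "v \<bullet> w = Rep_h1 v \<bullet> Rep_h1 w"
definition norm_h1 :: "'a h1 \<Rightarrow> real" where "norm (v :: 'a h1) = norm (Rep_h1 v)"
definition dist_h1 :: "'a h1 \<Rightarrow> 'a h1 \<Rightarrow> real" where "dist (v :: 'a h1) w = norm (v - w)"
definition sgn_h1 :: "'a h1 \<Rightarrow> 'a h1" where "sgn (v :: 'a h1) = inverse (norm v) *\<^sub>R v"
definition uniformity_h1 :: "('a h1 \<times> 'a h1) filter" where
  "uniformity = (INF e\<in>{0<..}. principal {(v, w :: 'a h1). dist v w < e})"
definition open_h1 :: "'a h1 set \<Rightarrow> bool" where
  "open U \<longleftrightarrow> (\<forall>v\<in>U. eventually (\<lambda>(v', w :: 'a h1). v' = v \<longrightarrow> w \<in> U) uniformity)"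

lemma Rep_h1_ops:
  fixes v w :: "'a h1"
  shows "Rep_h1 (0 :: 'a h1) = 0" "Rep_h1 (v + w) = Rep_h1 v + Rep_h1 w"
    "Rep_h1 (v - w) = Rep_h1 v - Rep_h1 w" "Rep_h1 (- v) = - Rep_h1 v"
    "Rep_h1 (c *\<^sub>R v) = c *\<^sub>R Rep_h1 v"
  unfolding zero_h1_def plus_h1_def minus_h1_def uminus_h1_def scaleR_h1_def
  by (intro Abs_h1_inverse subspace_0 subspace_add subspace_diff subspace_neg subspace_scale
      subspace_h1_graph Rep_h1)+

instance
proof
  fix u v w :: "'a h1" and c d :: real
  show "u + v + w = u + (v + w)" "u + v = v + u" "0 + v = v" "- v + v = 0" "v - w = v + - w"
    "c *\<^sub>R (v + w) = c *\<^sub>R v + c *\<^sub>R w" "(c + d) *\<^sub>R v = c *\<^sub>R v + d *\<^sub>R v"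
    "c *\<^sub>R d *\<^sub>R v = (c * d) *\<^sub>R v" "1 *\<^sub>R v = v"
    by (simp_all add: Rep_h1_inject[symmetric] Rep_h1_ops add.assoc add.commute scaleR_add_right scaleR_add_left)
  show "dist v w = norm (v - w)" by (rule dist_h1_def)
  show "sgn v = inverse (norm v) *\<^sub>R v" by (rule sgn_h1_def)
  show "uniformity = (INF e\<in>{0<..}. principal {(v, w :: 'a h1). dist v w < e})"
    by (rule uniformity_h1_def)
  show "open U \<longleftrightarrow> (\<forall>v\<in>U. eventually (\<lambda>(v', w). v' = v \<longrightarrow> w \<in> U) uniformity)"
    for U :: "'a h1 set" by (rule open_h1_def)
  show "norm v = sqrt (v \<bullet> v)" by (simp add: norm_h1_def inner_h1_def norm_eq_sqrt_inner)
  show "v \<bullet> w = w \<bullet> v" by (simp add: inner_h1_def inner_commute)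
  show "(u + v) \<bullet> w = u \<bullet> w + v \<bullet> w" "(c *\<^sub>R v) \<bullet> w = c * (v \<bullet> w)"
    "0 \<le> v \<bullet> v" "v \<bullet> v = 0 \<longleftrightarrow> v = 0"
    by (simp_all add: inner_h1_def Rep_h1_ops inner_add_left Rep_h1_inject[symmetric])
qed

end

lemma dist_Rep_h1: "dist (Rep_h1 v) (Rep_h1 w) = dist v w"
  by (simp add: dist_norm Rep_h1_ops norm_h1_def)

instance h1 :: (finite) banach
proof
  fix X :: "nat \<Rightarrow> 'a h1"
  assume "Cauchy X"
  then have "Cauchy (\<lambda>n. Rep_h1 (X n))" by (simp add: Cauchy_def dist_Rep_h1)
  then obtain F where F: "(\<lambda>n. Rep_h1 (X n)) \<longlonglongrightarrow> F"
    using convergent_eq_Cauchy by blast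
  have "F \<in> h1_graph"
    using closed_sequentially[OF closed_h1_graph _ F] Rep_h1 by blast
  then have "Rep_h1 (Abs_h1 F) = F" by (rule Abs_h1_inverse)
  then have "dist (X n) (Abs_h1 F) = dist (Rep_h1 (X n)) F" for n
    by (metis dist_Rep_h1)
  then have "X \<longlonglongrightarrow> Abs_h1 F"
    using tendsto_dist_iff[THEN iffD1, OF F] by (subst tendsto_dist_iff) simp
  then show "convergent X" by (auto simp: convergent_def)
qed

instance h1 :: (finite) second_countable_topology
  by standard (rule countable_basis_of_expanding_map[of 1 Rep_h1], simp add: dist_Rep_h1)

definition h1_val :: "'d::finite h1 \<Rightarrow> real^'d \<Rightarrow> complex" where
  "h1_val v x = fst (l2_fun (Rep_h1 v) x)"

definition h1_grad :: "'d::finite h1 \<Rightarrow> real^'d \<Rightarrow> complex^'d" where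
  "h1_grad v x = snd (l2_fun (Rep_h1 v) x)"

definition cscale_h1 :: "complex \<Rightarrow> 'd::finite h1 \<Rightarrow> 'd h1" where
  "cscale_h1 c v = Abs_h1 (abs_l2 (\<lambda>x. (c * h1_val v x, c *s h1_grad v x)))"

lemma norm_vector_scalar_mult: "norm (c *s (v :: complex^'d::finite)) = norm c * norm v"
  by (simp add: norm_vec_def L2_set_def norm_mult power_mult_distrib sum_distrib_left[symmetric] real_sqrt_mult)

lemma measurable_h1_val [measurable]: "h1_val v \<in> borel_measurable borel"
  unfolding h1_val_def [abs_def] by (rule measurable_fst_l2)

lemma measurable_h1_grad [measurable]: "h1_grad v \<in> borel_measurable borel"
  unfolding h1_grad_def [abs_def] by (rule measurable_snd_l2)

lemma sq_int_h1_val: "sq_int (h1_val v)"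
  by (rule sq_int_bound[OF sq_int_l2_fun[of "Rep_h1 v"], of _ 1]) (auto simp: h1_val_def norm_prod_def real_le_rsqrt)

lemma sq_int_h1_grad: "sq_int (h1_grad v)"
  by (rule sq_int_bound[OF sq_int_l2_fun[of "Rep_h1 v"], of _ 1]) (auto simp: h1_grad_def norm_prod_def real_le_rsqrt)

lemma weak_gradient_h1: "weak_gradient (h1_val v) (h1_grad v)"
  using Rep_h1[of v] by (simp add: h1_graph_def h1_val_def[abs_def] h1_grad_def[abs_def])

lemma norm_h1_sq:
  "(norm v)\<^sup>2 = (LINT x|lborel. (norm (h1_val v x))\<^sup>2) + (LINT x|lborel. (norm (h1_grad v x))\<^sup>2)"
proof -
  have "(norm v)\<^sup>2 = (LINT x|lborel. (norm (h1_val v x))\<^sup>2 + (norm (h1_grad v x))\<^sup>2)"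
    unfolding norm_h1_def norm_l2_sq by (simp add: h1_val_def h1_grad_def norm_prod_def)
  then show ?thesis
    using sq_int_h1_val[of v] sq_int_h1_grad[of v] by (simp add: sq_int_def)
qed

lemma h1_eqI:
  assumes "AE x in lborel. h1_val v x = h1_val w x" "AE x in lborel. h1_grad v x = h1_grad w x"
  shows "v = w"
proof -
  have "AE x in lborel. l2_fun (Rep_h1 v) x = l2_fun (Rep_h1 w) x"
    using assms by eventually_elim (simp add: h1_val_def h1_grad_def prod_eq_iff)
  then show ?thesis using l2_eqI Rep_h1_inject by blast
qed

lemma h1_exists:
  assumes "sq_int a" "sq_int g" "weak_gradient a g"
  shows "\<exists>v. (AE x in lborel. h1_val v x = a x) \<and> (AE x in lborel. h1_grad v x = g x)"
proof -
  define F where "F = abs_l2 (\<lambda>x. (a x, g x))"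
  have [measurable]: "a \<in> borel_measurable borel" "g \<in> borel_measurable borel"
    using assms(1,2) by (auto simp: sq_int_def)
  have "sq_int (\<lambda>x. (a x, g x))"
    using assms(1,2) unfolding sq_int_def by (auto simp: norm_prod_def)
  then have AE: "AE x in lborel. l2_fun F x = (a x, g x)"
    unfolding F_def by (rule l2_fun_abs)
  have "weak_gradient (\<lambda>x. fst (l2_fun F x)) (\<lambda>x. snd (l2_fun F x))"
    unfolding weak_gradient_def
  proof (intro allI impI)
    fix \<phi> :: "real^'a \<Rightarrow> complex" and j assume \<phi>: "test_function \<phi>"
    have [measurable]: "\<phi> \<in> borel_measurable borel" "partial_deriv j \<phi> \<in> borel_measurable borel"
      using sq_int_test_function[OF \<phi>] by (auto simp: sq_int_def)
    have nth: "(\<lambda>y :: complex^'a. y $ j) \<in> borel_measurable borel"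
      by (intro borel_measurable_continuous_onI continuous_intros)
    note [measurable] = measurable_compose[OF \<open>g \<in> borel_measurable borel\<close> nth]
      measurable_compose[OF measurable_snd_l2[of F] nth]
    have 1: "(LINT x|lborel. fst (l2_fun F x) * partial_deriv j \<phi> x) = (LINT x|lborel. a x * partial_deriv j \<phi> x)"
    proof (rule integral_cong_AE)
      show "AE x in lborel. fst (l2_fun F x) * partial_deriv j \<phi> x = a x * partial_deriv j \<phi> x"
        using AE by eventually_elim simp
    qed auto
    have 2: "(LINT x|lborel. snd (l2_fun F x) $ j * \<phi> x) = (LINT x|lborel. g x $ j * \<phi> x)"
    proof (rule integral_cong_AE)
      show "AE x in lborel. snd (l2_fun F x) $ j * \<phi> x = g x $ j * \<phi> x"
        using AE by eventually_elim simp
    qed auto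
    show "(LINT x|lborel. fst (l2_fun F x) * partial_deriv j \<phi> x) = - (LINT x|lborel. snd (l2_fun F x) $ j * \<phi> x)"
      using assms(3) \<phi> unfolding 1 2 weak_gradient_def by blast
  qed
  then have "Rep_h1 (Abs_h1 F) = F" by (intro Abs_h1_inverse) (simp add: h1_graph_def)
  moreover have "AE x in lborel. fst (l2_fun F x) = a x" "AE x in lborel. snd (l2_fun F x) = g x"
    using AE by (eventually_elim, simp)+
  ultimately show ?thesis
    by (intro exI[of _ "Abs_h1 F"] conjI) (simp_all add: h1_val_def h1_grad_def)
qed

lemma h1_val_cscale: "AE x in lborel. h1_val (cscale_h1 c v) x = c * h1_val v x"
  and h1_grad_cscale: "AE x in lborel. h1_grad (cscale_h1 c v) x = c *s h1_grad v x"
proof -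
  have ms: "(\<lambda>x. c *s h1_grad v x) \<in> borel_measurable borel"
  proof -
    have "continuous_on UNIV (\<lambda>y :: complex^'a. c *s y)"
      unfolding vector_scalar_mult_def by (intro continuous_intros)
    then show ?thesis by (rule measurable_compose[OF measurable_h1_grad borel_measurable_continuous_onI])
  qed
  have 1: "sq_int (\<lambda>x. c * h1_val v x)"
    by (rule sq_int_bound[OF sq_int_h1_val[of v], of _ "norm c"]) (auto simp: norm_mult)
  have 2: "sq_int (\<lambda>x. c *s h1_grad v x)"
    by (rule sq_int_bound[OF sq_int_h1_grad[of v], of _ "norm c"]) (auto simp: norm_vector_scalar_mult ms)
  have "weak_gradient (\<lambda>x. c * h1_val v x) (\<lambda>x. c *s h1_grad v x)"
    using weak_gradient_h1[of v] by (simp add: weak_gradient_def mult.assoc)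
  from h1_exists[OF 1 2 this] obtain w where
    w: "AE x in lborel. h1_val w x = c * h1_val v x" "AE x in lborel. h1_grad w x = c *s h1_grad v x"
    by blast
  have "sq_int (\<lambda>x. (c * h1_val v x, c *s h1_grad v x))"
    using 1 2 unfolding sq_int_def by (auto simp: norm_prod_def)
  from l2_fun_abs[OF this] w
  have "AE x in lborel. l2_fun (Rep_h1 w) x = l2_fun (abs_l2 (\<lambda>x. (c * h1_val v x, c *s h1_grad v x))) x"
    by eventually_elim (simp add: h1_val_def h1_grad_def prod_eq_iff)
  then have "Rep_h1 w = abs_l2 (\<lambda>x. (c * h1_val v x, c *s h1_grad v x))"
    by (rule l2_eqI)
  then have "cscale_h1 c v = w"
    unfolding cscale_h1_def by (metis Rep_h1_inverse)
  then show "AE x in lborel. h1_val (cscale_h1 c v) x = c * h1_val v x"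
    "AE x in lborel. h1_grad (cscale_h1 c v) x = c *s h1_grad v x"
    using w by simp_all
qed

lemma norm_cscale_h1: "norm (cscale_h1 c v) = norm c * norm v"
proof -
  have 1: "(LINT x|lborel. (norm (h1_val (cscale_h1 c v) x))\<^sup>2) = (LINT x|lborel. (norm c)\<^sup>2 * (norm (h1_val v x))\<^sup>2)"
  proof (rule integral_cong_AE)
    show "AE x in lborel. (norm (h1_val (cscale_h1 c v) x))\<^sup>2 = (norm c)\<^sup>2 * (norm (h1_val v x))\<^sup>2"
      using h1_val_cscale[of c v] by eventually_elim (simp add: norm_mult power_mult_distrib)
  qed auto
  have 2: "(LINT x|lborel. (norm (h1_grad (cscale_h1 c v) x))\<^sup>2) = (LINT x|lborel. (norm c)\<^sup>2 * (norm (h1_grad v x))\<^sup>2)"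
  proof (rule integral_cong_AE)
    show "AE x in lborel. (norm (h1_grad (cscale_h1 c v) x))\<^sup>2 = (norm c)\<^sup>2 * (norm (h1_grad v x))\<^sup>2"
      using h1_grad_cscale[of c v]
      by eventually_elim (simp add: norm_vector_scalar_mult power_mult_distrib)
  qed auto
  have "(norm (cscale_h1 c v))\<^sup>2 = (norm c * norm v)\<^sup>2"
    by (simp add: norm_h1_sq 1 2 power_mult_distrib distrib_left)
  then show ?thesis by (simp add: power2_eq_iff_nonneg)
qed

section \<open>The antidual of H1\<close>

definition antilinear_functionals :: "('d::finite h1 \<Rightarrow>\<^sub>L complex) set" where
  "antilinear_functionals = {\<Phi>. \<forall>c v. blinfun_apply \<Phi> (cscale_h1 c v) = cnj c * blinfun_apply \<Phi> v}"

lemma subspace_antilinear: "subspace (antilinear_functionals :: ('d::finite h1 \<Rightarrow>\<^sub>L complex) set)"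
  by (auto simp: subspace_def antilinear_functionals_def blinfun.add_left blinfun.scaleR_left
      blinfun.zero_left algebra_simps)

lemma closed_antilinear: "closed (antilinear_functionals :: ('d::finite h1 \<Rightarrow>\<^sub>L complex) set)"
proof -
  have eq: "(antilinear_functionals :: ('d h1 \<Rightarrow>\<^sub>L complex) set)
      = (\<Inter>(c, v)\<in>UNIV. {\<Phi>. blinfun_apply \<Phi> (cscale_h1 c v) = cnj c * blinfun_apply \<Phi> v})"
    unfolding antilinear_functionals_def by auto
  have "closed {\<Phi> :: 'd h1 \<Rightarrow>\<^sub>L complex. blinfun_apply \<Phi> (cscale_h1 c v) = cnj c * blinfun_apply \<Phi> v}" for c v
    by (intro closed_Collect_eq continuous_on_mult continuous_on_const
        linear_continuous_on[OF blinfun.bounded_linear_left])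
  then show ?thesis unfolding eq by (intro closed_INT) auto
qed

text \<open>Bounded antilinear functionals with the operator norm.\<close>

typedef (overloaded) 'd hm1 = "antilinear_functionals :: ('d::finite h1 \<Rightarrow>\<^sub>L complex) set"
  using subspace_0[OF subspace_antilinear] by blast

instantiation hm1 :: (finite) real_normed_vector
begin

definition zero_hm1 :: "'a hm1" where "0 = Abs_hm1 0"
definition plus_hm1 :: "'a hm1 \<Rightarrow> 'a hm1 \<Rightarrow> 'a hm1" where "F + G = Abs_hm1 (Rep_hm1 F + Rep_hm1 G)"
definition minus_hm1 :: "'a hm1 \<Rightarrow> 'a hm1 \<Rightarrow> 'a hm1" where "F - G = Abs_hm1 (Rep_hm1 F - Rep_hm1 G)"
definition uminus_hm1 :: "'a hm1 \<Rightarrow> 'a hm1" where "- F = Abs_hm1 (- Rep_hm1 F)"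
definition scaleR_hm1 :: "real \<Rightarrow> 'a hm1 \<Rightarrow> 'a hm1" where "c *\<^sub>R F = Abs_hm1 (c *\<^sub>R Rep_hm1 F)"
definition norm_hm1 :: "'a hm1 \<Rightarrow> real" where "norm (F :: 'a hm1) = norm (Rep_hm1 F)"
definition dist_hm1 :: "'a hm1 \<Rightarrow> 'a hm1 \<Rightarrow> real" where "dist (F :: 'a hm1) G = norm (F - G)"
definition sgn_hm1 :: "'a hm1 \<Rightarrow> 'a hm1" where "sgn (F :: 'a hm1) = inverse (norm F) *\<^sub>R F"
definition uniformity_hm1 :: "('a hm1 \<times> 'a hm1) filter" where
  "uniformity = (INF e\<in>{0<..}. principal {(F, G :: 'a hm1). dist F G < e})"
definition open_hm1 :: "'a hm1 set \<Rightarrow> bool" where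
  "open U \<longleftrightarrow> (\<forall>F\<in>U. eventually (\<lambda>(F', G :: 'a hm1). F' = F \<longrightarrow> G \<in> U) uniformity)"

lemma Rep_hm1_ops:
  fixes F G :: "'a hm1"
  shows "Rep_hm1 (0 :: 'a hm1) = 0" "Rep_hm1 (F + G) = Rep_hm1 F + Rep_hm1 G"
    "Rep_hm1 (F - G) = Rep_hm1 F - Rep_hm1 G" "Rep_hm1 (- F) = - Rep_hm1 F"
    "Rep_hm1 (c *\<^sub>R F) = c *\<^sub>R Rep_hm1 F"
  unfolding zero_hm1_def plus_hm1_def minus_hm1_def uminus_hm1_def scaleR_hm1_def
  by (intro Abs_hm1_inverse subspace_0 subspace_add subspace_diff subspace_neg subspace_scale
      subspace_antilinear Rep_hm1)+

instance
proof
  fix F G H :: "'a hm1" and c d :: real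
  show "F + G + H = F + (G + H)" "F + G = G + F" "0 + F = F" "- F + F = 0" "F - G = F + - G"
    "c *\<^sub>R (F + G) = c *\<^sub>R F + c *\<^sub>R G" "(c + d) *\<^sub>R F = c *\<^sub>R F + d *\<^sub>R F"
    "c *\<^sub>R d *\<^sub>R F = (c * d) *\<^sub>R F" "1 *\<^sub>R F = F"
    by (simp_all add: Rep_hm1_inject[symmetric] Rep_hm1_ops add.assoc add.commute scaleR_add_right scaleR_add_left)
  show "dist F G = norm (F - G)" by (rule dist_hm1_def)
  show "sgn F = inverse (norm F) *\<^sub>R F" by (rule sgn_hm1_def)
  show "uniformity = (INF e\<in>{0<..}. principal {(F, G :: 'a hm1). dist F G < e})"
    by (rule uniformity_hm1_def)
  show "open U \<longleftrightarrow> (\<forall>F\<in>U. eventually (\<lambda>(F', G). F' = F \<longrightarrow> G \<in> U) uniformity)"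
    for U :: "'a hm1 set" by (rule open_hm1_def)
  show "norm F = 0 \<longleftrightarrow> F = 0" by (simp add: norm_hm1_def Rep_hm1_inject[symmetric] Rep_hm1_ops)
  show "norm (F + G) \<le> norm F + norm G" by (simp add: norm_hm1_def Rep_hm1_ops norm_triangle_ineq)
  show "norm (c *\<^sub>R F) = \<bar>c\<bar> * norm F" by (simp add: norm_hm1_def Rep_hm1_ops)
qed

end

lemma dist_Rep_hm1: "dist (Rep_hm1 F) (Rep_hm1 G) = dist F G"
  by (simp add: dist_norm Rep_hm1_ops norm_hm1_def)

instance hm1 :: (finite) banach
proof
  fix X :: "nat \<Rightarrow> 'a hm1"
  assume "Cauchy X"
  then have "Cauchy (\<lambda>n. Rep_hm1 (X n))" by (simp add: Cauchy_def dist_Rep_hm1)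
  then obtain F where F: "(\<lambda>n. Rep_hm1 (X n)) \<longlonglongrightarrow> F"
    using convergent_eq_Cauchy by blast
  have "F \<in> antilinear_functionals"
    using closed_sequentially[OF closed_antilinear _ F] Rep_hm1 by blast
  then have "Rep_hm1 (Abs_hm1 F) = F" by (rule Abs_hm1_inverse)
  then have "dist (X n) (Abs_hm1 F) = dist (Rep_hm1 (X n)) F" for n
    by (metis dist_Rep_hm1)
  then have "X \<longlonglongrightarrow> Abs_hm1 F"
    using tendsto_dist_iff[THEN iffD1, OF F] by (subst tendsto_dist_iff) simp
  then show "convergent X" by (auto simp: convergent_def)
qed

text \<open>The duality pairing, linear in the first and antilinear in the second argument.\<close>

definition hm1_apply :: "'d::finite hm1 \<Rightarrow> 'd h1 \<Rightarrow> complex" where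
  "hm1_apply F w = blinfun_apply (Rep_hm1 F) w"

lemma hm1_apply_cscale: "hm1_apply F (cscale_h1 c w) = cnj c * hm1_apply F w"
  using Rep_hm1[of F] by (simp add: hm1_apply_def antilinear_functionals_def)

lemma hm1_apply_diff: "hm1_apply (F - G) w = hm1_apply F w - hm1_apply G w"
  by (simp add: hm1_apply_def Rep_hm1_ops blinfun.diff_left)

lemma bounded_linear_hm1_apply: "bounded_linear (hm1_apply F)"
  unfolding hm1_apply_def [abs_def] by (rule blinfun.bounded_linear_right)

lemma hm1_eqI: "(\<And>w. hm1_apply F w = hm1_apply G w) \<Longrightarrow> F = G"
  unfolding hm1_apply_def by (metis Rep_hm1_inject blinfun_eqI)

instance hm1 :: (finite) second_countable_topology
proof
  have "\<exists>z. \<forall>w. Re (hm1_apply F w) = z \<bullet> w" for F :: "'a hm1"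
    using riesz_representation_real[OF bounded_linear_compose[OF bounded_linear_Re bounded_linear_hm1_apply]]
    by metis
  then obtain z :: "'a hm1 \<Rightarrow> 'a h1" where z: "\<And>F w. Re (hm1_apply F w) = z F \<bullet> w" by metis
  have "dist F G \<le> 2 * dist (z F) (z G)" for F G
  proof -
    have Re: "\<bar>Re (hm1_apply (F - G) w)\<bar> \<le> dist (z F) (z G) * norm w" for w
      using Cauchy_Schwarz_ineq2[of "z F - z G" w]
      by (simp add: hm1_apply_diff z inner_diff_left dist_norm)
    have "norm (hm1_apply (F - G) w) \<le> 2 * dist (z F) (z G) * norm w" for w
    proof -
      have "Im (hm1_apply (F - G) w) = Re (hm1_apply (F - G) (cscale_h1 \<i> w))"
        by (simp add: hm1_apply_cscale)
      then have "\<bar>Im (hm1_apply (F - G) w)\<bar> \<le> dist (z F) (z G) * norm w"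
        using Re[of "cscale_h1 \<i> w"] by (simp add: norm_cscale_h1)
      then show ?thesis
        using Re[of w] cmod_le[of "hm1_apply (F - G) w"] by linarith
    qed
    then show ?thesis
      unfolding dist_norm[of F G] norm_hm1_def hm1_apply_def
      by (intro norm_blinfun_bound) auto
  qed
  then show "\<exists>B::'a hm1 set set. countable B \<and> open = generate_topology B"
    by (rule countable_basis_of_expanding_map)
qed

text \<open>The element of the antidual with prescribed values; meaningful when \<open>\<Phi>\<close> is a bounded
  antilinear functional, see below.\<close>

definition hm1_of :: "('d::finite h1 \<Rightarrow> complex) \<Rightarrow> 'd hm1" where
  "hm1_of \<Phi> = (THE F. \<forall>w. hm1_apply F w = \<Phi> w)"

lemma hm1_apply_hm1_of:
  assumes "bounded_linear \<Phi>" "\<And>c w. \<Phi> (cscale_h1 c w) = cnj c * \<Phi> w"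
  shows "hm1_apply (hm1_of \<Phi>) w = \<Phi> w"
proof -
  have "Blinfun \<Phi> \<in> antilinear_functionals"
    using assms by (simp add: antilinear_functionals_def bounded_linear_Blinfun_apply)
  then have "\<forall>w. hm1_apply (Abs_hm1 (Blinfun \<Phi>)) w = \<Phi> w"
    by (simp add: hm1_apply_def Abs_hm1_inverse bounded_linear_Blinfun_apply assms(1))
  then have "\<exists>!F. \<forall>w. hm1_apply F w = \<Phi> w"
    by (intro ex1I) (auto intro: hm1_eqI)
  from theI'[OF this] show ?thesis unfolding hm1_of_def by blast
qed

definition h1_to_hm1 :: "'d::finite h1 \<Rightarrow> 'd hm1" where
  "h1_to_hm1 v = hm1_of (\<lambda>w. LINT x|lborel. h1_val v x * cnj (h1_val w x))"

definition cdot :: "complex^'d::finite \<Rightarrow> complex^'d \<Rightarrow> complex" where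
  "cdot \<xi> \<eta> = (\<Sum>i\<in>UNIV. \<xi> $ i * cnj (\<eta> $ i))"

text \<open>\<open>div_grad A v\<close> is the distribution \<open>div (A \<nabla>v)\<close>.\<close>

definition div_grad :: "(real^'d::finite \<Rightarrow> complex^'d^'d) \<Rightarrow> 'd h1 \<Rightarrow> 'd hm1" where
  "div_grad A v = hm1_of (\<lambda>w. - (LINT x|lborel. cdot (A x *v h1_grad v x) (h1_grad w x)))"

lemma measurable_cnj [measurable]:
  "f \<in> borel_measurable M \<Longrightarrow> (\<lambda>x. cnj (f x)) \<in> borel_measurable M"
  by (rule borel_measurable_continuous_on[of cnj]) (auto intro: continuous_intros)

lemma bounded_linear_Rep_h1: "bounded_linear Rep_h1"
  by (rule bounded_linear_intro[where K = 1]) (auto simp: Rep_h1_ops norm_h1_def)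

lemma hm1_apply_h1_to_hm1:
  "hm1_apply (h1_to_hm1 v) w = (LINT x|lborel. h1_val v x * cnj (h1_val w x))"
  unfolding h1_to_hm1_def
proof (rule hm1_apply_hm1_of)
  have "bounded_linear (\<lambda>w. LINT x|lborel. cnj (fst (l2_fun (Rep_h1 w) x)) * h1_val v x)"
    by (intro bounded_linear_compose[OF bounded_linear_l2_pairing bounded_linear_Rep_h1]
        bounded_linear_compose[OF bounded_linear_cnj bounded_linear_fst] sq_int_h1_val)
  then show "bounded_linear (\<lambda>w. LINT x|lborel. h1_val v x * cnj (h1_val w x))"
    by (simp add: h1_val_def mult.commute)
  fix c w
  have "(LINT x|lborel. h1_val v x * cnj (h1_val (cscale_h1 c w) x))
      = (LINT x|lborel. cnj c * (h1_val v x * cnj (h1_val w x)))"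
  proof (rule integral_cong_AE)
    show "AE x in lborel. h1_val v x * cnj (h1_val (cscale_h1 c w) x) = cnj c * (h1_val v x * cnj (h1_val w x))"
      using h1_val_cscale[of c w] by eventually_elim (simp add: mult_ac)
  qed auto
  then show "(LINT x|lborel. h1_val v x * cnj (h1_val (cscale_h1 c w) x))
      = cnj c * (LINT x|lborel. h1_val v x * cnj (h1_val w x))"
    by simp
qed

lemma hm1_apply_div_grad:
  assumes A: "A \<in> borel_measurable borel" and bd: "\<And>x \<xi>. norm (A x *v \<xi>) \<le> \<Lambda> * norm \<xi>"
  shows "hm1_apply (div_grad A v) w = - (LINT x|lborel. cdot (A x *v h1_grad v x) (h1_grad w x))"
  unfolding div_grad_def
proof (rule hm1_apply_hm1_of)
  have nth: "(\<lambda>y :: complex^'a. y $ i) \<in> borel_measurable borel" for i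
    by (intro borel_measurable_continuous_onI continuous_intros)
  have nth2: "(\<lambda>y :: complex^'a^'a. y $ i $ j) \<in> borel_measurable borel" for i j
    by (intro borel_measurable_continuous_onI continuous_intros)
  note [measurable] = measurable_compose[OF A nth2] measurable_compose[OF measurable_h1_grad nth]
  have comp: "(\<lambda>x. (A x *v h1_grad v x) $ i) \<in> borel_measurable borel" for i
    unfolding matrix_vector_mult_def by simp
  have sq: "sq_int (\<lambda>x. (A x *v h1_grad v x) $ i)" for i
  proof (rule sq_int_bound[OF sq_int_h1_grad[of v]])
    show "norm ((A x *v h1_grad v x) $ i) \<le> \<Lambda> * norm (h1_grad v x)" for x
      using Finite_Cartesian_Product.norm_nth_le[of "A x *v h1_grad v x" i] bd[of x "h1_grad v x"] by linarith
  qed (use comp in simp)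
  have lin: "bounded_linear (\<lambda>y :: complex \<times> (complex^'a). cnj (snd y $ i))" for i
    by (intro bounded_linear_compose[OF bounded_linear_cnj]
        bounded_linear_compose[OF bounded_linear_vec_nth bounded_linear_snd])
  have eq: "(LINT x|lborel. cdot (A x *v h1_grad v x) (h1_grad w x))
      = (\<Sum>i\<in>UNIV. LINT x|lborel. cnj (snd (l2_fun (Rep_h1 w) x) $ i) * (A x *v h1_grad v x) $ i)" for w
  proof -
    have "(LINT x|lborel. cdot (A x *v h1_grad v x) (h1_grad w x))
      = (LINT x|lborel. (\<Sum>i\<in>UNIV. cnj (snd (l2_fun (Rep_h1 w) x) $ i) * (A x *v h1_grad v x) $ i))"
      by (simp add: cdot_def h1_grad_def mult.commute)
    then show ?thesis
      using integrable_l2_pairing[OF lin sq] by simp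
  qed
  show "bounded_linear (\<lambda>w. - (LINT x|lborel. cdot (A x *v h1_grad v x) (h1_grad w x)))"
    unfolding eq
    by (intro bounded_linear_minus bounded_linear_sum
        bounded_linear_compose[OF bounded_linear_l2_pairing[OF lin sq] bounded_linear_Rep_h1])
  fix c w
  have "(LINT x|lborel. cdot (A x *v h1_grad v x) (h1_grad (cscale_h1 c w) x))
      = (LINT x|lborel. cnj c * cdot (A x *v h1_grad v x) (h1_grad w x))"
  proof (rule integral_cong_AE)
    show "AE x in lborel. cdot (A x *v h1_grad v x) (h1_grad (cscale_h1 c w) x)
        = cnj c * cdot (A x *v h1_grad v x) (h1_grad w x)"
      using h1_grad_cscale[of c w]
      by eventually_elim (simp add: cdot_def sum_distrib_left mult_ac)
  qed (use comp in \<open>simp_all add: cdot_def\<close>)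
  then show "- (LINT x|lborel. cdot (A x *v h1_grad v x) (h1_grad (cscale_h1 c w) x))
      = cnj c * - (LINT x|lborel. cdot (A x *v h1_grad v x) (h1_grad w x))"
    by simp
qed

section \<open>Bochner spaces on the unit interval\<close>

text \<open>For values in a second countable (hence separable) Banach space, Borel measurability is
  strong measurability.\<close>

abbreviation I01 :: "real measure" where
  "I01 \<equiv> restrict_space lborel {0..1}"

definition Lp01 :: "real \<Rightarrow> (real \<Rightarrow> 'a::{banach, second_countable_topology}) set" where
  "Lp01 p = {u. u \<in> borel_measurable I01 \<and> integrable I01 (\<lambda>t. norm (u t) powr p)}"

definition time_test_function :: "(real \<Rightarrow> real) \<Rightarrow> bool" where
  "time_test_function \<phi> \<longleftrightarrow>
     (\<forall>n t. (deriv ^^ n) \<phi> differentiable at t) \<and> closure {t. \<phi> t \<noteq> 0} \<subseteq> {0<..<1}"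

definition weak_time_deriv ::
    "(real \<Rightarrow> 'a::{banach, second_countable_topology}) \<Rightarrow> (real \<Rightarrow> 'a) \<Rightarrow> bool" where
  "weak_time_deriv u g \<longleftrightarrow> (\<forall>\<phi>. time_test_function \<phi> \<longrightarrow>
     (LINT t|I01. deriv \<phi> t *\<^sub>R u t) = - (LINT t|I01. \<phi> t *\<^sub>R g t))"

definition W1p01 :: "real \<Rightarrow> (real \<Rightarrow> 'a::{banach, second_countable_topology}) set" where
  "W1p01 p = {u \<in> Lp01 p. \<exists>g\<in>Lp01 p. weak_time_deriv u g}"

section \<open>The parabolic problem\<close>

text \<open>Measurability is Borel measurability on \<open>[0,1] \<times> \<real>\<^sup>d\<close>, so that every time slice \<open>B t\<close> is
  measurable and \<open>div_grad (B t)\<close> is defined for every \<open>t \<in> [0,1]\<close>.\<close>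

definition elliptic :: "(real \<Rightarrow> real^'d::finite \<Rightarrow> complex^'d^'d) \<Rightarrow> bool" where
  "elliptic B \<longleftrightarrow>
     (\<lambda>(t, x). B t x) \<in> borel_measurable (restrict_space borel ({0..1} \<times> UNIV)) \<and>
     (\<exists>\<Lambda>>0. \<exists>l>0. \<forall>t\<in>{0..1}. \<forall>x \<xi>.
        norm (B t x *v \<xi>) \<le> \<Lambda> * norm \<xi> \<and> Re (cdot (B t x *v \<xi>) \<xi>) \<ge> l * (norm \<xi>)\<^sup>2)"

lemma hm1_apply_div_grad_elliptic:
  assumes "elliptic B" "t \<in> {0..1}"
  shows "hm1_apply (div_grad (B t) v) w = - (LINT x|lborel. cdot (B t x *v h1_grad v x) (h1_grad w x))"
proof -
  have B: "(\<lambda>(t, x). B t x) \<in> borel_measurable (restrict_space borel ({0..1} \<times> UNIV))"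
    using assms(1) by (simp add: elliptic_def)
  have "(\<lambda>x. (t, x)) \<in> measurable borel (restrict_space borel ({0..1} \<times> UNIV))"
    using assms(2)
    by (intro measurable_restrict_space2 borel_measurable_continuous_onI continuous_intros) auto
  from measurable_compose[OF this B] have "B t \<in> borel_measurable borel" by simp
  moreover obtain \<Lambda> where "\<And>x \<xi>. norm (B t x *v \<xi>) \<le> \<Lambda> * norm \<xi>"
    using assms unfolding elliptic_def by blast
  ultimately show ?thesis by (rule hm1_apply_div_grad)
qed

text \<open>The solution class \<open>L\<^sup>q(0,1;H\<^sup>1) \<inter> W\<^sup>1\<^sup>,\<^sup>q(0,1;H\<^sup>-\<^sup>1)\<close>. Solutions in the sense of Lions are those
  with \<open>q = 2\<close>; \<open>q = 1\<close> is the largest class in which the Bochner integrals below make sense. \<open>U\<close> is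
  the continuous representative of \<open>u\<close> with values in \<open>H\<^sup>-\<^sup>1\<close>; the case \<open>t = 0\<close> is the initial
  condition.\<close>

definition solution ::
    "real \<Rightarrow> (real \<Rightarrow> real^'d::finite \<Rightarrow> complex^'d^'d) \<Rightarrow> (real \<Rightarrow> 'd hm1) \<Rightarrow> (real \<Rightarrow> 'd h1) \<Rightarrow> bool" where
  "solution q B f u \<longleftrightarrow>
     u \<in> Lp01 q \<and> (\<lambda>t. h1_to_hm1 (u t)) \<in> W1p01 q \<and>
     (\<exists>U. continuous_on {0..1} U \<and> (AE t in I01. U t = h1_to_hm1 (u t)) \<and>
       (\<forall>t\<in>{0..1}. U t - (LINT \<tau>:{0..t}|lborel. div_grad (B \<tau>) (u \<tau>)) = (LINT \<tau>:{0..t}|lborel. f \<tau>)))"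

end

theory Submission
  imports Defs
begin

text \<open>Energy is handed from frequency \<open>2\<^sup>n\<close> to frequency \<open>2\<^sup>n\<^sup>+\<^sup>1\<close>, stage after stage, so that the
  gradient of a function grows while its \<open>L\<^sup>2\<close> norm decays. Let \<open>s\<close> be the distance in time from the
  singular instant and let \<open>X n\<close> be a fixed smooth cutoff times a plane wave of frequency \<open>2\<^sup>n\<close>, whose
  direction is one of two coordinate axes, alternating with \<open>n\<close>. While \<open>s\<close> decreases from
  \<open>4\<^sup>-\<^sup>n\<close> to \<open>4\<^sup>-\<^sup>n\<^sup>-\<^sup>1\<close>, the function
  \<open>w(s) = s\<^sup>\<epsilon> (cos \<theta> X n + sin \<theta> X (n+1))\<close> turns from the first wave into the second, the angle \<open>\<theta>\<close>
  running from \<open>0\<close> to \<open>\<pi>/2\<close>. Its \<open>L\<^sup>2\<close> norm is of order \<open>s\<^sup>\<epsilon>\<close> and its gradient of order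
  \<open>s\<^sup>\<epsilon>\<^sup>-\<^sup>1\<^sup>/\<^sup>2\<close> (\<open>norm_w_le\<close>, \<open>energy_density_ge\<close>).

  The coefficients are \<open>\<mu> I + \<kappa> K\<close>, where \<open>K\<close> is a skew-Hermitian matrix whose phase converts one wave
  into the other. Comparing coefficients of the two waves in \<open>-w' = div ((\<mu> I + \<kappa> K) \<nabla>w)\<close> gives two
  linear equations for \<open>\<mu>\<close> and \<open>\<kappa>\<close> (\<open>coefficient_odes\<close>). Their solution is bounded, and \<open>\<mu>\<close> is bounded
  below because \<open>s\<^sup>2\<^sup>\<epsilon>\<close> decays; as \<open>K\<close> is skew, this is ellipticity. Two space directions are needed
  so that the gradients of the two waves cannot cancel. The cutoff produces an
  error, called \<open>residual\<close>, which would grow like the frequency in \<open>L\<^sup>2\<close> but is bounded in \<open>H\<^sup>-\<^sup>1\<close>: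
  integrating by parts twice gains the lost factor (\<open>wave_derivative_defect\<close>).

  For \<open>p > 2\<close> put \<open>\<epsilon> = 1/2 - 1/p\<close> and let time run towards the singularity: \<open>u(t) = t w(1-t)\<close> starts
  at zero, solves the equation with a right-hand side bounded in \<open>H\<^sup>-\<^sup>1\<close>, and its norm in \<open>H\<^sup>1\<close> is of order
  \<open>(1-t)\<^sup>-\<^sup>1\<^sup>/\<^sup>p\<close>, which is square integrable and just fails to be in \<open>L\<^sup>p\<close>. Uniqueness among
  solutions in \<open>L\<^sup>2(H\<^sup>1)\<close> follows from the energy inequality \<open>energy_nonneg\<close>, proved for an abstract
  positive contraction with the product rule for Bochner integrals.

  For \<open>p < 2\<close> put \<open>\<epsilon> = 1/p - 1/2\<close>, so that the norm of \<open>w(s)\<close> is of order \<open>s\<close> to the power \<open>-1/p'\<close>,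
  \<open>p'\<close> being the dual exponent, and use the adjoint coefficients \<open>\<mu> I - \<kappa> K\<close> with the
  singularity at the initial time. If \<open>u\<close> were a solution in \<open>L\<^sup>p(H\<^sup>1)\<close>, then pairing it with
  \<open>w\<close> on \<open>[\<delta>,1]\<close> would cancel the operator and bound the integral of \<open>\<langle>f, w\<rangle>\<close> uniformly in \<open>\<delta>\<close>; the
  boundary term at \<open>\<delta>\<close> is under control exactly because \<open>w\<close> has this borderline size. But \<open>f\<close>
  is chosen in \<open>L\<^sup>p\<close> such that this integral diverges (\<open>no_solution_dual\<close>).\<close>

section \<open>The product rule for Bochner integrals\<close>

lemma borel_measurable_bilinear:
  fixes prod :: "'a::{real_normed_vector,second_countable_topology} \<Rightarrow> 'b::{real_normed_vector,second_countable_topology}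
    \<Rightarrow> 'c::real_normed_vector"
  assumes "bounded_bilinear prod" "G \<in> borel_measurable M" "H \<in> borel_measurable M"
  shows "(\<lambda>x. prod (G x) (H x)) \<in> borel_measurable M"
proof -
  interpret b: bounded_bilinear prod by fact
  have "(\<lambda>x. (G x, H x)) \<in> borel_measurable M" using assms(2,3) by (rule borel_measurable_Pair)
  moreover have "(\<lambda>z. prod (fst z) (snd z)) \<in> borel_measurable borel"
    by (intro borel_measurable_continuous_onI b.continuous_on continuous_intros)
  ultimately show ?thesis by (drule_tac measurable_compose) auto
qed

lemma integrable_bilinear_pair:
  fixes prod :: "'a::{banach,second_countable_topology} \<Rightarrow> 'b::{banach,second_countable_topology}
    \<Rightarrow> 'c::{banach,second_countable_topology}"
  assumes "bounded_bilinear prod" "integrable lborel (g :: real \<Rightarrow> 'a)" "integrable lborel (\<gamma> :: real \<Rightarrow> 'b)"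
  shows "integrable (lborel \<Otimes>\<^sub>M lborel) (\<lambda>(s, r). prod (g s) (\<gamma> r))"
proof -
  interpret b: bounded_bilinear prod by fact
  obtain K where K: "K > 0" "\<And>a b. norm (prod a b) \<le> norm a * norm b * K" using b.pos_bounded by blast
  have [measurable]: "g \<in> borel_measurable borel" "\<gamma> \<in> borel_measurable borel"
    using assms by auto
  have m: "(\<lambda>(s, r). prod (g s) (\<gamma> r)) \<in> borel_measurable (lborel \<Otimes>\<^sub>M lborel)"
    unfolding split_beta by (rule borel_measurable_bilinear[OF assms(1)]) measurable
  show ?thesis
  proof (rule Bochner_Integration.integrable_bound)
    have "integrable (lborel \<Otimes>\<^sub>M lborel) (\<lambda>(s, r). norm (g s) * norm (\<gamma> r))"
    proof (rule lborel_pair.Fubini_integrable)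
      show "integrable lborel (\<lambda>s. \<integral>r. norm (case (s, r) of (s, r) \<Rightarrow> norm (g s) * norm (\<gamma> r)) \<partial>lborel)"
        using assms by simp
    qed (use assms in auto)
    then show "integrable (lborel \<Otimes>\<^sub>M lborel) (\<lambda>(s, r). K * (norm (g s) * norm (\<gamma> r)))"
      unfolding split_beta by simp
    show "AE x in lborel \<Otimes>\<^sub>M lborel. norm (case x of (s, r) \<Rightarrow> prod (g s) (\<gamma> r))
        \<le> norm (case x of (s, r) \<Rightarrow> K * (norm (g s) * norm (\<gamma> r)))"
      using K by (auto simp: abs_mult mult_ac split_beta)
  qed (rule m)
qed

lemma integral_lessThan_eq:
  fixes g :: "real \<Rightarrow> 'a::{banach,second_countable_topology}"
  assumes "integrable lborel g"
  shows "(LINT s:{..<r}|lborel. g s) = (LINT s:{..r}|lborel. g s)"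
  unfolding set_lebesgue_integral_def
proof (rule integral_cong_AE)
  show "AE x in lborel. indicat_real {..<r} x *\<^sub>R g x = indicat_real {..r} x *\<^sub>R g x"
    using AE_lborel_singleton[of r] by eventually_elim (auto split: split_indicator)
qed (use assms in auto)

text \<open>Fubini's theorem: the product of the two integrals is the integral of \<open>prod (g s) (\<gamma> r)\<close> over
  the plane. The half \<open>r \<le> s\<close> integrates to \<open>prod g V\<close> and the other half to \<open>prod U \<gamma>\<close>.\<close>

lemma product_rule_zero:
  fixes prod :: "'a::{banach,second_countable_topology} \<Rightarrow> 'b::{banach,second_countable_topology}
    \<Rightarrow> 'c::{banach,second_countable_topology}"
  assumes bil: "bounded_bilinear prod" and g: "integrable lborel (g :: real \<Rightarrow> 'a)" and \<gamma>: "integrable lborel (\<gamma> :: real \<Rightarrow> 'b)"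
  defines "V \<equiv> \<lambda>t. LINT s:{..t}|lborel. \<gamma> s" and "U \<equiv> \<lambda>t. LINT s:{..t}|lborel. g s"
  shows "integrable lborel (\<lambda>t. prod (g t) (V t))" "integrable lborel (\<lambda>t. prod (U t) (\<gamma> t))"
    "prod (integral\<^sup>L lborel g) (integral\<^sup>L lborel \<gamma>) = (LINT t|lborel. prod (g t) (V t)) + (LINT t|lborel. prod (U t) (\<gamma> t))"
proof -
  interpret b: bounded_bilinear prod by fact
  define h where "h = (\<lambda>s r. prod (g s) (\<gamma> r))"
  have h: "integrable (lborel \<Otimes>\<^sub>M lborel) (\<lambda>(s, r). h s r)"
    unfolding h_def by (rule integrable_bilinear_pair[OF bil g \<gamma>])
  define L where "L = {z :: real \<times> real. snd z \<le> fst z}"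
  have L: "L \<in> sets (lborel \<Otimes>\<^sub>M lborel)"
  proof -
    have "L = {z \<in> space (lborel \<Otimes>\<^sub>M lborel). snd z \<le> fst z}" by (auto simp: L_def space_pair_measure)
    also have "\<dots> \<in> sets (lborel \<Otimes>\<^sub>M lborel)" by measurable
    finally show ?thesis .
  qed
  have h1: "integrable (lborel \<Otimes>\<^sub>M lborel) (\<lambda>(s, r). indicator L (s, r) *\<^sub>R h s r)"
    using integrable_mult_indicator[OF L h] by (simp add: split_beta')
  have h2: "integrable (lborel \<Otimes>\<^sub>M lborel) (\<lambda>(s, r). indicator (- L) (s, r) *\<^sub>R h s r)"
  proof -
    have "- L \<in> sets (lborel \<Otimes>\<^sub>M lborel)"
      using sets.compl_sets[OF L] by (simp add: space_pair_measure Compl_eq_Diff_UNIV)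
    from integrable_mult_indicator[OF this h] show ?thesis by (simp add: split_beta')
  qed
  have in1: "(LINT r|lborel. indicator L (s, r) *\<^sub>R h s r) = prod (g s) (V s)" for s
  proof -
    have "(LINT r|lborel. indicator L (s, r) *\<^sub>R h s r) = (LINT r|lborel. prod (g s) (indicator {..s} r *\<^sub>R \<gamma> r))"
      by (rule Bochner_Integration.integral_cong) (auto simp: L_def h_def b.scaleR_right split: split_indicator)
    also have "\<dots> = prod (g s) (V s)"
      unfolding V_def set_lebesgue_integral_def
      by (intro integral_bounded_linear[OF b.bounded_linear_right] integrable_mult_indicator \<gamma>) auto
    finally show ?thesis .
  qed
  have in2: "(LINT s|lborel. indicator (- L) (s, r) *\<^sub>R h s r) = prod (U r) (\<gamma> r)" for r
  proof -
    have "(LINT s|lborel. indicator (- L) (s, r) *\<^sub>R h s r) = (LINT s|lborel. prod (indicator {..<r} s *\<^sub>R g s) (\<gamma> r))"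
      by (rule Bochner_Integration.integral_cong) (auto simp: L_def h_def b.scaleR_left split: split_indicator)
    also have "\<dots> = prod (LINT s:{..<r}|lborel. g s) (\<gamma> r)"
      unfolding set_lebesgue_integral_def
      by (intro integral_bounded_linear[OF b.bounded_linear_left] integrable_mult_indicator g) auto
    finally show ?thesis by (simp add: U_def integral_lessThan_eq[OF g])
  qed
  show "integrable lborel (\<lambda>t. prod (g t) (V t))"
    using lborel_pair.integrable_fst'[OF h1] by (simp add: in1)
  show "integrable lborel (\<lambda>t. prod (U t) (\<gamma> t))"
    using lborel_pair.integrable_snd[OF h2] by (simp add: in2)
  have "prod (integral\<^sup>L lborel g) (integral\<^sup>L lborel \<gamma>) = (LINT s|lborel. LINT r|lborel. h s r)"
    using g \<gamma> by (simp add: h_def integral_bounded_linear[OF b.bounded_linear_right]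
        integral_bounded_linear[OF b.bounded_linear_left])
  also have "\<dots> = (LINT z|(lborel \<Otimes>\<^sub>M lborel). (case z of (s, r) \<Rightarrow> h s r))"
    using lborel_pair.integral_fst'[OF h] by simp
  also have "\<dots> = (LINT z|(lborel \<Otimes>\<^sub>M lborel). (case z of (s, r) \<Rightarrow> indicator L (s, r) *\<^sub>R h s r)
      + (case z of (s, r) \<Rightarrow> indicator (- L) (s, r) *\<^sub>R h s r))"
    by (rule Bochner_Integration.integral_cong) (auto split: split_indicator)
  also have "\<dots> = (LINT z|(lborel \<Otimes>\<^sub>M lborel). (case z of (s, r) \<Rightarrow> indicator L (s, r) *\<^sub>R h s r))
      + (LINT z|(lborel \<Otimes>\<^sub>M lborel). (case z of (s, r) \<Rightarrow> indicator (- L) (s, r) *\<^sub>R h s r))"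
    by (rule Bochner_Integration.integral_add[OF h1 h2])
  also have "(LINT z|(lborel \<Otimes>\<^sub>M lborel). (case z of (s, r) \<Rightarrow> indicator L (s, r) *\<^sub>R h s r)) = (LINT t|lborel. prod (g t) (V t))"
    using lborel_pair.integral_fst'[OF h1] by (simp add: in1)
  also have "(LINT z|(lborel \<Otimes>\<^sub>M lborel). (case z of (s, r) \<Rightarrow> indicator (- L) (s, r) *\<^sub>R h s r)) = (LINT t|lborel. prod (U t) (\<gamma> t))"
    using lborel_pair.integral_snd[OF h2] by (simp add: in2)
  finally show "prod (integral\<^sup>L lborel g) (integral\<^sup>L lborel \<gamma>)
    = (LINT t|lborel. prod (g t) (V t)) + (LINT t|lborel. prod (U t) (\<gamma> t))" .
qed

text \<open>Integration by parts for primitives of Bochner integrable functions. The bilinear maps of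
  interest are an inner product in the energy inequality, multiplication by scalars in the weak time
  derivative, and the pairing of \<open>H\<^sup>1\<close> with its antidual in the duality argument.\<close>

theorem product_rule:
  fixes prod :: "'a::{banach,second_countable_topology} \<Rightarrow> 'b::{banach,second_countable_topology}
    \<Rightarrow> 'c::{banach,second_countable_topology}"
  assumes bil: "bounded_bilinear prod" and ab: "(a :: real) \<le> b"
    and g: "set_integrable lborel {a..b} g" and \<gamma>: "set_integrable lborel {a..b} \<gamma>"
    and U: "\<And>t. t \<in> {a..b} \<Longrightarrow> U t = U a + (LINT s:{a..t}|lborel. g s)"
    and V: "\<And>t. t \<in> {a..b} \<Longrightarrow> V t = V a + (LINT s:{a..t}|lborel. \<gamma> s)"
  shows "set_integrable lborel {a..b} (\<lambda>t. prod (g t) (V t))"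
    and "set_integrable lborel {a..b} (\<lambda>t. prod (U t) (\<gamma> t))"
    and "prod (U b) (V b) - prod (U a) (V a)
      = (LINT t:{a..b}|lborel. prod (g t) (V t)) + (LINT t:{a..b}|lborel. prod (U t) (\<gamma> t))"
proof -
  interpret b: bounded_bilinear prod by fact
  define g' where "g' = (\<lambda>t. indicator {a..b} t *\<^sub>R g t)"
  define \<gamma>' where "\<gamma>' = (\<lambda>t. indicator {a..b} t *\<^sub>R \<gamma> t)"
  have g': "integrable lborel g'" using g by (simp add: g'_def set_integrable_def)
  have \<gamma>': "integrable lborel \<gamma>'" using \<gamma> by (simp add: \<gamma>'_def set_integrable_def)
  define U0 where "U0 t = (LINT s:{..t}|lborel. g' s)" for t
  define V0 where "V0 t = (LINT s:{..t}|lborel. \<gamma>' s)" for t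
  note pr = product_rule_zero[OF bil g' \<gamma>', folded U0_def V0_def]
  have U0: "U t = U a + U0 t" if "t \<in> {a..b}" for t
  proof -
    have "(LINT s:{a..t}|lborel. g s) = U0 t"
      unfolding U0_def g'_def set_lebesgue_integral_def
      by (rule Bochner_Integration.integral_cong) (use that in \<open>auto split: split_indicator\<close>)
    with U[OF that] show ?thesis by simp
  qed
  have V0: "V t = V a + V0 t" if "t \<in> {a..b}" for t
  proof -
    have "(LINT s:{a..t}|lborel. \<gamma> s) = V0 t"
      unfolding V0_def \<gamma>'_def set_lebesgue_integral_def
      by (rule Bochner_Integration.integral_cong) (use that in \<open>auto split: split_indicator\<close>)
    with V[OF that] show ?thesis by simp
  qed
  have Ub: "U b = U a + integral\<^sup>L lborel g'"
    using U[of b] ab by (simp add: g'_def set_lebesgue_integral_def)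
  have Vb: "V b = V a + integral\<^sup>L lborel \<gamma>'"
    using V[of b] ab by (simp add: \<gamma>'_def set_lebesgue_integral_def)
  have e1: "indicator {a..b} t *\<^sub>R prod (g t) (V t) = prod (g' t) (V a) + prod (g' t) (V0 t)" for t
    using V0[of t] by (simp add: g'_def b.scaleR_left b.add_right scaleR_add_right split: split_indicator)
  have e2: "indicator {a..b} t *\<^sub>R prod (U t) (\<gamma> t) = prod (U a) (\<gamma>' t) + prod (U0 t) (\<gamma>' t)" for t
    using U0[of t] by (simp add: \<gamma>'_def b.scaleR_right b.add_left scaleR_add_right split: split_indicator)
  have i1: "integrable lborel (\<lambda>t. prod (g' t) (V a))"
    by (rule integrable_bounded_linear[OF b.bounded_linear_left g'])
  have i2: "integrable lborel (\<lambda>t. prod (U a) (\<gamma>' t))"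
    by (rule integrable_bounded_linear[OF b.bounded_linear_right \<gamma>'])
  show "set_integrable lborel {a..b} (\<lambda>t. prod (g t) (V t))"
    unfolding set_integrable_def e1 by (intro Bochner_Integration.integrable_add i1 pr)
  show "set_integrable lborel {a..b} (\<lambda>t. prod (U t) (\<gamma> t))"
    unfolding set_integrable_def e2 by (intro Bochner_Integration.integrable_add i2 pr)
  have "(LINT t:{a..b}|lborel. prod (g t) (V t)) + (LINT t:{a..b}|lborel. prod (U t) (\<gamma> t))
     = prod (integral\<^sup>L lborel g') (V a) + prod (U a) (integral\<^sup>L lborel \<gamma>')
       + prod (integral\<^sup>L lborel g') (integral\<^sup>L lborel \<gamma>')"
    unfolding set_lebesgue_integral_def e1 e2 using i1 i2 pr(1,2)
    by (simp add: pr(3) integral_bounded_linear[OF b.bounded_linear_left g']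
        integral_bounded_linear[OF b.bounded_linear_right \<gamma>'])
  then show "prod (U b) (V b) - prod (U a) (V a)
      = (LINT t:{a..b}|lborel. prod (g t) (V t)) + (LINT t:{a..b}|lborel. prod (U t) (\<gamma> t))"
    unfolding Ub Vb by (simp add: b.add_left b.add_right)
qed

lemma set_integrable_bounded_interval:
  fixes f :: "real \<Rightarrow> 'b::{banach,second_countable_topology}"
  assumes "f \<in> borel_measurable borel" "\<And>x. x \<in> {a..b} \<Longrightarrow> norm (f x) \<le> D"
  shows "set_integrable lborel {a..b} f"
  unfolding set_integrable_def
proof (rule Bochner_Integration.integrable_bound)
  have "emeasure lborel {a..b} < \<infinity>" by (rule emeasure_bounded_finite) simp
  then show "integrable lborel (\<lambda>x. indicator {a..b} x *\<^sub>R \<bar>D\<bar>)"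
    by (intro integrable_scaleR_left integrable_real_indicator) auto
  show "AE x in lborel. norm (indicat_real {a..b} x *\<^sub>R f x) \<le> norm (indicat_real {a..b} x *\<^sub>R \<bar>D\<bar>)"
    using assms(2) by (force split: split_indicator)
qed (use assms in auto)

section \<open>Positive contractions and the energy inequality\<close>

lemma set_integral_singleton_lborel:
  fixes g :: "real \<Rightarrow> 'a::{banach,second_countable_topology}"
  shows "(LINT s:{a..a}|lborel. g s) = 0"
  unfolding set_lebesgue_integral_def
proof (rule integral_eq_zero_AE)
  show "AE x in lborel. indicat_real {a..a} x *\<^sub>R g x = 0"
    using AE_lborel_singleton[of a] by eventually_elim simp
qed

text \<open>In the application \<open>T\<close> is the embedding of \<open>H\<^sup>1\<close> into its antidual, followed by the Riesz
  isomorphism back to \<open>H\<^sup>1\<close>.\<close>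

locale positive_contraction =
  fixes T :: "'a::{real_inner,banach,second_countable_topology} \<Rightarrow> 'a"
  assumes bl: "bounded_linear T"
    and sym: "T x \<bullet> y = x \<bullet> T y"
    and pos: "0 \<le> T x \<bullet> x"
    and le: "T x \<bullet> x \<le> x \<bullet> x"
    and inj: "T x = 0 \<Longrightarrow> x = 0"
begin

interpretation T: bounded_linear T by (rule bl)

definition S :: "'a \<Rightarrow> 'a" where "S x = x - T x"

lemma bounded_linear_S_pow: "bounded_linear (S ^^ n)"
proof (induction n)
  case 0
  then show ?case by (simp add: id_def bounded_linear_ident)
next
  case (Suc n)
  have "bounded_linear S" unfolding S_def[abs_def] by (intro bounded_linear_sub bounded_linear_ident bl)
  from bounded_linear_compose[OF this Suc] show ?case by (simp add: o_def)
qed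

lemma S_pow_sym: "(S ^^ n) x \<bullet> y = x \<bullet> (S ^^ n) y"
proof (induction n arbitrary: x y)
  case (Suc n)
  have "S a \<bullet> b = a \<bullet> S b" for a b by (simp add: S_def inner_diff_left inner_diff_right sym)
  then show ?case by (simp add: Suc funpow_swap1)
qed simp

text \<open>An even power of the symmetric map \<open>S\<close> is the square of a power, an odd one is \<open>S\<close> itself between
  two equal powers, and \<open>S\<close> is positive because \<open>T \<le> 1\<close>.\<close>

lemma S_pow_nonneg: "0 \<le> (S ^^ n) x \<bullet> x"
proof -
  define m where "m = n div 2"
  have "(S ^^ (m + m)) x \<bullet> x = (S ^^ m) x \<bullet> (S ^^ m) x"
    by (simp add: funpow_add S_pow_sym)
  moreover have "(S ^^ (m + (1 + m))) x \<bullet> x = S ((S ^^ m) x) \<bullet> (S ^^ m) x"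
    by (subst funpow_add) (simp add: S_pow_sym)
  moreover have "0 \<le> S y \<bullet> y" for y using le[of y] by (simp add: S_def inner_diff_left)
  moreover have "n = m + m \<or> n = m + (1 + m)" unfolding m_def by presburger
  ultimately show ?thesis by (elim disjE) auto
qed

lemma T_sum_S_pow: "T (\<Sum>k<n. (S ^^ k) x) = x - (S ^^ n) x"
proof (induction n)
  case (Suc n)
  have "T (\<Sum>k<Suc n. (S ^^ k) x) = x - (S ^^ n) x + T ((S ^^ n) x)" by (simp add: T.add Suc)
  also have "\<dots> = x - (S ^^ Suc n) x" by (simp add: S_def)
  finally show ?case .
qed simp

text \<open>As operators, \<open>T - T\<^sup>2 = S T S + T S T\<close>, a sum of two positive ones.\<close>

lemma norm_T_sq_le: "(norm (T x))\<^sup>2 \<le> T x \<bullet> x"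
proof -
  have "T x \<bullet> x - T x \<bullet> T x = T (S x) \<bullet> S x + S (T x) \<bullet> T x"
    by (simp add: S_def T.diff inner_diff_left inner_diff_right sym)
  moreover have "0 \<le> S y \<bullet> y" for y using le[of y] by (simp add: S_def inner_diff_left)
  ultimately show ?thesis using pos[of "S x"] by (smt (verit) power2_norm_eq_inner)
qed

lemma norm_S_sq_le: "(norm (T x))\<^sup>2 \<le> (norm x)\<^sup>2 - (norm (S x))\<^sup>2"
proof -
  have "(norm (S x))\<^sup>2 = (norm x)\<^sup>2 - 2 * (T x \<bullet> x) + (norm (T x))\<^sup>2"
    by (simp add: S_def power2_norm_eq_inner inner_diff_left inner_diff_right inner_commute)
  then show ?thesis using norm_T_sq_le[of x] by linarith
qed

lemma norm_S_pow_le: "norm ((S ^^ n) x) \<le> norm x"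
proof (induction n)
  case (Suc n)
  have "(norm (S ((S ^^ n) x)))\<^sup>2 \<le> (norm ((S ^^ n) x))\<^sup>2"
    using norm_S_sq_le[of "(S ^^ n) x"] by (smt (verit) zero_le_power2)
  then have "norm (S ((S ^^ n) x)) \<le> norm ((S ^^ n) x)" by (rule power2_le_imp_le) simp
  with Suc show ?case by simp
qed simp

text \<open>The numbers \<open>(norm ((S ^^ n) x))\<^sup>2\<close> are nonnegative and decrease at step \<open>n\<close> by at least
  \<open>(norm (T ((S ^^ n) x)))\<^sup>2\<close>.\<close>

lemma T_S_pow_tendsto: "(\<lambda>n. T ((S ^^ n) x)) \<longlonglongrightarrow> 0"
proof -
  define a where "a n = (norm ((S ^^ n) x))\<^sup>2" for n
  have step: "(norm (T ((S ^^ n) x)))\<^sup>2 \<le> a n - a (Suc n)" for n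
    using norm_S_sq_le[of "(S ^^ n) x"] by (simp add: a_def)
  have "decseq a"
    by (rule decseq_SucI) (use step in \<open>smt (verit) zero_le_power2\<close>)
  moreover have "\<forall>n. 0 \<le> a n" by (simp add: a_def)
  ultimately obtain L where L: "a \<longlonglongrightarrow> L" by (rule decseq_convergent)
  have "(\<lambda>n. a n - a (Suc n)) \<longlonglongrightarrow> L - L" by (intro tendsto_diff L LIMSEQ_Suc)
  then have "(\<lambda>n. a n - a (Suc n)) \<longlonglongrightarrow> 0" by simp
  then have "(\<lambda>n. (norm (T ((S ^^ n) x)))\<^sup>2) \<longlonglongrightarrow> 0"
  proof (rule Lim_null_comparison[rotated, OF _ always_eventually[OF allI]])
    fix n show "norm ((norm (T ((S ^^ n) x)))\<^sup>2) \<le> a n - a (Suc n)" using step[of n] by simp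
  qed
  then have "(\<lambda>n. sqrt ((norm (T ((S ^^ n) x)))\<^sup>2)) \<longlonglongrightarrow> sqrt 0" by (rule tendsto_real_sqrt)
  then show ?thesis by (simp add: tendsto_norm_zero_iff)
qed

text \<open>The vectors against which \<open>(S ^^ n) x\<close> tends to zero form a closed subspace that contains the
  range of \<open>T\<close>; a vector orthogonal to it is annihilated by \<open>T\<close>, hence zero.\<close>

lemma S_pow_weakly_null: "(\<lambda>n. (S ^^ n) x \<bullet> y) \<longlonglongrightarrow> 0"
proof -
  define E where "E = {y. (\<lambda>n. (S ^^ n) x \<bullet> y) \<longlonglongrightarrow> 0}"
  have "subspace E"
    unfolding subspace_def E_def
    by (auto simp: inner_add_right intro: tendsto_add_zero tendsto_mult_right_zero)
  moreover have "closed E"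
    unfolding closed_sequential_limits
  proof (intro allI impI, elim conjE)
    fix z l assume z: "\<forall>m. z m \<in> E" "z \<longlonglongrightarrow> l"
    have "(\<lambda>n. (S ^^ n) x \<bullet> l) \<longlonglongrightarrow> 0"
    proof (rule LIMSEQ_I)
      fix e :: real assume e: "e > 0"
      define d where "d = e / (2 * (norm x + 1))"
      have nx: "norm x + 1 > 0" by (smt (verit) norm_ge_zero)
      then have d: "d > 0" using e by (simp add: d_def)
      then obtain m where m: "norm (z m - l) < d" using LIMSEQ_D[OF z(2) d] by blast
      have "(\<lambda>n. (S ^^ n) x \<bullet> z m) \<longlonglongrightarrow> 0" using z(1) by (simp add: E_def)
      then obtain N where N: "\<And>n. n \<ge> N \<Longrightarrow> \<bar>(S ^^ n) x \<bullet> z m\<bar> < e / 2"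
        using LIMSEQ_D[of _ 0 "e / 2"] e by (metis diff_zero half_gt_zero real_norm_def)
      have "norm ((S ^^ n) x \<bullet> l - 0) < e" if "n \<ge> N" for n
      proof -
        have "\<bar>(S ^^ n) x \<bullet> (l - z m)\<bar> \<le> norm ((S ^^ n) x) * norm (l - z m)" by (rule Cauchy_Schwarz_ineq2)
        also have "\<dots> \<le> norm x * d"
          using norm_S_pow_le[of n x] m by (intro mult_mono) (auto simp: norm_minus_commute)
        also have "\<dots> \<le> e / 2" using nx e by (simp add: d_def field_simps)
        finally show ?thesis using N[OF that] unfolding inner_diff_right real_norm_def by linarith
      qed
      then show "\<exists>N. \<forall>n\<ge>N. norm ((S ^^ n) x \<bullet> l - 0) < e" by blast
    qed
    then show "l \<in> E" by (simp add: E_def)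
  qed
  ultimately obtain p where p: "p \<in> E" "\<And>z. z \<in> E \<Longrightarrow> (y - p) \<bullet> z = 0"
    using orthogonal_projection_exists[of E y] by blast
  have "T z \<in> E" for z
    using tendsto_inner[OF T_S_pow_tendsto[of x] tendsto_const[of z]] by (simp add: E_def sym)
  then have "T (y - p) \<bullet> T (y - p) = 0" using p(2) by (simp add: sym)
  then have "y = p" using inj[of "y - p"] by simp
  with p(1) show ?thesis by (simp add: E_def)
qed

text \<open>In the application the integral is half the square of the \<open>L\<^sup>2\<close> norm of \<open>u\<close> at time \<open>1\<close>, but \<open>u\<close> has
  no trace at time \<open>1\<close> to begin with. So \<open>u\<close> is replaced by \<open>u - (S ^^ n) u = Q (T u)\<close> with
  \<open>Q = (\<Sum>k<n. S ^^ k)\<close>. Now \<open>G = T u\<close> is a primitive of \<open>\<gamma>\<close>, the operator \<open>Q\<close> is bounded, symmetric and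
  positive, and the product rule turns the integral into \<open>G 1 \<bullet> Q (G 1) / 2\<close>. The terms
  \<open>\<gamma> t \<bullet> (S ^^ n) (u t)\<close> tend to zero and are dominated.\<close>

theorem energy_nonneg:
  assumes \<gamma>: "set_integrable lborel {0..1} \<gamma>"
    and u: "u \<in> borel_measurable I01"
    and u\<gamma>: "integrable I01 (\<lambda>t. norm (\<gamma> t) * norm (u t))"
    and eq: "AE t in I01. T (u t) = (LINT s:{0..t}|lborel. \<gamma> s)"
  shows "0 \<le> (LINT t|I01. \<gamma> t \<bullet> u t)"
proof -
  define G where "G t = (LINT s:{0..t}|lborel. \<gamma> s)" for t
  have m\<gamma>: "\<gamma> \<in> borel_measurable I01"
    using \<gamma> by (simp add: set_integrable_def borel_measurable_restrict_space_iff)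
  note [measurable] = u m\<gamma>
  have nn: "0 \<le> (LINT t|I01. \<gamma> t \<bullet> (u t - (S ^^ n) (u t)))" for n
  proof -
    define Q where "Q x = (\<Sum>k<n. (S ^^ k) x)" for x
    have Q: "bounded_linear Q" unfolding Q_def[abs_def] by (intro bounded_linear_sum bounded_linear_S_pow)
    have Qsym: "x \<bullet> Q y = Q x \<bullet> y" for x y by (simp add: Q_def inner_sum_left inner_sum_right S_pow_sym)
    have bil: "bounded_bilinear (\<lambda>x y. x \<bullet> Q y)"
      using bounded_bilinear.comp[OF bounded_bilinear_inner bounded_linear_ident Q] .
    have G0: "G 0 = 0"
      unfolding G_def by (rule set_integral_singleton_lborel)
    have G: "G t = G 0 + (LINT s:{0..t}|lborel. \<gamma> s)" for t by (simp only: G0) (simp add: G_def)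
    note pr = product_rule[OF bil zero_le_one \<gamma> \<gamma> G G]
    have "0 \<le> G 1 \<bullet> Q (G 1)"
      unfolding Q_def inner_sum_right by (intro sum_nonneg) (metis S_pow_nonneg inner_commute)
    also have "\<dots> = (LINT t:{0..1}|lborel. \<gamma> t \<bullet> Q (G t)) + (LINT t:{0..1}|lborel. G t \<bullet> Q (\<gamma> t))"
      using pr(3) by (simp add: G0)
    also have "(LINT t:{0..1}|lborel. G t \<bullet> Q (\<gamma> t)) = (LINT t:{0..1}|lborel. \<gamma> t \<bullet> Q (G t))"
    proof -
      have "(\<lambda>t. G t \<bullet> Q (\<gamma> t)) = (\<lambda>t. \<gamma> t \<bullet> Q (G t))"
        by (rule ext) (metis Qsym inner_commute)
      then show ?thesis by simp
    qed
    finally have "0 \<le> (LINT t:{0..1}|lborel. \<gamma> t \<bullet> Q (G t))" by simp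
    also have "\<dots> = (LINT t|I01. \<gamma> t \<bullet> Q (G t))"
      by (simp add: integral_restrict_space set_lebesgue_integral_def)
    also have "\<dots> = (LINT t|I01. \<gamma> t \<bullet> (u t - (S ^^ n) (u t)))"
    proof (rule integral_cong_AE)
      have QT: "Q (T x) = x - (S ^^ n) x" for x
      proof -
        have "(Q (T x) - (x - (S ^^ n) x)) \<bullet> y = 0" for y
        proof -
          have "Q (T x) \<bullet> y = x \<bullet> T (Q y)" by (simp add: Qsym[symmetric] sym)
          also have "\<dots> = (x - (S ^^ n) x) \<bullet> y"
            by (simp add: Q_def T_sum_S_pow inner_diff_right inner_diff_left S_pow_sym)
          finally show ?thesis by (simp add: inner_diff_left)
        qed
        from this[of "Q (T x) - (x - (S ^^ n) x)"] show ?thesis by simp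
      qed
      show "AE t in I01. \<gamma> t \<bullet> Q (G t) = \<gamma> t \<bullet> (u t - (S ^^ n) (u t))"
        using eq by eventually_elim (simp add: G_def QT[symmetric])
      have "(\<lambda>t. indicator {0..1} t *\<^sub>R (\<gamma> t \<bullet> Q (G t))) \<in> borel_measurable lborel"
        using pr(1) unfolding set_integrable_def by (rule borel_measurable_integrable)
      then show "(\<lambda>t. \<gamma> t \<bullet> Q (G t)) \<in> borel_measurable I01"
        by (simp add: borel_measurable_restrict_space_iff)
      show "(\<lambda>t. \<gamma> t \<bullet> (u t - (S ^^ n) (u t))) \<in> borel_measurable I01"
        using measurable_compose[OF u borel_measurable_continuous_onI[OF linear_continuous_on[OF bounded_linear_S_pow[of n]]]]
        by measurable
    qed
    finally show ?thesis .
  qed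
  have "(\<lambda>n. LINT t|I01. \<gamma> t \<bullet> (u t - (S ^^ n) (u t))) \<longlonglongrightarrow> (LINT t|I01. \<gamma> t \<bullet> u t)"
  proof (rule integral_dominated_convergence[where w = "\<lambda>t. 2 * (norm (\<gamma> t) * norm (u t))"])
    show "integrable I01 (\<lambda>t. 2 * (norm (\<gamma> t) * norm (u t)))" using u\<gamma> by simp
    show "AE t in I01. (\<lambda>n. \<gamma> t \<bullet> (u t - (S ^^ n) (u t))) \<longlonglongrightarrow> \<gamma> t \<bullet> u t"
    proof (rule AE_I2)
      fix t
      have "(\<lambda>n. \<gamma> t \<bullet> u t - (S ^^ n) (u t) \<bullet> \<gamma> t) \<longlonglongrightarrow> \<gamma> t \<bullet> u t - 0"
        by (intro tendsto_diff tendsto_const S_pow_weakly_null)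
      then show "(\<lambda>n. \<gamma> t \<bullet> (u t - (S ^^ n) (u t))) \<longlonglongrightarrow> \<gamma> t \<bullet> u t"
        by (simp add: inner_diff_right inner_commute)
    qed
    show "AE t in I01. norm (\<gamma> t \<bullet> (u t - (S ^^ n) (u t))) \<le> 2 * (norm (\<gamma> t) * norm (u t))" for n
    proof (rule AE_I2)
      fix t
      have "norm (\<gamma> t \<bullet> (u t - (S ^^ n) (u t))) \<le> norm (\<gamma> t) * norm (u t - (S ^^ n) (u t))"
        using Cauchy_Schwarz_ineq2 by simp
      also have "\<dots> \<le> norm (\<gamma> t) * (2 * norm (u t))"
        using norm_triangle_ineq4[of "u t" "(S ^^ n) (u t)"] norm_S_pow_le[of n "u t"]
        by (intro mult_left_mono) auto
      finally show "norm (\<gamma> t \<bullet> (u t - (S ^^ n) (u t))) \<le> 2 * (norm (\<gamma> t) * norm (u t))" by simp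
    qed
    show "(\<lambda>t. \<gamma> t \<bullet> (u t - (S ^^ n) (u t))) \<in> borel_measurable I01" for n
      using measurable_compose[OF u borel_measurable_continuous_onI[OF linear_continuous_on[OF bounded_linear_S_pow[of n]]]]
      by measurable
  qed measurable
  then show ?thesis using nn by (intro LIMSEQ_le_const) auto
qed

end

section \<open>Smooth functions and integration by parts\<close>

text \<open>For \<open>P = 1\<close> this is the classical smooth function that is flat at the origin. The polynomial makes
  the family closed under differentiation.\<close>

definition flat :: "real poly \<Rightarrow> real \<Rightarrow> real" where
  "flat P t = (if t > 0 then poly P (1 / t) * exp (- (1 / t)) else 0)"

lemma poly_times_exp_minus_tendsto: "((\<lambda>x. poly P x * exp (- x)) \<longlongrightarrow> (0 :: real)) at_top"
proof -
  have "((\<lambda>x. \<Sum>i\<le>degree P. coeff P i * (x ^ i / exp x)) \<longlongrightarrow> (\<Sum>i\<le>degree P. coeff P i * 0)) at_top"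
    by (intro tendsto_sum tendsto_mult tendsto_const tendsto_power_div_exp_0)
  moreover have "(\<lambda>x. poly P x * exp (- x)) = (\<lambda>x. \<Sum>i\<le>degree P. coeff P i * (x ^ i / exp x))"
    by (simp add: fun_eq_iff poly_altdef sum_distrib_right exp_minus divide_inverse mult.assoc)
  ultimately show ?thesis by simp
qed

lemma flat_has_derivative:
  "(flat P has_real_derivative flat ([:0, 0, 1:] * (P - pderiv P)) t) (at t)"
proof -
  consider "t > 0" | "t < 0" | "t = 0" by linarith
  then show ?thesis
  proof cases
    case 1
    have "((\<lambda>t. poly P (1 / t) * exp (- (1 / t))) has_real_derivative
        flat ([:0, 0, 1:] * (P - pderiv P)) t) (at t)"
      using 1 by (auto intro!: derivative_eq_intros DERIV_chain2[OF poly_DERIV]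
          simp: flat_def field_simps power2_eq_square)
    then show ?thesis
      by (rule has_field_derivative_transform_within_open[of _ _ _ "{0<..}"]) (use 1 in \<open>auto simp: flat_def\<close>)
  next
    case 2
    have "((\<lambda>_. 0) has_real_derivative flat ([:0, 0, 1:] * (P - pderiv P)) t) (at t)"
      using 2 by (simp add: flat_def)
    then show ?thesis
      by (rule has_field_derivative_transform_within_open[of _ _ _ "{..<0}"]) (use 2 in \<open>auto simp: flat_def\<close>)
  next
    case 3
    have "((\<lambda>h. flat P h / h) \<longlongrightarrow> 0) (at_right 0)"
    proof (rule Lim_transform_eventually)
      show "((\<lambda>h. poly (pCons 0 P) (inverse h) * exp (- inverse h)) \<longlongrightarrow> 0) (at_right 0)"
        by (rule filterlim_compose[OF poly_times_exp_minus_tendsto filterlim_inverse_at_top_right])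
      show "\<forall>\<^sub>F h in at_right 0. poly (pCons 0 P) (inverse h) * exp (- inverse h) = flat P h / h"
        using eventually_at_right_less[of 0] by eventually_elim (simp add: flat_def divide_inverse)
    qed
    moreover have "((\<lambda>h. flat P h / h) \<longlongrightarrow> 0) (at_left 0)"
      by (rule tendsto_eventually) (auto simp: flat_def eventually_at_filter)
    ultimately have "((\<lambda>h. flat P h / h) \<longlongrightarrow> 0) (at 0)"
      by (simp add: filterlim_split_at_real)
    then show ?thesis using 3 by (simp add: DERIV_def flat_def)
  qed
qed

text \<open>An algebra of functions that is closed under partial derivatives, so that its members are smooth.
  The quadratic argument of the generator \<open>bump\<close> serves both the radial cutoff and smooth
  approximations of the indicators of arbitrary balls.\<close>

inductive smooth_alg :: "(real^'d::finite \<Rightarrow> complex) \<Rightarrow> bool" where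
  const: "smooth_alg (\<lambda>_. c)"
| coord: "smooth_alg (\<lambda>x. of_real (x $ i))"
| bump: "smooth_alg (\<lambda>x. of_real (flat P (a - b * (x \<bullet> x) + c \<bullet> x)))"
| wave: "smooth_alg (\<lambda>x. cis (N * x $ i))"
| add: "smooth_alg f \<Longrightarrow> smooth_alg g \<Longrightarrow> smooth_alg (\<lambda>x. f x + g x)"
| mult: "smooth_alg f \<Longrightarrow> smooth_alg g \<Longrightarrow> smooth_alg (\<lambda>x. f x * g x)"

lemma has_derivative_of_partials:
  assumes "(f has_derivative (\<lambda>h. \<Sum>j\<in>UNIV. of_real (h $ j) * f' j)) (at (x :: real^'d::finite))"
  shows "partial_deriv j f x = f' j"
proof -
  have "(\<Sum>k\<in>UNIV. of_real (axis j 1 $ k) * f' k) = (\<Sum>k\<in>UNIV. if k = j then f' k else 0)"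
    by (rule sum.cong) (auto simp: axis_def)
  then show ?thesis
    using frechet_derivative_at[OF assms] by (simp add: partial_deriv_def fun_eq_iff[symmetric]) (simp flip: frechet_derivative_at[OF assms])
qed

lemma has_derivative_cis_coord:
  fixes x :: "real^'d::finite"
  shows "((\<lambda>x. cis (N * x $ i)) has_derivative
      (\<lambda>h. \<Sum>j\<in>UNIV. of_real (h $ j) * (if j = i then \<i> * of_real N * cis (N * x $ i) else 0))) (at x)"
proof -
  have "((\<lambda>x. exp (\<i> * of_real (N * x $ i))) has_derivative
     (\<lambda>h. exp (\<i> * of_real (N * x $ i)) * (\<i> * of_real (N * h $ i)))) (at x)"
  proof -
    have "bounded_linear (\<lambda>h :: real^'d. \<i> * complex_of_real (N * h $ i))"
      by (intro bounded_linear_const_mult bounded_linear_compose[OF bounded_linear_of_real] bounded_linear_vec_nth)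
    from has_derivative_compose[OF bounded_linear_imp_has_derivative[OF this]
        DERIV_exp[unfolded has_field_derivative_def]] show ?thesis
      by simp
  qed
  then show ?thesis
    by (simp add: cis_conv_exp if_distrib cong: if_cong) (simp add: mult_ac)
qed

lemma smooth_alg_derivative:
  fixes f :: "real^'d::finite \<Rightarrow> complex"
  assumes "smooth_alg f"
  shows "\<exists>f'. (\<forall>j. smooth_alg (f' j)) \<and>
    (\<forall>x. (f has_derivative (\<lambda>h. \<Sum>j\<in>UNIV. of_real (h $ j) * f' j x)) (at x))"
  using assms
proof induction
  case (const c)
  show ?case by (intro exI[of _ "\<lambda>_ _. 0"]) (auto intro: smooth_alg.const)
next
  case (coord i)
  have "(\<Sum>j\<in>UNIV. of_real (h $ j) * (if j = i then 1 else 0)) = (of_real (h $ i) :: complex)" for h :: "real^'d"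
    by (simp add: if_distrib cong: if_cong)
  then show ?case
    by (intro exI[of _ "\<lambda>j _. if j = i then 1 else 0"])
       (auto intro!: smooth_alg.const derivative_eq_intros bounded_linear_imp_has_derivative
         bounded_linear_compose[OF bounded_linear_of_real bounded_linear_vec_nth])
next
  case (bump P a b c)
  define Q where "Q = [:0, 0, 1:] * (P - pderiv P)"
  define q where "q x = a - b * (x \<bullet> x) + c \<bullet> x" for x :: "real^'d"
  define f' where "f' j x = of_real (flat Q (q x)) * (of_real (- 2 * b) * of_real (x $ j) + complex_of_real (c $ j))"
    for j and x :: "real^'d"
  have "((\<lambda>x. complex_of_real (flat P (q x))) has_derivative (\<lambda>h. \<Sum>j\<in>UNIV. of_real (h $ j) * f' j x)) (at x)"
    for x :: "real^'d"
  proof -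
    have "(q has_derivative (\<lambda>h. c \<bullet> h - b * (x \<bullet> h + h \<bullet> x))) (at x)"
      unfolding q_def[abs_def] by (auto intro!: derivative_eq_intros)
    then have "((\<lambda>x. flat P (q x)) has_derivative (\<lambda>h. flat Q (q x) * (c \<bullet> h - b * (x \<bullet> h + h \<bullet> x)))) (at x)"
      using has_derivative_compose[OF _ flat_has_derivative[unfolded has_field_derivative_def]]
      unfolding Q_def by blast
    moreover have "complex_of_real (flat Q (q x) * (c \<bullet> h - b * (x \<bullet> h + h \<bullet> x)))
        = (\<Sum>j\<in>UNIV. of_real (h $ j) * f' j x)" for h
    proof -
      have "flat Q (q x) * (c \<bullet> h - b * (x \<bullet> h + h \<bullet> x)) = flat Q (q x) * (h \<bullet> ((- 2 * b) *\<^sub>R x + c))"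
        by (simp add: inner_commute[of c] inner_commute[of x] inner_add_right inner_diff_right)
      also have "\<dots> = (\<Sum>j\<in>UNIV. h $ j * (flat Q (q x) * (- 2 * b * x $ j + c $ j)))"
        by (subst inner_vec_def) (simp add: sum_distrib_left mult_ac)
      finally show ?thesis by (simp add: f'_def)
    qed
    ultimately show ?thesis
      using has_derivative_of_real[where 'a = complex] by fastforce
  qed
  moreover have "smooth_alg (f' j)" for j
    unfolding f'_def[abs_def] q_def
    by (intro smooth_alg.mult smooth_alg.add smooth_alg.const smooth_alg.coord smooth_alg.bump)
  ultimately show ?case unfolding q_def by blast
next
  case (wave N i)
  note has_derivative_cis_coord[of N i]
  moreover have "smooth_alg (\<lambda>x. if j = i then \<i> * of_real N * cis (N * x $ i) else 0)" for j
    by (cases "j = i") (auto intro!: smooth_alg.intros)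
  ultimately show ?case
    by (intro exI[of _ "\<lambda>j x. if j = i then \<i> * of_real N * cis (N * x $ i) else 0"]) auto
next
  case (add f g)
  then obtain f' g' where "\<And>j. smooth_alg (f' j)" "\<And>j. smooth_alg (g' j)"
    "\<And>x. (f has_derivative (\<lambda>h. \<Sum>j\<in>UNIV. of_real (h $ j) * f' j x)) (at x)"
    "\<And>x. (g has_derivative (\<lambda>h. \<Sum>j\<in>UNIV. of_real (h $ j) * g' j x)) (at x)" by blast
  then show ?case
    by (intro exI[of _ "\<lambda>j x. f' j x + g' j x"])
       (auto intro!: smooth_alg.add derivative_eq_intros simp: sum.distrib distrib_left)
next
  case (mult f g)
  then obtain f' g' where fg: "\<And>j. smooth_alg (f' j)" "\<And>j. smooth_alg (g' j)"
    "\<And>x. (f has_derivative (\<lambda>h. \<Sum>j\<in>UNIV. of_real (h $ j) * f' j x)) (at x)"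
    "\<And>x. (g has_derivative (\<lambda>h. \<Sum>j\<in>UNIV. of_real (h $ j) * g' j x)) (at x)" by blast
  have "((\<lambda>x. f x * g x) has_derivative (\<lambda>h. \<Sum>j\<in>UNIV. of_real (h $ j) * (f' j x * g x + f x * g' j x))) (at x)" for x
    by (rule has_derivative_eq_rhs[OF has_derivative_mult[OF fg(3,4)]])
       (simp add: fun_eq_iff sum.distrib distrib_left sum_distrib_left sum_distrib_right mult_ac)
  then show ?case
    using mult fg by (intro exI[of _ "\<lambda>j x. f' j x * g x + f x * g' j x"]) (auto intro!: smooth_alg.add smooth_alg.mult)
qed

lemma smooth_alg_partial_deriv: "smooth_alg f \<Longrightarrow> smooth_alg (partial_deriv j f)"
  and smooth_alg_differentiable: "smooth_alg f \<Longrightarrow> f differentiable (at x)"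
proof -
  assume "smooth_alg f"
  from smooth_alg_derivative[OF this] obtain f' where f': "\<And>j. smooth_alg (f' j)"
    "\<And>x. (f has_derivative (\<lambda>h. \<Sum>j\<in>UNIV. of_real (h $ j) * f' j x)) (at x)" by blast
  have "partial_deriv j f = f' j"
    using has_derivative_of_partials[OF f'(2)] by (simp add: fun_eq_iff)
  then show "smooth_alg (partial_deriv j f)" using f'(1) by simp
  show "f differentiable (at x)" using f'(2) by (auto simp: differentiable_def)
qed

lemma test_function_smooth_alg:
  assumes "smooth_alg f" "\<And>x. norm x > R \<Longrightarrow> f x = 0"
  shows "test_function f"
  unfolding test_function_def
proof (intro conjI allI)
  fix js x
  have "smooth_alg (foldr partial_deriv js f)"
    by (induction js) (auto intro: assms smooth_alg_partial_deriv)
  then show "foldr partial_deriv js f differentiable at x" by (rule smooth_alg_differentiable)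
next
  have "{x. f x \<noteq> 0} \<subseteq> cball 0 R" using assms(2) by (force simp: not_less)
  then have "bounded (closure {x. f x \<noteq> 0})" using bounded_subset bounded_closure bounded_cball by blast
  then show "compact (closure {x. f x \<noteq> 0})" by (simp add: compact_eq_bounded_closed)
qed

lemma partial_deriv_outside_ball:
  assumes "\<And>x. norm x > R \<Longrightarrow> f x = 0" "norm x > R"
  shows "partial_deriv j f x = 0"
proof -
  have "(f has_derivative (\<lambda>_. 0)) (at x)"
  proof (rule has_derivative_transform_within_open)
    show "((\<lambda>_. 0) has_derivative (\<lambda>_. 0)) (at x)" by simp
    show "open (- cball 0 R :: (real^'a) set)" by (simp add: open_Compl)
  qed (use assms in auto)
  from frechet_derivative_at[OF this] show ?thesis by (simp add: partial_deriv_def fun_eq_iff)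
qed

lemma partial_deriv_has_derivative_line:
  assumes "\<And>x. f differentiable (at x)"
  shows "((\<lambda>\<tau>. f (x + \<tau> *\<^sub>R axis j 1)) has_vector_derivative partial_deriv j f (x + \<tau> *\<^sub>R axis j 1)) (at \<tau> within A)"
proof -
  have "(f has_derivative frechet_derivative f (at (x + \<tau> *\<^sub>R axis j 1))) (at (x + \<tau> *\<^sub>R axis j 1))"
    using assms frechet_derivative_works by blast
  then have d: "((\<lambda>\<tau>. f (x + \<tau> *\<^sub>R axis j 1)) has_derivative
      (\<lambda>h. frechet_derivative f (at (x + \<tau> *\<^sub>R axis j 1)) (h *\<^sub>R axis j 1))) (at \<tau> within A)"
    by (rule has_derivative_compose[of "\<lambda>\<tau>. x + \<tau> *\<^sub>R axis j 1" "\<lambda>h. h *\<^sub>R axis j 1" \<tau> A f, rotated])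
       (auto intro!: derivative_eq_intros)
  have "linear (frechet_derivative f (at (x + \<tau> *\<^sub>R axis j 1)))"
    using assms linear_frechet_derivative by blast
  with d show ?thesis by (simp add: has_vector_derivative_def partial_deriv_def linear_scale)
qed

lemma partial_deriv_mult:
  assumes "f differentiable (at x)" "g differentiable (at x)"
  shows "partial_deriv j (\<lambda>x. f x * g x) x = partial_deriv j f x * g x + f x * partial_deriv j g x"
proof -
  have "((\<lambda>x. f x * g x) has_derivative (\<lambda>h. f x * frechet_derivative g (at x) h + frechet_derivative f (at x) h * g x)) (at x)"
    using assms by (intro has_derivative_mult) (auto simp: frechet_derivative_works)
  from frechet_derivative_at[OF this, symmetric] show ?thesis by (simp add: partial_deriv_def add.commute)
qed

lemma difference_quotient_tendsto:
  fixes g :: "real \<Rightarrow> 'a::real_normed_vector"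
  assumes "(g has_vector_derivative D) (at 0)"
  shows "((\<lambda>\<tau>. (1 / \<tau>) *\<^sub>R (g \<tau> - g 0)) \<longlongrightarrow> D) (at 0)"
proof -
  have "((\<lambda>h. norm (g h - g 0 - h *\<^sub>R D) / norm h) \<longlongrightarrow> 0) (at 0)"
    using assms unfolding has_vector_derivative_def has_derivative_at by simp
  moreover have "\<forall>\<^sub>F h in at 0. norm (g h - g 0 - h *\<^sub>R D) / norm h = norm ((1 / h) *\<^sub>R (g h - g 0) - D)"
  proof -
    have "norm (g h - g 0 - h *\<^sub>R D) / norm h = norm ((1 / h) *\<^sub>R (g h - g 0) - D)" if "h \<noteq> 0" for h
    proof -
      have "(1 / h) *\<^sub>R (g h - g 0) - D = (1 / h) *\<^sub>R (g h - g 0 - h *\<^sub>R D)"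
        using that by (simp add: scaleR_diff_right)
      then show ?thesis by simp
    qed
    then show ?thesis by (simp add: eventually_at_filter)
  qed
  ultimately have "((\<lambda>h. norm ((1 / h) *\<^sub>R (g h - g 0) - D)) \<longlongrightarrow> 0) (at 0)"
    by (rule Lim_transform_eventually)
  then show ?thesis by (metis LIM_zero_cancel tendsto_norm_zero_cancel)
qed

text \<open>Difference quotients in a coordinate direction integrate to zero because Lebesgue measure is
  translation invariant, and by the mean value inequality they converge dominatedly.\<close>

lemma integral_partial_deriv_zero:
  fixes F :: "real^'d::finite \<Rightarrow> complex"
  assumes diff: "\<And>x. F differentiable (at x)" and cont: "continuous_on UNIV (partial_deriv j F)"
    and K: "compact K" "\<And>x. x \<notin> K \<Longrightarrow> F x = 0"
  shows "(LINT x|lborel. partial_deriv j F x) = 0"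
proof -
  obtain r where r: "r > 0" "K \<subseteq> ball 0 r"
    using compact_imp_bounded[OF K(1)] bounded_subset_ballD by blast
  have contF: "continuous_on UNIV F"
    using diff by (intro differentiable_imp_continuous_on) (simp add: differentiable_on_def)
  have [measurable]: "F \<in> borel_measurable borel" "partial_deriv j F \<in> borel_measurable borel"
    using contF cont by (auto intro: borel_measurable_continuous_onI)
  have dz: "partial_deriv j F x = 0" if "x \<notin> K" for x
  proof -
    have "(F has_derivative (\<lambda>_. 0)) (at x)"
    proof (rule has_derivative_transform_within_open)
      show "((\<lambda>_. 0) has_derivative (\<lambda>_. 0)) (at x)" by simp
      show "open (- K)" using K(1) by (simp add: open_Compl compact_imp_closed)
    qed (use that K in auto)
    from frechet_derivative_at[OF this] show ?thesis by (simp add: partial_deriv_def fun_eq_iff)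
  qed
  have "compact (partial_deriv j F ` K)"
    by (intro compact_continuous_image K continuous_on_subset[OF cont]) auto
  from compact_imp_bounded[OF this]
  obtain M0 where M0: "\<And>x. x \<in> K \<Longrightarrow> norm (partial_deriv j F x) \<le> M0"
    unfolding bounded_iff by blast
  define M where "M = max M0 0"
  have M: "norm (partial_deriv j F x) \<le> M" for x
    using M0[of x] dz[of x] by (cases "x \<in> K") (auto simp: M_def)
  define e :: "real^'d" where "e = axis j 1"
  have e: "norm e = 1" by (simp add: e_def norm_axis_1)
  define h where "h n = 1 / real (Suc n)" for n
  have h: "0 < h n" "h n \<le> 1" for n by (auto simp: h_def)
  define q where "q n x = (1 / h n) *\<^sub>R (F (x + h n *\<^sub>R e) - F x)" for n x
  have incr: "norm (F (x + s *\<^sub>R e) - F x) \<le> M * s" if "s \<ge> 0" for x s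
  proof -
    have "norm (F (x + s *\<^sub>R e) - F (x + 0 *\<^sub>R e)) \<le> M * norm (s - 0)"
    proof (rule differentiable_bound[where S = UNIV and f' = "\<lambda>\<tau> h. h *\<^sub>R partial_deriv j F (x + \<tau> *\<^sub>R e)"])
      show "((\<lambda>\<tau>. F (x + \<tau> *\<^sub>R e)) has_derivative (\<lambda>h. h *\<^sub>R partial_deriv j F (x + \<tau> *\<^sub>R e))) (at \<tau> within UNIV)" for \<tau>
        using partial_deriv_has_derivative_line[OF diff, of x j \<tau> UNIV] by (simp add: has_vector_derivative_def e_def)
      show "onorm (\<lambda>h. h *\<^sub>R partial_deriv j F (x + \<tau> *\<^sub>R e)) \<le> M" for \<tau>
        by (rule onorm_le) (use M[of "x + \<tau> *\<^sub>R e"] in \<open>auto simp: mult.commute[of M] intro!: mult_left_mono\<close>)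
    qed auto
    then show ?thesis using that by simp
  qed
  have int: "integrable lborel F"
  proof -
    have "integrable lborel (\<lambda>x. indicator K x *\<^sub>R F x)"
      by (intro borel_integrable_compact K continuous_on_subset[OF contF]) auto
    moreover have "(\<lambda>x. indicator K x *\<^sub>R F x) = F" using K(2) by (auto simp: fun_eq_iff split: split_indicator)
    ultimately show ?thesis by simp
  qed
  have int_shift: "integrable lborel (\<lambda>x. F (x + c))" "(LINT x|lborel. F (x + c)) = integral\<^sup>L lborel F" for c
  proof -
    have "lborel = distr lborel borel ((+) c)" by (simp add: lborel_distr_plus)
    then have "integrable (distr lborel borel ((+) c)) F" using int by simp
    then show "integrable lborel (\<lambda>x. F (x + c))" by (subst (asm) integrable_distr_eq) (auto simp: add.commute)
    have "integral\<^sup>L (distr lborel borel ((+) c)) F = (LINT x|lborel. F (c + x))"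
      by (rule integral_distr) auto
    then show "(LINT x|lborel. F (x + c)) = integral\<^sup>L lborel F" by (simp add: lborel_distr_plus add.commute)
  qed
  have q0: "(LINT x|lborel. q n x) = 0" for n
    unfolding q_def using int int_shift by simp
  have "(\<lambda>n. LINT x|lborel. q n x) \<longlonglongrightarrow> (LINT x|lborel. partial_deriv j F x)"
  proof (rule integral_dominated_convergence[where w = "\<lambda>x. indicator (cball 0 (r + 1)) x *\<^sub>R M"])
    have "emeasure lborel (cball (0 :: real^'d) (r + 1)) < \<infinity>" by (rule emeasure_bounded_finite) simp
    then show "integrable lborel (\<lambda>x. indicator (cball (0 :: real^'d) (r + 1)) x *\<^sub>R M)"
      by (intro integrable_scaleR_left integrable_real_indicator) auto
    show "AE x in lborel. (\<lambda>n. q n x) \<longlonglongrightarrow> partial_deriv j F x"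
    proof (rule AE_I2)
      fix x
      have "((\<lambda>\<tau>. F (x + \<tau> *\<^sub>R e)) has_vector_derivative partial_deriv j F x) (at 0)"
        using partial_deriv_has_derivative_line[OF diff, of x j 0 UNIV] by (simp add: e_def)
      then have "((\<lambda>\<tau>. (1 / \<tau>) *\<^sub>R (F (x + \<tau> *\<^sub>R e) - F x)) \<longlongrightarrow> partial_deriv j F x) (at 0)"
        using difference_quotient_tendsto by fastforce
      moreover have "filterlim h (at 0) sequentially"
        unfolding filterlim_at using h LIMSEQ_Suc[OF lim_1_over_n] by (auto simp: h_def[abs_def])
      ultimately show "(\<lambda>n. q n x) \<longlonglongrightarrow> partial_deriv j F x"
        unfolding q_def by (rule filterlim_compose)
    qed
    show "AE x in lborel. norm (q n x) \<le> indicator (cball 0 (r + 1)) x *\<^sub>R M" for n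
    proof (rule AE_I2)
      fix x
      show "norm (q n x) \<le> indicator (cball 0 (r + 1)) x *\<^sub>R M"
      proof (cases "x \<in> cball 0 (r + 1)")
        case True
        then show ?thesis using incr[of "h n" x] h[of n] by (simp add: q_def pos_divide_le_eq del: scaleR_diff_right)
      next
        case False
        then have "norm (x + h n *\<^sub>R e) > r" "norm x > r"
          using norm_triangle_ineq2[of x "- h n *\<^sub>R e"] h[of n] e by auto
        then have "x \<notin> K" "x + h n *\<^sub>R e \<notin> K" using r by auto
        then show ?thesis using False by (simp add: q_def K(2))
      qed
    qed
    show "(\<lambda>x. q n x) \<in> borel_measurable lborel" for n unfolding q_def by measurable
  qed auto
  then show ?thesis using q0 by (simp add: LIMSEQ_const_iff)
qed

lemma test_function_continuous:
  assumes "test_function \<phi>"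
  shows "continuous_on UNIV \<phi>" "continuous_on UNIV (partial_deriv j \<phi>)" "\<phi> differentiable (at x)"
proof -
  have diff: "foldr partial_deriv js \<phi> differentiable at x" for js x
    using assms by (simp add: test_function_def)
  have "continuous_on UNIV (foldr partial_deriv js \<phi>)" for js
    using diff by (intro differentiable_imp_continuous_on) (simp add: differentiable_on_def)
  from this[of "[]"] this[of "[j]"] show "continuous_on UNIV \<phi>" "continuous_on UNIV (partial_deriv j \<phi>)" by auto
  show "\<phi> differentiable (at x)" using diff[of "[]"] by simp
qed

lemma integrable_mult_sq_int:
  fixes f g :: "'a::euclidean_space \<Rightarrow> complex"
  assumes "sq_int f" "sq_int g"
  shows "integrable lborel (\<lambda>x. f x * g x)"
  by (rule Bochner_Integration.integrable_bound[OF integrable_norm_mult[OF assms]])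
     (use assms in \<open>auto simp: sq_int_def norm_mult\<close>)

lemma weak_gradient_test_function:
  assumes "test_function a"
  shows "weak_gradient a (\<lambda>x. \<chi> i. partial_deriv i a x)"
  unfolding weak_gradient_def
proof (intro allI impI)
  fix \<phi> :: "real^'a \<Rightarrow> complex" and j assume \<phi>: "test_function \<phi>"
  note A = test_function_continuous[OF assms] and P = test_function_continuous[OF \<phi>]
  have pd: "partial_deriv j (\<lambda>x. a x * \<phi> x) = (\<lambda>x. partial_deriv j a x * \<phi> x + a x * partial_deriv j \<phi> x)"
    by (rule ext) (rule partial_deriv_mult[OF A(3) P(3)])
  have "(LINT x|lborel. partial_deriv j (\<lambda>x. a x * \<phi> x) x) = 0"
  proof (rule integral_partial_deriv_zero)
    show "(\<lambda>x. a x * \<phi> x) differentiable at x" for x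
      using A(3) P(3) by (intro differentiable_mult) auto
    show "continuous_on UNIV (partial_deriv j (\<lambda>x. a x * \<phi> x))"
      unfolding pd by (intro continuous_intros A P)
    show "compact (closure {x. \<phi> x \<noteq> 0})" using \<phi> by (simp add: test_function_def)
    show "a x * \<phi> x = 0" if "x \<notin> closure {x. \<phi> x \<noteq> 0}" for x
      using that closure_subset[of "{x. \<phi> x \<noteq> 0}"] by auto
  qed
  then show "(LINT x|lborel. a x * partial_deriv j \<phi> x) = - (LINT x|lborel. (\<chi> i. partial_deriv i a x) $ j * \<phi> x)"
    unfolding pd
    using integrable_mult_sq_int[OF sq_int_test_function(1)[OF assms] sq_int_test_function(2)[OF \<phi>]]
      integrable_mult_sq_int[OF sq_int_test_function(2)[OF assms] sq_int_test_function(1)[OF \<phi>]]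
    by (simp add: eq_neg_iff_add_eq_0 add.commute)
qed

lemma partial_deriv_cnj:
  assumes "\<phi> differentiable (at x)"
  shows "partial_deriv j (\<lambda>x. cnj (\<phi> x)) x = cnj (partial_deriv j \<phi> x)"
proof -
  have "((\<lambda>x. cnj (\<phi> x)) has_derivative (\<lambda>h. cnj (frechet_derivative \<phi> (at x) h))) (at x)"
    using assms by (intro bounded_linear.has_derivative[OF bounded_linear_cnj]) (simp add: frechet_derivative_works)
  from frechet_derivative_at[OF this, symmetric] show ?thesis by (simp add: partial_deriv_def)
qed

lemma test_function_cnj:
  assumes "test_function \<phi>"
  shows "test_function (\<lambda>x. cnj (\<phi> x))"
proof -
  have diff: "foldr partial_deriv js \<phi> differentiable at x" for js x
    using assms by (simp add: test_function_def)
  have eq: "foldr partial_deriv js (\<lambda>x. cnj (\<phi> x)) = (\<lambda>x. cnj (foldr partial_deriv js \<phi> x))" for js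
  proof (induction js)
    case (Cons a js)
    show ?case by (simp add: Cons partial_deriv_cnj[OF diff] fun_eq_iff)
  qed simp
  have "(\<lambda>x. cnj (foldr partial_deriv js \<phi> x)) differentiable at x" for js x
    using diff[of js x] bounded_linear.has_derivative[OF bounded_linear_cnj] unfolding differentiable_def
    by blast
  then show ?thesis using assms by (simp add: test_function_def eq)
qed

text \<open>The weak gradient is defined with a bilinear pairing; this is its sesquilinear form, obtained by
  conjugating the test function.\<close>

lemma h1_integration_by_parts:
  assumes "test_function \<phi>"
  shows "(LINT x|lborel. \<phi> x * cnj (h1_grad v x $ j)) = - (LINT x|lborel. partial_deriv j \<phi> x * cnj (h1_val v x))"
proof -
  have "(LINT x|lborel. h1_val v x * partial_deriv j (\<lambda>x. cnj (\<phi> x)) x) = - (LINT x|lborel. h1_grad v x $ j * cnj (\<phi> x))"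
    using weak_gradient_h1[of v] test_function_cnj[OF assms] by (simp add: weak_gradient_def)
  also have "(\<lambda>x. h1_val v x * partial_deriv j (\<lambda>x. cnj (\<phi> x)) x) = (\<lambda>x. cnj (partial_deriv j \<phi> x * cnj (h1_val v x)))"
    using test_function_continuous(3)[OF assms] by (simp add: partial_deriv_cnj fun_eq_iff)
  also have "(\<lambda>x. h1_grad v x $ j * cnj (\<phi> x)) = (\<lambda>x. cnj (\<phi> x * cnj (h1_grad v x $ j)))"
    by (rule ext) (simp add: mult.commute)
  finally have "cnj (LINT x|lborel. partial_deriv j \<phi> x * cnj (h1_val v x)) = cnj (- (LINT x|lborel. \<phi> x * cnj (h1_grad v x $ j)))"
    by (simp del: complex_cnj_mult)
  then show ?thesis by (simp add: complex_cnj_cancel_iff del: complex_cnj_minus)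
qed

section \<open>The fundamental lemma of the calculus of variations\<close>

lemma countable_ball_basis:
  "\<exists>B :: 'a::euclidean_space set set. countable B \<and> topological_basis B \<and> (\<forall>b\<in>B. \<exists>c r. b = ball c r)"
proof -
  obtain D :: "'a set" where D: "countable D" "\<And>X. open X \<Longrightarrow> X \<noteq> {} \<Longrightarrow> \<exists>d\<in>D. d \<in> X"
    using countable_dense_exists by blast
  define B where "B = (\<lambda>(c :: 'a, q :: rat). ball c (of_rat q)) ` (D \<times> UNIV)"
  have "topological_basis B"
  proof (rule topological_basisI)
    fix U :: "'a set" and x assume "open U" "x \<in> U"
    then obtain e where e: "e > 0" "ball x e \<subseteq> U" by (auto simp: open_contains_ball)
    obtain q :: rat where q: "0 < real_of_rat q" "real_of_rat q < e / 2"
      using of_rat_dense[of 0 "e / 2"] e(1) by auto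
    obtain c where c: "c \<in> D" "c \<in> ball x (of_rat q)" using D(2)[of "ball x (of_rat q)"] q(1) by auto
    have "ball c (of_rat q) \<subseteq> ball x e"
    proof
      fix y assume "y \<in> ball c (of_rat q)"
      then show "y \<in> ball x e" using c(2) q(2) dist_triangle[of x y c] by simp
    qed
    moreover have "x \<in> ball c (of_rat q)" "ball c (of_rat q) \<in> B"
      using c by (auto simp: dist_commute B_def)
    ultimately show "\<exists>B'\<in>B. x \<in> B' \<and> B' \<subseteq> U" using e(2) by blast
  qed (auto simp: B_def)
  then show ?thesis using D(1) by (intro exI[of _ B]) (auto simp: B_def)
qed

lemma flat_one: "flat 1 t = (if t > 0 then exp (- (1 / t)) else 0)"
  by (simp add: flat_def)

lemma flat_one_bounds: "0 \<le> flat 1 t" "flat 1 t \<le> 1" "0 < flat 1 t \<longleftrightarrow> 0 < t"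
  by (auto simp: flat_one)

lemma flat_one_tendsto_indicator:
  "(\<lambda>m. flat 1 (real m * t)) \<longlonglongrightarrow> (if t > 0 then 1 else 0)"
proof (cases "t > 0")
  case True
  have "(\<lambda>m. exp (- (inverse t * inverse (real m)))) \<longlonglongrightarrow> exp (- (inverse t * 0))"
    by (intro tendsto_intros tendsto_inverse_0_at_top filterlim_real_sequentially)
  then have "(\<lambda>m. exp (- (inverse t * inverse (real m)))) \<longlonglongrightarrow> 1" by simp
  moreover have "\<forall>\<^sub>F m in sequentially. exp (- (inverse t * inverse (real m))) = flat 1 (real m * t)"
    using eventually_gt_at_top[of 0] by eventually_elim (use True in \<open>simp add: flat_one divide_inverse mult.commute\<close>)
  ultimately show ?thesis using True by (simp add: Lim_transform_eventually)
next
  case False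
  then have "flat 1 (real m * t) = 0" for m by (simp add: flat_one zero_less_mult_iff)
  with False show ?thesis by simp
qed

text \<open>A product of functions \<open>flat 1 (m * q)\<close>, one for each of finitely many balls \<open>{x. q x > 0}\<close>, tends
  to the indicator of the intersection of the balls as \<open>m\<close> grows. Hence the integral of \<open>h\<close>, multiplied
  by a cutoff \<open>K R\<close> that provides compact support, vanishes over every such intersection, and
  these generate the Borel sets.\<close>

lemma fundamental_lemma:
  fixes h :: "real^'d::finite \<Rightarrow> complex"
  assumes h: "sq_int h" and zero: "\<And>\<phi>. test_function \<phi> \<Longrightarrow> (LINT x|lborel. \<phi> x * h x) = 0"
  shows "AE x in lborel. h x = 0"
proof -
  obtain B :: "(real^'d) set set" where B: "countable B" "topological_basis B" "\<And>b. b \<in> B \<Longrightarrow> \<exists>c r. b = ball c r"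
    using countable_ball_basis[where 'a = "real^'d"] by blast
  have [measurable]: "h \<in> borel_measurable borel" using h by (simp add: sq_int_def)
  define K where "K R x = complex_of_real (flat 1 ((real R)\<^sup>2 - 1 * (x \<bullet> x) + 0 \<bullet> x))" for R and x :: "real^'d"
  have K: "smooth_alg (K R)" for R unfolding K_def by (rule smooth_alg.bump)
  have K0: "K R x = 0" if "norm x > real R" for R x
  proof -
    have "(real R)\<^sup>2 < x \<bullet> x"
      using that power_strict_mono[of "real R" "norm x" 2] by (simp add: power2_norm_eq_inner)
    then show ?thesis by (simp add: K_def flat_one)
  qed
  have K1: "norm (K R x) \<le> 1" for R x using flat_one_bounds by (simp add: K_def)
  have intK: "integrable lborel (\<lambda>x. K R x * h x)" for R
    using test_function_smooth_alg[OF K K0] sq_int_test_function(1) h integrable_mult_sq_int by blast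
  have main: "(LINT x:\<Inter>\<F>|lborel. K R x * h x) = 0" if F: "finite \<F>" "\<F> \<subseteq> B" for R \<F>
  proof -
    have "\<forall>b\<in>\<F>. \<exists>cr. b = ball (fst cr) (snd cr)" using B(3) F(2) by (metis fst_conv snd_conv subsetD)
    then obtain cr where cr: "\<And>b. b \<in> \<F> \<Longrightarrow> b = ball (fst (cr b)) (snd (cr b))" by metis
    \<comment> \<open>The centre of an empty ball must not satisfy \<open>q b x > 0\<close>, hence the truncation of a negative radius.\<close>
    define rad where "rad b = (if snd (cr b) > 0 then (snd (cr b))\<^sup>2 else 0)" for b
    define q where "q b x = rad b - fst (cr b) \<bullet> fst (cr b) - 1 * (x \<bullet> x) + (2 *\<^sub>R fst (cr b)) \<bullet> x" for b x
    have q: "q b x > 0 \<longleftrightarrow> x \<in> b" if "b \<in> \<F>" for b x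
    proof -
      have "q b x = rad b - (dist (fst (cr b)) x)\<^sup>2"
        by (simp add: q_def dist_norm power2_norm_eq_inner inner_diff_left inner_diff_right inner_commute)
      moreover have "x \<in> b \<longleftrightarrow> dist (fst (cr b)) x < snd (cr b)" using cr[OF that] by (metis mem_ball)
      ultimately show ?thesis
        using zero_le_dist[of "fst (cr b)" x] zero_le_power2[of "dist (fst (cr b)) x"]
        by (cases "snd (cr b) > 0") (auto simp: rad_def power_strict_mono intro: power_less_imp_less_base
            simp del: zero_le_dist zero_le_power2)
    qed
    define \<phi> where "\<phi> m x = K R x * (\<Prod>b\<in>\<F>. complex_of_real (flat 1 (real m * q b x)))" for m x
    have "smooth_alg (\<lambda>x. \<Prod>b\<in>\<F>. complex_of_real (flat 1 (real m * q b x)))" for m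
      using F(1)
    proof induction
      case empty
      show ?case by (simp add: smooth_alg.const)
    next
      case (insert b \<F>)
      have "smooth_alg (\<lambda>x. complex_of_real (flat 1 (real m * q b x)))"
        using smooth_alg.bump[of 1 "real m * (rad b - fst (cr b) \<bullet> fst (cr b))" "real m" "(2 * real m) *\<^sub>R fst (cr b)"]
        by (simp add: q_def algebra_simps)
      with insert show ?case by (simp add: smooth_alg.mult)
    qed
    then have "test_function (\<phi> m)" for m
      using K K0 unfolding \<phi>_def by (intro test_function_smooth_alg[of _ "real R"] smooth_alg.mult) auto
    then have z: "(LINT x|lborel. \<phi> m x * h x) = 0" and c: "continuous_on UNIV (\<phi> m)" for m
      using zero test_function_continuous by blast+
    note [measurable] = borel_measurable_continuous_onI[OF c]
    have [measurable]: "\<Inter>\<F> \<in> sets borel"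
      using F topological_basis_open[OF B(2)] by (intro borel_open open_Inter) auto
    have "(\<lambda>m. LINT x|lborel. \<phi> m x * h x) \<longlonglongrightarrow> (LINT x|lborel. indicator (\<Inter>\<F>) x *\<^sub>R (K R x * h x))"
    proof (rule integral_dominated_convergence[where w = "\<lambda>x. norm (K R x * h x)"])
      show "AE x in lborel. (\<lambda>m. \<phi> m x * h x) \<longlonglongrightarrow> indicator (\<Inter>\<F>) x *\<^sub>R (K R x * h x)"
      proof (rule AE_I2)
        fix x
        have "(\<lambda>m. \<Prod>b\<in>\<F>. complex_of_real (flat 1 (real m * q b x)))
            \<longlonglongrightarrow> (\<Prod>b\<in>\<F>. complex_of_real (if q b x > 0 then 1 else 0))"
          by (intro tendsto_prod tendsto_of_real flat_one_tendsto_indicator)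
        also have "(\<Prod>b\<in>\<F>. complex_of_real (if q b x > 0 then 1 else 0)) = indicator (\<Inter>\<F>) x"
          using F(1) q by (auto simp: prod_zero_iff split: split_indicator intro!: prod.neutral)
        finally have "(\<lambda>m. \<phi> m x * h x) \<longlonglongrightarrow> K R x * indicator (\<Inter>\<F>) x * h x"
          unfolding \<phi>_def by (intro tendsto_mult tendsto_const)
        then show "(\<lambda>m. \<phi> m x * h x) \<longlonglongrightarrow> indicator (\<Inter>\<F>) x *\<^sub>R (K R x * h x)"
          by (cases "x \<in> \<Inter>\<F>") simp_all
      qed
      show "AE x in lborel. norm (\<phi> m x * h x) \<le> norm (K R x * h x)" for m
      proof (rule AE_I2)
        fix x
        have "norm (\<Prod>b\<in>\<F>. complex_of_real (flat 1 (real m * q b x))) \<le> 1"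
          unfolding prod_norm[symmetric] using flat_one_bounds by (intro prod_le_1) auto
        then have "norm (\<phi> m x) \<le> norm (K R x)"
          unfolding \<phi>_def norm_mult by (intro mult_left_le) auto
        then show "norm (\<phi> m x * h x) \<le> norm (K R x * h x)"
          unfolding norm_mult by (rule mult_right_mono) simp
      qed
      show "(\<lambda>x. indicator (\<Inter>\<F>) x *\<^sub>R (K R x * h x)) \<in> borel_measurable lborel"
        using borel_measurable_integrable[OF intK[of R]] by simp
    qed (use intK in auto)
    then show ?thesis by (simp add: z LIMSEQ_const_iff set_lebesgue_integral_def)
  qed
  have setint: "set_integrable lborel (\<Inter>\<F>) (\<lambda>x. K R x * h x)" if "finite \<F>" "\<F> \<subseteq> B" for R \<F>
    unfolding set_integrable_def
    using that topological_basis_open[OF B(2)] intK by (intro integrable_mult_indicator) (auto intro!: borel_open open_Inter)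
  have "AE x in lborel. Re (K R x * h x) = 0" for R
  proof (rule AE_zero_of_generator[OF _ B(1,2)])
    show "(LINT x:\<Inter>\<F>|lborel. Re (K R x * h x)) = 0" if "finite \<F>" "\<F> \<subseteq> B" for \<F>
      using integral_bounded_linear[OF bounded_linear_Re setint[OF that, of R, unfolded set_integrable_def]] main[OF that, of R]
      unfolding set_lebesgue_integral_def by (simp only: scaleR_complex.simps) simp
  qed (rule integrable_bounded_linear[OF bounded_linear_Re intK])
  moreover have "AE x in lborel. Im (K R x * h x) = 0" for R
  proof (rule AE_zero_of_generator[OF _ B(1,2)])
    show "(LINT x:\<Inter>\<F>|lborel. Im (K R x * h x)) = 0" if "finite \<F>" "\<F> \<subseteq> B" for \<F>
      using integral_bounded_linear[OF bounded_linear_Im setint[OF that, of R, unfolded set_integrable_def]] main[OF that, of R]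
      unfolding set_lebesgue_integral_def by (simp only: scaleR_complex.simps) simp
  qed (rule integrable_bounded_linear[OF bounded_linear_Im intK])
  ultimately have "AE x in lborel. \<forall>R. Re (K R x * h x) = 0 \<and> Im (K R x * h x) = 0"
    by (simp add: AE_all_countable)
  then show ?thesis
  proof eventually_elim
    case (elim x)
    obtain R where R: "norm x < real R" using reals_Archimedean2 by blast
    then have "x \<bullet> x < (real R)\<^sup>2"
      using power_strict_mono[of "norm x" "real R" 2] by (simp add: power2_norm_eq_inner)
    then have "K R x \<noteq> 0" using flat_one_bounds(3)[of "(real R)\<^sup>2 - x \<bullet> x"] by (simp add: K_def)
    moreover have "K R x * h x = 0" using elim complex_eqI[of "K R x * h x" 0] by simp
    ultimately show ?case by simp
  qed
qed

section \<open>Operators from H1 to its antidual\<close>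

lemma hm1_apply_ops:
  "hm1_apply (F + G) w = hm1_apply F w + hm1_apply G w"
  "hm1_apply (c *\<^sub>R F) w = c *\<^sub>R hm1_apply F w"
  "hm1_apply (- F) w = - hm1_apply F w"
  "hm1_apply 0 w = 0"
  by (simp_all add: hm1_apply_def Rep_hm1_ops blinfun.add_left blinfun.scaleR_left blinfun.minus_left blinfun.zero_left)

lemma norm_hm1_apply_le: "norm (hm1_apply F w) \<le> norm F * norm w"
  unfolding hm1_apply_def norm_hm1_def by (rule norm_blinfun)

lemma norm_hm1_leI: "0 \<le> C \<Longrightarrow> (\<And>w. norm (hm1_apply F w) \<le> C * norm w) \<Longrightarrow> norm F \<le> C"
  unfolding hm1_apply_def norm_hm1_def by (rule norm_blinfun_bound)

text \<open>Only the real part of the duality enters the energy and duality arguments. It makes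
  \<open>H\<^sup>1\<close> a real Hilbert space and its antidual the real dual.\<close>

definition pairing :: "'d::finite hm1 \<Rightarrow> 'd h1 \<Rightarrow> real" where
  "pairing F w = Re (hm1_apply F w)"

lemma bounded_bilinear_pairing: "bounded_bilinear (pairing :: 'd::finite hm1 \<Rightarrow> 'd h1 \<Rightarrow> real)"
proof
  interpret l: bounded_linear "hm1_apply F" for F :: "'d hm1" by (rule bounded_linear_hm1_apply)
  fix F G :: "'d hm1" and v w :: "'d h1" and r :: real
  show "pairing (F + G) w = pairing F w + pairing G w" "pairing (r *\<^sub>R F) w = r *\<^sub>R pairing F w"
    by (simp_all add: pairing_def hm1_apply_ops)
  show "pairing F (v + w) = pairing F v + pairing F w" "pairing F (r *\<^sub>R w) = r *\<^sub>R pairing F w"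
    by (simp_all add: pairing_def l.add l.scaleR)
  show "\<exists>K. \<forall>(F :: 'd hm1) w. norm (pairing F w) \<le> norm F * norm w * K"
    using abs_Re_le_cmod norm_hm1_apply_le by (intro exI[of _ 1]) (auto simp: pairing_def intro: order_trans)
qed

lemma abs_pairing_le: "\<bar>pairing F w\<bar> \<le> norm F * norm w"
  unfolding pairing_def using abs_Re_le_cmod norm_hm1_apply_le by (rule order_trans)

interpretation pairing: bounded_bilinear "pairing :: 'd::finite hm1 \<Rightarrow> 'd h1 \<Rightarrow> real"
  by (rule bounded_bilinear_pairing)

definition l2norm :: "('a::euclidean_space \<Rightarrow> 'b::euclidean_space) \<Rightarrow> real" where
  "l2norm f = sqrt (LINT x|lborel. (norm (f x))\<^sup>2)"

lemma l2norm_nonneg: "0 \<le> l2norm f" by (simp add: l2norm_def)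

lemma l2norm_mono:
  assumes "sq_int f" "sq_int g" "\<And>x. norm (f x) \<le> norm (g x)"
  shows "l2norm f \<le> l2norm g"
  unfolding l2norm_def using assms
  by (intro real_sqrt_le_mono integral_mono power_mono) (auto simp: sq_int_def)

lemma l2norm_h1_le:
  shows "l2norm (h1_val v) \<le> norm v" "l2norm (h1_grad v) \<le> norm v" "l2norm (\<lambda>x. h1_grad v x $ i) \<le> norm v"
    "sq_int (\<lambda>x. h1_grad v x $ i)"
proof -
  show v: "l2norm (h1_val v) \<le> norm v"
    unfolding l2norm_def by (rule real_le_lsqrt) (auto simp: norm_h1_sq intro!: integral_nonneg)
  show g: "l2norm (h1_grad v) \<le> norm v"
    unfolding l2norm_def by (rule real_le_lsqrt) (auto simp: norm_h1_sq intro!: integral_nonneg)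
  have nth: "(\<lambda>y :: complex^'a. y $ i) \<in> borel_measurable borel"
    by (intro borel_measurable_continuous_onI continuous_intros)
  show s: "sq_int (\<lambda>x. h1_grad v x $ i)"
    by (rule sq_int_bound[OF sq_int_h1_grad[of v], of _ 1])
       (use measurable_compose[OF measurable_h1_grad nth] Finite_Cartesian_Product.norm_nth_le in auto)
  show "l2norm (\<lambda>x. h1_grad v x $ i) \<le> norm v"
    using l2norm_mono[OF s sq_int_h1_grad Finite_Cartesian_Product.norm_nth_le] g by linarith
qed

lemma integral_cnj_bound:
  fixes b \<psi> :: "'a::euclidean_space \<Rightarrow> complex"
  assumes "sq_int b" "sq_int \<psi>"
  shows "integrable lborel (\<lambda>x. b x * cnj (\<psi> x))"
    "norm (LINT x|lborel. b x * cnj (\<psi> x)) \<le> l2norm b * l2norm \<psi>"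
proof -
  have c: "sq_int (\<lambda>x. cnj (\<psi> x))" using assms(2) measurable_cnj[of \<psi> borel] by (simp add: sq_int_def)
  show i: "integrable lborel (\<lambda>x. b x * cnj (\<psi> x))" by (rule integrable_mult_sq_int[OF assms(1) c])
  have "norm (LINT x|lborel. b x * cnj (\<psi> x)) \<le> (LINT x|lborel. norm (b x) * norm (\<psi> x))"
    using integral_norm_bound[of lborel "\<lambda>x. b x * cnj (\<psi> x)"] by (simp add: norm_mult)
  also have "\<dots> \<le> l2norm b * l2norm \<psi>" unfolding l2norm_def by (rule integral_norm_mult_le[OF assms])
  finally show "norm (LINT x|lborel. b x * cnj (\<psi> x)) \<le> l2norm b * l2norm \<psi>" .
qed

lemma h1_grad_add: "AE x in lborel. h1_grad (v + w) x = h1_grad v x + h1_grad w x"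
  and h1_grad_scaleR: "AE x in lborel. h1_grad (r *\<^sub>R v) x = r *\<^sub>R h1_grad v x"
  using l2_fun_plus[of "Rep_h1 v" "Rep_h1 w"] l2_fun_scaleR[of r "Rep_h1 v"]
  by (auto simp: h1_grad_def Rep_h1_ops)

lemma hm1_apply_h1_to_hm1_cnj: "hm1_apply (h1_to_hm1 v) w = cnj (hm1_apply (h1_to_hm1 w) v)"
proof -
  have "cnj (LINT x|lborel. h1_val w x * cnj (h1_val v x)) = (LINT x|lborel. cnj (h1_val w x * cnj (h1_val v x)))"
    by (simp del: complex_cnj_mult)
  then show ?thesis by (simp add: hm1_apply_h1_to_hm1 mult.commute)
qed

lemma pairing_h1_to_hm1_sym: "pairing (h1_to_hm1 v) w = pairing (h1_to_hm1 w) v"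
  unfolding pairing_def by (subst hm1_apply_h1_to_hm1_cnj) simp

lemma norm_hm1_apply_h1_to_hm1_le: "norm (hm1_apply (h1_to_hm1 v) w) \<le> l2norm (h1_val v) * norm w"
  using integral_cnj_bound(2)[OF sq_int_h1_val[of v] sq_int_h1_val[of w]] l2norm_h1_le(1)[of w]
    mult_left_mono[OF l2norm_h1_le(1)[of w] l2norm_nonneg[of "h1_val v"]]
  unfolding hm1_apply_h1_to_hm1 by linarith

lemma norm_h1_to_hm1_le_l2norm: "norm (h1_to_hm1 v) \<le> l2norm (h1_val v)"
  by (rule norm_hm1_leI[OF l2norm_nonneg norm_hm1_apply_h1_to_hm1_le])

lemma norm_h1_to_hm1_le: "norm (h1_to_hm1 v) \<le> norm v"
  using norm_h1_to_hm1_le_l2norm l2norm_h1_le(1) by (rule order_trans)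

lemma bounded_linear_h1_to_hm1: "bounded_linear h1_to_hm1"
proof (rule bounded_linear_intro[where K = 1])
  interpret l: bounded_linear "hm1_apply F" for F :: "'a hm1" by (rule bounded_linear_hm1_apply)
  show "h1_to_hm1 (v + w) = h1_to_hm1 v + h1_to_hm1 w" for v w :: "'a h1"
  proof (rule hm1_eqI)
    show "hm1_apply (h1_to_hm1 (v + w)) z = hm1_apply (h1_to_hm1 v + h1_to_hm1 w) z" for z
      by (simp add: hm1_apply_ops hm1_apply_h1_to_hm1_cnj[of _ z] l.add)
  qed
  show "h1_to_hm1 (r *\<^sub>R v) = r *\<^sub>R h1_to_hm1 v" for r and v :: "'a h1"
  proof (rule hm1_eqI)
    show "hm1_apply (h1_to_hm1 (r *\<^sub>R v)) z = hm1_apply (r *\<^sub>R h1_to_hm1 v) z" for z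
      by (simp add: hm1_apply_ops hm1_apply_h1_to_hm1_cnj[of _ z] l.scaleR)
  qed
qed (simp add: norm_h1_to_hm1_le)

lemma pairing_h1_to_hm1_self: "pairing (h1_to_hm1 v) v = (LINT x|lborel. (norm (h1_val v x))\<^sup>2)"
proof -
  have "hm1_apply (h1_to_hm1 v) v = (LINT x|lborel. complex_of_real ((norm (h1_val v x))\<^sup>2))"
    unfolding hm1_apply_h1_to_hm1
    by (rule Bochner_Integration.integral_cong) (simp_all add: complex_norm_square[symmetric])
  then show ?thesis by (simp add: pairing_def del: of_real_power)
qed

text \<open>If the function vanishes, then so does the integral of its weak gradient against every test
  function. This makes the embedding of \<open>H\<^sup>1\<close> into its antidual injective.\<close>

lemma h1_eq_zero_if_val_zero:
  assumes "AE x in lborel. h1_val v x = 0"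
  shows "v = 0"
proof -
  have "AE x in lborel. h1_grad v x $ i = 0" for i
  proof (rule fundamental_lemma[OF l2norm_h1_le(4)])
    fix \<phi> :: "real^'a \<Rightarrow> complex" assume \<phi>: "test_function \<phi>"
    have "(LINT x|lborel. h1_val v x * partial_deriv i \<phi> x) = 0"
      by (rule integral_eq_zero_AE) (use assms in \<open>eventually_elim, simp\<close>)
    then show "(LINT x|lborel. \<phi> x * h1_grad v x $ i) = 0"
      using weak_gradient_h1[of v] \<phi> by (simp add: weak_gradient_def mult.commute)
  qed
  then have "AE x in lborel. \<forall>i\<in>UNIV. h1_grad v x $ i = 0" by (subst AE_finite_all) auto
  then have "AE x in lborel. (norm (h1_grad v x))\<^sup>2 = 0" by eventually_elim (simp add: vec_eq_iff)
  then have "(LINT x|lborel. (norm (h1_grad v x))\<^sup>2) = 0" by (rule integral_eq_zero_AE)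
  moreover have "(LINT x|lborel. (norm (h1_val v x))\<^sup>2) = 0"
    by (rule integral_eq_zero_AE) (use assms in \<open>eventually_elim, simp\<close>)
  ultimately have "(norm v)\<^sup>2 = 0" unfolding norm_h1_sq by simp
  then show ?thesis by simp
qed

lemma pairing_h1_to_hm1_self_eq_zero:
  assumes "pairing (h1_to_hm1 v) v = 0"
  shows "v = 0"
proof (rule h1_eq_zero_if_val_zero)
  have "(LINT x|lborel. (norm (h1_val v x))\<^sup>2) = 0" using assms by (simp add: pairing_h1_to_hm1_self)
  then have "AE x in lborel. (norm (h1_val v x))\<^sup>2 = 0"
    using sq_int_h1_val[of v] by (subst (asm) integral_nonneg_eq_0_iff_AE) (auto simp: sq_int_def)
  then show "AE x in lborel. h1_val v x = 0" by eventually_elim simp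
qed

lemma cdot_linear:
  "cdot (a + b) c = cdot a c + cdot b c" "cdot (r *\<^sub>R a) c = r *\<^sub>R cdot a c"
  by (simp_all add: cdot_def sum.distrib distrib_right scaleR_sum_right)

lemma cdot_cnj: "cnj (cdot a b) = cdot b a"
  by (simp add: cdot_def mult.commute)

lemma cdot_self: "cdot a a = of_real ((norm a)\<^sup>2)"
  by (simp add: cdot_def norm_vec_def L2_set_def sum_nonneg complex_norm_square[symmetric])

lemma norm_cdot_le: "norm (cdot a b) \<le> norm a * norm b"
proof -
  have "norm (cdot a b) \<le> (\<Sum>i\<in>UNIV. norm (a $ i) * norm (b $ i))"
    unfolding cdot_def by (rule order_trans[OF norm_sum]) (simp add: norm_mult)
  also have "\<dots> = (\<Sum>i\<in>UNIV. \<bar>norm (a $ i)\<bar> * \<bar>norm (b $ i)\<bar>)" by simp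
  also have "\<dots> \<le> norm a * norm b" unfolding norm_vec_def by (rule L2_set_mult_ineq)
  finally show ?thesis .
qed

definition bounded_coeff :: "(real^'d::finite \<Rightarrow> complex^'d^'d) \<Rightarrow> bool" where
  "bounded_coeff A \<longleftrightarrow> A \<in> borel_measurable borel \<and> (\<exists>\<Lambda>. \<forall>x \<xi>. norm (A x *v \<xi>) \<le> \<Lambda> * norm \<xi>)"

lemma hm1_apply_div_grad':
  "bounded_coeff A \<Longrightarrow> hm1_apply (div_grad A v) w = - (LINT x|lborel. cdot (A x *v h1_grad v x) (h1_grad w x))"
  unfolding bounded_coeff_def by (auto intro: hm1_apply_div_grad)

lemma measurable_matrix_vector:
  fixes A :: "'a::topological_space \<Rightarrow> complex^'d::finite^'d"
  assumes "A \<in> borel_measurable borel" "g \<in> borel_measurable borel"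
  shows "(\<lambda>x. A x *v g x) \<in> borel_measurable borel"
proof -
  have P: "(\<lambda>x. (A x, g x)) \<in> borel_measurable borel" using assms by (rule borel_measurable_Pair)
  have C: "continuous_on UNIV (\<lambda>z :: (complex^'d^'d) \<times> (complex^'d). fst z *v snd z)"
    unfolding matrix_vector_mult_def by (intro continuous_intros)
  show ?thesis using measurable_compose[OF P borel_measurable_continuous_onI[OF C]] by simp
qed

lemma measurable_cdot:
  assumes "f \<in> borel_measurable M" "g \<in> borel_measurable M"
  shows "(\<lambda>x. cdot (f x) (g x)) \<in> borel_measurable M"
proof -
  have P: "(\<lambda>x. (f x, g x)) \<in> borel_measurable M" using assms by (rule borel_measurable_Pair)
  have C: "continuous_on UNIV (\<lambda>z :: (complex^'b) \<times> (complex^'b). cdot (fst z) (snd z))"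
    unfolding cdot_def by (intro continuous_intros)
  show ?thesis using measurable_compose[OF P borel_measurable_continuous_onI[OF C]] by simp
qed

lemma div_grad_form:
  assumes A: "A \<in> borel_measurable borel" and bd: "\<And>x \<xi>. norm (A x *v \<xi>) \<le> \<Lambda> * norm \<xi>"
  shows integrable_div_grad_form: "integrable lborel (\<lambda>x. cdot (A x *v h1_grad v x) (h1_grad w x))"
    and norm_div_grad_form_le: "norm (LINT x|lborel. cdot (A x *v h1_grad v x) (h1_grad w x)) \<le> \<bar>\<Lambda>\<bar> * norm v * norm w"
proof -
  have le: "norm (cdot (A x *v h1_grad v x) (h1_grad w x)) \<le> \<bar>\<Lambda>\<bar> * (norm (h1_grad v x) * norm (h1_grad w x))" for x
  proof -
    have "norm (A x *v h1_grad v x) \<le> \<bar>\<Lambda>\<bar> * norm (h1_grad v x)"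
      using bd[of x "h1_grad v x"] mult_right_mono[OF abs_ge_self[of \<Lambda>] norm_ge_zero[of "h1_grad v x"]] by linarith
    from mult_right_mono[OF this norm_ge_zero[of "h1_grad w x"]] norm_cdot_le[of "A x *v h1_grad v x" "h1_grad w x"]
    show ?thesis by (simp add: mult.assoc)
  qed
  have ig: "integrable lborel (\<lambda>x. \<bar>\<Lambda>\<bar> * (norm (h1_grad v x) * norm (h1_grad w x)))"
    by (intro integrable_mult_right integrable_norm_mult sq_int_h1_grad)
  show i: "integrable lborel (\<lambda>x. cdot (A x *v h1_grad v x) (h1_grad w x))"
  proof (rule Bochner_Integration.integrable_bound[OF ig])
    show "(\<lambda>x. cdot (A x *v h1_grad v x) (h1_grad w x)) \<in> borel_measurable lborel"
      using measurable_cdot[OF measurable_matrix_vector[OF A measurable_h1_grad[of v]] measurable_h1_grad[of w]] by simp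
    show "AE x in lborel. norm (cdot (A x *v h1_grad v x) (h1_grad w x))
        \<le> norm (\<bar>\<Lambda>\<bar> * (norm (h1_grad v x) * norm (h1_grad w x)))"
      using le by (auto simp: abs_mult)
  qed
  have "norm (LINT x|lborel. cdot (A x *v h1_grad v x) (h1_grad w x))
      \<le> (LINT x|lborel. \<bar>\<Lambda>\<bar> * (norm (h1_grad v x) * norm (h1_grad w x)))"
    by (rule Bochner_Integration.integral_norm_bound_integral[OF i ig le])
  also have "\<dots> \<le> \<bar>\<Lambda>\<bar> * (l2norm (h1_grad v) * l2norm (h1_grad w))"
    using integral_norm_mult_le[OF sq_int_h1_grad[of v] sq_int_h1_grad[of w]]
    by (simp add: mult_left_mono l2norm_def)
  also have "\<dots> \<le> \<bar>\<Lambda>\<bar> * (norm v * norm w)"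
    by (intro mult_left_mono mult_mono l2norm_h1_le l2norm_nonneg) auto
  finally show "norm (LINT x|lborel. cdot (A x *v h1_grad v x) (h1_grad w x)) \<le> \<bar>\<Lambda>\<bar> * norm v * norm w"
    by (simp add: mult.assoc)
qed

lemma bounded_coeffE:
  assumes "bounded_coeff A"
  obtains \<Lambda> where "A \<in> borel_measurable borel" "\<And>x \<xi>. norm (A x *v \<xi>) \<le> \<Lambda> * norm \<xi>"
  using assms unfolding bounded_coeff_def by blast

lemma norm_div_grad_le:
  assumes A: "A \<in> borel_measurable borel" and bd: "\<And>x \<xi>. norm (A x *v \<xi>) \<le> \<Lambda> * norm \<xi>"
  shows "norm (div_grad A v) \<le> \<bar>\<Lambda>\<bar> * norm v"
proof (rule norm_hm1_leI)
  show "norm (hm1_apply (div_grad A v) w) \<le> \<bar>\<Lambda>\<bar> * norm v * norm w" for w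
    using norm_div_grad_form_le[OF A bd] by (simp add: hm1_apply_div_grad[OF A bd])
qed simp

lemma bounded_linear_div_grad:
  assumes "bounded_coeff (A :: real^'d::finite \<Rightarrow> _)"
  shows "bounded_linear (div_grad A)"
proof -
  from assms obtain \<Lambda> where A: "A \<in> borel_measurable borel" and bd: "\<And>x \<xi>. norm (A x *v \<xi>) \<le> \<Lambda> * norm \<xi>"
    by (rule bounded_coeffE) blast
  note int = integrable_div_grad_form[OF A bd]
  show ?thesis
  proof (rule bounded_linear_intro)
    show "div_grad A (v + w) = div_grad A v + div_grad A w" for v w :: "'d h1"
    proof (rule hm1_eqI)
      fix z
      have "(LINT x|lborel. cdot (A x *v h1_grad (v + w) x) (h1_grad z x))
        = (LINT x|lborel. cdot (A x *v h1_grad v x) (h1_grad z x) + cdot (A x *v h1_grad w x) (h1_grad z x))"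
      proof (rule integral_cong_AE)
        show "AE x in lborel. cdot (A x *v h1_grad (v + w) x) (h1_grad z x)
            = cdot (A x *v h1_grad v x) (h1_grad z x) + cdot (A x *v h1_grad w x) (h1_grad z x)"
          using h1_grad_add[of v w] by eventually_elim (simp add: matrix_vector_right_distrib cdot_linear)
      qed (use int in auto)
      then show "hm1_apply (div_grad A (v + w)) z = hm1_apply (div_grad A v + div_grad A w) z"
        by (simp add: hm1_apply_ops hm1_apply_div_grad'[OF assms] int)
    qed
    show "div_grad A (r *\<^sub>R v) = r *\<^sub>R div_grad A v" for r and v :: "'d h1"
    proof (rule hm1_eqI)
      fix z
      have scale: "M *v (r *\<^sub>R \<xi>) = r *\<^sub>R (M *v \<xi>)" for M :: "complex^'d^'d" and \<xi>
        by (simp add: matrix_vector_mult_def vec_eq_iff scaleR_sum_right)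
      have "(LINT x|lborel. cdot (A x *v h1_grad (r *\<^sub>R v) x) (h1_grad z x))
        = (LINT x|lborel. r *\<^sub>R cdot (A x *v h1_grad v x) (h1_grad z x))"
      proof (rule integral_cong_AE)
        show "AE x in lborel. cdot (A x *v h1_grad (r *\<^sub>R v) x) (h1_grad z x)
            = r *\<^sub>R cdot (A x *v h1_grad v x) (h1_grad z x)"
          using h1_grad_scaleR[of r v] by eventually_elim (simp add: scale cdot_linear)
      qed (use int in auto)
      then show "hm1_apply (div_grad A (r *\<^sub>R v)) z = hm1_apply (r *\<^sub>R div_grad A v) z"
        by (simp add: hm1_apply_ops hm1_apply_div_grad'[OF assms])
    qed
    show "norm (div_grad A v) \<le> norm v * \<bar>\<Lambda>\<bar>" for v
      using norm_div_grad_le[OF A bd] by (simp add: mult.commute)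
  qed
qed

lemma bounded_coeff_combine:
  assumes "bounded_coeff A" "bounded_coeff B"
  shows "bounded_coeff (\<lambda>x. a *\<^sub>R A x + b *\<^sub>R B x)"
proof -
  from assms(1) obtain \<Lambda> where A: "A \<in> borel_measurable borel" and bd: "\<And>x \<xi>. norm (A x *v \<xi>) \<le> \<Lambda> * norm \<xi>"
    by (rule bounded_coeffE) blast
  from assms(2) obtain M where B: "B \<in> borel_measurable borel" and bd': "\<And>x \<xi>. norm (B x *v \<xi>) \<le> M * norm \<xi>"
    by (rule bounded_coeffE) blast
  have mult: "(a *\<^sub>R P + b *\<^sub>R Q) *v \<xi> = a *\<^sub>R (P *v \<xi>) + b *\<^sub>R (Q *v \<xi>)" for P Q :: "complex^'a^'a" and \<xi>
    by (simp add: matrix_vector_mult_def vec_eq_iff scaleR_sum_right sum.distrib distrib_right)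
  have "norm ((a *\<^sub>R A x + b *\<^sub>R B x) *v \<xi>) \<le> (\<bar>a\<bar> * \<Lambda> + \<bar>b\<bar> * M) * norm \<xi>" for x \<xi>
    unfolding mult using mult_left_mono[OF bd[of x \<xi>], of "\<bar>a\<bar>"] mult_left_mono[OF bd'[of x \<xi>], of "\<bar>b\<bar>"]
    by (intro order_trans[OF norm_triangle_ineq]) (simp add: algebra_simps)
  then show ?thesis unfolding bounded_coeff_def using A B by auto
qed

lemma div_grad_combine:
  assumes "bounded_coeff A" "bounded_coeff (B :: real^'d::finite \<Rightarrow> _)"
  shows "div_grad (\<lambda>x. a *\<^sub>R A x + b *\<^sub>R B x) v = a *\<^sub>R div_grad A v + b *\<^sub>R div_grad B v"
proof (rule hm1_eqI)
  fix w
  have mult: "(a *\<^sub>R P + b *\<^sub>R Q) *v \<xi> = a *\<^sub>R (P *v \<xi>) + b *\<^sub>R (Q *v \<xi>)" for P Q :: "complex^'d^'d" and \<xi>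
    by (simp add: matrix_vector_mult_def vec_eq_iff scaleR_sum_right sum.distrib distrib_right)
  have "integrable lborel (\<lambda>x. cdot (A x *v h1_grad v x) (h1_grad w x))"
    "integrable lborel (\<lambda>x. cdot (B x *v h1_grad v x) (h1_grad w x))"
    by (rule bounded_coeffE[OF assms(1)], rule integrable_div_grad_form, assumption, blast)
      (rule bounded_coeffE[OF assms(2)], rule integrable_div_grad_form, assumption, blast)
  then show "hm1_apply (div_grad (\<lambda>x. a *\<^sub>R A x + b *\<^sub>R B x) v) w = hm1_apply (a *\<^sub>R div_grad A v + b *\<^sub>R div_grad B v) w"
    by (simp add: hm1_apply_ops hm1_apply_div_grad' assms bounded_coeff_combine mult cdot_linear)
qed

section \<open>The Riesz map\<close>

definition riesz :: "'d::finite hm1 \<Rightarrow> 'd h1" where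
  "riesz F = (SOME z. \<forall>w. pairing F w = z \<bullet> w)"

lemma inner_riesz: "riesz F \<bullet> w = pairing F w"
proof -
  have "bounded_linear (pairing F)" by (rule pairing.bounded_linear_right)
  then have "\<exists>z. \<forall>w. pairing F w = z \<bullet> w" using riesz_representation_real by metis
  then have "\<forall>w. pairing F w = riesz F \<bullet> w" unfolding riesz_def by (rule someI_ex)
  then show ?thesis by simp
qed

lemma bounded_linear_riesz: "bounded_linear riesz"
proof (rule bounded_linear_intro[where K = 1])
  have ext: "v = w" if "\<And>z. v \<bullet> z = w \<bullet> z" for v w :: "'a h1"
    using that[of "v - w"] by (metis inner_diff_left eq_iff_diff_eq_0 inner_eq_zero_iff)
  show "riesz (F + G) = riesz F + riesz G" for F G :: "'a hm1"
    by (rule ext) (simp add: inner_add_left inner_riesz pairing.add_left)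
  show "riesz (r *\<^sub>R F) = r *\<^sub>R riesz F" for r and F :: "'a hm1"
    by (rule ext) (simp add: inner_riesz pairing.scaleR_left)
  show "norm (riesz F) \<le> norm F * 1" for F :: "'a hm1"
  proof -
    have "norm (riesz F) * norm (riesz F) \<le> norm F * norm (riesz F)"
      using abs_pairing_le[of F "riesz F"] inner_riesz[of F "riesz F"] by (simp add: dot_square_norm power2_eq_square)
    then show ?thesis by (cases "norm (riesz F) = 0") auto
  qed
qed

interpretation h1_embedding: positive_contraction "\<lambda>v :: 'd::finite h1. riesz (h1_to_hm1 v)"
proof (rule positive_contraction.intro)
  show "bounded_linear (\<lambda>v :: 'd h1. riesz (h1_to_hm1 v))"
    by (rule bounded_linear_compose[OF bounded_linear_riesz bounded_linear_h1_to_hm1])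
  fix v w :: "'d h1"
  show "riesz (h1_to_hm1 v) \<bullet> w = v \<bullet> riesz (h1_to_hm1 w)"
    by (simp add: inner_commute[of v] inner_riesz pairing_h1_to_hm1_sym[of v w])
  show "0 \<le> riesz (h1_to_hm1 v) \<bullet> v" by (simp add: inner_riesz pairing_h1_to_hm1_self)
  have "\<bar>pairing (h1_to_hm1 v) v\<bar> \<le> norm v * norm v"
    using abs_pairing_le[of "h1_to_hm1 v" v] mult_right_mono[OF norm_h1_to_hm1_le[of v] norm_ge_zero[of v]] by linarith
  then show "riesz (h1_to_hm1 v) \<bullet> v \<le> v \<bullet> v" by (simp add: inner_riesz dot_square_norm power2_eq_square)
  assume "riesz (h1_to_hm1 v) = 0"
  then have "pairing (h1_to_hm1 v) v = 0" by (metis inner_riesz inner_zero_left)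
  then show "v = 0" by (rule pairing_h1_to_hm1_self_eq_zero)
qed

section \<open>Modulated waves\<close>

definition cutoff :: "real^'d::finite \<Rightarrow> complex" where
  "cutoff x = of_real (flat 1 (1 - x \<bullet> x))"

definition wave_fun :: "real \<Rightarrow> 'd \<Rightarrow> real^'d::finite \<Rightarrow> complex" where
  "wave_fun N j x = cutoff x * cis (N * x $ j)"

lemma smooth_alg_cutoff: "smooth_alg cutoff"
  using smooth_alg.bump[of 1 1 1 0] by (simp add: cutoff_def[abs_def])

definition unit_supported :: "(real^'d::finite \<Rightarrow> complex) \<Rightarrow> bool" where
  "unit_supported f \<longleftrightarrow> (\<forall>x. norm x > 1 \<longrightarrow> f x = 0)"

lemma unit_supported_cutoff: "unit_supported cutoff"
  unfolding unit_supported_def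
proof (intro allI impI)
  fix x :: "real^'a" assume "norm x > 1"
  then have "1 < x \<bullet> x" using power_strict_mono[of 1 "norm x" 2] by (simp add: power2_norm_eq_inner)
  then show "cutoff x = 0" by (simp add: cutoff_def flat_one)
qed

lemma test_function_modulated:
  assumes "smooth_alg f" "unit_supported f"
  shows "test_function (\<lambda>x. f x * cis (N * x $ j))"
  by (rule test_function_smooth_alg[of _ 1])
    (use assms in \<open>auto intro!: smooth_alg.mult smooth_alg.wave simp: unit_supported_def\<close>)

lemma partial_deriv_modulated:
  assumes "smooth_alg f"
  shows "partial_deriv i (\<lambda>x. f x * cis (N * x $ j)) x
    = partial_deriv i f x * cis (N * x $ j) + (if i = j then \<i> * of_real N * (f x * cis (N * x $ j)) else 0)"
proof -
  have d: "((\<lambda>x. cis (N * x $ j)) has_derivative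
      (\<lambda>h. \<Sum>k\<in>UNIV. of_real (h $ k) * (if k = j then \<i> * of_real N * cis (N * x $ j) else 0))) (at x)"
    by (rule has_derivative_cis_coord)
  have "partial_deriv i (\<lambda>x. f x * cis (N * x $ j)) x
     = partial_deriv i f x * cis (N * x $ j) + f x * partial_deriv i (\<lambda>x. cis (N * x $ j)) x"
    using d by (intro partial_deriv_mult smooth_alg_differentiable[OF assms]) (auto simp: differentiable_def)
  also have "partial_deriv i (\<lambda>x. cis (N * x $ j)) x = (if i = j then \<i> * of_real N * cis (N * x $ j) else 0)"
    by (rule has_derivative_of_partials[OF d])
  finally show ?thesis by (simp add: mult_ac)
qed

lemma smooth_alg_pderivs: "smooth_alg (partial_deriv i cutoff)" "smooth_alg (partial_deriv i (partial_deriv k cutoff))"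
  by (intro smooth_alg_partial_deriv smooth_alg_cutoff)+

lemma unit_supported_partial_deriv: "unit_supported f \<Longrightarrow> unit_supported (partial_deriv i f)"
  using partial_deriv_outside_ball[of 1 f] by (auto simp: unit_supported_def)

lemma sq_int_modulated:
  assumes "smooth_alg f" "unit_supported f"
  shows "sq_int f" "sq_int (\<lambda>x. f x * cis (N * x $ j))" "l2norm (\<lambda>x. f x * cis (N * x $ j)) = l2norm f"
proof -
  show "sq_int (\<lambda>x. f x * cis (N * x $ j))" using test_function_modulated[OF assms] sq_int_test_function(1) by blast
  show "sq_int f" using test_function_smooth_alg[of f 1] assms sq_int_test_function(1) by (auto simp: unit_supported_def)
  show "l2norm (\<lambda>x. f x * cis (N * x $ j)) = l2norm f" by (simp add: l2norm_def norm_mult)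
qed

text \<open>One constant for all frequencies: it dominates the \<open>L\<^sup>2\<close> norms of the cutoff and of its first and
  pure second derivatives.\<close>

definition cutoff_bound :: "'d::finite itself \<Rightarrow> real" where
  "cutoff_bound _ = l2norm (cutoff :: real^'d \<Rightarrow> complex)
     + (\<Sum>i\<in>UNIV. l2norm (partial_deriv i (cutoff :: real^'d \<Rightarrow> complex)))
     + (\<Sum>i\<in>UNIV. l2norm (partial_deriv i (partial_deriv i (cutoff :: real^'d \<Rightarrow> complex))))"

lemma cutoff_bound:
  fixes i :: "'d::finite"
  shows "l2norm (cutoff :: real^'d \<Rightarrow> complex) \<le> cutoff_bound TYPE('d)"
    "l2norm (partial_deriv i cutoff) \<le> cutoff_bound TYPE('d)"
    "l2norm (partial_deriv i (partial_deriv i cutoff)) \<le> cutoff_bound TYPE('d)"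
    "0 \<le> cutoff_bound TYPE('d)"
proof -
  have 1: "l2norm (partial_deriv i (cutoff :: real^'d \<Rightarrow> complex)) \<le> (\<Sum>i\<in>UNIV. l2norm (partial_deriv i (cutoff :: real^'d \<Rightarrow> complex)))"
    by (rule member_le_sum) (auto simp: l2norm_nonneg)
  have 2: "l2norm (partial_deriv i (partial_deriv i (cutoff :: real^'d \<Rightarrow> complex)))
      \<le> (\<Sum>i\<in>UNIV. l2norm (partial_deriv i (partial_deriv i (cutoff :: real^'d \<Rightarrow> complex))))"
    by (rule member_le_sum[where f = "\<lambda>i. l2norm (partial_deriv i (partial_deriv i (cutoff :: real^'d \<Rightarrow> complex)))"])
       (auto simp: l2norm_nonneg)
  have 3: "0 \<le> l2norm (cutoff :: real^'d \<Rightarrow> complex)" "0 \<le> (\<Sum>i\<in>UNIV. l2norm (partial_deriv i (cutoff :: real^'d \<Rightarrow> complex)))"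
    "0 \<le> (\<Sum>i\<in>UNIV. l2norm (partial_deriv i (partial_deriv i (cutoff :: real^'d \<Rightarrow> complex))))"
    by (auto simp: l2norm_nonneg intro!: sum_nonneg)
  show "l2norm (cutoff :: real^'d \<Rightarrow> complex) \<le> cutoff_bound TYPE('d)"
    "l2norm (partial_deriv i cutoff) \<le> cutoff_bound TYPE('d)"
    "l2norm (partial_deriv i (partial_deriv i cutoff)) \<le> cutoff_bound TYPE('d)"
    "0 \<le> cutoff_bound TYPE('d)"
    unfolding cutoff_bound_def using 1 2 3 by linarith+
qed

definition wave :: "real \<Rightarrow> 'd \<Rightarrow> 'd::finite h1" where
  "wave N j = (SOME v. (AE x in lborel. h1_val v x = wave_fun N j x) \<and>
     (AE x in lborel. h1_grad v x = (\<chi> i. partial_deriv i (wave_fun N j) x)))"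

lemma wave_fun:
  fixes j :: "'d::finite"
  shows "test_function (wave_fun N j)" "sq_int (wave_fun N j)" "l2norm (wave_fun N j) = l2norm (cutoff :: real^'d \<Rightarrow> complex)"
  unfolding wave_fun_def[abs_def]
  by (rule test_function_modulated sq_int_modulated; rule smooth_alg_cutoff unit_supported_cutoff)+

lemma partial_deriv_wave_fun:
  "partial_deriv i (wave_fun N j) x = partial_deriv i cutoff x * cis (N * x $ j) + (if i = j then \<i> * of_real N * wave_fun N j x else 0)"
  unfolding wave_fun_def[abs_def] by (rule partial_deriv_modulated[OF smooth_alg_cutoff])

lemma wave_AE:
  shows h1_val_wave: "AE x in lborel. h1_val (wave N j) x = wave_fun N j x"
    and h1_grad_wave: "AE x in lborel. h1_grad (wave N j) x = (\<chi> i. partial_deriv i (wave_fun N j) x)"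
proof -
  have "sq_int (\<lambda>x. \<chi> i. partial_deriv i (wave_fun N j) x)"
  proof (rule sq_int_compact_support)
    show "continuous_on UNIV (\<lambda>x. \<chi> i. partial_deriv i (wave_fun N j) x)"
      by (intro continuous_on_vec_lambda test_function_continuous wave_fun)
    show "(\<chi> i. partial_deriv i (wave_fun N j) x) = 0" if x: "x \<notin> cball 0 1" for x
    proof -
      have v: "unit_supported f \<Longrightarrow> f x = 0" for f using x by (auto simp: unit_supported_def)
      have "cutoff x = 0" "partial_deriv i cutoff x = 0" for i
        by (intro v unit_supported_partial_deriv unit_supported_cutoff)+
      then show ?thesis by (simp add: vec_eq_iff partial_deriv_wave_fun wave_fun_def)
    qed
  qed simp
  from h1_exists[OF wave_fun(2) this weak_gradient_test_function[OF wave_fun(1)]]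
  have "\<exists>v. (AE x in lborel. h1_val v x = wave_fun N j x) \<and>
     (AE x in lborel. h1_grad v x = (\<chi> i. partial_deriv i (wave_fun N j) x))" .
  from someI_ex[OF this] show "AE x in lborel. h1_val (wave N j) x = wave_fun N j x"
    "AE x in lborel. h1_grad (wave N j) x = (\<chi> i. partial_deriv i (wave_fun N j) x)"
    unfolding wave_def by auto
qed

lemma pairing_integral_bound:
  assumes f: "smooth_alg f" "unit_supported f"
  shows "norm (LINT x|lborel. f x * cis (N * x $ j) * cnj (h1_val v x)) \<le> l2norm f * norm v"
    and "norm (LINT x|lborel. f x * cis (N * x $ j) * cnj (h1_grad v x $ i)) \<le> l2norm f * norm v"
    and "integrable lborel (\<lambda>x. f x * cis (N * x $ j) * cnj (h1_val v x))"
proof -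
  note s = sq_int_modulated(1)[OF f] sq_int_modulated(2,3)[OF f, of N j]
  show "norm (LINT x|lborel. f x * cis (N * x $ j) * cnj (h1_val v x)) \<le> l2norm f * norm v"
    using integral_cnj_bound(2)[OF s(2) sq_int_h1_val[of v]] mult_left_mono[OF l2norm_h1_le(1)[of v] l2norm_nonneg[of f]]
    unfolding s(3) by linarith
  show "norm (LINT x|lborel. f x * cis (N * x $ j) * cnj (h1_grad v x $ i)) \<le> l2norm f * norm v"
    using integral_cnj_bound(2)[OF s(2) l2norm_h1_le(4)[of v i]] mult_left_mono[OF l2norm_h1_le(3)[of v i] l2norm_nonneg[of f]]
    unfolding s(3) by linarith
  show "integrable lborel (\<lambda>x. f x * cis (N * x $ j) * cnj (h1_val v x))"
    by (rule integral_cnj_bound(1)[OF s(2) sq_int_h1_val])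
qed

text \<open>Integrating by parts once leaves \<open>\<i> N\<close> times an integral in which the cutoff is
  differentiated. Since \<open>\<i> N\<close> times the exponential is again a derivative, a second integration by parts
  absorbs the factor \<open>N\<close>. This gain keeps the error bounded in the antidual of \<open>H\<^sup>1\<close>.\<close>

lemma wave_derivative_defect:
  fixes j :: "'d::finite"
  shows "norm (of_real (N\<^sup>2) * (LINT x|lborel. wave_fun N j x * cnj (h1_val v x))
      - \<i> * of_real N * (LINT x|lborel. wave_fun N j x * cnj (h1_grad v x $ j)))
    \<le> 2 * cutoff_bound TYPE('d) * norm v"
proof -
  let ?c1 = "partial_deriv j (cutoff :: real^'d \<Rightarrow> complex)"
  let ?c2 = "partial_deriv j ?c1"
  let ?W = "LINT x|lborel. wave_fun N j x * cnj (h1_val v x)"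
  let ?E = "\<lambda>x. cis (N * x $ j)"
  have sm: "smooth_alg cutoff" "smooth_alg ?c1" "smooth_alg ?c2"
    by (rule smooth_alg_cutoff smooth_alg_pderivs)+
  have out: "unit_supported ?c1" "unit_supported ?c2"
    by (intro unit_supported_partial_deriv unit_supported_cutoff)+
  note b0 = pairing_integral_bound[OF sm(1) unit_supported_cutoff, of N j v]
  note b1 = pairing_integral_bound[OF sm(2) out(1), of N j v]
  note b2 = pairing_integral_bound[OF sm(3) out(2), of N j v]
  have "(LINT x|lborel. wave_fun N j x * cnj (h1_grad v x $ j))
     = - (LINT x|lborel. ?c1 x * ?E x * cnj (h1_val v x) + \<i> * of_real N * (wave_fun N j x * cnj (h1_val v x)))"
    by (subst h1_integration_by_parts[OF wave_fun(1)]) (simp add: partial_deriv_wave_fun distrib_right mult.assoc)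
  also have "\<dots> = - ((LINT x|lborel. ?c1 x * ?E x * cnj (h1_val v x)) + \<i> * of_real N * ?W)"
    using Bochner_Integration.integral_add[OF b1(3) integrable_mult_right[OF b0(3), of "\<i> * of_real N"]]
    by (simp add: wave_fun_def mult.assoc)
  finally have 1: "(LINT x|lborel. wave_fun N j x * cnj (h1_grad v x $ j))
     = - ((LINT x|lborel. ?c1 x * ?E x * cnj (h1_val v x)) + \<i> * of_real N * ?W)" .
  have "(LINT x|lborel. ?c1 x * ?E x * cnj (h1_grad v x $ j))
     = - (LINT x|lborel. ?c2 x * ?E x * cnj (h1_val v x) + \<i> * of_real N * (?c1 x * ?E x * cnj (h1_val v x)))"
    by (subst h1_integration_by_parts[OF test_function_modulated[OF sm(2) out(1)]])
       (simp_all add: partial_deriv_modulated[OF sm(2)] distrib_right mult.assoc)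
  also have "\<dots> = - ((LINT x|lborel. ?c2 x * ?E x * cnj (h1_val v x)) + \<i> * of_real N * (LINT x|lborel. ?c1 x * ?E x * cnj (h1_val v x)))"
    using Bochner_Integration.integral_add[OF b2(3) integrable_mult_right[OF b1(3), of "\<i> * of_real N"]]
    by (simp add: mult.assoc)
  finally have eq2: "(LINT x|lborel. ?c1 x * ?E x * cnj (h1_grad v x $ j))
     = - ((LINT x|lborel. ?c2 x * ?E x * cnj (h1_val v x)) + \<i> * of_real N * (LINT x|lborel. ?c1 x * ?E x * cnj (h1_val v x)))" .
  have isolate: "p = - (q + r) \<Longrightarrow> r = - p - q" for p q r :: complex by simp
  have cancel: "of_real (N\<^sup>2) * w - \<i> * of_real N * (- (c + \<i> * of_real N * w)) = \<i> * of_real N * c" for w c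
    by (simp add: algebra_simps power2_eq_square)
  from eq2 have 2: "\<i> * of_real N * (LINT x|lborel. ?c1 x * ?E x * cnj (h1_val v x))
     = - (LINT x|lborel. ?c1 x * ?E x * cnj (h1_grad v x $ j)) - (LINT x|lborel. ?c2 x * ?E x * cnj (h1_val v x))"
    by (rule isolate)
  have "of_real (N\<^sup>2) * ?W - \<i> * of_real N * (LINT x|lborel. wave_fun N j x * cnj (h1_grad v x $ j))
     = \<i> * of_real N * (LINT x|lborel. ?c1 x * ?E x * cnj (h1_val v x))"
    unfolding 1 by (rule cancel)
  also have "norm \<dots> \<le> l2norm ?c1 * norm v + l2norm ?c2 * norm v"
    unfolding 2 using b1(2)[of j] b2(1) by (intro order_trans[OF norm_triangle_ineq4]) simp
  also have "\<dots> \<le> cutoff_bound TYPE('d) * norm v + cutoff_bound TYPE('d) * norm v"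
    by (intro add_mono mult_right_mono cutoff_bound) auto
  finally show ?thesis by (simp only: mult_2 distrib_right)
qed

lemma hm1_apply_wave:
  "hm1_apply (h1_to_hm1 (wave N j)) v = (LINT x|lborel. wave_fun N j x * cnj (h1_val v x))"
  unfolding hm1_apply_h1_to_hm1
proof (rule integral_cong_AE)
  show "AE x in lborel. h1_val (wave N j) x * cnj (h1_val v x) = wave_fun N j x * cnj (h1_val v x)"
    using h1_val_wave[of N j] by eventually_elim simp
  show "(\<lambda>x. wave_fun N j x * cnj (h1_val v x)) \<in> borel_measurable lborel"
    using borel_measurable_integrable[OF integral_cnj_bound(1)[OF wave_fun(2) sq_int_h1_val]] by simp
qed simp

lemma norm_h1_to_hm1_wave: "norm (h1_to_hm1 (wave N (j :: 'd::finite))) \<le> cutoff_bound TYPE('d)"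
proof (rule norm_hm1_leI)
  show "norm (hm1_apply (h1_to_hm1 (wave N j)) v) \<le> cutoff_bound TYPE('d) * norm v" for v
    unfolding hm1_apply_wave wave_fun_def
    using pairing_integral_bound(1)[OF smooth_alg_cutoff unit_supported_cutoff, of N j v]
      mult_right_mono[OF cutoff_bound(1)[where 'd = 'd] norm_ge_zero[of v]] by linarith
qed (rule cutoff_bound)

section \<open>The Laplacian and the coupling matrices\<close>

lemma bounded_coeff_mat_1: "bounded_coeff (\<lambda>_ :: real^'d::finite. mat 1 :: complex^'d^'d)"
  unfolding bounded_coeff_def by (auto intro!: exI[of _ 1])

text \<open>The phase of the upper entry turns a wave of frequency \<open>M\<close> in direction \<open>l\<close> into one of
  frequency \<open>N\<close> in direction \<open>j\<close>, and that of the lower entry reverses this. Being skew-Hermitian, the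
  matrix drops out of the lower ellipticity bound.\<close>

definition coupling :: "real \<Rightarrow> 'd \<Rightarrow> real \<Rightarrow> 'd \<Rightarrow> real^'d::finite \<Rightarrow> complex^'d^'d" where
  "coupling N j M l x = (\<chi> a b. if a = j \<and> b = l then cis (N * x $ j - M * x $ l)
     else if a = l \<and> b = j then - cis (M * x $ l - N * x $ j) else 0)"

lemma coupling_vector:
  assumes "j \<noteq> l"
  shows "coupling N j M l x *v \<xi> = (\<chi> a. if a = j then cis (N * x $ j - M * x $ l) * \<xi> $ l
     else if a = l then - cis (M * x $ l - N * x $ j) * \<xi> $ j else 0)"
proof -
  have "(\<Sum>b\<in>UNIV. coupling N j M l x $ a $ b * \<xi> $ b) = (if a = j then cis (N * x $ j - M * x $ l) * \<xi> $ l
     else if a = l then - cis (M * x $ l - N * x $ j) * \<xi> $ j else 0)" for a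
  proof -
    have "(\<Sum>b\<in>UNIV. coupling N j M l x $ a $ b * \<xi> $ b)
       = (\<Sum>b\<in>UNIV. (if b = l then (if a = j then cis (N * x $ j - M * x $ l) * \<xi> $ l else 0) else 0)
          + (if b = j then (if a = l then - cis (M * x $ l - N * x $ j) * \<xi> $ j else 0) else 0))"
      using assms by (intro sum.cong) (auto simp: coupling_def)
    then show ?thesis using assms by (simp add: sum.distrib)
  qed
  then show ?thesis by (simp add: matrix_vector_mult_def)
qed

lemma cdot_coupling:
  assumes "j \<noteq> l"
  shows "cdot (coupling N j M l x *v \<xi>) \<eta>
    = cis (N * x $ j - M * x $ l) * \<xi> $ l * cnj (\<eta> $ j) - cis (M * x $ l - N * x $ j) * \<xi> $ j * cnj (\<eta> $ l)"
proof -
  have "cdot (coupling N j M l x *v \<xi>) \<eta> = (\<Sum>a\<in>UNIV. (if a = j then cis (N * x $ j - M * x $ l) * \<xi> $ l * cnj (\<eta> $ j) else 0)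
    + (if a = l then - cis (M * x $ l - N * x $ j) * \<xi> $ j * cnj (\<eta> $ l) else 0))"
    unfolding cdot_def coupling_vector[OF assms] using assms by (intro sum.cong) auto
  then show ?thesis by (simp add: sum.distrib)
qed

lemma norm_coupling_le:
  assumes "j \<noteq> l"
  shows "norm (coupling N j M l x *v \<xi>) \<le> norm \<xi>"
proof -
  have "(norm (coupling N j M l x *v \<xi>))\<^sup>2 = (\<Sum>a\<in>UNIV. (norm ((coupling N j M l x *v \<xi>) $ a))\<^sup>2)"
    by (simp add: norm_vec_def L2_set_def sum_nonneg)
  also have "\<dots> = (\<Sum>a\<in>UNIV. (if a = j then (norm (\<xi> $ l))\<^sup>2 else 0) + (if a = l then (norm (\<xi> $ j))\<^sup>2 else 0))"
    unfolding coupling_vector[OF assms] using assms by (intro sum.cong) (auto simp: norm_mult)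
  also have "\<dots> = (\<Sum>a\<in>{j, l}. (norm (\<xi> $ a))\<^sup>2)" using assms by (simp add: sum.distrib)
  also have "\<dots> \<le> (\<Sum>a\<in>UNIV. (norm (\<xi> $ a))\<^sup>2)" by (rule sum_mono2) auto
  also have "\<dots> = (norm \<xi>)\<^sup>2" by (simp add: norm_vec_def L2_set_def sum_nonneg)
  finally show ?thesis by (rule power2_le_imp_le) simp
qed

lemma Re_cdot_coupling_self:
  assumes "j \<noteq> l"
  shows "Re (cdot (coupling N j M l x *v \<xi>) \<xi>) = 0"
proof -
  have "cdot (coupling N j M l x *v \<xi>) \<xi> = - cnj (cdot (coupling N j M l x *v \<xi>) \<xi>)"
    unfolding cdot_coupling[OF assms] by (simp add: cis_cnj mult_ac)
  then have "Re (cdot (coupling N j M l x *v \<xi>) \<xi>) = - Re (cdot (coupling N j M l x *v \<xi>) \<xi>)"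
    by (metis complex_cnj_minus cnj.sel(1) uminus_complex.sel(1))
  then show ?thesis by simp
qed

lemma continuous_coupling:
  fixes j l :: "'d::finite"
  shows "continuous_on UNIV (\<lambda>x. coupling N j M l x)"
proof -
  have c: "continuous_on UNIV (\<lambda>x :: real^'d. cis (A * x $ i - B * x $ k))" for A B :: real and i k :: 'd
    unfolding cis_conv_exp by (intro continuous_intros)
  have m: "continuous_on UNIV (\<lambda>x. if P then f x else if Q then g x else 0)"
    if "continuous_on UNIV f" "continuous_on UNIV g" for P Q and f g :: "real^'d \<Rightarrow> complex"
    using that by (cases P; cases Q) auto
  show ?thesis unfolding coupling_def
  proof (intro continuous_on_vec_lambda)
    fix a b
    show "continuous_on UNIV (\<lambda>x. if a = j \<and> b = l then cis (N * x $ j - M * x $ l)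
       else if a = l \<and> b = j then - cis (M * x $ l - N * x $ j) else 0)"
      by (rule m[OF c continuous_on_minus[OF c]])
  qed
qed

lemma bounded_coeff_coupling:
  assumes "j \<noteq> l"
  shows "bounded_coeff (coupling N j M l)"
  unfolding bounded_coeff_def
  using norm_coupling_le[OF assms] borel_measurable_continuous_onI[OF continuous_coupling]
  by (auto intro!: exI[of _ 1])

lemma pairing_laplace_sym: "pairing (div_grad (\<lambda>_. mat 1) v) w = pairing (div_grad (\<lambda>_. mat 1) w) v"
proof -
  have "(LINT x|lborel. cdot (h1_grad w x) (h1_grad v x)) = cnj (LINT x|lborel. cdot (h1_grad v x) (h1_grad w x))"
  proof -
    have "(LINT x|lborel. cnj (cdot (h1_grad v x) (h1_grad w x))) = cnj (LINT x|lborel. cdot (h1_grad v x) (h1_grad w x))"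
      by simp
    then show ?thesis by (simp only: cdot_cnj)
  qed
  then show ?thesis by (simp add: pairing_def hm1_apply_div_grad'[OF bounded_coeff_mat_1])
qed

lemma pairing_laplace_self: "pairing (div_grad (\<lambda>_. mat 1) v) v = - (LINT x|lborel. (norm (h1_grad v x))\<^sup>2)"
  by (simp add: pairing_def hm1_apply_div_grad'[OF bounded_coeff_mat_1] cdot_self del: of_real_power)

lemma pairing_coupling_antisym:
  assumes "j \<noteq> l"
  shows "pairing (div_grad (coupling N j M l) v) w = - pairing (div_grad (coupling N j M l) w) v"
proof -
  have "cdot (coupling N j M l x *v \<xi>) \<eta> = - cnj (cdot (coupling N j M l x *v \<eta>) \<xi>)" for x \<xi> \<eta>
    unfolding cdot_coupling[OF assms] by (simp add: cis_cnj mult_ac)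
  then have "(LINT x|lborel. cdot (coupling N j M l x *v h1_grad v x) (h1_grad w x))
     = (LINT x|lborel. - cnj (cdot (coupling N j M l x *v h1_grad w x) (h1_grad v x)))"
    by (intro Bochner_Integration.integral_cong refl)
  then have "(LINT x|lborel. cdot (coupling N j M l x *v h1_grad v x) (h1_grad w x))
     = - cnj (LINT x|lborel. cdot (coupling N j M l x *v h1_grad w x) (h1_grad v x))" by simp
  then show ?thesis by (simp add: pairing_def hm1_apply_div_grad'[OF bounded_coeff_coupling[OF assms]])
qed

section \<open>The action of the operators on waves\<close>

lemma h1_grad_wave_nth:
  "AE x in lborel. \<forall>i. h1_grad (wave N j) x $ i
     = partial_deriv i cutoff x * cis (N * x $ j) + (if i = j then \<i> * of_real N * wave_fun N j x else 0)"
  using h1_grad_wave[of N j] by eventually_elim (simp add: partial_deriv_wave_fun)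

lemma cutoff_deriv_pairing:
  fixes i k :: "'d::finite"
  shows "norm (LINT x|lborel. partial_deriv i cutoff x * cis (N * x $ j) * cnj (h1_grad v x $ k)) \<le> cutoff_bound TYPE('d) * norm v"
    and "integrable lborel (\<lambda>x. partial_deriv i cutoff x * cis (N * x $ j) * cnj (h1_grad v x $ k))"
    and "continuous_on UNIV c \<Longrightarrow> (\<And>x. norm (c x) = 1) \<Longrightarrow>
      norm (LINT x|lborel. partial_deriv i cutoff x * (c x) * cnj (h1_grad v x $ k)) \<le> cutoff_bound TYPE('d) * norm v"
    and "continuous_on UNIV c \<Longrightarrow> (\<And>x. norm (c x) = 1) \<Longrightarrow>
      integrable lborel (\<lambda>x. partial_deriv i cutoff x * (c x) * cnj (h1_grad v x $ k))"
    and "integrable lborel (\<lambda>x. wave_fun N j x * cnj (h1_grad v x $ k))"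
proof -
  have gen: "norm (LINT x|lborel. partial_deriv i cutoff x * (c x) * cnj (h1_grad v x $ k)) \<le> cutoff_bound TYPE('d) * norm v"
    "integrable lborel (\<lambda>x. partial_deriv i cutoff x * (c x) * cnj (h1_grad v x $ k))"
    if c: "continuous_on UNIV c" "\<And>x. norm (c x) = 1" for c
  proof -
    have p: "test_function (partial_deriv i (cutoff :: real^'d \<Rightarrow> complex))"
      using test_function_modulated[OF smooth_alg_pderivs(1) unit_supported_partial_deriv[OF unit_supported_cutoff], of i 0 undefined]
      by simp
    note [measurable] = borel_measurable_continuous_onI[OF c(1)] borel_measurable_continuous_onI[OF test_function_continuous(1)[OF p]]
    have s: "sq_int (\<lambda>x. partial_deriv i cutoff x * c x)"
      by (rule sq_int_bound[OF sq_int_test_function(1)[OF p], of _ 1]) (auto simp: norm_mult c)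
    have n: "l2norm (\<lambda>x. partial_deriv i cutoff x * c x) = l2norm (partial_deriv i cutoff)"
      by (simp add: l2norm_def norm_mult c)
    show "integrable lborel (\<lambda>x. partial_deriv i cutoff x * (c x) * cnj (h1_grad v x $ k))"
      by (rule integral_cnj_bound(1)[OF s l2norm_h1_le(4)])
    have "norm (LINT x|lborel. partial_deriv i cutoff x * (c x) * cnj (h1_grad v x $ k))
        \<le> l2norm (partial_deriv i cutoff) * l2norm (\<lambda>x. h1_grad v x $ k)"
      using integral_cnj_bound(2)[OF s l2norm_h1_le(4)[of v k]] unfolding n .
    also have "\<dots> \<le> cutoff_bound TYPE('d) * norm v"
      by (intro mult_mono cutoff_bound l2norm_h1_le l2norm_nonneg)
    finally show "norm (LINT x|lborel. partial_deriv i cutoff x * (c x) * cnj (h1_grad v x $ k)) \<le> cutoff_bound TYPE('d) * norm v" .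
  qed
  show "norm (LINT x|lborel. partial_deriv i cutoff x * (c x) * cnj (h1_grad v x $ k)) \<le> cutoff_bound TYPE('d) * norm v"
    "integrable lborel (\<lambda>x. partial_deriv i cutoff x * (c x) * cnj (h1_grad v x $ k))"
    if "continuous_on UNIV c" "\<And>x. norm (c x) = 1"
    using gen that by blast+
  have "continuous_on UNIV (\<lambda>x :: real^'d. cis (N * x $ j))"
    unfolding cis_conv_exp by (intro continuous_intros)
  from gen[OF this] show "norm (LINT x|lborel. partial_deriv i cutoff x * cis (N * x $ j) * cnj (h1_grad v x $ k)) \<le> cutoff_bound TYPE('d) * norm v"
    "integrable lborel (\<lambda>x. partial_deriv i cutoff x * cis (N * x $ j) * cnj (h1_grad v x $ k))" by simp_all
  show "integrable lborel (\<lambda>x. wave_fun N j x * cnj (h1_grad v x $ k))"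
    by (rule integral_cnj_bound(1)[OF wave_fun(2) l2norm_h1_le(4)])
qed

text \<open>Up to terms in which the cutoff is differentiated, a wave is an eigenfunction of the Laplacian with
  eigenvalue \<open>- N\<^sup>2\<close>.\<close>

lemma laplace_wave:
  fixes j :: "'d::finite"
  shows "norm (div_grad (\<lambda>_. mat 1) (wave N j) + N\<^sup>2 *\<^sub>R h1_to_hm1 (wave N j)) \<le> (2 + real CARD('d)) * cutoff_bound TYPE('d)"
proof (rule norm_hm1_leI)
  fix v
  let ?G = "\<lambda>k. LINT x|lborel. partial_deriv k cutoff x * cis (N * x $ j) * cnj (h1_grad v x $ k)"
  let ?V = "LINT x|lborel. wave_fun N j x * cnj (h1_grad v x $ j)"
  note int = cutoff_deriv_pairing(2)[of _ N j v] cutoff_deriv_pairing(5)[of N j v j]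
  have "(LINT x|lborel. cdot (mat 1 *v h1_grad (wave N j) x) (h1_grad v x))
      = (LINT x|lborel. (\<Sum>k\<in>UNIV. partial_deriv k cutoff x * cis (N * x $ j) * cnj (h1_grad v x $ k))
          + \<i> * of_real N * (wave_fun N j x * cnj (h1_grad v x $ j)))"
  proof (rule integral_cong_AE)
    have pick: "(\<Sum>k\<in>UNIV. (if k = j then \<i> * of_real N * wave_fun N j x else 0) * cnj (y k))
        = \<i> * of_real N * (wave_fun N j x * cnj (y j))" for x y
    proof -
      have "(\<Sum>k\<in>UNIV. (if k = j then \<i> * of_real N * wave_fun N j x else 0) * cnj (y k))
        = (\<Sum>k\<in>UNIV. if k = j then \<i> * of_real N * wave_fun N j x * cnj (y k) else 0)"
        by (rule sum.cong) auto
      then show ?thesis by simp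
    qed
    show "AE x in lborel. cdot (mat 1 *v h1_grad (wave N j) x) (h1_grad v x)
      = (\<Sum>k\<in>UNIV. partial_deriv k cutoff x * cis (N * x $ j) * cnj (h1_grad v x $ k))
          + \<i> * of_real N * (wave_fun N j x * cnj (h1_grad v x $ j))"
      using h1_grad_wave_nth[of N j] by eventually_elim (simp add: cdot_def distrib_right sum.distrib pick)
    show "(\<lambda>x. cdot (mat 1 *v h1_grad (wave N j) x) (h1_grad v x)) \<in> borel_measurable lborel"
      by (simp add: measurable_cdot)
    show "(\<lambda>x. (\<Sum>k\<in>UNIV. partial_deriv k cutoff x * cis (N * x $ j) * cnj (h1_grad v x $ k))
          + \<i> * of_real N * (wave_fun N j x * cnj (h1_grad v x $ j))) \<in> borel_measurable lborel"
      using int by (intro borel_measurable_integrable Bochner_Integration.integrable_add Bochner_Integration.integrable_sum integrable_mult_right)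
  qed
  also have "\<dots> = (\<Sum>k\<in>UNIV. ?G k) + \<i> * of_real N * ?V"
  proof -
    have "(LINT x|lborel. (\<Sum>k\<in>UNIV. partial_deriv k cutoff x * cis (N * x $ j) * cnj (h1_grad v x $ k)))
       = (\<Sum>k\<in>UNIV. ?G k)" using int by (intro Bochner_Integration.integral_sum) auto
    then show ?thesis
      using int by (subst Bochner_Integration.integral_add) (auto intro!: Bochner_Integration.integrable_sum)
  qed
  finally have "hm1_apply (div_grad (\<lambda>_. mat 1) (wave N j) + N\<^sup>2 *\<^sub>R h1_to_hm1 (wave N j)) v
    = (of_real (N\<^sup>2) * (LINT x|lborel. wave_fun N j x * cnj (h1_val v x)) - \<i> * of_real N * ?V) - (\<Sum>k\<in>UNIV. ?G k)"
    by (simp add: hm1_apply_ops hm1_apply_div_grad'[OF bounded_coeff_mat_1] hm1_apply_wave scaleR_conv_of_real)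
  also have "norm \<dots> \<le> 2 * cutoff_bound TYPE('d) * norm v + real CARD('d) * (cutoff_bound TYPE('d) * norm v)"
  proof (rule order_trans[OF norm_triangle_ineq4 add_mono[OF wave_derivative_defect]])
    show "norm (\<Sum>k\<in>UNIV. ?G k) \<le> real CARD('d) * (cutoff_bound TYPE('d) * norm v)"
      by (rule order_trans[OF sum_norm_bound[OF cutoff_deriv_pairing(1)]]) simp
  qed
  finally show "norm (hm1_apply (div_grad (\<lambda>_. mat 1) (wave N j) + N\<^sup>2 *\<^sub>R h1_to_hm1 (wave N j)) v)
    \<le> (2 + real CARD('d)) * cutoff_bound TYPE('d) * norm v" by (simp add: algebra_simps)
qed (simp add: cutoff_bound)

lemma continuous_phase: "continuous_on UNIV (\<lambda>x :: real^'d::finite. cis (A * x $ i - B * x $ k) * cis (D * x $ m))"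
  unfolding cis_conv_exp by (intro continuous_intros)

text \<open>The common part of the two estimates that follow: a derivative that falls on the cutoff contributes
  a bounded functional, and what remains is a multiple of the derivative pairing of a single wave.\<close>

lemma coupling_wave_form:
  assumes "j \<noteq> l" and c: "continuous_on UNIV c1" "continuous_on UNIV c2" "\<And>x. norm (c1 x) = 1" "\<And>x. norm (c2 x) = 1"
    and eq: "AE x in lborel. cdot (coupling N j M l x *v h1_grad w x) (h1_grad v x)
      = partial_deriv l cutoff x * c1 x * cnj (h1_grad v x $ j) - partial_deriv j cutoff x * c2 x * cnj (h1_grad v x $ l)
        + a * (wave_fun P b x * cnj (h1_grad v x $ b))"
  shows "norm (hm1_apply (div_grad (coupling N j M l) w) v + a * (LINT x|lborel. wave_fun P b x * cnj (h1_grad v x $ b)))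
     \<le> 2 * cutoff_bound TYPE('d::finite) * norm (v :: 'd h1)"
proof -
  let ?I1 = "LINT x|lborel. partial_deriv l cutoff x * c1 x * cnj (h1_grad v x $ j)"
  let ?I2 = "LINT x|lborel. partial_deriv j cutoff x * c2 x * cnj (h1_grad v x $ l)"
  note i1 = cutoff_deriv_pairing(4)[OF c(1,3), of l v j] and i2 = cutoff_deriv_pairing(4)[OF c(2,4), of j v l]
    and i3 = cutoff_deriv_pairing(5)[of P b v b]
  note i12 = Bochner_Integration.integrable_diff[OF i1 i2] and i3' = integrable_mult_right[OF i3, of a]
  have "(LINT x|lborel. cdot (coupling N j M l x *v h1_grad w x) (h1_grad v x))
     = (LINT x|lborel. partial_deriv l cutoff x * c1 x * cnj (h1_grad v x $ j) - partial_deriv j cutoff x * c2 x * cnj (h1_grad v x $ l)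
        + a * (wave_fun P b x * cnj (h1_grad v x $ b)))"
  proof (rule integral_cong_AE[OF _ _ eq])
    show "(\<lambda>x. cdot (coupling N j M l x *v h1_grad w x) (h1_grad v x)) \<in> borel_measurable lborel"
      using measurable_cdot[OF measurable_matrix_vector[OF borel_measurable_continuous_onI[OF continuous_coupling] measurable_h1_grad] measurable_h1_grad]
      by simp
    show "(\<lambda>x. partial_deriv l cutoff x * c1 x * cnj (h1_grad v x $ j) - partial_deriv j cutoff x * c2 x * cnj (h1_grad v x $ l)
        + a * (wave_fun P b x * cnj (h1_grad v x $ b))) \<in> borel_measurable lborel"
      by (rule borel_measurable_integrable[OF Bochner_Integration.integrable_add[OF i12 i3']])
  qed
  also have "\<dots> = ?I1 - ?I2 + a * (LINT x|lborel. wave_fun P b x * cnj (h1_grad v x $ b))"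
    unfolding Bochner_Integration.integral_add[OF i12 i3'] Bochner_Integration.integral_diff[OF i1 i2]
      integral_mult_right_zero ..
  finally have "hm1_apply (div_grad (coupling N j M l) w) v + a * (LINT x|lborel. wave_fun P b x * cnj (h1_grad v x $ b)) = ?I2 - ?I1"
    by (simp only: hm1_apply_div_grad'[OF bounded_coeff_coupling[OF assms(1)]]) (simp only: minus_add_distrib minus_diff_eq add.assoc, simp)
  also have "norm \<dots> \<le> cutoff_bound TYPE('d) * norm v + cutoff_bound TYPE('d) * norm v"
    by (rule order_trans[OF norm_triangle_ineq4 add_mono]) (rule cutoff_deriv_pairing(3)[OF c(2,4)] cutoff_deriv_pairing(3)[OF c(1,3)])+
  finally show ?thesis by (simp only: mult_2 distrib_right)
qed

lemma rescale_defect: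
  assumes "N \<noteq> 0"
  shows "of_real (M / N) * (of_real (N\<^sup>2) * W - \<i> * of_real N * V) = of_real (N * M) * W - \<i> * of_real M * (V :: complex)"
  using assms by (simp add: right_diff_distrib power2_eq_square)

text \<open>The coupling carries one wave to the other at the rate \<open>N * M\<close>, with opposite signs in the two
  directions, up to functionals bounded in terms of the ratio of the frequencies.\<close>

lemma coupling_wave_down:
  fixes j l :: "'d::finite"
  assumes jl: "j \<noteq> l" and N: "N > 0" and M: "M > 0"
  shows "norm (div_grad (coupling N j M l) (wave M l) + (N * M) *\<^sub>R h1_to_hm1 (wave N j)) \<le> (2 + 2 * (M / N)) * cutoff_bound TYPE('d)"
proof (rule norm_hm1_leI)
  fix v :: "'d h1"
  let ?W = "LINT x|lborel. wave_fun N j x * cnj (h1_val v x)"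
  let ?V = "LINT x|lborel. wave_fun N j x * cnj (h1_grad v x $ j)"
  have "norm (hm1_apply (div_grad (coupling N j M l) (wave M l)) v + \<i> * of_real M * ?V) \<le> 2 * cutoff_bound TYPE('d) * norm v"
  proof (rule coupling_wave_form[OF jl continuous_phase continuous_phase])
    show "AE x in lborel. cdot (coupling N j M l x *v h1_grad (wave M l) x) (h1_grad v x)
      = partial_deriv l cutoff x * (cis (N * x $ j - M * x $ l) * cis (M * x $ l)) * cnj (h1_grad v x $ j)
        - partial_deriv j cutoff x * (cis (M * x $ l - N * x $ j) * cis (M * x $ l)) * cnj (h1_grad v x $ l)
        + \<i> * of_real M * (wave_fun N j x * cnj (h1_grad v x $ j))"
      using h1_grad_wave_nth[of M l]
    proof eventually_elim
      case (elim x)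
      have "wave_fun M l x * cis (N * x $ j - M * x $ l) = wave_fun N j x"
        by (simp add: wave_fun_def cis_mult)
      then show ?case using elim jl by (simp add: cdot_coupling[OF jl] distrib_left distrib_right mult_ac)
    qed
  qed (simp_all add: norm_mult)
  moreover have "norm (of_real (M / N) * (of_real (N\<^sup>2) * ?W - \<i> * of_real N * ?V)) \<le> M / N * (2 * cutoff_bound TYPE('d) * norm v)"
    using mult_left_mono[OF wave_derivative_defect[of N j v], of "M / N"] N M by (simp add: norm_mult del: of_real_power of_real_divide)
  moreover have "hm1_apply (div_grad (coupling N j M l) (wave M l) + (N * M) *\<^sub>R h1_to_hm1 (wave N j)) v
     = (hm1_apply (div_grad (coupling N j M l) (wave M l)) v + \<i> * of_real M * ?V)
       + of_real (M / N) * (of_real (N\<^sup>2) * ?W - \<i> * of_real N * ?V)"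
    using N by (subst rescale_defect) (simp_all add: hm1_apply_ops hm1_apply_wave scaleR_conv_of_real)
  ultimately have "norm (hm1_apply (div_grad (coupling N j M l) (wave M l) + (N * M) *\<^sub>R h1_to_hm1 (wave N j)) v)
     \<le> 2 * cutoff_bound TYPE('d) * norm v + M / N * (2 * cutoff_bound TYPE('d) * norm v)"
    by (simp only:) (rule order_trans[OF norm_triangle_ineq add_mono])
  then show "norm (hm1_apply (div_grad (coupling N j M l) (wave M l) + (N * M) *\<^sub>R h1_to_hm1 (wave N j)) v)
     \<le> (2 + 2 * (M / N)) * cutoff_bound TYPE('d) * norm v" by (simp add: algebra_simps)
qed (use N M in \<open>simp add: cutoff_bound\<close>)

lemma coupling_wave_up:
  fixes j l :: "'d::finite"
  assumes jl: "j \<noteq> l" and N: "N > 0" and M: "M > 0"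
  shows "norm (div_grad (coupling N j M l) (wave N j) - (N * M) *\<^sub>R h1_to_hm1 (wave M l)) \<le> (2 + 2 * (N / M)) * cutoff_bound TYPE('d)"
proof (rule norm_hm1_leI)
  fix v :: "'d h1"
  let ?W = "LINT x|lborel. wave_fun M l x * cnj (h1_val v x)"
  let ?V = "LINT x|lborel. wave_fun M l x * cnj (h1_grad v x $ l)"
  have "norm (hm1_apply (div_grad (coupling N j M l) (wave N j)) v + - \<i> * of_real N * ?V) \<le> 2 * cutoff_bound TYPE('d) * norm v"
  proof (rule coupling_wave_form[OF jl continuous_phase continuous_phase])
    show "AE x in lborel. cdot (coupling N j M l x *v h1_grad (wave N j) x) (h1_grad v x)
      = partial_deriv l cutoff x * (cis (N * x $ j - M * x $ l) * cis (N * x $ j)) * cnj (h1_grad v x $ j)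
        - partial_deriv j cutoff x * (cis (M * x $ l - N * x $ j) * cis (N * x $ j)) * cnj (h1_grad v x $ l)
        + - \<i> * of_real N * (wave_fun M l x * cnj (h1_grad v x $ l))"
      using h1_grad_wave_nth[of N j]
    proof eventually_elim
      case (elim x)
      have "wave_fun N j x * cis (M * x $ l - N * x $ j) = wave_fun M l x"
        by (simp add: wave_fun_def cis_mult)
      then show ?case using elim jl by (simp add: cdot_coupling[OF jl] distrib_left distrib_right mult_ac)
    qed
  qed (simp_all add: norm_mult)
  moreover have "norm (of_real (N / M) * (of_real (M\<^sup>2) * ?W - \<i> * of_real M * ?V)) \<le> N / M * (2 * cutoff_bound TYPE('d) * norm v)"
    using mult_left_mono[OF wave_derivative_defect[of M l v], of "N / M"] N M by (simp add: norm_mult del: of_real_power of_real_divide)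
  moreover have "hm1_apply (div_grad (coupling N j M l) (wave N j) - (N * M) *\<^sub>R h1_to_hm1 (wave M l)) v
     = (hm1_apply (div_grad (coupling N j M l) (wave N j)) v + - \<i> * of_real N * ?V)
       - of_real (N / M) * (of_real (M\<^sup>2) * ?W - \<i> * of_real M * ?V)"
    using M by (subst rescale_defect) (simp_all add: hm1_apply_ops hm1_apply_diff hm1_apply_wave scaleR_conv_of_real mult.commute)
  ultimately have "norm (hm1_apply (div_grad (coupling N j M l) (wave N j) - (N * M) *\<^sub>R h1_to_hm1 (wave M l)) v)
     \<le> 2 * cutoff_bound TYPE('d) * norm v + N / M * (2 * cutoff_bound TYPE('d) * norm v)"
    by (simp only:) (rule order_trans[OF norm_triangle_ineq4 add_mono])
  then show "norm (hm1_apply (div_grad (coupling N j M l) (wave N j) - (N * M) *\<^sub>R h1_to_hm1 (wave M l)) v)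
     \<le> (2 + 2 * (N / M)) * cutoff_bound TYPE('d) * norm v" by (simp add: algebra_simps)
qed (use N M in \<open>simp add: cutoff_bound\<close>)

section \<open>The size of waves and of their gradients\<close>

lemma l2norm_cutoff_pos: "0 < l2norm (cutoff :: real^'d::finite \<Rightarrow> complex)"
proof -
  have s: "sq_int (cutoff :: real^'d \<Rightarrow> complex)"
    using sq_int_modulated(1)[OF smooth_alg_cutoff unit_supported_cutoff] .
  have "l2norm (cutoff :: real^'d \<Rightarrow> complex) \<noteq> 0"
  proof
    assume "l2norm (cutoff :: real^'d \<Rightarrow> complex) = 0"
    then have "(LINT x|lborel. (norm (cutoff (x :: real^'d)))\<^sup>2) = 0" by (simp add: l2norm_def)
    then have "AE x in lborel. (norm (cutoff (x :: real^'d)))\<^sup>2 = 0"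
      using s by (subst (asm) integral_nonneg_eq_0_iff_AE) (auto simp: sq_int_def)
    then have "AE x in lborel. x \<notin> ball (0 :: real^'d) 1"
    proof eventually_elim
      case (elim x)
      show ?case
      proof
        assume "x \<in> ball 0 1"
        then have "x \<bullet> x < 1" using power_strict_mono[of "norm x" 1 2] by (simp add: power2_norm_eq_inner)
        then show False using elim flat_one_bounds(3)[of "1 - x \<bullet> x"] by (simp add: cutoff_def)
      qed
    qed
    then have "emeasure lborel (ball (0 :: real^'d) 1) = 0"
      by (subst (asm) AE_iff_measurable[of "ball 0 1"]) auto
    then show False using content_ball_pos[of 1 "0 :: real^'d"] by (simp add: measure_def)
  qed
  then show ?thesis using l2norm_nonneg[of "cutoff :: real^'d \<Rightarrow> complex"] by linarith
qed

lemma norm_add_sq_le: "(norm (a + b))\<^sup>2 \<le> 2 * (norm a)\<^sup>2 + 2 * (norm (b :: 'a::real_normed_vector))\<^sup>2"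
proof -
  have "(norm (a + b))\<^sup>2 \<le> (norm a + norm b)\<^sup>2" by (intro power_mono norm_triangle_ineq) auto
  also have "\<dots> \<le> 2 * (norm a)\<^sup>2 + 2 * (norm b)\<^sup>2"
    using sum_squares_bound[of "norm a" "norm b"] by (simp add: power2_sum)
  finally show ?thesis .
qed

lemma l2norm_sq: "(l2norm f)\<^sup>2 = (LINT x|lborel. (norm (f x))\<^sup>2)"
  by (simp add: l2norm_def)

lemma norm_vec_sq: "(norm (x :: complex^'d::finite))\<^sup>2 = (\<Sum>i\<in>UNIV. (norm (x $ i))\<^sup>2)"
  by (simp add: norm_vec_def L2_set_def sum_nonneg)

lemma norm_wave_le:
  fixes j :: "'d::finite"
  assumes "N \<ge> 1"
  shows "norm (wave N j) \<le> (2 + 2 * real CARD('d)) * cutoff_bound TYPE('d) * N"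
proof -
  let ?C = "cutoff_bound TYPE('d)" and ?n = "real CARD('d)"
  have sq: "sq_int (cutoff :: real^'d \<Rightarrow> complex)" "sq_int (partial_deriv i (cutoff :: real^'d \<Rightarrow> complex))" for i
    by (intro sq_int_modulated(1) smooth_alg_cutoff smooth_alg_pderivs unit_supported_partial_deriv unit_supported_cutoff)+
  have b: "(LINT x|lborel. (norm (cutoff (x :: real^'d)))\<^sup>2) \<le> ?C\<^sup>2"
    "(LINT x|lborel. (norm (partial_deriv i cutoff (x :: real^'d)))\<^sup>2) \<le> ?C\<^sup>2" for i
    unfolding l2norm_sq[symmetric] by (intro power_mono cutoff_bound l2norm_nonneg)+
  have "(LINT x|lborel. (norm (h1_val (wave N j) x))\<^sup>2) = (LINT x|lborel. (norm (cutoff (x :: real^'d)))\<^sup>2)"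
  proof (rule integral_cong_AE)
    show "AE x in lborel. (norm (h1_val (wave N j) x))\<^sup>2 = (norm (cutoff x))\<^sup>2"
      using h1_val_wave[of N j] by eventually_elim (simp add: wave_fun_def norm_mult)
  qed (use sq in \<open>auto simp: sq_int_def\<close>)
  then have 1: "(LINT x|lborel. (norm (h1_val (wave N j) x))\<^sup>2) \<le> ?C\<^sup>2" using b by simp
  have "(LINT x|lborel. (norm (h1_grad (wave N j) x))\<^sup>2)
      \<le> (LINT x|lborel. (\<Sum>i\<in>UNIV. 2 * (norm (partial_deriv i cutoff (x :: real^'d)))\<^sup>2 + 2 * (N\<^sup>2 * (norm (cutoff x))\<^sup>2)))"
  proof (rule integral_mono_AE)
    show "AE x in lborel. (norm (h1_grad (wave N j) x))\<^sup>2
      \<le> (\<Sum>i\<in>UNIV. 2 * (norm (partial_deriv i cutoff x))\<^sup>2 + 2 * (N\<^sup>2 * (norm (cutoff x))\<^sup>2))"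
      using h1_grad_wave_nth[of N j]
    proof eventually_elim
      case (elim x)
      show ?case unfolding norm_vec_sq
      proof (rule sum_mono)
        fix i
        show "(norm (h1_grad (wave N j) x $ i))\<^sup>2 \<le> 2 * (norm (partial_deriv i cutoff x))\<^sup>2 + 2 * (N\<^sup>2 * (norm (cutoff x))\<^sup>2)"
          unfolding elim[rule_format]
          by (rule order_trans[OF norm_add_sq_le]) (auto simp: norm_mult wave_fun_def power_mult_distrib)
      qed
    qed
  qed (use sq sq_int_h1_grad[of "wave N j"] in \<open>auto simp: sq_int_def\<close>)
  also have "\<dots> = (\<Sum>i\<in>UNIV. 2 * (LINT x|lborel. (norm (partial_deriv i cutoff (x :: real^'d)))\<^sup>2)
      + 2 * (N\<^sup>2 * (LINT x|lborel. (norm (cutoff (x :: real^'d)))\<^sup>2)))"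
    using sq by (simp add: sq_int_def)
  also have "\<dots> \<le> (\<Sum>i\<in>(UNIV :: 'd set). 2 * ?C\<^sup>2 + 2 * (N\<^sup>2 * ?C\<^sup>2))"
    by (intro sum_mono add_mono mult_left_mono b) auto
  also have "\<dots> = ?n * (2 * ?C\<^sup>2 + 2 * (N\<^sup>2 * ?C\<^sup>2))" by simp
  finally have 2: "(norm (wave N j))\<^sup>2 \<le> ?C\<^sup>2 + ?n * (2 * ?C\<^sup>2 + 2 * (N\<^sup>2 * ?C\<^sup>2))"
    using 1 unfolding norm_h1_sq by linarith
  have N1: "1 \<le> N\<^sup>2" using assms by simp
  have CN: "?C\<^sup>2 \<le> N\<^sup>2 * ?C\<^sup>2" using mult_right_mono[OF N1, of "?C\<^sup>2"] by simp
  have "?C\<^sup>2 + ?n * (2 * ?C\<^sup>2 + 2 * (N\<^sup>2 * ?C\<^sup>2)) \<le> N\<^sup>2 * ?C\<^sup>2 + ?n * (2 * (N\<^sup>2 * ?C\<^sup>2) + 2 * (N\<^sup>2 * ?C\<^sup>2))"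
    using CN by (intro add_mono mult_left_mono) auto
  also have "\<dots> = (1 + 4 * ?n) * (N\<^sup>2 * ?C\<^sup>2)" by (simp add: algebra_simps)
  also have "\<dots> \<le> (2 + 2 * ?n)\<^sup>2 * (N\<^sup>2 * ?C\<^sup>2)"
  proof (rule mult_right_mono)
    show "1 + 4 * ?n \<le> (2 + 2 * ?n)\<^sup>2" unfolding power2_sum by simp
  qed simp
  also have "\<dots> = ((2 + 2 * ?n) * ?C * N)\<^sup>2" by (simp only: power_mult_distrib mult_ac)
  finally have "(norm (wave N j))\<^sup>2 \<le> ((2 + 2 * ?n) * ?C * N)\<^sup>2" using 2 by linarith
  moreover have "0 \<le> (2 + 2 * ?n) * ?C * N"
    using assms cutoff_bound(4)[where 'd = 'd] by (intro mult_nonneg_nonneg) auto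
  ultimately show ?thesis by (rule power2_le_imp_le)
qed

text \<open>The waves oscillate in different directions, so the leading terms of their gradients lie in
  different components and cannot cancel.\<close>

lemma grad_wave_pair_ge:
  fixes j l :: "'d::finite"
  assumes jl: "j \<noteq> l" and NM: "0 \<le> N" "N \<le> M"
  shows "(a\<^sup>2 + b\<^sup>2) * (N\<^sup>2 / 2 * (l2norm (cutoff :: real^'d \<Rightarrow> complex))\<^sup>2 - 4 * (cutoff_bound TYPE('d))\<^sup>2)
    \<le> (LINT x|lborel. (norm (h1_grad (a *\<^sub>R wave N j + b *\<^sub>R wave M l) x))\<^sup>2)"
proof -
  let ?w = "a *\<^sub>R wave N j + b *\<^sub>R wave M l" and ?s = "a\<^sup>2 + b\<^sup>2"
  let ?p = "\<lambda>i x. (norm (partial_deriv i (cutoff :: real^'d \<Rightarrow> complex) x))\<^sup>2"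
  have sq: "sq_int (cutoff :: real^'d \<Rightarrow> complex)" "sq_int (partial_deriv i (cutoff :: real^'d \<Rightarrow> complex))" for i
    by (intro sq_int_modulated(1) smooth_alg_cutoff smooth_alg_pderivs unit_supported_partial_deriv unit_supported_cutoff)+
  have b: "(LINT x|lborel. ?p i x) \<le> (cutoff_bound TYPE('d))\<^sup>2" for i
    unfolding l2norm_sq[symmetric] by (intro power_mono cutoff_bound l2norm_nonneg)
  have lower: "K\<^sup>2 * (r\<^sup>2 * c\<^sup>2) / 2 - 2 * ?s * q\<^sup>2 \<le> (norm (y + z))\<^sup>2"
    if "norm z = K * (\<bar>r\<bar> * c)" "norm y \<le> (\<bar>a\<bar> + \<bar>b\<bar>) * q" "0 \<le> q" for y z :: complex and K r c q
  proof -
    have "(norm (y + z + (- y)))\<^sup>2 \<le> 2 * (norm (y + z))\<^sup>2 + 2 * (norm y)\<^sup>2"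
      using norm_add_sq_le[of "y + z" "- y"] by simp
    moreover have "(norm y)\<^sup>2 \<le> ((\<bar>a\<bar> + \<bar>b\<bar>) * q)\<^sup>2" by (intro power_mono that) simp
    moreover have "((\<bar>a\<bar> + \<bar>b\<bar>) * q)\<^sup>2 \<le> 2 * ?s * q\<^sup>2"
    proof -
      have "(\<bar>a\<bar> + \<bar>b\<bar>)\<^sup>2 \<le> 2 * ?s" using sum_squares_bound[of "\<bar>a\<bar>" "\<bar>b\<bar>"] by (simp add: power2_sum)
      then show ?thesis unfolding power_mult_distrib by (rule mult_right_mono) simp
    qed
    moreover have "(norm z)\<^sup>2 = K\<^sup>2 * (r\<^sup>2 * c\<^sup>2)" using that(1) by (simp add: power_mult_distrib)
    ultimately show ?thesis by (simp add: algebra_simps)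
  qed
  have "?s * (N\<^sup>2 / 2 * (l2norm (cutoff :: real^'d \<Rightarrow> complex))\<^sup>2 - 4 * (cutoff_bound TYPE('d))\<^sup>2)
     \<le> ?s * (N\<^sup>2 / 2 * (l2norm (cutoff :: real^'d \<Rightarrow> complex))\<^sup>2 - 2 * ((LINT x|lborel. ?p j x) + (LINT x|lborel. ?p l x)))"
    using b[of j] b[of l] by (intro mult_left_mono) auto
  also have "\<dots> = (LINT x|lborel. ?s * (N\<^sup>2 / 2 * (norm (cutoff (x :: real^'d)))\<^sup>2 - 2 * (?p j x + ?p l x)))"
    using sq unfolding l2norm_sq by (simp add: sq_int_def)
  also have "\<dots> \<le> (LINT x|lborel. (norm (h1_grad ?w x))\<^sup>2)"
  proof (rule integral_mono_AE)
    show "AE x in lborel. ?s * (N\<^sup>2 / 2 * (norm (cutoff x))\<^sup>2 - 2 * (?p j x + ?p l x)) \<le> (norm (h1_grad ?w x))\<^sup>2"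
      using h1_grad_wave_nth[of N j] h1_grad_wave_nth[of M l] h1_grad_add[of "a *\<^sub>R wave N j" "b *\<^sub>R wave M l"]
        h1_grad_scaleR[of a "wave N j"] h1_grad_scaleR[of b "wave M l"]
    proof eventually_elim
      case (elim x)
      let ?q = "\<lambda>i. partial_deriv i cutoff x"
      define y where "y i = a *\<^sub>R (?q i * cis (N * x $ j)) + b *\<^sub>R (?q i * cis (M * x $ l))" for i
      have y: "norm (y i) \<le> (\<bar>a\<bar> + \<bar>b\<bar>) * norm (?q i)" for i
        unfolding y_def by (rule order_trans[OF norm_triangle_ineq]) (simp add: norm_mult distrib_right)
      have gj: "h1_grad ?w x $ j = y j + a *\<^sub>R (\<i> * of_real N * wave_fun N j x)"
        using elim jl by (simp add: y_def scaleR_add_right)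
      have gl: "h1_grad ?w x $ l = y l + b *\<^sub>R (\<i> * of_real M * wave_fun M l x)"
        using elim jl by (simp add: y_def scaleR_add_right)
      have "N\<^sup>2 * (a\<^sup>2 * (norm (cutoff x))\<^sup>2) / 2 - 2 * ?s * ?p j x \<le> (norm (h1_grad ?w x $ j))\<^sup>2"
        unfolding gj using NM by (intro lower y) (auto simp: norm_mult wave_fun_def)
      moreover have "M\<^sup>2 * (b\<^sup>2 * (norm (cutoff x))\<^sup>2) / 2 - 2 * ?s * ?p l x \<le> (norm (h1_grad ?w x $ l))\<^sup>2"
        unfolding gl using NM by (intro lower y) (auto simp: norm_mult wave_fun_def)
      moreover have "N\<^sup>2 * (b\<^sup>2 * (norm (cutoff x))\<^sup>2) \<le> M\<^sup>2 * (b\<^sup>2 * (norm (cutoff x))\<^sup>2)"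
        using NM by (intro mult_right_mono power_mono) auto
      moreover have "(norm (h1_grad ?w x $ j))\<^sup>2 + (norm (h1_grad ?w x $ l))\<^sup>2 \<le> (norm (h1_grad ?w x))\<^sup>2"
        unfolding norm_vec_sq using jl sum_mono2[of UNIV "{j, l}" "\<lambda>i. (norm (h1_grad ?w x $ i))\<^sup>2"] by simp
      ultimately show ?case by (simp add: algebra_simps)
    qed
  qed (use sq sq_int_h1_grad[of ?w] in \<open>auto simp: sq_int_def\<close>)
  finally show ?thesis .
qed

section \<open>The cascade\<close>

locale cascade =
  fixes i0 i1 :: "'d::finite" and \<epsilon> :: real
  assumes dirs: "i0 \<noteq> i1" and eps: "0 < \<epsilon>" "\<epsilon> < 1 / 2"
begin

definition dir :: "nat \<Rightarrow> 'd" where "dir n = (if even n then i0 else i1)"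

lemma dir_Suc: "dir n \<noteq> dir (Suc n)"
  using dirs by (simp add: dir_def)

definition X :: "nat \<Rightarrow> 'd h1" where "X n = wave (2 ^ n) (dir n)"

definition A :: "'d h1 \<Rightarrow> 'd hm1" where "A = div_grad (\<lambda>_. mat 1)"

definition Kmat :: "nat \<Rightarrow> real^'d \<Rightarrow> complex^'d^'d" where
  "Kmat n = coupling (2 ^ n) (dir n) (2 ^ Suc n) (dir (Suc n))"

definition K :: "nat \<Rightarrow> 'd h1 \<Rightarrow> 'd hm1" where "K n = div_grad (Kmat n)"

lemma bounded_linear_A: "bounded_linear A"
  unfolding A_def by (rule bounded_linear_div_grad[OF bounded_coeff_mat_1])

lemma bounded_coeff_Kmat: "bounded_coeff (Kmat n)"
  unfolding Kmat_def by (rule bounded_coeff_coupling[OF dir_Suc])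

lemma bounded_linear_K: "bounded_linear (K n)"
  unfolding K_def by (rule bounded_linear_div_grad[OF bounded_coeff_Kmat])

lemma norm_A_le: "norm (A v) \<le> norm v"
  using norm_div_grad_le[of "\<lambda>_. mat 1" 1 v] by (simp add: A_def)

lemma norm_K_le: "norm (K n v) \<le> norm v"
  using norm_div_grad_le[of "Kmat n" 1 v] bounded_coeff_Kmat[of n] norm_coupling_le[OF dir_Suc]
  by (simp add: K_def Kmat_def bounded_coeff_def)

lemma pairing_A_sym: "pairing (A v) w = pairing (A w) v"
  unfolding A_def by (rule pairing_laplace_sym)

lemma pairing_K_antisym: "pairing (K n v) w = - pairing (K n w) v"
  unfolding K_def Kmat_def by (rule pairing_coupling_antisym[OF dir_Suc])

definition C0 :: real where "C0 = (6 + 2 * real CARD('d)) * cutoff_bound TYPE('d)"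

lemma C0_ge: "c \<le> 6 + 2 * real CARD('d) \<Longrightarrow> c * cutoff_bound TYPE('d) \<le> C0"
  unfolding C0_def by (intro mult_right_mono cutoff_bound)

lemma C0_nonneg: "0 \<le> C0"
  unfolding C0_def using cutoff_bound(4)[where 'd = 'd] by simp

lemma X_bounds:
  shows A_X: "norm (A (X n) + 4 ^ n *\<^sub>R h1_to_hm1 (X n)) \<le> C0"
    and K_X: "norm (K n (X n) - (2 * 4 ^ n) *\<^sub>R h1_to_hm1 (X (Suc n))) \<le> C0"
    and K_X_Suc: "norm (K n (X (Suc n)) + (2 * 4 ^ n) *\<^sub>R h1_to_hm1 (X n)) \<le> C0"
    and norm_X: "norm (X n) \<le> C0 * 2 ^ n"
    and norm_h1_to_hm1_X: "norm (h1_to_hm1 (X n)) \<le> C0"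
proof -
  have sq: "((2 :: real) ^ n)\<^sup>2 = 4 ^ n" by (simp add: power2_eq_square flip: power_mult_distrib)
  have pr: "(2 :: real) ^ n * 2 ^ Suc n = 2 * 4 ^ n" by (simp flip: power_mult_distrib)
  show "norm (A (X n) + 4 ^ n *\<^sub>R h1_to_hm1 (X n)) \<le> C0"
    using laplace_wave[of "2 ^ n" "dir n"] C0_ge[of "2 + real CARD('d)"] by (simp add: A_def X_def sq)
  have "norm (K n (X n) - (2 * 4 ^ n) *\<^sub>R h1_to_hm1 (X (Suc n))) \<le> (2 + 2 * (2 ^ n / 2 ^ Suc n)) * cutoff_bound TYPE('d)"
    using coupling_wave_up[OF dir_Suc[of n], of "2 ^ n" "2 ^ Suc n"] unfolding pr K_def Kmat_def X_def by simp
  also have "\<dots> \<le> C0" by (rule C0_ge) simp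
  finally show "norm (K n (X n) - (2 * 4 ^ n) *\<^sub>R h1_to_hm1 (X (Suc n))) \<le> C0" .
  have "norm (K n (X (Suc n)) + (2 * 4 ^ n) *\<^sub>R h1_to_hm1 (X n)) \<le> (2 + 2 * (2 ^ Suc n / 2 ^ n)) * cutoff_bound TYPE('d)"
    using coupling_wave_down[OF dir_Suc[of n], of "2 ^ n" "2 ^ Suc n"] unfolding pr K_def Kmat_def X_def by simp
  also have "\<dots> \<le> C0" by (rule C0_ge) simp
  finally show "norm (K n (X (Suc n)) + (2 * 4 ^ n) *\<^sub>R h1_to_hm1 (X n)) \<le> C0" .
  have "norm (X n) \<le> (2 + 2 * real CARD('d)) * cutoff_bound TYPE('d) * 2 ^ n"
    unfolding X_def by (rule norm_wave_le) simp
  also have "\<dots> \<le> C0 * 2 ^ n" by (intro mult_right_mono C0_ge) auto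
  finally show "norm (X n) \<le> C0 * 2 ^ n" .
  show "norm (h1_to_hm1 (X n)) \<le> C0"
    using norm_h1_to_hm1_wave[of "2 ^ n" "dir n"] C0_ge[of 1] by (simp add: X_def)
qed

text \<open>Stage \<open>n\<close> consists of the \<open>s\<close> with \<open>4\<^sup>-\<^sup>n\<^sup>-\<^sup>1 < s \<le> 4\<^sup>-\<^sup>n\<close>, which is the parabolic time scale of
  the frequency \<open>2\<^sup>n\<close>.\<close>

definition stage :: "real \<Rightarrow> nat" where "stage s = nat \<lfloor>- ln s / ln 4\<rfloor>"

text \<open>On stage \<open>n\<close> the angle increases from \<open>0\<close> to \<open>pi / 2\<close> as \<open>s\<close> decreases; its derivative
  is \<open>- \<omega> / s\<close> with the constant \<open>\<omega>\<close> below.\<close>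

definition angle :: "nat \<Rightarrow> real \<Rightarrow> real" where "angle n s = pi / 2 * (- ln s / ln 4 - real n)"

definition \<omega> :: real where "\<omega> = pi / (2 * ln 4)"

definition piece :: "nat \<Rightarrow> real \<Rightarrow> 'd h1" where
  "piece n s = s powr \<epsilon> *\<^sub>R (cos (angle n s) *\<^sub>R X n + sin (angle n s) *\<^sub>R X (Suc n))"

definition piece' :: "nat \<Rightarrow> real \<Rightarrow> 'd h1" where
  "piece' n s = (s powr \<epsilon> / s) *\<^sub>R ((\<epsilon> * cos (angle n s) + \<omega> * sin (angle n s)) *\<^sub>R X n
     + (\<epsilon> * sin (angle n s) - \<omega> * cos (angle n s)) *\<^sub>R X (Suc n))"

text \<open>Where two stages meet, both pieces reduce to the wave common to them, so that \<open>w\<close> is continuous.\<close>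

definition w :: "real \<Rightarrow> 'd h1" where "w s = piece (stage s) s"

text \<open>The derivative of \<open>w\<close> except at the times where two stages meet.\<close>

definition w' :: "real \<Rightarrow> 'd h1" where "w' s = piece' (stage s) s"

text \<open>The solution of the two linear equations in \<open>coefficient_odes\<close>. The value \<open>1\<close> at the singular time
  keeps the coefficients elliptic there.\<close>

definition \<mu> :: "real \<Rightarrow> real" where
  "\<mu> s = (if s \<le> 0 then 1 else \<epsilon> / (s * 4 ^ stage s * (1 + 3 * (sin (angle (stage s) s))\<^sup>2)))"

definition \<kappa> :: "real \<Rightarrow> real" where
  "\<kappa> s = (if s \<le> 0 then 0 else
    (\<omega> / (s * 4 ^ stage s) + 3 * \<mu> s * sin (angle (stage s) s) * cos (angle (stage s) s)) / 2)"

lemma \<omega>_pos: "\<omega> > 0" by (simp add: \<omega>_def)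

lemma stage_eq:
  assumes "1 / 4 ^ Suc n < s" "s \<le> 1 / 4 ^ n"
  shows "stage s = n"
proof -
  have s: "s > 0" using assms(1) by (rule less_trans[rotated]) simp
  have l4: "ln (4 :: real) > 0" by simp
  have "ln s \<le> ln (1 / 4 ^ n)" using assms(2) s by (subst ln_le_cancel_iff) auto
  then have 1: "real n * ln 4 \<le> - ln s" by (simp add: ln_div ln_realpow)
  have "ln (1 / 4 ^ Suc n) < ln s" using assms(1) s by (subst ln_less_cancel_iff) auto
  then have 2: "- ln s < real (Suc n) * ln 4" by (simp add: ln_div ln_realpow del: power_Suc)
  have "\<lfloor>- ln s / ln 4\<rfloor> = int n"
    using 1 2 l4 by (intro floor_unique) (auto simp: field_simps)
  then show ?thesis by (simp add: stage_def)
qed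

lemma stage_bounds:
  assumes "0 < s" "s \<le> 1"
  shows "1 / 4 ^ Suc (stage s) < s" "s \<le> 1 / 4 ^ stage s"
proof -
  define y where "y = - ln s / ln 4"
  have l4: "ln (4 :: real) > 0" by simp
  have y: "y \<ge> 0" using assms l4 by (simp add: y_def divide_nonpos_pos)
  have n: "real (stage s) \<le> y" "y < real (Suc (stage s))"
  proof -
    have "real (stage s) = real_of_int \<lfloor>y\<rfloor>" using y unfolding stage_def y_def[symmetric] by simp
    then show "real (stage s) \<le> y" "y < real (Suc (stage s))"
      unfolding of_nat_Suc using floor_correct[of y] by linarith+
  qed
  have "ln s = - y * ln 4" using l4 by (simp add: y_def)
  then have "ln s \<le> ln (1 / 4 ^ stage s)" "ln (1 / 4 ^ Suc (stage s)) < ln s"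
    using n l4 by (auto simp: ln_div ln_realpow simp del: power_Suc)
  then show "s \<le> 1 / 4 ^ stage s" "1 / 4 ^ Suc (stage s) < s" using assms by auto
qed

text \<open>All bounds on the coefficients come from \<open>s * 4 ^ stage s\<close> being of order one.\<close>

lemma four_stage:
  assumes "0 < s" "s \<le> 1"
  shows "1 / 4 < s * 4 ^ stage s" "s * 4 ^ stage s \<le> 1" "2 ^ stage s \<le> s powr (- 1 / 2)" "1 / (4 * s) \<le> 4 ^ stage s"
proof -
  note b = stage_bounds[OF assms]
  have p: "(4 :: real) ^ stage s > 0" by simp
  show 1: "1 / 4 < s * 4 ^ stage s" using b(1) p by (simp add: field_simps)
  show 2: "s * 4 ^ stage s \<le> 1" using b(2) p by (simp add: field_simps)
  show "1 / (4 * s) \<le> 4 ^ stage s" using 1 assms by (simp add: field_simps)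
  have "(2 ^ stage s)\<^sup>2 \<le> (s powr (- 1 / 2))\<^sup>2"
  proof -
    have "(2 ^ stage s :: real)\<^sup>2 = 4 ^ stage s" by (simp add: power2_eq_square flip: power_mult_distrib)
    also have "\<dots> \<le> 1 / s" using 2 assms by (simp add: field_simps)
    also have "\<dots> = (s powr (- 1 / 2))\<^sup>2"
      using assms by (simp add: power2_eq_square powr_minus_divide flip: powr_add)
    finally show ?thesis .
  qed
  then show "2 ^ stage s \<le> s powr (- 1 / 2)" by (rule power2_le_imp_le) simp
qed

lemma powr_eps_le_1: "0 \<le> s \<Longrightarrow> s \<le> 1 \<Longrightarrow> s powr \<epsilon> \<le> 1"
  using eps by (simp add: powr_le1)

lemma \<mu>_bounds:
  assumes "0 < s" "s \<le> 1"
  shows "\<epsilon> / 4 \<le> \<mu> s" "\<mu> s \<le> 4 * \<epsilon>" "\<bar>\<kappa> s\<bar> \<le> 2 * \<omega> + 6 * \<epsilon>"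
proof -
  define q where "q = s * 4 ^ stage s"
  define z where "z = (sin (angle (stage s) s))\<^sup>2"
  have q: "1 / 4 < q" "q \<le> 1" using four_stage[OF assms] by (auto simp: q_def)
  have z: "0 \<le> z" "z \<le> 1" by (auto simp: z_def abs_square_le_1)
  have mu: "\<mu> s = \<epsilon> / (q * (1 + 3 * z))" using assms by (simp add: \<mu>_def q_def z_def)
  have "q * (1 + 3 * z) \<le> 1 * 4" using q z by (intro mult_mono) auto
  moreover have pos: "0 < q * (1 + 3 * z)" using q z by (intro mult_pos_pos) auto
  ultimately show 1: "\<epsilon> / 4 \<le> \<mu> s" unfolding mu using eps by (intro divide_left_mono) auto
  have "1 / 4 * 1 \<le> q * (1 + 3 * z)" using q z by (intro mult_mono) auto
  then have "\<epsilon> / (q * (1 + 3 * z)) \<le> \<epsilon> / (1 / 4)" using eps pos by (intro divide_left_mono) auto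
  then show 2: "\<mu> s \<le> 4 * \<epsilon>" unfolding mu by simp
  have "\<omega> / q \<le> \<omega> / (1 / 4)" using q \<omega>_pos by (intro divide_left_mono) auto
  then have a: "\<bar>\<omega> / q\<bar> \<le> 4 * \<omega>" using q \<omega>_pos by simp
  have mu0: "0 \<le> \<mu> s" using 1 eps by linarith
  have "\<bar>3 * \<mu> s * sin (angle (stage s) s) * cos (angle (stage s) s)\<bar> \<le> 3 * \<mu> s * 1 * 1"
    unfolding abs_mult using mu0 by (intro mult_mono) auto
  then have "\<bar>\<omega> / q + 3 * \<mu> s * sin (angle (stage s) s) * cos (angle (stage s) s)\<bar> \<le> 4 * \<omega> + 12 * \<epsilon>"
    using a 2 by linarith
  then show "\<bar>\<kappa> s\<bar> \<le> 2 * \<omega> + 6 * \<epsilon>" using assms by (simp add: \<kappa>_def q_def)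
qed

text \<open>These equate the coefficients of the two waves in \<open>-w' = div ((\<mu> I + \<kappa> K) \<nabla>w)\<close> when the Laplacian
  is taken to multiply them by \<open>- 4 ^ n\<close> and \<open>- 4 ^ Suc n\<close>, and \<open>K\<close> to exchange them at the rate
  \<open>2 * 4 ^ n\<close> with opposite signs.\<close>

lemma coefficient_odes:
  assumes "0 < s" "s \<le> 1"
  defines "c \<equiv> cos (angle (stage s) s)" and "z \<equiv> sin (angle (stage s) s)" and "q \<equiv> s * 4 ^ stage s"
  shows "\<epsilon> * c + \<omega> * z = q * (\<mu> s * c + 2 * \<kappa> s * z)" "\<epsilon> * z - \<omega> * c = q * (4 * \<mu> s * z - 2 * \<kappa> s * c)"
proof -
  have q: "q > 0" using assms by simp
  have cz: "c * c = 1 - z * z" using sin_cos_squared_add2[of "angle (stage s) s"] by (simp add: c_def z_def power2_eq_square algebra_simps)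
  have pos: "1 + 3 * z\<^sup>2 > 0" using zero_le_power2[of z] by linarith
  have "\<mu> s = \<epsilon> / (q * (1 + 3 * z\<^sup>2))" using assms(1) by (simp add: \<mu>_def q_def z_def)
  then have qmu: "\<epsilon> = q * \<mu> s * (1 + 3 * z * z)"
    using q pos by (simp add: power2_eq_square mult.assoc)
  have qk: "2 * q * \<kappa> s = \<omega> + 3 * q * \<mu> s * z * c"
    using assms q by (simp add: \<kappa>_def q_def z_def c_def field_simps)
  have "q * (\<mu> s * c + 2 * \<kappa> s * z) = q * \<mu> s * c + (2 * q * \<kappa> s) * z" by (simp add: algebra_simps)
  also have "\<dots> = \<epsilon> * c + \<omega> * z" unfolding qk by (subst qmu) (simp add: algebra_simps)
  finally show "\<epsilon> * c + \<omega> * z = q * (\<mu> s * c + 2 * \<kappa> s * z)" by simp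
  have "q * (4 * \<mu> s * z - 2 * \<kappa> s * c) = 4 * q * \<mu> s * z - (2 * q * \<kappa> s) * c" by (simp add: algebra_simps)
  also have "\<dots> = 4 * (q * \<mu> s) * z - \<omega> * c - 3 * (q * \<mu> s) * z * (c * c)" unfolding qk by (simp add: algebra_simps)
  also have "\<dots> = \<epsilon> * z - \<omega> * c" unfolding cz by (subst qmu) (simp add: algebra_simps)
  finally show "\<epsilon> * z - \<omega> * c = q * (4 * \<mu> s * z - 2 * \<kappa> s * c)" by simp
qed

text \<open>The error with which \<open>w\<close> solves the backward equation, since the last two terms together are
  \<open>- div ((\<mu> I + \<kappa> K) \<nabla>w)\<close>.\<close>

definition residual :: "real \<Rightarrow> 'd hm1" where
  "residual s = - h1_to_hm1 (w' s) - \<mu> s *\<^sub>R A (w s) - \<kappa> s *\<^sub>R K (stage s) (w s)"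

text \<open>The leading parts cancel by \<open>coefficient_odes\<close>; what remains is a combination, with bounded
  coefficients, of the four functionals estimated in \<open>A_X\<close>, \<open>K_X\<close> and \<open>K_X_Suc\<close>.\<close>

lemma norm_residual_le:
  assumes "0 < s" "s \<le> 1"
  shows "norm (residual s) \<le> (20 * \<epsilon> + 4 * \<omega>) * C0"
proof -
  interpret I: bounded_linear "h1_to_hm1 :: 'd h1 \<Rightarrow> _" by (rule bounded_linear_h1_to_hm1)
  interpret A: bounded_linear A by (rule bounded_linear_A)
  interpret K: bounded_linear "K n" for n by (rule bounded_linear_K)
  define n where "n = stage s"
  define c where "c = cos (angle n s)"
  define z where "z = sin (angle n s)"
  define r where "r = s powr \<epsilon>"
  define F where "F = (\<mu> s * c) *\<^sub>R (A (X n) + 4 ^ n *\<^sub>R h1_to_hm1 (X n))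
    + (\<mu> s * z) *\<^sub>R (A (X (Suc n)) + 4 ^ Suc n *\<^sub>R h1_to_hm1 (X (Suc n)))
    + ((\<kappa> s * c) *\<^sub>R (K n (X n) - (2 * 4 ^ n) *\<^sub>R h1_to_hm1 (X (Suc n)))
    + (\<kappa> s * z) *\<^sub>R (K n (X (Suc n)) + (2 * 4 ^ n) *\<^sub>R h1_to_hm1 (X n)))"
  note ode = coefficient_odes[OF assms, folded n_def, folded c_def z_def]
  have e1: "r / s * (\<epsilon> * c + \<omega> * z) = r * (4 ^ n * (\<mu> s * c + 2 * \<kappa> s * z))"
    unfolding ode using assms by simp
  have e2: "r / s * (\<epsilon> * z - \<omega> * c) = r * (4 ^ n * (4 * \<mu> s * z - 2 * \<kappa> s * c))"
    unfolding ode using assms by simp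
  have w': "w' s = (r * (4 ^ n * (\<mu> s * c + 2 * \<kappa> s * z))) *\<^sub>R X n + (r * (4 ^ n * (4 * \<mu> s * z - 2 * \<kappa> s * c))) *\<^sub>R X (Suc n)"
    unfolding w'_def piece'_def n_def[symmetric] c_def[symmetric] z_def[symmetric] r_def[symmetric]
    by (simp only: scaleR_add_right scaleR_scaleR e1 e2)
  have Iw': "h1_to_hm1 (w' s) = (r * (4 ^ n * (\<mu> s * c + 2 * \<kappa> s * z))) *\<^sub>R h1_to_hm1 (X n)
      + (r * (4 ^ n * (4 * \<mu> s * z - 2 * \<kappa> s * c))) *\<^sub>R h1_to_hm1 (X (Suc n))"
    unfolding w' I.add I.scaleR ..
  have w: "w s = (r * c) *\<^sub>R X n + (r * z) *\<^sub>R X (Suc n)"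
    unfolding w_def piece_def n_def[symmetric] c_def[symmetric] z_def[symmetric] r_def[symmetric]
    by (simp add: scaleR_add_right)
  have "residual s = - (r *\<^sub>R F)"
    unfolding residual_def Iw' w F_def n_def[symmetric]
    by (simp add: A.add A.scaleR K.add K.scaleR scaleR_add_right scaleR_diff_right scaleR_add_left
        scaleR_diff_left algebra_simps)
  moreover have "norm (r *\<^sub>R F) \<le> 1 * ((20 * \<epsilon> + 4 * \<omega>) * C0)"
    unfolding norm_scaleR
  proof (rule mult_mono)
    show "\<bar>r\<bar> \<le> 1" using powr_eps_le_1[of s] assms by (simp add: r_def)
    have mu: "\<bar>\<mu> s\<bar> \<le> 4 * \<epsilon>" using \<mu>_bounds[OF assms] eps by linarith
    note ka = \<mu>_bounds(3)[OF assms]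
    have cz: "\<bar>c\<bar> \<le> 1" "\<bar>z\<bar> \<le> 1" by (auto simp: c_def z_def)
    have t: "norm ((a * b) *\<^sub>R G) \<le> L * C0" if "\<bar>a\<bar> \<le> L" "\<bar>b\<bar> \<le> 1" "norm G \<le> C0" for a b L and G :: "'d hm1"
    proof -
      have "\<bar>a\<bar> * \<bar>b\<bar> \<le> L * 1" using that by (intro mult_mono) auto
      then have "(\<bar>a\<bar> * \<bar>b\<bar>) * norm G \<le> L * C0" using that by (intro mult_mono) auto
      then show ?thesis by (simp add: abs_mult)
    qed
    have "norm F \<le> (4 * \<epsilon> * C0 + 4 * \<epsilon> * C0) + ((2 * \<omega> + 6 * \<epsilon>) * C0 + (2 * \<omega> + 6 * \<epsilon>) * C0)"
      unfolding F_def
      by (intro order_trans[OF norm_triangle_ineq] add_mono t mu ka cz A_X K_X K_X_Suc)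
    then show "norm F \<le> (20 * \<epsilon> + 4 * \<omega>) * C0" by (simp add: algebra_simps)
  qed auto
  ultimately show ?thesis by simp
qed

lemma norm_X_pair_le:
  assumes "0 < s" "s \<le> 1" "\<bar>a\<bar> \<le> L" "\<bar>b\<bar> \<le> L"
  shows "norm (a *\<^sub>R X (stage s) + b *\<^sub>R X (Suc (stage s))) \<le> 3 * L * C0 * s powr (- 1 / 2)"
proof -
  have "norm (a *\<^sub>R X (stage s) + b *\<^sub>R X (Suc (stage s))) \<le> \<bar>a\<bar> * norm (X (stage s)) + \<bar>b\<bar> * norm (X (Suc (stage s)))"
    by (rule order_trans[OF norm_triangle_ineq]) simp
  also have "\<dots> \<le> L * (C0 * 2 ^ stage s) + L * (C0 * 2 ^ Suc (stage s))"
    using assms by (intro add_mono mult_mono norm_X) auto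
  also have "\<dots> = 3 * L * C0 * 2 ^ stage s" by (simp add: algebra_simps)
  also have "\<dots> \<le> 3 * L * C0 * s powr (- 1 / 2)"
    using assms C0_nonneg by (intro mult_left_mono four_stage) auto
  finally show ?thesis .
qed

lemma norm_w_le:
  assumes "0 < s" "s \<le> 1"
  shows "norm (w s) \<le> 3 * C0 * s powr (\<epsilon> - 1 / 2)"
proof -
  have "norm (w s) = s powr \<epsilon> * norm (cos (angle (stage s) s) *\<^sub>R X (stage s) + sin (angle (stage s) s) *\<^sub>R X (Suc (stage s)))"
    by (simp add: w_def piece_def)
  also have "\<dots> \<le> s powr \<epsilon> * (3 * 1 * C0 * s powr (- 1 / 2))"
    by (intro mult_left_mono norm_X_pair_le assms) auto
  also have "\<dots> = 3 * C0 * s powr (\<epsilon> - 1 / 2)" using assms by (simp flip: powr_add)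
  finally show ?thesis .
qed

lemma norm_w'_le:
  assumes "0 < s" "s \<le> 1"
  shows "norm (w' s) \<le> 1 / s * (3 * (\<epsilon> + \<omega>) * C0 * s powr (- 1 / 2))"
proof -
  have b: "\<bar>\<epsilon> * cos x + \<omega> * sin x\<bar> \<le> \<epsilon> + \<omega>" "\<bar>\<epsilon> * sin x - \<omega> * cos x\<bar> \<le> \<epsilon> + \<omega>" for x
  proof -
    have "\<bar>\<epsilon> * cos x\<bar> \<le> \<epsilon>" "\<bar>\<omega> * sin x\<bar> \<le> \<omega>" "\<bar>\<epsilon> * sin x\<bar> \<le> \<epsilon>" "\<bar>\<omega> * cos x\<bar> \<le> \<omega>"
      using eps \<omega>_pos by (simp_all add: abs_mult mult_left_le)
    then show "\<bar>\<epsilon> * cos x + \<omega> * sin x\<bar> \<le> \<epsilon> + \<omega>" "\<bar>\<epsilon> * sin x - \<omega> * cos x\<bar> \<le> \<epsilon> + \<omega>" by linarith+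
  qed
  have "norm (w' s) = s powr \<epsilon> / s * norm ((\<epsilon> * cos (angle (stage s) s) + \<omega> * sin (angle (stage s) s)) *\<^sub>R X (stage s)
     + (\<epsilon> * sin (angle (stage s) s) - \<omega> * cos (angle (stage s) s)) *\<^sub>R X (Suc (stage s)))"
    using assms by (simp add: w'_def piece'_def)
  also have "\<dots> \<le> 1 / s * (3 * (\<epsilon> + \<omega>) * C0 * s powr (- 1 / 2))"
    using assms powr_eps_le_1[of s] by (intro mult_mono norm_X_pair_le b divide_right_mono) auto
  finally show ?thesis .
qed

lemma norm_h1_to_hm1_w_le:
  assumes "0 \<le> s" "s \<le> 1"
  shows "norm (h1_to_hm1 (w s)) \<le> 2 * C0"
proof -
  interpret I: bounded_linear "h1_to_hm1 :: 'd h1 \<Rightarrow> _" by (rule bounded_linear_h1_to_hm1)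
  let ?n = "stage s"
  have "norm (h1_to_hm1 (w s)) = s powr \<epsilon> * norm (cos (angle ?n s) *\<^sub>R h1_to_hm1 (X ?n) + sin (angle ?n s) *\<^sub>R h1_to_hm1 (X (Suc ?n)))"
    by (simp add: w_def piece_def I.scaleR I.add)
  also have "\<dots> \<le> 1 * (1 * C0 + 1 * C0)"
  proof (rule mult_mono)
    have "norm (cos (angle ?n s) *\<^sub>R h1_to_hm1 (X ?n) + sin (angle ?n s) *\<^sub>R h1_to_hm1 (X (Suc ?n)))
       \<le> \<bar>cos (angle ?n s)\<bar> * norm (h1_to_hm1 (X ?n)) + \<bar>sin (angle ?n s)\<bar> * norm (h1_to_hm1 (X (Suc ?n)))"
      by (rule order_trans[OF norm_triangle_ineq]) simp
    also have "\<dots> \<le> 1 * C0 + 1 * C0"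
      by (intro add_mono mult_mono norm_h1_to_hm1_X) auto
    finally show "norm (cos (angle ?n s) *\<^sub>R h1_to_hm1 (X ?n) + sin (angle ?n s) *\<^sub>R h1_to_hm1 (X (Suc ?n))) \<le> 1 * C0 + 1 * C0" .
  qed (use powr_eps_le_1 assms in auto)
  finally show ?thesis by simp
qed

lemma energy_density_ge:
  obtains c s0 where "c > 0" "0 < s0" "s0 \<le> 1"
    "\<And>s. 0 < s \<Longrightarrow> s \<le> s0 \<Longrightarrow> c * s powr (2 * \<epsilon> - 1) \<le> - pairing (A (w s)) (w s)"
proof -
  let ?c0 = "(l2norm (cutoff :: real^'d \<Rightarrow> complex))\<^sup>2" and ?b = "(cutoff_bound TYPE('d))\<^sup>2"
  have c0: "?c0 > 0" using l2norm_cutoff_pos[where 'd = 'd] by simp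
  \<comment> \<open>For \<open>s \<le> s0\<close> the frequency is so high that the derivatives of the cutoff cost at most half of the energy.\<close>
  define s0 where "s0 = min 1 (?c0 / (64 * (?b + 1)))"
  have b0: "0 \<le> ?b" by simp
  have b1: "0 < 64 * (?b + 1)" by (intro mult_pos_pos add_nonneg_pos b0) auto
  have s0: "0 < s0" "s0 \<le> 1" using c0 b1 by (auto simp: s0_def simp del: distrib_left_numeral)
  show ?thesis
  proof (rule that[of "?c0 / 16" s0])
    show "?c0 / 16 > 0" using c0 by simp
    fix s assume s: "0 < s" "s \<le> s0"
    then have s1: "s \<le> 1" using s0 by simp
    let ?n = "stage s" and ?r = "s powr \<epsilon>"
    have w: "w s = (?r * cos (angle ?n s)) *\<^sub>R wave (2 ^ ?n) (dir ?n) + (?r * sin (angle ?n s)) *\<^sub>R wave (2 ^ Suc ?n) (dir (Suc ?n))"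
      by (simp add: w_def piece_def X_def scaleR_add_right)
    have four: "((2 :: real) ^ ?n)\<^sup>2 = 4 ^ ?n" by (simp add: power2_eq_square flip: power_mult_distrib)
    have "(?r * cos (angle ?n s))\<^sup>2 + (?r * sin (angle ?n s))\<^sup>2 = ?r\<^sup>2"
      by (simp add: power_mult_distrib flip: distrib_left)
    then have "?r\<^sup>2 * (4 ^ ?n / 2 * ?c0 - 4 * ?b) \<le> - pairing (A (w s)) (w s)"
      using grad_wave_pair_ge[OF dir_Suc[of ?n], of "2 ^ ?n" "2 ^ Suc ?n" "?r * cos (angle ?n s)" "?r * sin (angle ?n s)"]
      unfolding w[symmetric] four by (simp add: A_def pairing_laplace_self)
    moreover have "?c0 / (16 * s) \<le> 4 ^ ?n / 2 * ?c0 - 4 * ?b"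
    proof -
      have "s \<le> ?c0 / (64 * (?b + 1))" using s by (simp add: s0_def)
      then have "s * (64 * (?b + 1)) \<le> ?c0" using b1 by (simp only: pos_le_divide_eq)
      then have "64 * ?b * s \<le> ?c0" using s(1) b0 by (simp add: algebra_simps)
      then have 1: "4 * ?b \<le> ?c0 / (16 * s)" using s(1) by (simp add: field_simps)
      have "1 / (4 * s) * (?c0 / 2) \<le> 4 ^ ?n * (?c0 / 2)"
        using four_stage(4)[OF s(1) s1] c0 by (intro mult_right_mono) auto
      then have "?c0 / (8 * s) \<le> 4 ^ ?n / 2 * ?c0" by simp
      moreover have "?c0 / (8 * s) = ?c0 / (16 * s) + ?c0 / (16 * s)" using s(1) by (simp add: field_simps)
      ultimately show ?thesis using 1 by linarith
    qed
    ultimately have "?r\<^sup>2 * (?c0 / (16 * s)) \<le> - pairing (A (w s)) (w s)"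
      using mult_left_mono[of "?c0 / (16 * s)" _ "?r\<^sup>2"] by (meson order_trans zero_le_power2)
    moreover have "?r\<^sup>2 * (?c0 / (16 * s)) = ?c0 / 16 * s powr (2 * \<epsilon> - 1)"
      using s(1) by (simp add: powr_diff power2_eq_square flip: powr_add)
    ultimately show "?c0 / 16 * s powr (2 * \<epsilon> - 1) \<le> - pairing (A (w s)) (w s)" by (simp only:)
  qed (use s0 in auto)
qed

lemma pairing_A_self_nonpos: "pairing (A v) v \<le> 0" "- pairing (A v) v \<le> (norm v)\<^sup>2"
  unfolding A_def pairing_laplace_self norm_h1_sq by (auto intro!: integral_nonneg)

lemma measurable_stage [measurable]: "stage \<in> measurable borel (count_space UNIV)"
  unfolding stage_def[abs_def] by measurable

lemma measurable_angle: "(\<lambda>s. angle n s) \<in> borel_measurable borel"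
  unfolding angle_def by measurable

lemma measurable_angle_stage [measurable]: "(\<lambda>s. angle (stage s) s) \<in> borel_measurable borel"
  by (rule measurable_compose_countable[OF measurable_angle measurable_stage])

lemma measurable_w [measurable]: "w \<in> borel_measurable borel" and measurable_w' [measurable]: "w' \<in> borel_measurable borel"
proof -
  have [measurable]: "(\<lambda>s. X (f s)) \<in> borel_measurable borel" if "f \<in> measurable borel (count_space UNIV)" for f :: "real \<Rightarrow> nat"
    using measurable_compose[OF that, of X borel] by simp
  have [measurable]: "(\<lambda>s. X (stage s)) \<in> borel_measurable borel" "(\<lambda>s. X (Suc (stage s))) \<in> borel_measurable borel"
    by measurable
  show "w \<in> borel_measurable borel" "w' \<in> borel_measurable borel"
    unfolding w_def[abs_def] piece_def w'_def[abs_def] piece'_def by measurable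
qed

lemma measurable_coefficients [measurable]: "\<mu> \<in> borel_measurable borel" "\<kappa> \<in> borel_measurable borel"
proof -
  have [measurable]: "(\<lambda>s. (4 :: real) ^ stage s) \<in> borel_measurable borel"
    using measurable_compose[OF measurable_stage, of "\<lambda>n. (4 :: real) ^ n" borel] by simp
  show m [measurable]: "\<mu> \<in> borel_measurable borel" unfolding \<mu>_def[abs_def] by measurable
  show "\<kappa> \<in> borel_measurable borel" unfolding \<kappa>_def[abs_def] by measurable
qed

lemma measurable_A [measurable (raw)]: "u \<in> borel_measurable M \<Longrightarrow> (\<lambda>t. A (u t)) \<in> borel_measurable M"
  using measurable_compose[OF _ borel_measurable_continuous_onI[OF linear_continuous_on[OF bounded_linear_A]]] .

lemma measurable_K_stage:
  assumes "g \<in> borel_measurable M" "u \<in> borel_measurable M"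
  shows "(\<lambda>t. K (stage (g t)) (u t)) \<in> borel_measurable M"
proof (rule measurable_compose_countable[where f = "\<lambda>n t. K n (u t)" and g = "\<lambda>t. stage (g t)"])
  show "(\<lambda>t. K n (u t)) \<in> borel_measurable M" for n
    using measurable_compose[OF assms(2) borel_measurable_continuous_onI[OF linear_continuous_on[OF bounded_linear_K]]] .
  show "(\<lambda>t. stage (g t)) \<in> measurable M (count_space UNIV)"
    using measurable_compose[OF assms(1) measurable_stage] .
qed

lemma measurable_residual [measurable]: "residual \<in> borel_measurable borel"
proof -
  have [measurable]: "(\<lambda>s. h1_to_hm1 (w' s)) \<in> borel_measurable borel"
    using measurable_compose[OF measurable_w' borel_measurable_continuous_onI[OF linear_continuous_on[OF bounded_linear_h1_to_hm1]]] .
  have [measurable]: "(\<lambda>s. K (stage s) (w s)) \<in> borel_measurable borel"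
    by (rule measurable_K_stage) measurable
  show ?thesis unfolding residual_def[abs_def] by measurable
qed

lemma piece_has_derivative:
  assumes "s > 0"
  shows "(piece n has_vector_derivative piece' n s) (at s within T)"
proof -
  have an: "(angle n has_real_derivative - \<omega> / s) (at s within T)"
    unfolding angle_def[abs_def] \<omega>_def using assms by (auto intro!: derivative_eq_intros simp: field_simps)
  have p: "((\<lambda>s. s powr \<epsilon>) has_real_derivative \<epsilon> * (s powr \<epsilon> / s)) (at s within T)"
    using assms by (auto intro!: derivative_eq_intros simp: powr_diff)
  have c: "((\<lambda>s. s powr \<epsilon> * cos (angle n s)) has_real_derivative s powr \<epsilon> / s * (\<epsilon> * cos (angle n s) + \<omega> * sin (angle n s))) (at s within T)"
    by (rule derivative_eq_intros p an refl)+ (simp add: algebra_simps)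
  have z: "((\<lambda>s. s powr \<epsilon> * sin (angle n s)) has_real_derivative s powr \<epsilon> / s * (\<epsilon> * sin (angle n s) - \<omega> * cos (angle n s))) (at s within T)"
    by (rule derivative_eq_intros p an refl)+ (simp add: algebra_simps)
  have "((\<lambda>s. (s powr \<epsilon> * cos (angle n s)) *\<^sub>R X n + (s powr \<epsilon> * sin (angle n s)) *\<^sub>R X (Suc n)) has_vector_derivative
     (s powr \<epsilon> / s * (\<epsilon> * cos (angle n s) + \<omega> * sin (angle n s))) *\<^sub>R X n
     + (s powr \<epsilon> / s * (\<epsilon> * sin (angle n s) - \<omega> * cos (angle n s))) *\<^sub>R X (Suc n)) (at s within T)"
    using has_vector_derivative_add[OF has_vector_derivative_scaleR[OF c has_vector_derivative_const[of "X n"]]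
        has_vector_derivative_scaleR[OF z has_vector_derivative_const[of "X (Suc n)"]]] by simp
  then show ?thesis by (simp add: piece_def[abs_def] piece'_def scaleR_add_right)
qed

lemma w_eq_piece:
  assumes "1 / 4 ^ Suc n \<le> s" "s \<le> 1 / 4 ^ n"
  shows "w s = piece n s"
proof (cases "s = 1 / 4 ^ Suc n")
  case False
  then show ?thesis using stage_eq[of n s] assms by (simp add: w_def)
next
  case True
  have "stage s = Suc n" using True by (intro stage_eq) (auto simp: field_simps)
  moreover have "angle (Suc n) s = 0" "angle n s = pi / 2"
    unfolding angle_def True by (simp_all add: ln_div ln_realpow del: power_Suc)
  ultimately show ?thesis by (simp only: w_def piece_def cos_zero sin_zero cos_pi_half sin_pi_half) simp
qed

lemma continuous_on_w: "continuous_on {1 / 4 ^ m..1} w"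
proof (induction m)
  case 0
  show ?case by simp
next
  case (Suc m)
  have "continuous_on {1 / 4 ^ Suc m..1 / 4 ^ m} (piece m)"
    unfolding continuous_on_eq_continuous_within
  proof
    fix s :: real assume "s \<in> {1 / 4 ^ Suc m..1 / 4 ^ m}"
    then have "s > 0" by (auto intro: less_le_trans[of 0 "1 / 4 ^ Suc m"] simp del: power_Suc)
    then show "continuous (at s within {1 / 4 ^ Suc m..1 / 4 ^ m}) (piece m)"
      by (rule has_vector_derivative_continuous[OF piece_has_derivative])
  qed
  then have "continuous_on {1 / 4 ^ Suc m..1 / 4 ^ m} w"
    by (rule continuous_on_eq) (rule w_eq_piece[symmetric], auto simp del: power_Suc)
  then have "continuous_on ({1 / 4 ^ Suc m..1 / 4 ^ m} \<union> {1 / 4 ^ m..1}) w"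
    using Suc by (intro continuous_on_closed_Un) auto
  moreover have "{1 / 4 ^ Suc m..1 / 4 ^ m} \<union> {1 / 4 ^ m..1} = {1 / 4 ^ Suc m..(1 :: real)}"
    by (intro ivl_disj_un_two_touch) (auto simp: field_simps)
  ultimately show ?case by simp
qed

text \<open>The scalar functions \<open>\<lambda>s. w s \<bullet> z\<close> are continuous and, off the finitely many ends of stages in the
  interval, differentiable, so the classical fundamental theorem applies to them.\<close>

lemma w_fundamental_theorem:
  assumes "0 < a" "a \<le> b" "b \<le> 1"
  shows "set_integrable lborel {a..b} w'" "w b = w a + (LINT s:{a..b}|lborel. w' s)"
proof -
  have "norm (w' s) \<le> 1 / a * (3 * (\<epsilon> + \<omega>) * C0 * a powr (- 1 / 2))" if "s \<in> {a..b}" for s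
  proof -
    have "norm (w' s) \<le> 1 / s * (3 * (\<epsilon> + \<omega>) * C0 * s powr (- 1 / 2))"
      using norm_w'_le[of s] that assms by simp
    also have "\<dots> \<le> 1 / a * (3 * (\<epsilon> + \<omega>) * C0 * a powr (- 1 / 2))"
      using that assms eps \<omega>_pos C0_nonneg
      by (intro mult_mono divide_left_mono powr_mono2') auto
    finally show ?thesis .
  qed
  then show int: "set_integrable lborel {a..b} w'"
    by (intro set_integrable_bounded_interval measurable_w')
  obtain m where m: "1 / 4 ^ m < a" using real_arch_pow_inv[of a "1/4"] assms by (auto simp: power_divide)
  have "(w b - w a - (LINT s:{a..b}|lborel. w' s)) \<bullet> z = 0" for z
  proof -
    define S where "S = (\<lambda>k. 1 / (4 :: real) ^ k) ` {..Suc m}"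
    have "((\<lambda>s. w' s \<bullet> z) has_integral (w b \<bullet> z - w a \<bullet> z)) {a..b}"
    proof (rule fundamental_theorem_of_calculus_interior_strong[of S])
      show "finite S" by (simp add: S_def)
      show "continuous_on {a..b} (\<lambda>s. w s \<bullet> z)"
        using m assms by (intro continuous_on_inner continuous_on_const continuous_on_subset[OF continuous_on_w[of m]]) auto
      fix s assume s: "s \<in> {a<..<b} - S"
      then have s01: "0 < s" "s \<le> 1" using assms by auto
      define n where "n = stage s"
      note sb = stage_bounds[OF s01, folded n_def]
      have "s \<noteq> 1 / 4 ^ n"
      proof
        assume e: "s = 1 / 4 ^ n"
        have "1 / 4 ^ m < 1 / (4 :: real) ^ n" using m s e by auto
        then have "(4 :: real) ^ n < 4 ^ m" by (simp add: field_simps)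
        then have "n < m" by simp
        then show False using s e by (auto simp: S_def)
      qed
      then have sn: "s \<in> {1 / 4 ^ Suc n<..<1 / 4 ^ n}" using sb by auto
      have "(piece n has_vector_derivative w' s) (at s)"
        using piece_has_derivative[OF s01(1), of n UNIV] by (simp add: w'_def n_def)
      then have "(w has_vector_derivative w' s) (at s)"
        by (rule has_vector_derivative_transform_within_open[OF _ open_greaterThanLessThan sn])
           (rule w_eq_piece[symmetric], auto simp del: power_Suc)
      then show "((\<lambda>s. w s \<bullet> z) has_vector_derivative w' s \<bullet> z) (at s)"
        by (rule bounded_linear.has_vector_derivative[OF bounded_linear_inner_left])
    qed (use assms in simp)
    moreover have iz: "set_integrable lborel {a..b} (\<lambda>s. w' s \<bullet> z)"
      using integrable_bounded_linear[OF bounded_linear_inner_left int[unfolded set_integrable_def], of z]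
      by (simp add: set_integrable_def)
    ultimately have "w b \<bullet> z - w a \<bullet> z = (LINT s:{a..b}|lborel. w' s \<bullet> z)"
      using set_borel_integral_eq_integral(2)[OF iz] by (simp add: integral_unique)
    also have "\<dots> = (LINT s:{a..b}|lborel. w' s) \<bullet> z"
      using integral_bounded_linear[OF bounded_linear_inner_left int[unfolded set_integrable_def], of z]
      by (simp add: set_lebesgue_integral_def)
    finally show ?thesis by (simp add: inner_diff_left)
  qed
  from this[of "w b - w a - (LINT s:{a..b}|lborel. w' s)"]
  have "w b - w a - (LINT s:{a..b}|lborel. w' s) = 0" by (simp only: inner_eq_zero_iff)
  then show "w b = w a + (LINT s:{a..b}|lborel. w' s)" by (simp add: algebra_simps)
qed

text \<open>For \<open>\<sigma> = 1\<close> these are the coefficients of the equation that \<open>w\<close> solves; \<open>\<sigma> = - 1\<close> gives their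
  adjoint.\<close>

definition B :: "real \<Rightarrow> real \<Rightarrow> real^'d \<Rightarrow> complex^'d^'d" where
  "B \<sigma> s x = \<mu> s *\<^sub>R mat 1 + (\<sigma> * \<kappa> s) *\<^sub>R Kmat (stage s) x"

lemma div_grad_B: "div_grad (B \<sigma> s) v = \<mu> s *\<^sub>R A v + (\<sigma> * \<kappa> s) *\<^sub>R K (stage s) v"
  unfolding B_def[abs_def] A_def K_def by (rule div_grad_combine[OF bounded_coeff_mat_1 bounded_coeff_Kmat])

lemma coefficient_bounds:
  assumes "s \<in> {0..1}"
  shows "min 1 (\<epsilon> / 4) \<le> \<mu> s" "\<mu> s \<le> 1 + 4 * \<epsilon>" "\<bar>\<kappa> s\<bar> \<le> 2 * \<omega> + 6 * \<epsilon>"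
  using \<mu>_bounds[of s] assms eps \<omega>_pos by (auto simp: \<mu>_def \<kappa>_def)

lemma elliptic_B:
  assumes \<sigma>: "\<bar>\<sigma>\<bar> = 1" and g: "g \<in> borel_measurable borel" "g \<in> {0..1} \<rightarrow> {0..1}"
  shows "elliptic (\<lambda>t. B \<sigma> (g t))"
  unfolding elliptic_def
proof (rule conjI, goal_cases)
  case 1
  have fstm: "(\<lambda>z :: real \<times> (real^'d). g (fst z)) \<in> borel_measurable borel"
    using measurable_compose[OF borel_measurable_continuous_onI[OF continuous_on_fst[OF continuous_on_id]] g(1)] by simp
  have km: "(\<lambda>z :: real \<times> (real^'d). Kmat (stage (g (fst z))) (snd z)) \<in> borel_measurable borel"
  proof (rule measurable_compose_countable[where f = "\<lambda>n z. Kmat n (snd z)" and g = "\<lambda>z. stage (g (fst z))"])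
    show "(\<lambda>z :: real \<times> (real^'d). Kmat n (snd z)) \<in> borel_measurable borel" for n
      unfolding Kmat_def
      by (intro borel_measurable_continuous_onI continuous_on_compose2[OF continuous_coupling] continuous_intros) auto
    show "(\<lambda>z :: real \<times> (real^'d). stage (g (fst z))) \<in> measurable borel (count_space UNIV)"
      using measurable_compose[OF fstm measurable_stage] .
  qed
  note [measurable] = measurable_compose[OF fstm measurable_coefficients(1)] measurable_compose[OF fstm measurable_coefficients(2)] km
  have "(\<lambda>(t, x). B \<sigma> (g t) x) \<in> borel_measurable borel"
    unfolding B_def split_beta by measurable
  then show ?case by (rule measurable_restrict_space1)
next
  case 2
  show ?case
  proof (rule exI[of _ "1 + 4 * \<epsilon> + (2 * \<omega> + 6 * \<epsilon>)"], rule conjI[rotated], rule exI[of _ "min 1 (\<epsilon> / 4)"],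
      intro conjI ballI allI)
  show "0 < 1 + 4 * \<epsilon> + (2 * \<omega> + 6 * \<epsilon>)" "0 < min 1 (\<epsilon> / 4)" using eps \<omega>_pos by auto
  fix t :: real and x :: "real^'d" and \<xi> assume t: "t \<in> {0..1}"
  let ?k = "coupling (2 ^ stage (g t)) (dir (stage (g t))) (2 ^ Suc (stage (g t))) (dir (Suc (stage (g t)))) x *v \<xi>"
  have mult: "B \<sigma> (g t) x *v \<xi> = \<mu> (g t) *\<^sub>R \<xi> + (\<sigma> * \<kappa> (g t)) *\<^sub>R ?k"
  proof -
    have "(a *\<^sub>R P + b *\<^sub>R Q) *v \<xi> = a *\<^sub>R (P *v \<xi>) + b *\<^sub>R (Q *v \<xi>)" for a b and P Q :: "complex^'d^'d"
      by (simp add: matrix_vector_mult_def vec_eq_iff scaleR_sum_right sum.distrib distrib_right)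
    then show ?thesis by (simp add: B_def Kmat_def)
  qed
  note cb = coefficient_bounds[OF funcset_mem[OF g(2) t]]
  have mu0: "0 \<le> \<mu> (g t)" using cb(1) eps by (auto simp: min_def split: if_splits)
  have "norm (B \<sigma> (g t) x *v \<xi>) \<le> \<bar>\<mu> (g t)\<bar> * norm \<xi> + \<bar>\<sigma> * \<kappa> (g t)\<bar> * norm ?k"
    unfolding mult by (rule order_trans[OF norm_triangle_ineq]) simp
  also have "\<dots> \<le> (1 + 4 * \<epsilon>) * norm \<xi> + (2 * \<omega> + 6 * \<epsilon>) * norm \<xi>"
    using cb mu0 \<sigma> eps \<omega>_pos by (intro add_mono mult_mono norm_coupling_le dir_Suc) (auto simp: abs_mult)
  finally show "norm (B \<sigma> (g t) x *v \<xi>) \<le> (1 + 4 * \<epsilon> + (2 * \<omega> + 6 * \<epsilon>)) * norm \<xi>" by (simp add: algebra_simps)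
  have "Re (cdot (B \<sigma> (g t) x *v \<xi>) \<xi>) = \<mu> (g t) * (norm \<xi>)\<^sup>2"
    unfolding mult by (simp add: cdot_linear cdot_self Re_cdot_coupling_self[OF dir_Suc] del: of_real_power)
  then show "Re (cdot (B \<sigma> (g t) x *v \<xi>) \<xi>) \<ge> min 1 (\<epsilon> / 4) * (norm \<xi>)\<^sup>2"
    using mult_right_mono[OF cb(1), of "(norm \<xi>)\<^sup>2"] by simp
  qed
qed

lemma pairing_div_grad_B_adjoint: "pairing (div_grad (B \<sigma> s) v) u = pairing (div_grad (B (- \<sigma>) s) u) v"
  by (simp add: div_grad_B pairing.add_left pairing.diff_left pairing.scaleR_left pairing_A_sym[of v u] pairing_K_antisym[of _ v u])

end

section \<open>Calculus in Bochner spaces on the unit interval\<close>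

lemma integrable_I01_iff:
  fixes f :: "real \<Rightarrow> 'a::{banach,second_countable_topology}"
  shows "integrable I01 f \<longleftrightarrow> set_integrable lborel {0..1} f"
  by (simp add: integrable_restrict_space set_integrable_def)

lemma integral_I01:
  fixes f :: "real \<Rightarrow> 'a::{banach,second_countable_topology}"
  shows "(LINT t|I01. f t) = (LINT t:{0..1}|lborel. f t)"
  by (simp add: integral_restrict_space set_lebesgue_integral_def)

lemma AE_I01_iff: "(AE t in I01. P t) \<longleftrightarrow> (AE t in lborel. t \<in> {0..1} \<longrightarrow> P t)"
  by (simp add: AE_restrict_space_iff)

lemma finite_measure_I01: "finite_measure I01"
  by (rule finite_measureI) (simp add: emeasure_restrict_space space_restrict_space)

lemma integrable_I01_const: "integrable I01 (\<lambda>_. c :: 'a::{banach,second_countable_topology})"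
  using finite_measure.integrable_const[OF finite_measure_I01] .

lemma borel_measurable_I01: "f \<in> borel_measurable borel \<Longrightarrow> f \<in> borel_measurable I01"
  by (simp add: measurable_restrict_space1)

lemma set_integrable_subinterval:
  fixes f :: "real \<Rightarrow> 'a::{banach,second_countable_topology}"
  assumes "integrable I01 f" "0 \<le> a" "b \<le> (1::real)"
  shows "set_integrable lborel {a..b} f"
  by (rule set_integrable_subset[of lborel "{0..1}"]) (use assms in \<open>auto simp: integrable_I01_iff\<close>)

lemma integrable_I01_bound:
  fixes f :: "real \<Rightarrow> 'a::{banach,second_countable_topology}" and g :: "real \<Rightarrow> real"
  assumes "integrable I01 g" "f \<in> borel_measurable I01" "\<And>t. t \<in> {0..1} \<Longrightarrow> norm (f t) \<le> g t"
  shows "integrable I01 f"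
proof (rule Bochner_Integration.integrable_bound[OF assms(1,2)])
  show "AE t in I01. norm (f t) \<le> norm (g t)"
    unfolding AE_I01_iff using assms(3) by (force intro!: AE_I2)
qed

lemma Lp01_bound:
  fixes f :: "real \<Rightarrow> 'a::{banach,second_countable_topology}"
  assumes u: "u \<in> Lp01 p" and f: "f \<in> borel_measurable I01" and p: "0 < p" and C: "0 \<le> C"
    and le: "\<And>t. t \<in> {0..1} \<Longrightarrow> norm (f t) \<le> C * norm (u t)"
  shows "f \<in> Lp01 p"
proof -
  have "integrable I01 (\<lambda>t. norm (f t) powr p)"
  proof (rule integrable_I01_bound)
    show "integrable I01 (\<lambda>t. C powr p * norm (u t) powr p)" using u by (simp add: Lp01_def)
    show "(\<lambda>t. norm (f t) powr p) \<in> borel_measurable I01" using f by measurable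
    show "norm (norm (f t) powr p) \<le> C powr p * norm (u t) powr p" if "t \<in> {0..1}" for t
      using powr_mono2[of p "norm (f t)" "C * norm (u t)"] le[OF that] p C by (simp add: powr_mult)
  qed
  then show ?thesis using f by (simp add: Lp01_def)
qed

lemma Lp01_bounded:
  fixes f :: "real \<Rightarrow> 'a::{banach,second_countable_topology}"
  assumes "f \<in> borel_measurable I01" "\<And>t. t \<in> {0..1} \<Longrightarrow> norm (f t) \<le> C" "0 < p"
  shows "f \<in> Lp01 p"
proof (rule Lp01_bound[of "\<lambda>_. 1 :: real"])
  show "(\<lambda>_. 1 :: real) \<in> Lp01 p" by (simp add: Lp01_def integrable_I01_const)
  show "0 \<le> C" using assms(2)[of 0] order_trans[OF norm_ge_zero[of "f 0"]] by simp
qed (use assms in auto)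

lemma Lp01_add:
  fixes f g :: "real \<Rightarrow> 'a::{banach,second_countable_topology}"
  assumes "f \<in> Lp01 p" "g \<in> Lp01 p" "0 < p"
  shows "(\<lambda>t. f t + g t) \<in> Lp01 p"
proof -
  have [measurable]: "f \<in> borel_measurable I01" "g \<in> borel_measurable I01" using assms by (auto simp: Lp01_def)
  have "integrable I01 (\<lambda>t. norm (f t + g t) powr p)"
  proof (rule integrable_I01_bound)
    show "integrable I01 (\<lambda>t. 2 powr p * (norm (f t) powr p + norm (g t) powr p))"
      using assms by (simp add: Lp01_def)
    fix t
    have "norm (f t + g t) \<le> 2 * max (norm (f t)) (norm (g t))" using norm_triangle_ineq[of "f t" "g t"] by linarith
    then have "norm (f t + g t) powr p \<le> (2 * max (norm (f t)) (norm (g t))) powr p" using assms(3) by (intro powr_mono2) auto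
    also have "\<dots> = 2 powr p * max (norm (f t)) (norm (g t)) powr p" by (rule powr_mult)
    also have "\<dots> \<le> 2 powr p * (norm (f t) powr p + norm (g t) powr p)"
      by (intro mult_left_mono) (auto simp: max_def)
    finally show "norm (norm (f t + g t) powr p) \<le> 2 powr p * (norm (f t) powr p + norm (g t) powr p)" by simp
  qed measurable
  then show ?thesis by (simp add: Lp01_def)
qed

lemma Lp01_mono:
  assumes "u \<in> Lp01 p" "0 < q" "q \<le> p"
  shows "u \<in> Lp01 q"
proof -
  have [measurable]: "u \<in> borel_measurable I01" using assms by (auto simp: Lp01_def)
  have "integrable I01 (\<lambda>t. norm (u t) powr q)"
  proof (rule integrable_I01_bound)
    show "integrable I01 (\<lambda>t. 1 + norm (u t) powr p)"
      using assms integrable_I01_const[of "1 :: real"] by (simp add: Lp01_def)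
    show "norm (norm (u t) powr q) \<le> 1 + norm (u t) powr p" for t
    proof (cases "norm (u t) \<le> 1")
      case True
      then have "norm (u t) powr q \<le> 1" using assms by (intro powr_le1) auto
      then show ?thesis by (simp add: add_increasing2)
    next
      case False
      then have "norm (u t) powr q \<le> norm (u t) powr p" using assms by (intro powr_mono) auto
      then show ?thesis by simp
    qed
  qed measurable
  then show ?thesis by (simp add: Lp01_def)
qed

lemma Lp01_integrable:
  assumes "u \<in> Lp01 p" "1 \<le> p"
  shows "integrable I01 u"
proof -
  have "u \<in> Lp01 1" by (rule Lp01_mono[OF assms(1)]) (use assms in auto)
  then have "u \<in> borel_measurable I01" "integrable I01 (\<lambda>t. norm (u t))" by (auto simp: Lp01_def)
  then show ?thesis by (simp add: integrable_norm_iff)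
qed

lemma Lp01_cong_AE:
  assumes "u \<in> Lp01 p" "v \<in> borel_measurable I01" "AE t in I01. v t = u t"
  shows "v \<in> Lp01 p"
proof -
  have [measurable]: "u \<in> borel_measurable I01" "v \<in> borel_measurable I01" using assms by (auto simp: Lp01_def)
  have "integrable I01 (\<lambda>t. norm (v t) powr p) \<longleftrightarrow> integrable I01 (\<lambda>t. norm (u t) powr p)"
  proof (rule integrable_cong_AE)
    show "AE t in I01. norm (v t) powr p = norm (u t) powr p" using assms(3) by eventually_elim simp
  qed measurable
  then show ?thesis using assms by (simp add: Lp01_def)
qed

lemma reflect_I01:
  fixes f :: "real \<Rightarrow> 'a::{banach,second_countable_topology}"
  assumes "integrable I01 f"
  shows "integrable I01 (\<lambda>t. f (1 - t))"
proof -
  have "integrable lborel (\<lambda>t. indicator {0..1} t *\<^sub>R f t)"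
    using assms by (simp add: integrable_I01_iff set_integrable_def)
  from lborel_integrable_real_affine[OF this, of "-1" 1]
  have "integrable lborel (\<lambda>t. indicator {0..1} (1 - t) *\<^sub>R f (1 - t))" by simp
  moreover have "indicator {0..1} (1 - t) = (indicator {0..1} t :: real)" for t :: real
    by (auto split: split_indicator)
  ultimately show ?thesis by (simp add: integrable_I01_iff set_integrable_def)
qed

lemma reflect_set_integral:
  fixes f :: "real \<Rightarrow> 'a::{banach,second_countable_topology}"
  shows "(LINT s:{1 - t..1}|lborel. f s) = (LINT r:{0..t}|lborel. f (1 - r))"
proof -
  have "(LINT s|lborel. indicator {1 - t..1} s *\<^sub>R f s) = (LINT r|lborel. indicator {1 - t..1} (1 - r) *\<^sub>R f (1 - r))"
    using lborel_integral_real_affine[of "-1" "\<lambda>s. indicator {1 - t..1} s *\<^sub>R f s" 1] by simp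
  moreover have "indicator {1 - t..1} (1 - r) = (indicator {0..t} r :: real)" for r
    by (auto split: split_indicator)
  ultimately show ?thesis by (simp add: set_lebesgue_integral_def)
qed

lemma inverse_eq_powr: "0 < (s :: real) \<Longrightarrow> 1 / s = s powr (- 1)"
  by (simp add: powr_minus_divide)

lemma set_integral_split_Icc:
  fixes g :: "real \<Rightarrow> 'a::{banach,second_countable_topology}"
  assumes g: "integrable I01 g" and ab: "0 \<le> a" "a \<le> b" "b \<le> 1"
  shows "(LINT s:{0..b}|lborel. g s) = (LINT s:{0..a}|lborel. g s) + (LINT s:{a..b}|lborel. g s)"
proof -
  have sub: "set_integrable lborel S g" if "S \<subseteq> {0..1}" "S \<in> sets lborel" for S
    using g that set_integrable_subset[of lborel "{0..1}" g S] by (simp add: integrable_I01_iff)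
  have split: "(LINT s:{c..b}|lborel. g s) = (LINT s:{c..a}|lborel. g s) + (LINT s:{a<..b}|lborel. g s)"
    if "0 \<le> c" "c \<le> a" for c
  proof -
    have "{c..b} = {c..a} \<union> {a<..b}" using that ab by auto
    moreover have "(LINT s:{c..a} \<union> {a<..b}|lborel. g s) = (LINT s:{c..a}|lborel. g s) + (LINT s:{a<..b}|lborel. g s)"
      by (intro set_integral_Un sub) (use that ab in auto)
    ultimately show ?thesis by simp
  qed
  have "(LINT s:{a<..b}|lborel. g s) = (LINT s:{a..b}|lborel. g s)"
    using split[of a] ab(1) unfolding set_integral_singleton_lborel by simp
  then show ?thesis using split[of 0] ab(1) by simp
qed

text \<open>A weak form of Hoelder's inequality with the optimal power of the length. It rests on the
  pointwise bound of \<open>x\<close> by \<open>\<delta> powr (1 - 1 / p) * (x powr p + 1 / \<delta>)\<close>, in which one of the two terms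
  suffices according to the size of \<open>x\<close>.\<close>

lemma Lp01_integral_short_interval:
  fixes g :: "real \<Rightarrow> 'a::{banach,second_countable_topology}"
  assumes p: "1 < p" and gp: "g \<in> Lp01 p" and \<delta>: "0 < \<delta>" "\<delta> \<le> 1"
  shows "(LINT t:{0..\<delta>}|lborel. norm (g t)) \<le> \<delta> powr (1 - 1 / p) * ((LINT t|I01. norm (g t) powr p) + 1)"
proof -
  have gi: "integrable I01 g" using Lp01_integrable[OF gp] p by simp
  have young: "x \<le> \<delta> powr (1 - 1 / p) * (x powr p + 1 / \<delta>)" if x: "0 \<le> x" for x
  proof (cases "x \<le> \<delta> powr (- 1 / p)")
    case True
    have "\<delta> powr (1 - 1 / p) * (1 / \<delta>) = \<delta> powr (- 1 / p)"
      unfolding inverse_eq_powr[OF \<delta>(1)] powr_add[symmetric] by simp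
    moreover have "0 \<le> \<delta> powr (1 - 1 / p) * x powr p" by simp
    ultimately show ?thesis using True unfolding distrib_left by linarith
  next
    case False
    moreover have "0 < \<delta> powr (- 1 / p)" using \<delta> by simp
    ultimately have xp: "0 < x" "\<delta> powr (- 1 / p) \<le> x" by linarith+
    have "1 = \<delta> powr (1 - 1 / p) * (\<delta> powr (- 1 / p)) powr (p - 1)"
    proof -
      have "1 - 1 / p + - 1 / p * (p - 1) = 0" using p by (simp add: field_simps)
      then show ?thesis unfolding powr_powr powr_add[symmetric] using \<delta> by simp
    qed
    also have "\<dots> \<le> \<delta> powr (1 - 1 / p) * x powr (p - 1)"
      using xp p by (intro mult_left_mono powr_mono2) auto
    finally have "1 * x \<le> \<delta> powr (1 - 1 / p) * x powr (p - 1) * x" using xp by (intro mult_right_mono) auto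
    also have "\<dots> = \<delta> powr (1 - 1 / p) * x powr p" using xp by (simp add: powr_diff mult.assoc)
    finally show ?thesis using \<delta> by (simp add: distrib_left add_increasing2)
  qed
  have i1: "integrable I01 (\<lambda>t. norm (g t) powr p)" using gp by (simp add: Lp01_def)
  have s1: "set_integrable lborel {0..\<delta>} (\<lambda>t. norm (g t) powr p)" "set_integrable lborel {0..\<delta>} (\<lambda>_. 1 / \<delta>)"
    "set_integrable lborel {0..\<delta>} g"
    using \<delta> by (auto intro!: set_integrable_subinterval i1 gi integrable_I01_const)
  have "(LINT t:{0..\<delta>}|lborel. norm (g t)) \<le> (LINT t:{0..\<delta>}|lborel. \<delta> powr (1 - 1 / p) * (norm (g t) powr p + 1 / \<delta>))"
    using s1 young by (intro set_integral_mono set_integrable_norm set_integrable_mult_right set_integral_add) auto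
  also have "\<dots> = \<delta> powr (1 - 1 / p) * ((LINT t:{0..\<delta>}|lborel. norm (g t) powr p) + (LINT t:{0..\<delta>}|lborel. 1 / \<delta>))"
    using set_integral_add(2)[OF s1(1,2)] by simp
  also have "(LINT t:{0..\<delta>}|lborel. 1 / \<delta>) = 1" using \<delta> by (simp add: set_lebesgue_integral_def)
  also have "(LINT t:{0..\<delta>}|lborel. norm (g t) powr p) \<le> (LINT t|I01. norm (g t) powr p)"
    unfolding integral_I01 set_lebesgue_integral_def
  proof (rule integral_mono)
    show "integrable lborel (\<lambda>t. indicat_real {0..\<delta>} t *\<^sub>R norm (g t) powr p)" using s1(1) by (simp add: set_integrable_def)
    show "integrable lborel (\<lambda>t. indicat_real {0..1} t *\<^sub>R norm (g t) powr p)" using i1 by (simp add: integrable_I01_iff set_integrable_def)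
    show "indicat_real {0..\<delta>} t *\<^sub>R norm (g t) powr p \<le> indicat_real {0..1} t *\<^sub>R norm (g t) powr p" for t
      using \<delta> by (auto split: split_indicator)
  qed
  finally show ?thesis by (simp add: mult_left_mono)
qed

lemma integrable_I01_of_has_integral:
  fixes f :: "real \<Rightarrow> real"
  assumes "(f has_integral c) {0..1}" "f \<in> borel_measurable borel" "\<And>t. t \<in> {0..1} \<Longrightarrow> 0 \<le> f t"
  shows "integrable I01 f"
proof -
  have "f absolutely_integrable_on {0..1}"
    using assms by (intro nonnegative_absolutely_integrable_1) auto
  then have "integrable (completion lborel) (\<lambda>t. indicator {0..1} t *\<^sub>R f t)" by (simp add: set_integrable_def)
  then have "integrable lborel (\<lambda>t. indicator {0..1} t *\<^sub>R f t)"
    using assms(2) by (subst (asm) integrable_completion) auto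
  then show ?thesis by (simp add: integrable_I01_iff set_integrable_def)
qed

text \<open>The integrals of \<open>h\<close> over \<open>[\<delta>, 1]\<close> would be bounded, although they dominate \<open>G \<delta> - G r\<close>.\<close>

lemma divergent_lower_bound:
  fixes h k G :: "real \<Rightarrow> real"
  assumes r: "0 < r" "r \<le> 1"
    and G: "\<And>t. 0 < t \<Longrightarrow> t \<le> r \<Longrightarrow> (G has_real_derivative - k t) (at t)"
    and k: "\<And>t. 0 < t \<Longrightarrow> t \<le> r \<Longrightarrow> 0 \<le> k t" "k \<in> borel_measurable borel"
    and hk: "\<And>t. 0 < t \<Longrightarrow> t \<le> r \<Longrightarrow> k t \<le> h t" and h: "\<And>t. 0 < t \<Longrightarrow> t \<le> 1 \<Longrightarrow> 0 \<le> h t"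
    and int: "\<And>\<delta>. 0 < \<delta> \<Longrightarrow> \<delta> \<le> r \<Longrightarrow> set_integrable lborel {\<delta>..1} h"
    and le: "\<And>\<delta>. 0 < \<delta> \<Longrightarrow> \<delta> \<le> r \<Longrightarrow> (LINT t:{\<delta>..1}|lborel. h t) \<le> M"
    and unb: "\<And>M. \<exists>\<delta>. 0 < \<delta> \<and> \<delta> \<le> r \<and> M < G \<delta>"
  shows False
proof -
  obtain \<delta> where \<delta>: "0 < \<delta>" "\<delta> \<le> r" "M + G r < G \<delta>" using unb by blast
  have F: "((\<lambda>t. - G t) has_real_derivative k t) (at t)" if "\<delta> \<le> t" "t \<le> r" for t
    using DERIV_minus[OF G[of t]] that \<delta> by simp
  have FTC: "integrable lborel (\<lambda>t. k t * indicator {\<delta>..r} t)" "(LINT t|lborel. k t * indicator {\<delta>..r} t) = - G r - (- G \<delta>)"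
    using \<delta> k F by (intro integrable_FTC_Icc_nonneg[where F = "\<lambda>t. - G t"] integral_FTC_Icc_nonneg[where F = "\<lambda>t. - G t"]; simp)+
  have "(LINT t|lborel. k t * indicator {\<delta>..r} t) \<le> (LINT t|lborel. indicator {\<delta>..1} t *\<^sub>R h t)"
  proof (rule integral_mono[OF FTC(1)])
    show "integrable lborel (\<lambda>t. indicator {\<delta>..1} t *\<^sub>R h t)" using int[OF \<delta>(1,2)] by (simp add: set_integrable_def)
    show "k t * indicator {\<delta>..r} t \<le> indicator {\<delta>..1} t *\<^sub>R h t" for t
      using hk[of t] h[of t] \<delta> r by (auto split: split_indicator)
  qed
  then show False using FTC(2) le[OF \<delta>(1,2)] \<delta>(3) by (simp add: set_lebesgue_integral_def)
qed

lemma continuous_on_indefinite_integral: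
  fixes g :: "real \<Rightarrow> 'a::{banach,second_countable_topology}"
  assumes "integrable I01 g"
  shows "continuous_on {0..1} (\<lambda>t. LINT s:{0..t}|lborel. g s)"
  unfolding continuous_on_sequentially
proof (intro allI impI ballI, elim conjE)
  fix x a assume a: "a \<in> {0..1}" and x: "\<forall>n. x n \<in> {0..1}" "x \<longlonglongrightarrow> (a :: real)"
  define g0 where "g0 t = indicator {0..1} t *\<^sub>R g t" for t
  have g0: "integrable lborel g0" using assms by (simp add: g0_def[abs_def] integrable_I01_iff set_integrable_def)
  have eq: "(LINT s:{0..t}|lborel. g s) = (LINT s|lborel. indicator {..t} s *\<^sub>R g0 s)" if "t \<in> {0..1}" for t
    unfolding set_lebesgue_integral_def g0_def
    by (rule Bochner_Integration.integral_cong) (use that in \<open>auto split: split_indicator\<close>)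
  have "(\<lambda>n. LINT s|lborel. indicator {..x n} s *\<^sub>R g0 s) \<longlonglongrightarrow> (LINT s|lborel. indicator {..a} s *\<^sub>R g0 s)"
  proof (rule integral_dominated_convergence[where w = "\<lambda>s. norm (g0 s)"])
    show "AE s in lborel. (\<lambda>n. indicator {..x n} s *\<^sub>R g0 s) \<longlonglongrightarrow> indicator {..a} s *\<^sub>R g0 s"
      using AE_lborel_singleton[of a]
    proof eventually_elim
      case (elim s)
      show ?case
      proof (cases "s < a")
        case True
        then have "\<forall>\<^sub>F n in sequentially. s < x n" using x(2) by (rule order_tendstoD(1)[rotated])
        then have "\<forall>\<^sub>F n in sequentially. indicator {..x n} s *\<^sub>R g0 s = indicator {..a} s *\<^sub>R g0 s"
          by eventually_elim (use True in simp)
        then show ?thesis by (rule tendsto_eventually)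
      next
        case False
        then have "\<forall>\<^sub>F n in sequentially. x n < s" using x(2) elim by (intro order_tendstoD(2)[OF x(2)]) auto
        then have "\<forall>\<^sub>F n in sequentially. indicator {..x n} s *\<^sub>R g0 s = indicator {..a} s *\<^sub>R g0 s"
          by eventually_elim (use False elim in simp)
        then show ?thesis by (rule tendsto_eventually)
      qed
    qed
    show "AE s in lborel. norm (indicat_real {..x n} s *\<^sub>R g0 s) \<le> norm (g0 s)" for n
      by (rule AE_I2) (auto split: split_indicator)
  qed (use g0 in auto)
  then show "((\<lambda>t. LINT s:{0..t}|lborel. g s) \<circ> x) \<longlonglongrightarrow> (LINT s:{0..a}|lborel. g s)"
    using x(1) a by (simp add: o_def eq)
qed

lemma weak_time_deriv_indefinite_integral:
  fixes u g :: "real \<Rightarrow> 'a::{banach,second_countable_topology}"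
  assumes g: "integrable I01 g" and u: "u \<in> borel_measurable I01"
    and eq: "AE t in I01. u t = (LINT s:{0..t}|lborel. g s)"
  shows "weak_time_deriv u g"
  unfolding weak_time_deriv_def
proof (intro allI impI)
  fix \<phi> assume \<phi>: "time_test_function \<phi>"
  define G where "G t = (LINT s:{0..t}|lborel. g s)" for t
  have diff: "(deriv ^^ n) \<phi> differentiable at t" for n t using \<phi> by (simp add: time_test_function_def)
  have D: "(\<phi> has_real_derivative deriv \<phi> t) (at t)" for t
    using diff[of 0 t] DERIV_deriv_iff_real_differentiable by simp
  have cont: "continuous_on UNIV (deriv \<phi>)"
    using diff[of 1] by (intro differentiable_imp_continuous_on) (simp add: differentiable_on_def)
  have [measurable]: "deriv \<phi> \<in> borel_measurable borel" "\<phi> \<in> borel_measurable borel"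
    using cont D by (auto intro!: borel_measurable_continuous_onI DERIV_continuous_on)
  have "closure {t. \<phi> t \<noteq> 0} \<subseteq> {0<..<1}" using \<phi> by (simp add: time_test_function_def)
  then have zero: "\<phi> 0 = 0" "\<phi> 1 = 0" using closure_subset[of "{t. \<phi> t \<noteq> 0}"] by force+
  have sd: "set_integrable lborel {0..1} (deriv \<phi>)"
    unfolding set_integrable_def by (rule borel_integrable_compact) (auto intro: continuous_on_subset[OF cont])
  have V: "\<phi> t = \<phi> 0 + (LINT s:{0..t}|lborel. deriv \<phi> s)" if "t \<in> {0..1}" for t
  proof -
    have "(LINT s|lborel. indicator {0..t} s *\<^sub>R deriv \<phi> s) = \<phi> t - \<phi> 0"
      using that D by (intro integral_FTC_Icc)
        (auto simp: has_real_derivative_iff_has_vector_derivative[symmetric] intro: has_field_derivative_at_within continuous_on_subset[OF cont])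
    then show ?thesis by (simp add: set_lebesgue_integral_def)
  qed
  have G0: "G 0 = 0" unfolding G_def by (rule set_integral_singleton_lborel)
  have Ueq: "G t = G 0 + (LINT s:{0..t}|lborel. g s)" for t by (simp only: G0) (simp add: G_def)
  have sg: "set_integrable lborel {0..1} g" using g by (simp add: integrable_I01_iff)
  note pr = product_rule[OF bounded_bilinear_scaleR zero_le_one sd sg V Ueq]
  have "0 = (LINT t:{0..1}|lborel. deriv \<phi> t *\<^sub>R G t) + (LINT t:{0..1}|lborel. \<phi> t *\<^sub>R g t)"
    using pr(3) zero by simp
  moreover have "(LINT t|I01. deriv \<phi> t *\<^sub>R u t) = (LINT t|I01. deriv \<phi> t *\<^sub>R G t)"
  proof (rule integral_cong_AE)
    show "AE t in I01. deriv \<phi> t *\<^sub>R u t = deriv \<phi> t *\<^sub>R G t" using eq by eventually_elim (simp add: G_def)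
    have "deriv \<phi> \<in> borel_measurable I01" by (rule borel_measurable_I01) simp
    then show "(\<lambda>t. deriv \<phi> t *\<^sub>R u t) \<in> borel_measurable I01" using u by (rule borel_measurable_scaleR)
    show "(\<lambda>t. deriv \<phi> t *\<^sub>R G t) \<in> borel_measurable I01"
      using pr(1) integrable_I01_iff by (blast intro: borel_measurable_integrable)
  qed
  ultimately show "(LINT t|I01. deriv \<phi> t *\<^sub>R u t) = - (LINT t|I01. \<phi> t *\<^sub>R g t)"
    by (simp add: integral_I01 eq_neg_iff_add_eq_0)
qed

section \<open>Uniqueness in the energy class\<close>

lemma div_grad_eq_zero:
  assumes "(LINT x|lborel. (norm (h1_grad v x))\<^sup>2) = 0" "bounded_coeff A"
  shows "div_grad A v = 0"
proof (rule hm1_eqI)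
  fix z
  have "AE x in lborel. (norm (h1_grad v x))\<^sup>2 = 0"
    using assms(1) sq_int_h1_grad[of v] by (subst (asm) integral_nonneg_eq_0_iff_AE) (auto simp: sq_int_def)
  then have "AE x in lborel. cdot (A x *v h1_grad v x) (h1_grad z x) = 0"
    by eventually_elim (simp add: cdot_def)
  then have "(LINT x|lborel. cdot (A x *v h1_grad v x) (h1_grad z x)) = 0" by (rule integral_eq_zero_AE)
  then show "hm1_apply (div_grad A v) z = hm1_apply 0 z"
    by (simp add: hm1_apply_div_grad'[OF assms(2)] hm1_apply_ops)
qed

text \<open>The integrated equation alone, without the integrability exponent. Solutions for every exponent
  are of this kind, so uniqueness and nonexistence can be shown for all of them at once.\<close>

definition integral_solution ::
    "(real \<Rightarrow> real^'d::finite \<Rightarrow> complex^'d^'d) \<Rightarrow> (real \<Rightarrow> 'd hm1) \<Rightarrow> (real \<Rightarrow> 'd h1) \<Rightarrow> bool" where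
  "integral_solution B f u \<longleftrightarrow> u \<in> borel_measurable I01 \<and> (\<exists>U. (AE t in I01. U t = h1_to_hm1 (u t)) \<and>
       (\<forall>t\<in>{0..1}. U t - (LINT \<tau>:{0..t}|lborel. div_grad (B \<tau>) (u \<tau>)) = (LINT \<tau>:{0..t}|lborel. f \<tau>)))"

lemma integral_solution_if_solution: "solution q B f u \<Longrightarrow> integral_solution B f u"
  unfolding solution_def integral_solution_def Lp01_def by auto

context cascade
begin

lemma B_flow:
  assumes g: "g \<in> borel_measurable borel" "g \<in> {0..1} \<rightarrow> {0..1}" and \<sigma>: "\<bar>\<sigma>\<bar> = 1"
    and u: "u \<in> borel_measurable I01"
  shows measurable_B_flow: "(\<lambda>t. div_grad (B \<sigma> (g t)) (u t)) \<in> borel_measurable I01"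
    and norm_B_flow_le: "t \<in> {0..1} \<Longrightarrow> norm (div_grad (B \<sigma> (g t)) v) \<le> (1 + 10 * \<epsilon> + 2 * \<omega>) * norm v"
proof -
  have [measurable]: "g \<in> borel_measurable I01" "u \<in> borel_measurable I01"
    using g(1) u by (auto intro: borel_measurable_I01)
  have [measurable]: "(\<lambda>t. K (stage (g t)) (u t)) \<in> borel_measurable I01"
    by (rule measurable_K_stage) measurable
  show "(\<lambda>t. div_grad (B \<sigma> (g t)) (u t)) \<in> borel_measurable I01"
    unfolding div_grad_B by measurable
  assume t: "t \<in> {0..1}"
  note cb = coefficient_bounds[OF funcset_mem[OF g(2) t]]
  have mu0: "0 \<le> \<mu> (g t)" using cb(1) eps by (auto simp: min_def split: if_splits)
  have "norm (div_grad (B \<sigma> (g t)) v) \<le> \<bar>\<mu> (g t)\<bar> * norm (A v) + \<bar>\<sigma> * \<kappa> (g t)\<bar> * norm (K (stage (g t)) v)"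
    unfolding div_grad_B by (rule order_trans[OF norm_triangle_ineq]) simp
  also have "\<dots> \<le> (1 + 4 * \<epsilon>) * norm v + (2 * \<omega> + 6 * \<epsilon>) * norm v"
    using cb mu0 \<sigma> eps \<omega>_pos by (intro add_mono mult_mono norm_A_le norm_K_le) (auto simp: abs_mult)
  finally show "norm (div_grad (B \<sigma> (g t)) v) \<le> (1 + 10 * \<epsilon> + 2 * \<omega>) * norm v" by (simp add: algebra_simps)
qed

lemma Lp01_B_flow:
  assumes g: "g \<in> borel_measurable borel" "g \<in> {0..1} \<rightarrow> {0..1}" and \<sigma>: "\<bar>\<sigma>\<bar> = 1"
    and u: "u \<in> Lp01 p" "0 < p"
  shows "(\<lambda>t. div_grad (B \<sigma> (g t)) (u t)) \<in> Lp01 p"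
proof (rule Lp01_bound[OF u(1) _ u(2)])
  have "u \<in> borel_measurable I01" using u(1) by (simp add: Lp01_def)
  then show "(\<lambda>t. div_grad (B \<sigma> (g t)) (u t)) \<in> borel_measurable I01" by (rule measurable_B_flow[OF g \<sigma>])
  show "norm (div_grad (B \<sigma> (g t)) (u t)) \<le> (1 + 10 * \<epsilon> + 2 * \<omega>) * norm (u t)" if "t \<in> {0..1}" for t
    by (rule norm_B_flow_le[OF g \<sigma> \<open>u \<in> borel_measurable I01\<close> that])
  show "0 \<le> 1 + 10 * \<epsilon> + 2 * \<omega>" using eps \<omega>_pos by simp
qed

lemma pairing_B_flow_self: "pairing (div_grad (B \<sigma> s) v) v = \<mu> s * pairing (A v) v"
  using pairing_K_antisym[of _ v v] by (simp add: div_grad_B pairing.add_left pairing.scaleR_left)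

text \<open>The difference \<open>d\<close> of two solutions has the primitive of \<open>div (B \<nabla>d)\<close> as its image in the
  antidual, so the energy inequality states that the time integral of \<open>\<langle>div (B \<nabla>d), d\<rangle>\<close> is nonnegative. But
  the skew part of \<open>B\<close> drops out and the integrand is \<open>- \<mu>\<close> times the square of the \<open>L\<^sup>2\<close> norm of
  \<open>\<nabla>d\<close>. Hence \<open>\<nabla>d\<close> vanishes, then the primitive does, and so does \<open>d\<close>.\<close>

theorem integral_solution_unique:
  assumes g: "g \<in> borel_measurable borel" "g \<in> {0..1} \<rightarrow> {0..1}" and \<sigma>: "\<bar>\<sigma>\<bar> = 1"
    and u: "integral_solution (\<lambda>t. B \<sigma> (g t)) f u" "u \<in> Lp01 2"
    and v: "integral_solution (\<lambda>t. B \<sigma> (g t)) f v" "v \<in> Lp01 2"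
  shows "AE t in I01. u t = v t"
proof -
  interpret I: bounded_linear "h1_to_hm1 :: 'd h1 \<Rightarrow> _" by (rule bounded_linear_h1_to_hm1)
  interpret R: bounded_linear "riesz :: 'd hm1 \<Rightarrow> _" by (rule bounded_linear_riesz)
  have bl: "bounded_linear (div_grad (B \<sigma> s))" for s
    unfolding B_def[abs_def] by (intro bounded_linear_div_grad bounded_coeff_combine bounded_coeff_mat_1 bounded_coeff_Kmat)
  interpret D: bounded_linear "div_grad (B \<sigma> s)" for s by (rule bl)
  define d where "d t = u t - v t" for t
  define h where "h t = div_grad (B \<sigma> (g t)) (d t)" for t
  have mu [measurable]: "u \<in> borel_measurable I01" "v \<in> borel_measurable I01" using u(2) v(2) by (auto simp: Lp01_def)
  have d2: "d \<in> Lp01 2"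
  proof -
    have "(\<lambda>t. - v t) \<in> Lp01 2" by (rule Lp01_bound[OF v(2), of _ 1]) auto
    from Lp01_add[OF u(2) this] show ?thesis by (simp add: d_def[abs_def])
  qed
  have md [measurable]: "d \<in> borel_measurable I01" using d2 by (simp add: Lp01_def)
  have h2: "h \<in> Lp01 2" unfolding h_def[abs_def] by (rule Lp01_B_flow[OF g \<sigma> d2 zero_less_numeral])
  have hint: "integrable I01 h" using h2 by (rule Lp01_integrable) simp
  have fu: "integrable I01 (\<lambda>t. div_grad (B \<sigma> (g t)) (u t))" "integrable I01 (\<lambda>t. div_grad (B \<sigma> (g t)) (v t))"
    using Lp01_integrable[OF Lp01_B_flow[OF g \<sigma> u(2) zero_less_numeral]] Lp01_integrable[OF Lp01_B_flow[OF g \<sigma> v(2) zero_less_numeral]] by auto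
  obtain U where U: "AE t in I01. U t = h1_to_hm1 (u t)"
    "\<And>t. t \<in> {0..1} \<Longrightarrow> U t - (LINT \<tau>:{0..t}|lborel. div_grad (B \<sigma> (g \<tau>)) (u \<tau>)) = (LINT \<tau>:{0..t}|lborel. f \<tau>)"
    using u(1) unfolding integral_solution_def by blast
  obtain V where V: "AE t in I01. V t = h1_to_hm1 (v t)"
    "\<And>t. t \<in> {0..1} \<Longrightarrow> V t - (LINT \<tau>:{0..t}|lborel. div_grad (B \<sigma> (g \<tau>)) (v \<tau>)) = (LINT \<tau>:{0..t}|lborel. f \<tau>)"
    using v(1) unfolding integral_solution_def by blast
  have UV: "U t - V t = (LINT \<tau>:{0..t}|lborel. h \<tau>)" if t: "t \<in> {0..1}" for t
  proof -
    have s: "set_integrable lborel {0..t} (\<lambda>t. div_grad (B \<sigma> (g t)) (u t))" "set_integrable lborel {0..t} (\<lambda>t. div_grad (B \<sigma> (g t)) (v t))"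
      using t by (auto intro!: set_integrable_subinterval fu)
    have "U t - V t = (LINT \<tau>:{0..t}|lborel. div_grad (B \<sigma> (g \<tau>)) (u \<tau>)) - (LINT \<tau>:{0..t}|lborel. div_grad (B \<sigma> (g \<tau>)) (v \<tau>))"
      using U(2)[OF t] V(2)[OF t] by (metis (no_types, lifting) add_diff_cancel_left' diff_add_cancel diff_diff_eq2)
    also have "\<dots> = (LINT \<tau>:{0..t}|lborel. h \<tau>)"
      using set_integral_diff(2)[OF s] by (simp add: h_def d_def D.diff)
    finally show ?thesis .
  qed
  have eqd: "AE t in I01. h1_to_hm1 (d t) = (LINT \<tau>:{0..t}|lborel. h \<tau>)"
    using U(1) V(1) AE_space[of I01]
  proof eventually_elim
    case (elim t)
    then have "t \<in> {0..1}" by (simp add: space_restrict_space)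
    from UV[OF this] elim show ?case by (simp add: d_def I.diff)
  qed
  have "0 \<le> (LINT t|I01. riesz (h t) \<bullet> d t)"
  proof (rule h1_embedding.energy_nonneg)
    have rh: "integrable I01 (\<lambda>t. riesz (h t))" by (rule integrable_bounded_linear[OF bounded_linear_riesz hint])
    then show "set_integrable lborel {0..1} (\<lambda>t. riesz (h t))" by (simp add: integrable_I01_iff)
    show "integrable I01 (\<lambda>t. norm (riesz (h t)) * norm (d t))"
    proof (rule integrable_I01_bound)
      show "integrable I01 (\<lambda>t. norm (h t) powr 2 + norm (d t) powr 2)" using h2 d2 by (simp add: Lp01_def)
      show "(\<lambda>t. norm (riesz (h t)) * norm (d t)) \<in> borel_measurable I01"
        using borel_measurable_integrable[OF rh] by measurable
      fix t
      have "riesz (h t) \<bullet> riesz (h t) \<le> norm (h t) * norm (riesz (h t))"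
        using abs_pairing_le[of "h t" "riesz (h t)"] by (simp add: inner_riesz)
      then have "norm (riesz (h t)) * norm (riesz (h t)) \<le> norm (h t) * norm (riesz (h t))"
        by (simp add: dot_square_norm power2_eq_square)
      then have n: "norm (riesz (h t)) \<le> norm (h t)" by (cases "norm (riesz (h t)) = 0") auto
      have "norm (riesz (h t)) * norm (d t) \<le> norm (h t) * norm (d t)" by (intro mult_right_mono n) simp
      also have "\<dots> \<le> (norm (h t))\<^sup>2 + (norm (d t))\<^sup>2"
        using sum_squares_bound[of "norm (h t)" "norm (d t)"] mult_nonneg_nonneg[OF norm_ge_zero[of "h t"] norm_ge_zero[of "d t"]]
        by linarith
      finally show "norm (norm (riesz (h t)) * norm (d t)) \<le> norm (h t) powr 2 + norm (d t) powr 2" by simp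
    qed
    show "AE t in I01. riesz (h1_to_hm1 (d t)) = (LINT s:{0..t}|lborel. riesz (h s))"
      using eqd AE_space[of I01]
    proof eventually_elim
      case (elim t)
      then have "set_integrable lborel {0..t} h" using hint by (intro set_integrable_subinterval) (auto simp: space_restrict_space)
      then have "(LINT s:{0..t}|lborel. riesz (h s)) = riesz (LINT s:{0..t}|lborel. h s)"
        using integral_bounded_linear[OF bounded_linear_riesz, of lborel "\<lambda>s. indicator {0..t} s *\<^sub>R h s"]
        by (simp add: set_lebesgue_integral_def set_integrable_def R.scaleR)
      then show ?case using elim by simp
    qed
  qed (rule md)
  also have "(LINT t|I01. riesz (h t) \<bullet> d t) = (LINT t|I01. \<mu> (g t) * pairing (A (d t)) (d t))"
    by (simp add: inner_riesz h_def pairing_B_flow_self)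
  finally have nonneg: "0 \<le> (LINT t|I01. \<mu> (g t) * pairing (A (d t)) (d t))" .
  define e where "e t = - (\<mu> (g t) * pairing (A (d t)) (d t))" for t
  have mupos: "0 < \<mu> (g t)" if "t \<in> {0..1}" for t
    using coefficient_bounds(1)[OF funcset_mem[OF g(2) that]] eps by (auto simp: min_def split: if_splits)
  have e0: "0 \<le> e t" if "t \<in> {0..1}" for t
    unfolding e_def using mupos[OF that] pairing_A_self_nonpos(1)[of "d t"] by (simp add: mult_nonneg_nonpos)
  have gI: "g \<in> borel_measurable I01" using g(1) by (rule borel_measurable_I01)
  have me: "e \<in> borel_measurable I01"
    unfolding e_def[abs_def]
    using borel_measurable_bilinear[OF bounded_bilinear_pairing measurable_A[OF md] md] measurable_compose[OF gI measurable_coefficients(1)]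
    by measurable
  have eint: "integrable I01 e"
  proof (rule integrable_I01_bound[OF _ me])
    show "integrable I01 (\<lambda>t. (1 + 4 * \<epsilon>) * norm (d t) powr 2)" using d2 by (simp add: Lp01_def)
    fix t :: real assume t: "t \<in> {0..1}"
    have "e t = \<mu> (g t) * (- pairing (A (d t)) (d t))" by (simp add: e_def)
    also have "\<dots> \<le> (1 + 4 * \<epsilon>) * (norm (d t))\<^sup>2"
      using coefficient_bounds(2)[OF funcset_mem[OF g(2) t]] pairing_A_self_nonpos[of "d t"] eps mupos[OF t]
      by (intro mult_mono) auto
    finally show "norm (e t) \<le> (1 + 4 * \<epsilon>) * norm (d t) powr 2" using e0[OF t] by simp
  qed
  have "(LINT t|I01. e t) \<le> 0" using nonneg by (simp add: e_def)
  moreover have "0 \<le> (LINT t|I01. e t)"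
    by (rule integral_nonneg_AE) (use e0 in \<open>auto simp: AE_I01_iff intro!: AE_I2\<close>)
  ultimately have "(LINT t|I01. e t) = 0" by simp
  then have "AE t in I01. e t = 0"
    using e0 eint by (subst (asm) integral_nonneg_eq_0_iff_AE) (auto simp: AE_I01_iff intro!: AE_I2)
  then have "AE t in I01. h t = 0"
    using AE_space[of I01]
  proof eventually_elim
    case (elim t)
    then have t: "t \<in> {0..1}" by (simp add: space_restrict_space)
    have "pairing (A (d t)) (d t) = 0" using elim mupos[OF t] by (simp add: e_def)
    then have "(LINT x|lborel. (norm (h1_grad (d t) x))\<^sup>2) = 0" by (simp add: A_def pairing_laplace_self)
    then show ?case
      unfolding h_def B_def[abs_def]
      by (rule div_grad_eq_zero) (intro bounded_coeff_combine bounded_coeff_mat_1 bounded_coeff_Kmat)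
  qed
  then have h0: "AE t in lborel. t \<in> {0..1} \<longrightarrow> h t = 0" by (simp add: AE_I01_iff)
  from eqd show ?thesis
    using AE_space[of I01]
  proof eventually_elim
    case (elim t)
    then have t: "t \<in> {0..1}" by (simp add: space_restrict_space)
    have "(LINT \<tau>:{0..t}|lborel. h \<tau>) = 0"
      unfolding set_lebesgue_integral_def
    proof (rule integral_eq_zero_AE)
      show "AE x in lborel. indicat_real {0..t} x *\<^sub>R h x = 0"
        using h0 by eventually_elim (use t in \<open>auto split: split_indicator\<close>)
    qed
    then have "pairing (h1_to_hm1 (d t)) (d t) = 0" using elim by (simp add: pairing.zero_left)
    then have "d t = 0" by (rule pairing_h1_to_hm1_self_eq_zero)
    then show ?case by (simp add: d_def)
  qed
qed

end

section \<open>Powers and logarithms near the initial time\<close>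

lemma integrable_I01_powr:
  assumes "a > (-1 :: real)"
  shows "integrable I01 (\<lambda>s. s powr a)"
  by (rule integrable_I01_of_has_integral[OF has_integral_powr_from_0[OF assms]]) auto

text \<open>The antiderivative \<open>(1 - ln t) powr (1 - p) / (p - 1)\<close> extends continuously by zero to \<open>t = 0\<close>.\<close>

lemma integrable_I01_log_weight:
  assumes p: "(1 :: real) < p"
  shows "integrable I01 (\<lambda>t. 1 / t * (1 - ln t) powr (- p))"
proof -
  define F where "F t = (if t \<le> 0 then 0 else (1 - ln t) powr (1 - p) / (p - 1))" for t :: real
  have ln0: "1 - ln t > 0" if "0 < t" "t \<le> 1" for t :: real
    using that ln_le_zero_iff[of t] by linarith
  have "((\<lambda>t. 1 / t * (1 - ln t) powr (- p)) has_integral (F 1 - F 0)) {0..1}"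
  proof (rule fundamental_theorem_of_calculus_interior)
    have deriv: "((\<lambda>t. (1 - ln t) powr (1 - p) / (p - 1)) has_real_derivative 1 / t * (1 - ln t) powr (- p)) (at t)"
      if "0 < t" "t \<le> 1" for t
    proof -
      have "((\<lambda>t. (1 - ln t) powr (1 - p)) has_real_derivative (1 - p) * (1 - ln t) powr (1 - p - 1) * (- (1 / t))) (at t)"
        by (rule DERIV_chain2[where f = "\<lambda>z. z powr (1 - p)" and g = "\<lambda>t. 1 - ln t",
            OF has_real_derivative_powr[OF ln0[OF that]]]) (use that in \<open>auto intro!: derivative_eq_intros\<close>)
      from DERIV_cdivide[OF this, of "p - 1"] show ?thesis
        by (rule DERIV_cong) (use that p in \<open>simp add: field_simps\<close>)
    qed
    show "continuous_on {0..1} F"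
      unfolding continuous_on_eq_continuous_within
    proof
      fix t :: real assume t: "t \<in> {0..1}"
      show "continuous (at t within {0..1}) F"
      proof (cases "t = 0")
        case False
        then have "isCont (\<lambda>t. (1 - ln t) powr (1 - p) / (p - 1)) t" using deriv[of t] t by (auto intro: DERIV_isCont)
        moreover have "\<forall>\<^sub>F s in nhds t. F s = (1 - ln s) powr (1 - p) / (p - 1)"
        proof -
          have "\<forall>\<^sub>F s in nhds t. s > 0" using t False by (intro eventually_nhds_in_open[of "{0<..}", simplified]) auto
          then show ?thesis by eventually_elim (simp add: F_def)
        qed
        ultimately have "isCont F t"
          using isCont_cong[of F "\<lambda>t. (1 - ln t) powr (1 - p) / (p - 1)" t] by simp
        then show ?thesis by (rule continuous_at_imp_continuous_at_within)
      next
        case True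
        have "((\<lambda>t. (1 - ln t) powr (1 - p) / (p - 1)) \<longlongrightarrow> 0 / (p - 1)) (at_right 0)"
        proof (intro tendsto_divide tendsto_const)
          have "filterlim (\<lambda>t :: real. 1 - ln t) at_top (at_right 0)"
            using filterlim_tendsto_add_at_top[OF tendsto_const[of 1] filterlim_uminus_at_top_at_bot[THEN filterlim_compose, OF ln_at_0]]
            by simp
          then show "((\<lambda>t. (1 - ln t) powr (1 - p)) \<longlongrightarrow> 0) (at_right 0)"
            using p by (intro tendsto_neg_powr) auto
        qed (use p in simp)
        moreover have "\<forall>\<^sub>F t in at_right 0. (1 - ln t) powr (1 - p) / (p - 1) = F t"
          using eventually_at_right_less[of 0] by eventually_elim (simp add: F_def)
        ultimately have "(F \<longlongrightarrow> F 0) (at_right 0)" by (simp add: F_def Lim_transform_eventually)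
        then have "(F \<longlongrightarrow> F 0) (at 0 within {0..1})" by (simp add: at_within_Icc_at_right)
        then show ?thesis by (simp add: True continuous_within)
      qed
    qed
    fix t :: real assume t: "t \<in> {0<..<1}"
    have "(F has_real_derivative 1 / t * (1 - ln t) powr (- p)) (at t)"
      by (rule has_field_derivative_transform_within_open[OF deriv, of _ "{0<..}"]) (use t in \<open>auto simp: F_def\<close>)
    then show "(F has_vector_derivative 1 / t * (1 - ln t) powr (- p)) (at t)"
      by (simp add: has_real_derivative_iff_has_vector_derivative)
  qed simp
  then show ?thesis
    by (rule integrable_I01_of_has_integral) auto
qed

lemma reflect_map: "(\<lambda>t :: real. 1 - t) \<in> borel_measurable borel" "(\<lambda>t :: real. 1 - t) \<in> {0..1} \<rightarrow> {0..1}"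
  by auto

lemma one_minus_ln_ge: "0 < t \<Longrightarrow> t \<le> 1 \<Longrightarrow> 1 \<le> 1 - ln (t :: real)"
  using ln_le_zero_iff[of t] by simp

context cascade
begin

lemma w_residual_zero: "w 0 = 0" "residual 0 = 0"
proof -
  interpret I: bounded_linear "h1_to_hm1 :: 'd h1 \<Rightarrow> _" by (rule bounded_linear_h1_to_hm1)
  interpret A: bounded_linear A by (rule bounded_linear_A)
  show w: "w 0 = 0" by (simp add: w_def piece_def)
  have "w' 0 = 0" by (simp add: w'_def piece'_def)
  then show "residual 0 = 0" by (simp add: residual_def w I.zero A.zero \<kappa>_def)
qed

lemma residual_bound: "s \<in> {0..1} \<Longrightarrow> norm (residual s) \<le> (20 * \<epsilon> + 4 * \<omega>) * C0"
  using norm_residual_le[of s] eps \<omega>_pos C0_nonneg by (cases "s = 0") (auto simp: w_residual_zero)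

section \<open>Exponents above two\<close>

text \<open>The factor \<open>t\<close> in \<open>u_fwd\<close> below provides the zero initial value; its derivative accounts for the
  first summand.\<close>

definition f_fwd :: "real \<Rightarrow> 'd hm1" where
  "f_fwd t = h1_to_hm1 (w (1 - t)) + t *\<^sub>R residual (1 - t)"

definition u_fwd :: "real \<Rightarrow> 'd h1" where "u_fwd t = t *\<^sub>R w (1 - t)"

abbreviation B_fwd :: "real \<Rightarrow> real^'d \<Rightarrow> complex^'d^'d" where "B_fwd \<equiv> \<lambda>t. B 1 (1 - t)"

lemma measurable_fwd: "f_fwd \<in> borel_measurable I01" "u_fwd \<in> borel_measurable I01"
proof -
  have 1 [measurable]: "(\<lambda>t. w (1 - t)) \<in> borel_measurable borel" "(\<lambda>t. residual (1 - t)) \<in> borel_measurable borel"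
    by measurable
  have [measurable]: "(\<lambda>t. h1_to_hm1 (w (1 - t))) \<in> borel_measurable borel"
    using measurable_compose[OF 1(1) borel_measurable_continuous_onI[OF linear_continuous_on[OF bounded_linear_h1_to_hm1]]] .
  show "f_fwd \<in> borel_measurable I01" "u_fwd \<in> borel_measurable I01"
    unfolding f_fwd_def[abs_def] u_fwd_def[abs_def] by (rule borel_measurable_I01; measurable)+
qed

lemma Lp01_f_fwd: "0 < p \<Longrightarrow> f_fwd \<in> Lp01 p"
proof (rule Lp01_bounded[OF measurable_fwd(1)])
  fix t :: real assume t: "t \<in> {0..1}"
  have "norm (f_fwd t) \<le> norm (h1_to_hm1 (w (1 - t))) + \<bar>t\<bar> * norm (residual (1 - t))"
    unfolding f_fwd_def by (rule order_trans[OF norm_triangle_ineq]) simp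
  also have "\<dots> \<le> 2 * C0 + 1 * ((20 * \<epsilon> + 4 * \<omega>) * C0)"
    using t by (intro add_mono norm_h1_to_hm1_w_le mult_mono residual_bound) auto
  finally show "norm (f_fwd t) \<le> 2 * C0 + 1 * ((20 * \<epsilon> + 4 * \<omega>) * C0)" .
qed

lemma Lp01_u_fwd: "u_fwd \<in> Lp01 2"
proof -
  have "integrable I01 (\<lambda>t. norm (u_fwd t) powr 2)"
  proof (rule integrable_I01_bound)
    show "integrable I01 (\<lambda>t. (3 * C0)\<^sup>2 * (1 - t) powr (2 * \<epsilon> - 1))"
      using reflect_I01[OF integrable_I01_powr[of "2 * \<epsilon> - 1"]] eps by simp
    show "(\<lambda>t. norm (u_fwd t) powr 2) \<in> borel_measurable I01" using measurable_fwd(2) by measurable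
    fix t :: real assume t: "t \<in> {0..1}"
    have "norm (u_fwd t) \<le> 3 * C0 * (1 - t) powr (\<epsilon> - 1 / 2)"
    proof (cases "t = 1")
      case False
      have "norm (u_fwd t) \<le> 1 * norm (w (1 - t))" unfolding u_fwd_def norm_scaleR using t by (intro mult_right_mono) auto
      then show ?thesis using norm_w_le[of "1 - t"] t False by simp
    qed (simp add: u_fwd_def w_residual_zero)
    then have "(norm (u_fwd t))\<^sup>2 \<le> (3 * C0 * (1 - t) powr (\<epsilon> - 1 / 2))\<^sup>2" by (intro power_mono) auto
    also have "\<dots> = (3 * C0)\<^sup>2 * (1 - t) powr (2 * \<epsilon> - 1)"
    proof -
      have "((1 - t) powr (\<epsilon> - 1 / 2))\<^sup>2 = (1 - t) powr (2 * \<epsilon> - 1)"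
        unfolding power2_eq_square powr_add[symmetric] by (simp add: algebra_simps)
      then show ?thesis by (simp add: power_mult_distrib)
    qed
    finally show "norm (norm (u_fwd t) powr 2) \<le> (3 * C0)\<^sup>2 * (1 - t) powr (2 * \<epsilon> - 1)" by simp
  qed
  then show ?thesis using measurable_fwd(2) by (simp add: Lp01_def)
qed

lemma minus_h1_to_hm1_w':
  "- h1_to_hm1 (w' s) = residual s + div_grad (B 1 s) (w s)"
  by (simp add: residual_def div_grad_B)

text \<open>The product rule for \<open>(1 - s) *\<^sub>R w s\<close> on \<open>[1 - t, 1]\<close>, followed by the reflection of time and the
  definition of the residual.\<close>

lemma u_fwd_integral:
  assumes t: "0 \<le> t" "t < 1"
  shows "h1_to_hm1 (u_fwd t) = (LINT \<tau>:{0..t}|lborel. div_grad (B_fwd \<tau>) (u_fwd \<tau>) + f_fwd \<tau>)"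
proof -
  interpret I: bounded_linear "h1_to_hm1 :: 'd h1 \<Rightarrow> _" by (rule bounded_linear_h1_to_hm1)
  interpret D: bounded_linear "div_grad (B \<sigma> s)" for \<sigma> s
    unfolding B_def[abs_def] by (intro bounded_linear_div_grad bounded_coeff_combine bounded_coeff_mat_1 bounded_coeff_Kmat)
  let ?a = "1 - t"
  have c1: "set_integrable lborel {?a..1} (\<lambda>_. - 1 :: real)"
    by (rule set_integrable_bounded_interval[of _ _ _ 1]) auto
  have U: "1 - s = (1 - ?a) + (LINT r:{?a..s}|lborel. (- 1 :: real))" if "s \<in> {?a..1}" for s
  proof -
    have "(LINT r:{?a..s}|lborel. (- 1 :: real)) = - (LINT r:{?a..s}|lborel. 1)"
      by (simp add: set_lebesgue_integral_def)
    also have "(LINT r:{?a..s}|lborel. (1 :: real)) = s - ?a" using that by (simp add: set_lebesgue_integral_def)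
    finally show ?thesis by simp
  qed
  have V: "w s = w ?a + (LINT r:{?a..s}|lborel. w' r)" if "s \<in> {?a..1}" for s
    using w_fundamental_theorem(2)[of ?a s] that t by auto
  have wi: "set_integrable lborel {?a..1} w'" using w_fundamental_theorem(1)[of ?a 1] t by auto
  have a1: "?a \<le> 1" using t by simp
  note pr = product_rule[OF bounded_bilinear_scaleR a1 c1 wi U V]
  have neg: "- (t *\<^sub>R w ?a) = (LINT s:{?a..1}|lborel. (- 1) *\<^sub>R w s) + (LINT s:{?a..1}|lborel. (1 - s) *\<^sub>R w' s)"
    using pr(3) by simp
  have "t *\<^sub>R w ?a = - ((LINT s:{?a..1}|lborel. (- 1) *\<^sub>R w s) + (LINT s:{?a..1}|lborel. (1 - s) *\<^sub>R w' s))"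
    unfolding neg[symmetric] by simp
  also have "\<dots> = - (LINT s:{?a..1}|lborel. (- 1) *\<^sub>R w s + (1 - s) *\<^sub>R w' s)"
    using set_integral_add(2)[OF pr(1,2)] by simp
  finally have "h1_to_hm1 (u_fwd t) = - h1_to_hm1 (LINT s:{?a..1}|lborel. (- 1) *\<^sub>R w s + (1 - s) *\<^sub>R w' s)"
    by (simp only: u_fwd_def I.neg)
  also have "h1_to_hm1 (LINT s:{?a..1}|lborel. (- 1) *\<^sub>R w s + (1 - s) *\<^sub>R w' s)
      = (LINT s:{?a..1}|lborel. h1_to_hm1 ((- 1) *\<^sub>R w s + (1 - s) *\<^sub>R w' s))"
    using integral_bounded_linear[OF bounded_linear_h1_to_hm1 set_integral_add(1)[OF pr(1,2), unfolded set_integrable_def]]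
    by (simp add: set_lebesgue_integral_def I.scaleR)
  also have "- \<dots> = (LINT s:{?a..1}|lborel. - h1_to_hm1 ((- 1) *\<^sub>R w s + (1 - s) *\<^sub>R w' s))"
    by (simp add: set_lebesgue_integral_def)
  also have "\<dots> = (LINT s:{?a..1}|lborel. (1 - s) *\<^sub>R (residual s + div_grad (B 1 s) (w s)) + h1_to_hm1 (w s))"
  proof -
    have "- h1_to_hm1 ((- 1) *\<^sub>R w s + (1 - s) *\<^sub>R w' s) = (1 - s) *\<^sub>R (residual s + div_grad (B 1 s) (w s)) + h1_to_hm1 (w s)" for s
      unfolding minus_h1_to_hm1_w'[symmetric] I.add I.scaleR by simp
    then show ?thesis by simp
  qed
  also have "\<dots> = (LINT \<tau>:{0..t}|lborel. (1 - (1 - \<tau>)) *\<^sub>R (residual (1 - \<tau>) + div_grad (B_fwd \<tau>) (w (1 - \<tau>))) + h1_to_hm1 (w (1 - \<tau>)))"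
    by (rule reflect_set_integral)
  also have "\<dots> = (LINT \<tau>:{0..t}|lborel. div_grad (B_fwd \<tau>) (u_fwd \<tau>) + f_fwd \<tau>)"
    by (simp add: u_fwd_def f_fwd_def D.scaleR scaleR_add_right add_ac)
  finally show ?thesis .
qed

lemma solution_fwd: "solution 2 B_fwd f_fwd u_fwd"
proof -
  let ?F = "\<lambda>t. div_grad (B_fwd t) (u_fwd t)"
  have F2: "?F \<in> Lp01 2" by (rule Lp01_B_flow[OF reflect_map _ Lp01_u_fwd]) auto
  have f2: "f_fwd \<in> Lp01 2" by (rule Lp01_f_fwd) simp
  have g2: "(\<lambda>t. ?F t + f_fwd t) \<in> Lp01 2" by (rule Lp01_add[OF F2 f2]) simp
  have int: "integrable I01 ?F" "integrable I01 f_fwd" "integrable I01 (\<lambda>t. ?F t + f_fwd t)"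
    using Lp01_integrable[OF F2] Lp01_integrable[OF f2] Lp01_integrable[OF g2] by auto
  have eq: "AE t in I01. h1_to_hm1 (u_fwd t) = (LINT \<tau>:{0..t}|lborel. ?F \<tau> + f_fwd \<tau>)"
    \<comment> \<open>At the singular time \<open>u_fwd\<close> vanishes, whereas the integral need not.\<close>
    unfolding AE_I01_iff using AE_lborel_singleton[of 1]
    by eventually_elim (auto intro: u_fwd_integral)
  have mI: "(\<lambda>t. h1_to_hm1 (u_fwd t)) \<in> borel_measurable I01"
    using measurable_compose[OF measurable_fwd(2) borel_measurable_continuous_onI[OF linear_continuous_on[OF bounded_linear_h1_to_hm1]]] .
  have "(\<lambda>t. h1_to_hm1 (u_fwd t)) \<in> W1p01 2"
    unfolding W1p01_def
  proof (intro CollectI conjI bexI[OF _ g2])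
    show "(\<lambda>t. h1_to_hm1 (u_fwd t)) \<in> Lp01 2"
      by (rule Lp01_bound[OF Lp01_u_fwd mI, of 1]) (auto simp: norm_h1_to_hm1_le)
    show "weak_time_deriv (\<lambda>t. h1_to_hm1 (u_fwd t)) (\<lambda>t. ?F t + f_fwd t)"
      by (rule weak_time_deriv_indefinite_integral[OF int(3) mI eq])
  qed
  moreover have "(LINT \<tau>:{0..t}|lborel. ?F \<tau> + f_fwd \<tau>) = (LINT \<tau>:{0..t}|lborel. ?F \<tau>) + (LINT \<tau>:{0..t}|lborel. f_fwd \<tau>)"
    if "t \<in> {0..1}" for t
    using that by (intro set_integral_add set_integrable_subinterval int) auto
  ultimately show ?thesis
    unfolding solution_def using Lp01_u_fwd continuous_on_indefinite_integral[OF int(3)] eq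
    by (intro conjI exI[of _ "\<lambda>t. LINT \<tau>:{0..t}|lborel. ?F \<tau> + f_fwd \<tau>"]) auto
qed

text \<open>Near \<open>t = 1\<close> the \<open>p\<close>-th power of the norm is at least a multiple of \<open>1 / (1 - t)\<close>, because
  \<open>(\<epsilon> - 1 / 2) * p = - 1\<close>.\<close>

lemma u_fwd_not_Lp01:
  assumes p: "2 < p" "\<epsilon> = 1 / 2 - 1 / p"
  shows "u_fwd \<notin> Lp01 p"
proof
  assume "u_fwd \<in> Lp01 p"
  then have int: "integrable I01 (\<lambda>t. norm (u_fwd t) powr p)" by (simp add: Lp01_def)
  obtain c s0 where c: "c > 0" "0 < s0" "s0 \<le> 1"
    "\<And>s. 0 < s \<Longrightarrow> s \<le> s0 \<Longrightarrow> c * s powr (2 * \<epsilon> - 1) \<le> - pairing (A (w s)) (w s)"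
    by (rule energy_density_ge) blast
  define h where "h s = norm (u_fwd (1 - s)) powr p" for s
  define C where "C = (sqrt c / 2) powr p"
  \<comment> \<open>Below \<open>1 / 2\<close> the factor \<open>1 - s\<close> of \<open>u_fwd (1 - s)\<close> is at least \<open>1 / 2\<close>.\<close>
  define s1 where "s1 = min s0 (1 / 2)"
  have C: "C > 0" using c by (simp add: C_def)
  have hint: "integrable I01 h" using reflect_I01[OF int] by (simp add: h_def[abs_def])
  have low: "C * (1 / s) \<le> h s" if s: "0 < s" "s \<le> s1" for s
  proof -
    have ss: "s \<le> s0" "s \<le> 1 / 2" using s by (auto simp: s1_def)
    have "c * s powr (2 * \<epsilon> - 1) \<le> (norm (w s))\<^sup>2"
      using c(4)[OF s(1) ss(1)] pairing_A_self_nonpos(2)[of "w s"] by linarith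
    then have "sqrt (c * s powr (2 * \<epsilon> - 1)) \<le> sqrt ((norm (w s))\<^sup>2)" by (rule real_sqrt_le_mono)
    then have "sqrt (c * s powr (2 * \<epsilon> - 1)) \<le> norm (w s)" by simp
    moreover have "sqrt (c * s powr (2 * \<epsilon> - 1)) = sqrt c * s powr (\<epsilon> - 1 / 2)"
      using s(1) by (simp add: real_sqrt_mult powr_half_sqrt[symmetric] powr_powr algebra_simps)
    ultimately have 1: "sqrt c * s powr (\<epsilon> - 1 / 2) \<le> norm (w s)" by simp
    have "sqrt c / 2 * s powr (\<epsilon> - 1 / 2) \<le> 1 / 2 * norm (w s)" using 1 by simp
    also have "\<dots> \<le> norm (u_fwd (1 - s))"
      unfolding u_fwd_def norm_scaleR using ss s(1) by (intro mult_mono) auto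
    finally have "(sqrt c / 2 * s powr (\<epsilon> - 1 / 2)) powr p \<le> h s"
      unfolding h_def using p c by (intro powr_mono2) auto
    also have "(sqrt c / 2 * s powr (\<epsilon> - 1 / 2)) powr p = C * (1 / s)"
    proof -
      have "(\<epsilon> - 1 / 2) * p = - 1" using p by (simp add: field_simps)
      then show ?thesis unfolding powr_mult powr_powr C_def inverse_eq_powr[OF s(1)] by simp
    qed
    finally show ?thesis .
  qed
  show False
  proof (rule divergent_lower_bound[where r = s1 and h = h and k = "\<lambda>t. C * (1 / t)" and G = "\<lambda>t. - (C * ln t)"
        and M = "LINT t|I01. h t"])
    show "0 < s1" "s1 \<le> 1" using c by (auto simp: s1_def)
    show "((\<lambda>t. - (C * ln t)) has_real_derivative - (C * (1 / t))) (at t)" if "0 < t" for t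
      using that by (auto intro!: derivative_eq_intros)
    show "set_integrable lborel {\<delta>..1} h" if "0 < \<delta>" for \<delta>
      using that by (intro set_integrable_subinterval hint) auto
    show "(LINT t:{\<delta>..1}|lborel. h t) \<le> (LINT t|I01. h t)" if "0 < \<delta>" for \<delta>
      unfolding integral_I01 set_lebesgue_integral_def
    proof (rule integral_mono)
      show "integrable lborel (\<lambda>t. indicat_real {\<delta>..1} t *\<^sub>R h t)" "integrable lborel (\<lambda>t. indicat_real {0..1} t *\<^sub>R h t)"
        using set_integrable_subinterval[OF hint, of \<delta> 1] hint that by (auto simp: integrable_I01_iff set_integrable_def)
      show "indicat_real {\<delta>..1} t *\<^sub>R h t \<le> indicat_real {0..1} t *\<^sub>R h t" for t
        using that by (auto simp: h_def split: split_indicator)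
    qed
    show "\<exists>\<delta>. 0 < \<delta> \<and> \<delta> \<le> s1 \<and> M < - (C * ln \<delta>)" for M
    proof (intro exI[of _ "min s1 (exp (- ((\<bar>M\<bar> + 1) / C)))"] conjI)
      let ?\<delta> = "min s1 (exp (- ((\<bar>M\<bar> + 1) / C)))"
      show "0 < ?\<delta>" using c by (auto simp: s1_def)
      then have "ln ?\<delta> \<le> ln (exp (- ((\<bar>M\<bar> + 1) / C)))" by (subst ln_le_cancel_iff) auto
      then have "C * ln ?\<delta> \<le> C * (- ((\<bar>M\<bar> + 1) / C))" using C by (intro mult_left_mono) auto
      then show "M < - (C * ln ?\<delta>)" using C by simp
    qed simp
  qed (use C low in \<open>auto simp: h_def\<close>)
qed

lemma counterexample_above_two:
  assumes p: "2 < p" "\<epsilon> = 1 / 2 - 1 / p"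
  shows "elliptic B_fwd \<and> f_fwd \<in> Lp01 p \<and>
    (\<exists>u. solution 2 B_fwd f_fwd u \<and> (\<forall>v. solution 2 B_fwd f_fwd v \<longrightarrow> (AE t in I01. v t = u t)) \<and> u \<notin> Lp01 p) \<and>
    (\<forall>u. solution 1 B_fwd f_fwd u \<longrightarrow> u \<notin> Lp01 p)"
proof (intro conjI exI[of _ u_fwd] allI impI notI)
  have u: "integral_solution B_fwd f_fwd u_fwd" using integral_solution_if_solution[OF solution_fwd] .
  have uniq: "AE t in I01. v t = u_fwd t" if "integral_solution B_fwd f_fwd v" "v \<in> Lp01 2" for v
    by (rule integral_solution_unique[OF reflect_map _ that u Lp01_u_fwd]) simp
  show "elliptic B_fwd" by (rule elliptic_B[OF _ reflect_map]) simp
  show "f_fwd \<in> Lp01 p" using p by (intro Lp01_f_fwd) simp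
  show "solution 2 B_fwd f_fwd u_fwd" by (rule solution_fwd)
  show "AE t in I01. v t = u_fwd t" if "solution 2 B_fwd f_fwd v" for v
    using that by (intro uniq integral_solution_if_solution) (auto simp: solution_def)
  show "False" if "u_fwd \<in> Lp01 p" using u_fwd_not_Lp01[OF p] that by blast
  show "False" if v: "solution 1 B_fwd f_fwd v" "v \<in> Lp01 p" for v
  proof -
    have "v \<in> Lp01 2" by (rule Lp01_mono[OF v(2)]) (use p in auto)
    then have "AE t in I01. v t = u_fwd t" using v(1) by (intro uniq integral_solution_if_solution)
    then have "AE t in I01. u_fwd t = v t" by eventually_elim simp
    from Lp01_cong_AE[OF v(2) measurable_fwd(2) this] show False using u_fwd_not_Lp01[OF p] by blast
  qed
qed

section \<open>Exponents below two\<close>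

text \<open>With this weight the \<open>p\<close>-th power of the norm of \<open>f_dual t\<close> is at most of order
  \<open>1 / (t (1 - ln t)\<^sup>p)\<close>, which is integrable, whereas its pairing with \<open>w t\<close> is of order
  \<open>1 / (t (1 - ln t))\<close>, which is not.\<close>

definition \<psi> :: "real \<Rightarrow> real" where "\<psi> t = t powr (- 2 * \<epsilon>) / (1 - ln t)"

definition f_dual :: "real \<Rightarrow> 'd hm1" where "f_dual t = - (\<psi> t *\<^sub>R A (w t))"

lemma measurable_f_dual: "f_dual \<in> borel_measurable I01"
  unfolding f_dual_def[abs_def] \<psi>_def[abs_def] by (rule borel_measurable_I01) measurable

lemma Lp01_f_dual:
  assumes p: "1 < p" "\<epsilon> = 1 / p - 1 / 2"
  shows "f_dual \<in> Lp01 p"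
proof -
  have "integrable I01 (\<lambda>t. norm (f_dual t) powr p)"
  proof (rule integrable_I01_bound)
    show "integrable I01 (\<lambda>t. (3 * C0) powr p * (1 / t * (1 - ln t) powr (- p)))"
      by (intro integrable_mult_right integrable_I01_log_weight p)
    show "(\<lambda>t. norm (f_dual t) powr p) \<in> borel_measurable I01" using measurable_f_dual by measurable
    fix t :: real assume t: "t \<in> {0..1}"
    show "norm (norm (f_dual t) powr p) \<le> (3 * C0) powr p * (1 / t * (1 - ln t) powr (- p))"
    proof (cases "t = 0")
      case True
      have "A 0 = 0" using bounded_linear.linear[OF bounded_linear_A] linear_0 by blast
      with True show ?thesis by (simp add: f_dual_def w_residual_zero)
    next
      case False
      then have t: "0 < t" "t \<le> 1" using t by auto
      have ln: "1 \<le> 1 - ln t" using one_minus_ln_ge t by blast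
      have "norm (f_dual t) \<le> \<psi> t * norm (w t)"
        unfolding f_dual_def using norm_A_le[of "w t"] ln by (auto simp: \<psi>_def intro!: mult_left_mono divide_right_mono)
      also have "\<dots> \<le> \<psi> t * (3 * C0 * t powr (\<epsilon> - 1 / 2))"
        using ln by (intro mult_left_mono norm_w_le t) (simp add: \<psi>_def)
      also have "\<dots> = 3 * C0 * (t powr (- (\<epsilon> + 1 / 2)) * (1 - ln t) powr (- 1))"
      proof -
        have "t powr (- 2 * \<epsilon>) * t powr (\<epsilon> - 1 / 2) = t powr (- (\<epsilon> + 1 / 2))"
          unfolding powr_add[symmetric] by (simp add: algebra_simps)
        moreover have "(1 - ln t) powr (- 1) = 1 / (1 - ln t)" using ln by (simp add: powr_minus_divide)
        ultimately show ?thesis by (simp add: \<psi>_def field_simps)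
      qed
      finally have "norm (f_dual t) powr p \<le> (3 * C0 * (t powr (- (\<epsilon> + 1 / 2)) * (1 - ln t) powr (- 1))) powr p"
        using p by (intro powr_mono2) auto
      also have "\<dots> = (3 * C0) powr p * (t powr (- (\<epsilon> + 1 / 2) * p) * (1 - ln t) powr (- 1 * p))"
        unfolding powr_mult powr_powr by simp
      also have "- (\<epsilon> + 1 / 2) * p = - 1" using p by (simp add: field_simps)
      finally show ?thesis unfolding inverse_eq_powr[OF t(1)] by simp
    qed
  qed
  then show ?thesis using measurable_f_dual by (simp add: Lp01_def)
qed

text \<open>Differentiating the pairing of \<open>u\<close> with \<open>w\<close>, the operator terms cancel because \<open>B (- 1)\<close> is
  the adjoint of \<open>B 1\<close>; the integral of \<open>\<langle>f_dual, w\<rangle>\<close> over \<open>[\<delta>, 1]\<close> is therefore the sum of boundary terms and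
  of the integral of \<open>\<langle>residual, u\<rangle>\<close>. The term at \<open>\<delta>\<close> stays bounded: \<open>u\<close> is of order
  \<open>\<delta> powr (1 - 1 / p)\<close> in the antidual, as the primitive of an \<open>L\<^sup>p\<close> function, and \<open>w\<close> is of
  order \<open>\<delta> powr (1 / p - 1)\<close>. So the integral stays bounded, which contradicts the choice of \<open>\<psi>\<close>.\<close>

lemma no_solution_dual:
  assumes p: "1 < p" "p < 2" "\<epsilon> = 1 / p - 1 / 2"
    and sol: "integral_solution (B (- 1)) f_dual u" and u: "u \<in> Lp01 p"
  shows False
proof -
  let ?F = "\<lambda>t. div_grad (B (- 1) t) (u t)"
  define g where "g t = ?F t + f_dual t" for t
  have id: "(\<lambda>t :: real. t) \<in> borel_measurable borel" "(\<lambda>t :: real. t) \<in> {0..1} \<rightarrow> {0..1}" by auto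
  have p0: "0 < p" using p by simp
  have fp: "f_dual \<in> Lp01 p" by (rule Lp01_f_dual[OF p(1,3)])
  have Fp: "?F \<in> Lp01 p" using Lp01_B_flow[OF id _ u p0, of "- 1"] by simp
  have gp: "g \<in> Lp01 p" unfolding g_def[abs_def] by (rule Lp01_add[OF Fp fp p0])
  have int: "integrable I01 ?F" "integrable I01 f_dual" "integrable I01 g" "integrable I01 u"
    using Lp01_integrable[OF Fp] Lp01_integrable[OF fp] Lp01_integrable[OF gp] Lp01_integrable[OF u] p by auto
  have mu: "u \<in> borel_measurable I01" using u by (simp add: Lp01_def)
  obtain U where U: "AE t in I01. U t = h1_to_hm1 (u t)"
    "\<And>t. t \<in> {0..1} \<Longrightarrow> U t - (LINT \<tau>:{0..t}|lborel. ?F \<tau>) = (LINT \<tau>:{0..t}|lborel. f_dual \<tau>)"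
    using sol unfolding integral_solution_def by blast
  have Ug: "U t = (LINT \<tau>:{0..t}|lborel. g \<tau>)" if t: "t \<in> {0..1}" for t
  proof -
    have "(LINT \<tau>:{0..t}|lborel. g \<tau>) = (LINT \<tau>:{0..t}|lborel. ?F \<tau>) + (LINT \<tau>:{0..t}|lborel. f_dual \<tau>)"
      unfolding g_def using t by (intro set_integral_add set_integrable_subinterval int) auto
    then show ?thesis using U(2)[OF t] by (simp add: algebra_simps)
  qed
  \<comment> \<open>The choice of \<open>\<epsilon>\<close> makes the power of \<open>\<delta>\<close> gained by \<open>U\<close> cancel the one lost by \<open>w\<close>.\<close>
  define N where "N = (LINT t|I01. norm (g t) powr p) + 1"
  have bd: "norm (U \<delta>) * norm (w \<delta>) \<le> 3 * C0 * N" if \<delta>: "0 < \<delta>" "\<delta> \<le> 1" for \<delta>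
  proof -
    have "norm (U \<delta>) \<le> (LINT t:{0..\<delta>}|lborel. norm (g t))"
      using Ug[of \<delta>] \<delta> integral_norm_bound[of lborel "\<lambda>t. indicator {0..\<delta>} t *\<^sub>R g t"]
      by (simp add: set_lebesgue_integral_def)
    also have "\<dots> \<le> \<delta> powr (1 - 1 / p) * N"
      unfolding N_def by (rule Lp01_integral_short_interval[OF p(1) gp \<delta>])
    finally have "norm (U \<delta>) \<le> \<delta> powr (1 - 1 / p) * N" .
    then have "norm (U \<delta>) * norm (w \<delta>) \<le> (\<delta> powr (1 - 1 / p) * N) * (3 * C0 * \<delta> powr (\<epsilon> - 1 / 2))"
      by (intro mult_mono norm_w_le \<delta>) (auto intro: order_trans[OF norm_ge_zero])
    also have "\<dots> = 3 * C0 * N * (\<delta> powr (1 - 1 / p) * \<delta> powr (\<epsilon> - 1 / 2))" by (simp add: algebra_simps)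
    also have "\<delta> powr (1 - 1 / p) * \<delta> powr (\<epsilon> - 1 / 2) = 1"
      unfolding powr_add[symmetric] using \<delta> p(3) by simp
    finally show ?thesis by simp
  qed
  define Rc where "Rc = (20 * \<epsilon> + 4 * \<omega>) * C0"
  define h where "h t = pairing (f_dual t) (w t)" for t
  have hval: "h t = \<psi> t * (- pairing (A (w t)) (w t))" for t
    by (simp add: h_def f_dual_def pairing.minus_left pairing.scaleR_left)
  have main: "set_integrable lborel {\<delta>..1} h"
    "(LINT t:{\<delta>..1}|lborel. h t) \<le> norm (U 1) * norm (w 1) + 3 * C0 * N + Rc * (LINT t|I01. norm (u t))"
    if \<delta>: "0 < \<delta>" "\<delta> \<le> 1" for \<delta>
  proof -
    have gi: "set_integrable lborel {\<delta>..1} g" using \<delta> by (intro set_integrable_subinterval int) auto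
    have Ueq: "U t = U \<delta> + (LINT \<tau>:{\<delta>..t}|lborel. g \<tau>)" if t: "t \<in> {\<delta>..1}" for t
      using set_integral_split_Icc[OF int(3), of \<delta> t] Ug[of t] Ug[of \<delta>] t \<delta> by simp
    have weq: "w t = w \<delta> + (LINT s:{\<delta>..t}|lborel. w' s)" if "t \<in> {\<delta>..1}" for t
      using w_fundamental_theorem(2)[of \<delta> t] that \<delta> by auto
    have wi: "set_integrable lborel {\<delta>..1} w'" using w_fundamental_theorem(1)[of \<delta> 1] \<delta> by auto
    note pr = product_rule[OF bounded_bilinear_pairing \<delta>(2) gi wi Ueq weq]
    have dual: "pairing (g t) (w t) + pairing (h1_to_hm1 (u t)) (w' t) = h t - pairing (residual t) (u t)" for t
    proof -
      have "pairing (h1_to_hm1 (u t)) (w' t) = - pairing (- h1_to_hm1 (w' t)) (u t)"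
        by (simp add: pairing.minus_left pairing_h1_to_hm1_sym[of "u t"])
      also have "\<dots> = - pairing (residual t) (u t) - pairing (?F t) (w t)"
        unfolding minus_h1_to_hm1_w' pairing.add_left pairing_div_grad_B_adjoint[of 1 t "w t"] by simp
      finally show ?thesis by (simp add: g_def h_def pairing.add_left)
    qed
    have mres: "residual \<in> borel_measurable I01" "w \<in> borel_measurable I01"
      by (auto intro: borel_measurable_I01)
    have ri: "integrable I01 (\<lambda>t. pairing (residual t) (u t))"
    proof (rule integrable_I01_bound)
      show "integrable I01 (\<lambda>t. Rc * norm (u t))" using int(4) by simp
      show "(\<lambda>t. pairing (residual t) (u t)) \<in> borel_measurable I01"
        by (rule borel_measurable_bilinear[OF bounded_bilinear_pairing mres(1) mu])
      show "norm (pairing (residual t) (u t)) \<le> Rc * norm (u t)" if "t \<in> {0..1}" for t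
        using abs_pairing_le[of "residual t" "u t"] mult_right_mono[OF residual_bound[OF that] norm_ge_zero[of "u t"]]
        by (simp add: Rc_def)
    qed
    have ris: "set_integrable lborel {\<delta>..1} (\<lambda>t. pairing (residual t) (u t))"
      using \<delta> by (intro set_integrable_subinterval ri) auto
    have sumi: "set_integrable lborel {\<delta>..1} (\<lambda>t. pairing (g t) (w t) + pairing (U t) (w' t))"
      by (rule set_integral_add(1)[OF pr(1,2)])
    have mh: "h \<in> borel_measurable I01"
      unfolding h_def[abs_def]
      by (rule borel_measurable_bilinear[OF bounded_bilinear_pairing measurable_f_dual mres(2)])
    have AEeq: "AE t in lborel. indicator {\<delta>..1} t *\<^sub>R (pairing (g t) (w t) + pairing (U t) (w' t) + pairing (residual t) (u t))
       = indicator {\<delta>..1} t *\<^sub>R h t"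
    proof -
      have "AE t in lborel. t \<in> {0..1} \<longrightarrow> U t = h1_to_hm1 (u t)" using U(1) by (simp add: AE_I01_iff)
      then show ?thesis
      proof eventually_elim
        case (elim t)
        then show ?case using dual[of t] \<delta> by (auto split: split_indicator)
      qed
    qed
    have tot: "set_integrable lborel {\<delta>..1} (\<lambda>t. pairing (g t) (w t) + pairing (U t) (w' t) + pairing (residual t) (u t))"
      by (rule set_integral_add(1)[OF sumi ris])
    have mh': "(\<lambda>t. indicator {\<delta>..1} t *\<^sub>R h t) \<in> borel_measurable lborel"
    proof -
      have "(\<lambda>t. indicator {0..1} t *\<^sub>R h t) \<in> borel_measurable lborel"
        using mh by (simp add: borel_measurable_restrict_space_iff)
      then have "(\<lambda>t. indicat_real {\<delta>..1} t *\<^sub>R (indicat_real {0..1} t *\<^sub>R h t)) \<in> borel_measurable lborel" by measurable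
      moreover have "indicat_real {\<delta>..1} t *\<^sub>R (indicat_real {0..1} t *\<^sub>R h t) = indicat_real {\<delta>..1} t *\<^sub>R h t" for t
        using \<delta> by (auto split: split_indicator)
      ultimately show ?thesis by (simp only:)
    qed
    show hi: "set_integrable lborel {\<delta>..1} h"
      using tot integrable_cong_AE[OF _ mh' AEeq] unfolding set_integrable_def by (blast intro: borel_measurable_integrable)
    have "(LINT t:{\<delta>..1}|lborel. h t) = (LINT t:{\<delta>..1}|lborel. pairing (g t) (w t) + pairing (U t) (w' t) + pairing (residual t) (u t))"
      unfolding set_lebesgue_integral_def
      by (rule integral_cong_AE[symmetric, OF _ mh' AEeq]) (use tot in \<open>auto simp: set_integrable_def intro: borel_measurable_integrable\<close>)
    also have "\<dots> = (pairing (U 1) (w 1) - pairing (U \<delta>) (w \<delta>)) + (LINT t:{\<delta>..1}|lborel. pairing (residual t) (u t))"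
      using set_integral_add(2)[OF sumi ris] set_integral_add(2)[OF pr(1,2)] pr(3) by simp
    also have "\<dots> \<le> (norm (U 1) * norm (w 1) + 3 * C0 * N) + Rc * (LINT t|I01. norm (u t))"
    proof (rule add_mono)
      show "pairing (U 1) (w 1) - pairing (U \<delta>) (w \<delta>) \<le> norm (U 1) * norm (w 1) + 3 * C0 * N"
        using abs_pairing_le[of "U 1" "w 1"] abs_pairing_le[of "U \<delta>" "w \<delta>"] bd[OF \<delta>] by linarith
      have "(LINT t:{\<delta>..1}|lborel. pairing (residual t) (u t)) \<le> (LINT t:{0..1}|lborel. Rc * norm (u t))"
        unfolding set_lebesgue_integral_def
      proof (rule integral_mono)
        show "integrable lborel (\<lambda>t. indicat_real {\<delta>..1} t *\<^sub>R pairing (residual t) (u t))" using ris by (simp add: set_integrable_def)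
        have "integrable I01 (\<lambda>t. Rc * norm (u t))" using int(4) by simp
        then show "integrable lborel (\<lambda>t. indicat_real {0..1} t *\<^sub>R (Rc * norm (u t)))"
          by (simp only: integrable_I01_iff set_integrable_def)
        fix t
        have "t \<in> {0..1} \<Longrightarrow> pairing (residual t) (u t) \<le> Rc * norm (u t)"
          using abs_pairing_le[of "residual t" "u t"] mult_right_mono[OF residual_bound[of t] norm_ge_zero[of "u t"]]
          unfolding Rc_def by linarith
        moreover have "0 \<le> Rc * norm (u t)" unfolding Rc_def using eps \<omega>_pos C0_nonneg by simp
        ultimately show "indicat_real {\<delta>..1} t *\<^sub>R pairing (residual t) (u t) \<le> indicat_real {0..1} t *\<^sub>R (Rc * norm (u t))"
          using \<delta> by (auto split: split_indicator)
      qed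
      then show "(LINT t:{\<delta>..1}|lborel. pairing (residual t) (u t)) \<le> Rc * (LINT t|I01. norm (u t))"
        by (simp add: integral_I01)
    qed
    finally show "(LINT t:{\<delta>..1}|lborel. h t) \<le> norm (U 1) * norm (w 1) + 3 * C0 * N + Rc * (LINT t|I01. norm (u t))" .
  qed
  obtain c s0 where c: "c > 0" "0 < s0" "s0 \<le> 1"
    "\<And>s. 0 < s \<Longrightarrow> s \<le> s0 \<Longrightarrow> c * s powr (2 * \<epsilon> - 1) \<le> - pairing (A (w s)) (w s)"
    by (rule energy_density_ge) blast
  have \<psi>0: "0 \<le> \<psi> t" if "0 < t" "t \<le> 1" for t using one_minus_ln_ge[OF that] by (simp add: \<psi>_def)
  show False
  proof (rule divergent_lower_bound[where r = s0 and h = h and k = "\<lambda>t. c / (t * (1 - ln t))" and G = "\<lambda>t. c * ln (1 - ln t)"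
        and M = "norm (U 1) * norm (w 1) + 3 * C0 * N + Rc * (LINT t|I01. norm (u t))"])
    have ln_gt: "0 < 1 - ln t" if "0 < t" "t \<le> s0" for t
      using one_minus_ln_ge[of t] that c(3) by linarith
    show "((\<lambda>t. c * ln (1 - ln t)) has_real_derivative - (c / (t * (1 - ln t)))) (at t)" if "0 < t" "t \<le> s0" for t
      using that ln_gt[OF that] by (auto intro!: derivative_eq_intros)
    show "0 \<le> c / (t * (1 - ln t))" if "0 < t" "t \<le> s0" for t
      using that ln_gt[OF that] c(1) by (intro divide_nonneg_nonneg mult_nonneg_nonneg) auto
    show "0 \<le> h t" if "0 < t" "t \<le> 1" for t
      unfolding hval using \<psi>0[OF that] pairing_A_self_nonpos(1)[of "w t"] by (intro mult_nonneg_nonneg) auto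
    show "c / (t * (1 - ln t)) \<le> h t" if t: "0 < t" "t \<le> s0" for t
    proof -
      have "t powr (- 2 * \<epsilon>) * t powr (2 * \<epsilon> - 1) = 1 / t"
        unfolding powr_add[symmetric] inverse_eq_powr[OF t(1)] by simp
      then have "c / (t * (1 - ln t)) = \<psi> t * (c * t powr (2 * \<epsilon> - 1))"
        by (simp add: \<psi>_def field_simps)
      also have "\<dots> \<le> h t" unfolding hval using t c \<psi>0 by (intro mult_left_mono c(4)) auto
      finally show ?thesis .
    qed
    show "\<exists>\<delta>. 0 < \<delta> \<and> \<delta> \<le> s0 \<and> M < c * ln (1 - ln \<delta>)" for M
    \<comment> \<open>The integral grows only like an iterated logarithm of \<open>1 / \<delta>\<close>.\<close>
    proof (intro exI[of _ "min s0 (exp (- exp ((\<bar>M\<bar> + 1) / c)))"] conjI)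
      let ?\<delta> = "min s0 (exp (- exp ((\<bar>M\<bar> + 1) / c)))"
      show d0: "0 < ?\<delta>" using c by auto
      then have "ln ?\<delta> \<le> ln (exp (- exp ((\<bar>M\<bar> + 1) / c)))" by (subst ln_le_cancel_iff) auto
      then have le: "exp ((\<bar>M\<bar> + 1) / c) \<le> 1 - ln ?\<delta>" by simp
      have "0 < 1 - ln ?\<delta>" by (rule less_le_trans[OF exp_gt_zero le])
      with le have "ln (exp ((\<bar>M\<bar> + 1) / c)) \<le> ln (1 - ln ?\<delta>)"
        by (subst ln_le_cancel_iff) simp_all
      then have "c * ((\<bar>M\<bar> + 1) / c) \<le> c * ln (1 - ln ?\<delta>)" using c by (intro mult_left_mono) auto
      then show "M < c * ln (1 - ln ?\<delta>)" using c by simp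
    qed simp
  qed (use c main in auto)
qed

lemma counterexample_below_two:
  assumes p: "1 < p" "p < 2" "\<epsilon> = 1 / p - 1 / 2"
  shows "elliptic (B (- 1)) \<and> f_dual \<in> Lp01 p \<and> (\<forall>u. solution 1 (B (- 1)) f_dual u \<longrightarrow> u \<notin> Lp01 p)"
proof (intro conjI allI impI notI)
  show "elliptic (B (- 1))" using elliptic_B[of "- 1" "\<lambda>t. t"] by simp
  show "f_dual \<in> Lp01 p" by (rule Lp01_f_dual[OF p(1,3)])
  show "False" if "solution 1 (B (- 1)) f_dual u" "u \<in> Lp01 p" for u
    using no_solution_dual[OF p integral_solution_if_solution] that by blast
qed

end

theorem theorem2p5:
  fixes p :: real
  assumes "2 \<le> CARD('d::finite)" and "1 < p" and "p \<noteq> 2"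
  shows "\<exists>(B :: real \<Rightarrow> real^'d \<Rightarrow> complex^'d^'d) (f :: real \<Rightarrow> 'd hm1).
    elliptic B \<and> f \<in> Lp01 p \<and>
    (2 < p \<longrightarrow> (\<exists>u. solution 2 B f u \<and>
                   (\<forall>v. solution 2 B f v \<longrightarrow> (AE t in I01. v t = u t)) \<and>
                   u \<notin> Lp01 p)) \<and>
    (\<forall>u. solution 1 B f u \<longrightarrow> u \<notin> Lp01 p)"
proof -
  have "\<not> card (UNIV :: 'd set) \<le> Suc 0" using assms(1) by simp
  then obtain i0 i1 :: 'd where i: "i0 \<noteq> i1"
    by (subst (asm) card_le_Suc0_iff_eq) auto
  show ?thesis
  proof (cases "2 < p")
    case True
    interpret cascade i0 i1 "1 / 2 - 1 / p"
      by unfold_locales (use i True in \<open>auto simp: field_simps\<close>)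
    show ?thesis using counterexample_above_two[OF True refl] by blast
  next
    case False
    then have p: "p < 2" using assms by simp
    interpret cascade i0 i1 "1 / p - 1 / 2"
      by unfold_locales (use i p assms in \<open>auto simp: field_simps\<close>)
    show ?thesis using counterexample_below_two[OF assms(2) p refl] False by blast
  qed
qed

end
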